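(* Let $G$ be a compact Lie group with Lie algebra $\mathcal{G}$, let $m\le 4$, and let $A\in W^{1,2}(\wedge^1B^m,\mathcal{G})$ satisfy the Yang–Mills equation $d_A^\ast F_A=0$, i.e. $\sum_{j=1}^m\partial_{x_j}(F_A)_{ij}+[A_j,(F_A)_{ij}]=0$ for all $i$, in $\mathcal{D}'(B^m)$. Then for any gauge $g$ such that $A^g\in W^{1,2}(\wedge^1B^m,\mathcal{G})$ and $d^\ast A^g=0$ (a $W^{1,2}$ Coulomb gauge), the $1$-form $A^g$ is $C^\infty$ in $B^m$.
   Context: $B^m$ is the unit ball of $\mathbb{R}^m$. $G$ is a matrix group, $\mathcal{G}$ carries an $\mathrm{Ad}$-invariant inner product. $F_A=dA+A\wedge A$, $(F_A)_{ij}=\partial_{x_i}A_j-\partial_{x_j}A_i+[A_i,A_j]$, and $A^g=g^{-1}dg+g^{-1}Ag$. *)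

theory Defs
  imports "HOL-Analysis.Analysis"
begin

fun mat_pow :: "real^'n^'n \<Rightarrow> nat \<Rightarrow> real^'n^'n" where
  "mat_pow X 0 = mat 1"
| "mat_pow X (Suc k) = X ** mat_pow X k"

definition mat_exp :: "real^'n^'n \<Rightarrow> real^'n^'n" where
  "mat_exp X = (\<Sum>k. (1 / fact k) *\<^sub>R mat_pow X k)"

text \<open>A compact matrix Lie group: a compact subgroup of GL(n,R)
  (closed subgroups of GL(n,R) are Lie groups; every compact Lie group arises so).\<close>
definition compact_matrix_group :: "(real^'n^'n) set \<Rightarrow> bool" where
  "compact_matrix_group G \<longleftrightarrow>
     compact G \<and> mat 1 \<in> G \<and> (\<forall>g\<in>G. invertible g) \<and>
     (\<forall>g\<in>G. \<forall>h\<in>G. g ** h \<in> G) \<and> (\<forall>g\<in>G. matrix_inv g \<in> G)"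

definition lie_algebra :: "(real^'n^'n) set \<Rightarrow> (real^'n^'n) set" where
  "lie_algebra G = {X. \<forall>t::real. mat_exp (t *\<^sub>R X) \<in> G}"

definition lie_bracket :: "real^'n^'n \<Rightarrow> real^'n^'n \<Rightarrow> real^'n^'n" where
  "lie_bracket X Y = X ** Y - Y ** X"

fun Ck_on :: "nat \<Rightarrow> 'a::euclidean_space set \<Rightarrow> ('a \<Rightarrow> 'b::real_normed_vector) \<Rightarrow> bool" where
  "Ck_on 0 S f = continuous_on S f"
| "Ck_on (Suc k) S f = (\<exists>f'. (\<forall>x\<in>S. (f has_derivative f' x) (at x)) \<and>
                               (\<forall>v. Ck_on k S (\<lambda>x. f' x v)))"

definition smooth_on :: "'a::euclidean_space set \<Rightarrow> ('a \<Rightarrow> 'b::real_normed_vector) \<Rightarrow> bool" where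
  "smooth_on S f \<longleftrightarrow> (\<forall>k. Ck_on k S f)"

definition pderiv :: "'m::finite \<Rightarrow> (real^'m \<Rightarrow> 'b::real_normed_vector) \<Rightarrow> real^'m \<Rightarrow> 'b" where
  "pderiv i f x = frechet_derivative f (at x) (axis i 1)"

definition test_fun :: "(real^'m::finite) set \<Rightarrow> (real^'m \<Rightarrow> real) \<Rightarrow> bool" where
  "test_fun U \<phi> \<longleftrightarrow> smooth_on UNIV \<phi> \<and> compact (closure {x. \<phi> x \<noteq> 0})
                     \<and> closure {x. \<phi> x \<noteq> 0} \<subseteq> U"

definition loc_integrable :: "(real^'m::finite) set \<Rightarrow> (real^'m \<Rightarrow> 'b::euclidean_space) \<Rightarrow> bool" where
  "loc_integrable U f \<longleftrightarrow> (\<forall>K. compact K \<and> K \<subseteq> U \<longrightarrow> set_integrable lborel K f)"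

definition L2_on :: "(real^'m::finite) set \<Rightarrow> (real^'m \<Rightarrow> 'b::euclidean_space) \<Rightarrow> bool" where
  "L2_on U f \<longleftrightarrow> set_borel_measurable lborel U f \<and> set_integrable lborel U (\<lambda>x. norm (f x) ^ 2)"

definition weak_pderiv :: "(real^'m::finite) set \<Rightarrow> 'm \<Rightarrow> (real^'m \<Rightarrow> 'b::euclidean_space)
                             \<Rightarrow> (real^'m \<Rightarrow> 'b) \<Rightarrow> bool" where
  "weak_pderiv U i f v \<longleftrightarrow> loc_integrable U f \<and> loc_integrable U v \<and>
     (\<forall>\<phi>. test_fun U \<phi> \<longrightarrow>
        (LINT x:U|lborel. pderiv i \<phi> x *\<^sub>R f x) = - (LINT x:U|lborel. \<phi> x *\<^sub>R v x))"

definition W12 :: "(real^'m::finite) set \<Rightarrow> (real^'m \<Rightarrow> 'b::euclidean_space) \<Rightarrow> bool" where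
  "W12 U f \<longleftrightarrow> L2_on U f \<and> (\<forall>i. \<exists>v. weak_pderiv U i f v \<and> L2_on U v)"

text \<open>Curvature of A computed from given weak derivatives DA (DA i j = weak d_i of A_j).\<close>
definition curvature :: "('m \<Rightarrow> real^'m \<Rightarrow> real^'n^'n) \<Rightarrow> ('m \<Rightarrow> 'm \<Rightarrow> real^'m \<Rightarrow> real^'n^'n)
                          \<Rightarrow> 'm \<Rightarrow> 'm \<Rightarrow> real^'m \<Rightarrow> real^'n^'n" where
  "curvature A DA i j x = DA i j x - DA j i x + lie_bracket (A i x) (A j x)"

text \<open>Gauge transform A^g = g^{-1} dg + g^{-1} A g, with dg i the weak d_i g.\<close>
definition gauge_transform :: "(real^'m \<Rightarrow> real^'n^'n) \<Rightarrow> ('m \<Rightarrow> real^'m \<Rightarrow> real^'n^'n)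
                               \<Rightarrow> ('m \<Rightarrow> real^'m \<Rightarrow> real^'n^'n) \<Rightarrow> 'm \<Rightarrow> real^'m \<Rightarrow> real^'n^'n" where
  "gauge_transform g dg A i x = matrix_inv (g x) ** dg i x + matrix_inv (g x) ** A i x ** g x"

end

theory Submission
  imports Defs
begin

text \<open>The gauge transform \<open>B = A\<^sup>g\<close> is again a weak Yang--Mills connection, and with \<open>d\<^sup>* B = 0\<close> the
  equation becomes an elliptic system \<open>\<Delta> B = B \<partial>B + B B B\<close>.  In dimension at most four the Sobolev
  embedding of \<open>W\<^sup>1\<^sup>,\<^sup>2\<close> into \<open>L\<^sup>4\<close> makes the right-hand side exactly critical.  Testing with
  difference quotients, the critical terms are absorbed by splitting an \<open>L\<^sup>2\<close> coefficient into a
  small and a bounded part, so \<open>B\<close> has locally square-integrable second derivatives.  The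
  derivatives of \<open>B\<close> together with \<open>B\<close> satisfy a system of the same form, so this iterates, and
  a function with all weak derivatives in \<open>L\<^sup>2\<close> is smooth.\<close>

section \<open>Smooth functions and test functions\<close>

text \<open>In dimension four the term \<open>B dB\<close> is only in L^{4/3}: it pairs with W^{1,2}
  functions but not with L2 functions. Right-hand sides are therefore functionals on compactly
  supported W^{1,2} functions (\<open>adm\<close>), and the energy of the difference quotients is
  bounded directly. After differencing, every nonlinear term has two differenced factors, so that,
  up to Young's inequality, an L2 coefficient meets the square of a W^{1,2} function. The unknowns
  are coupled, so only the sum of their energies can be absorbed. A second obstacle is the gauge:
  \<open>g\<close> is bounded and W^{1,2}, and its second derivatives exist only as distributions.
  Their symmetry still yields \<open>g F_B = F_A g\<close>, and the Yang--Mills equation is carried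
  over by multiplying its weak form by the inverse gauge on the left and by \<open>g\<close> on the
  right. All functions are reduced to real entries on the whole space, with cutoffs in place of
  domains. Pointwise regularity at the end comes from one elementary bound: the supremum is
  controlled by the L1 norm of the mixed derivative taken once in each coordinate.\<close>

lemma Ck_on_Suc_imp: "Ck_on (Suc k) S f \<Longrightarrow> Ck_on k S f"
proof (induction k arbitrary: f)
  case 0
  then obtain f' where "\<forall>x\<in>S. (f has_derivative f' x) (at x)" by auto
  then show ?case
    by (auto intro!: continuous_at_imp_continuous_on has_derivative_continuous)
next
  case (Suc k)
  then obtain f' where f': "\<forall>x\<in>S. (f has_derivative f' x) (at x)"
    "\<And>v. Ck_on (Suc k) S (\<lambda>x. f' x v)" by auto
  then have "\<And>v. Ck_on k S (\<lambda>x. f' x v)" using Suc.IH by blast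
  then show ?case using f' by auto
qed

lemma Ck_on_const: "Ck_on k S (\<lambda>x. c)"
proof (induction k arbitrary: c)
  case (Suc k)
  have "Ck_on (Suc k) S (\<lambda>x. c)"
    unfolding Ck_on.simps by (rule exI[of _ "\<lambda>x v. 0"]) (simp add: Suc)
  then show ?case .
qed simp

lemma Ck_on_add: "Ck_on k S f \<Longrightarrow> Ck_on k S g \<Longrightarrow> Ck_on k S (\<lambda>x. f x + g x)"
proof (induction k arbitrary: f g)
  case 0 then show ?case by (simp add: continuous_on_add)
next
  case (Suc k)
  obtain f' where f': "\<forall>x\<in>S. (f has_derivative f' x) (at x)" "\<And>v. Ck_on k S (\<lambda>x. f' x v)"
    using Suc.prems by auto
  obtain g' where g': "\<forall>x\<in>S. (g has_derivative g' x) (at x)" "\<And>v. Ck_on k S (\<lambda>x. g' x v)"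
    using Suc.prems by auto
  show ?case unfolding Ck_on.simps
    by (rule exI[of _ "\<lambda>x v. f' x v + g' x v"]) (use f' g' Suc.IH in \<open>auto intro!: has_derivative_add\<close>)
qed

lemma Ck_on_mult:
  fixes f g :: "'a::euclidean_space \<Rightarrow> real"
  shows "Ck_on k S f \<Longrightarrow> Ck_on k S g \<Longrightarrow> Ck_on k S (\<lambda>x. f x * g x)"
proof (induction k arbitrary: f g)
  case 0 then show ?case by (simp add: continuous_on_mult)
next
  case (Suc k)
  obtain f' where f': "\<forall>x\<in>S. (f has_derivative f' x) (at x)" "\<And>v. Ck_on k S (\<lambda>x. f' x v)"
    using Suc.prems by auto
  obtain g' where g': "\<forall>x\<in>S. (g has_derivative g' x) (at x)" "\<And>v. Ck_on k S (\<lambda>x. g' x v)"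
    using Suc.prems by auto
  have fg: "Ck_on k S f" "Ck_on k S g" using Suc.prems Ck_on_Suc_imp by blast+
  show ?case unfolding Ck_on.simps
    by (rule exI[of _ "\<lambda>x v. f x * g' x v + f' x v * g x"])
       (use f' g' fg Suc.IH in \<open>auto intro!: has_derivative_mult Ck_on_add\<close>)
qed

lemma Ck_on_affine:
  fixes f :: "'b::euclidean_space \<Rightarrow> 'c::real_normed_vector" and L :: "'a::euclidean_space \<Rightarrow> 'b"
  assumes L: "bounded_linear L"
  shows "Ck_on k UNIV f \<Longrightarrow> Ck_on k UNIV (\<lambda>x. f (a + L x))"
proof (induction k arbitrary: f)
  case 0
  have "continuous_on UNIV (\<lambda>x. a + L x)"
    by (intro continuous_intros linear_continuous_on L)
  then show ?case using 0 continuous_on_compose2[of UNIV f UNIV] by auto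
next
  case (Suc k)
  obtain f' where f': "\<forall>x. (f has_derivative f' x) (at x)" "\<And>v. Ck_on k UNIV (\<lambda>x. f' x v)"
    using Suc.prems by auto
  have "((\<lambda>x. f (a + L x)) has_derivative (\<lambda>v. f' (a + L x) (L v))) (at x)" for x
  proof -
    have "((\<lambda>x. a + L x) has_derivative (\<lambda>v. L v)) (at x)"
      by (auto intro!: derivative_eq_intros bounded_linear_imp_has_derivative L)
    then show ?thesis using f'(1) has_derivative_compose by blast
  qed
  then show ?case unfolding Ck_on.simps
    by (intro exI[of _ "\<lambda>x v. f' (a + L x) (L v)"]) (use f' Suc.IH in auto)
qed

abbreviation smooth :: "('a::euclidean_space \<Rightarrow> real) \<Rightarrow> bool" where
  "smooth f \<equiv> smooth_on UNIV f"

lemma smooth_const: "smooth (\<lambda>x. c)" by (simp add: smooth_on_def Ck_on_const)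
lemma smooth_add: "smooth f \<Longrightarrow> smooth g \<Longrightarrow> smooth (\<lambda>x. f x + g x)"
  by (simp add: smooth_on_def Ck_on_add)
lemma smooth_mult: "smooth f \<Longrightarrow> smooth g \<Longrightarrow> smooth (\<lambda>x. f x * g x)"
  by (simp add: smooth_on_def Ck_on_mult)
lemma smooth_prod: "(\<And>i. i \<in> I \<Longrightarrow> smooth (f i)) \<Longrightarrow> smooth (\<lambda>x. \<Prod>i\<in>I. f i x)"
  by (induction I rule: infinite_finite_induct) (auto intro: smooth_const smooth_mult)
lemma smooth_affine: "bounded_linear L \<Longrightarrow> smooth f \<Longrightarrow> smooth (\<lambda>x. f (a + L x))"
  by (simp add: smooth_on_def Ck_on_affine)
lemma smooth_translate: "smooth f \<Longrightarrow> smooth (\<lambda>x. f (x + a))"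
  using smooth_affine[OF bounded_linear_ident, of f a] by (simp add: add.commute)
lemma smooth_continuous: "smooth f \<Longrightarrow> continuous_on S f"
  unfolding smooth_on_def using Ck_on.simps(1) continuous_on_subset by blast
lemma smooth_measurable [measurable (raw)]: "smooth f \<Longrightarrow> f \<in> borel_measurable borel"
  by (simp add: smooth_continuous borel_measurable_continuous_onI)

lemma smooth_component: "smooth (\<lambda>x::real^'m. x $ l)"
proof -
  have "Ck_on k UNIV (\<lambda>x::real^'m. x $ l)" for k
  proof (cases k)
    case 0 then show ?thesis by (auto intro!: continuous_intros)
  next
    case (Suc n)
    show ?thesis unfolding Suc Ck_on.simps
      by (intro exI[of _ "\<lambda>x v. v $ l"])
         (auto intro!: Ck_on_const bounded_linear_imp_has_derivative bounded_linear_vec_nth)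
  qed
  then show ?thesis by (simp add: smooth_on_def)
qed

section \<open>Partial derivatives of smooth functions\<close>

lemma vec_expand: "(v::real^'m) = (\<Sum>l\<in>UNIV. v $ l *\<^sub>R axis l 1)"
  by (simp add: vec_eq_iff axis_def if_distrib sum.delta' cong: if_cong)

lemma pderiv_eqI: "(f has_derivative f') (at x) \<Longrightarrow> pderiv l f x = f' (axis l 1)"
  unfolding pderiv_def using frechet_derivative_at by metis

lemma smooth_has_derivative:
  fixes f :: "real^'m \<Rightarrow> real"
  assumes "smooth f"
  shows "(f has_derivative (\<lambda>v. \<Sum>l\<in>UNIV. v $ l * pderiv l f x)) (at x)"
proof -
  have "Ck_on (Suc 0) UNIV f" using assms smooth_on_def by blast
  then obtain f' where f': "\<And>x. (f has_derivative f' x) (at x)" by auto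
  have lin: "linear (f' x)" by (rule has_derivative_linear[OF f'])
  have "f' x v = (\<Sum>l\<in>UNIV. v $ l * pderiv l f x)" for v
  proof -
    have "f' x v = f' x (\<Sum>l\<in>UNIV. v $ l *\<^sub>R axis l 1)" using vec_expand[of v] by simp
    also have "\<dots> = (\<Sum>l\<in>UNIV. v $ l * f' x (axis l 1))"
      by (simp add: linear_sum[OF lin] linear_cmul[OF lin])
    also have "\<dots> = (\<Sum>l\<in>UNIV. v $ l * pderiv l f x)"
      by (simp add: pderiv_eqI[OF f'])
    finally show ?thesis .
  qed
  then have "f' x = (\<lambda>v. \<Sum>l\<in>UNIV. v $ l * pderiv l f x)" by auto
  then show ?thesis using f'[of x] by simp
qed

lemma smooth_pderiv:
  fixes f :: "real^'m \<Rightarrow> real"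
  assumes "smooth f" shows "smooth (pderiv l f)"
proof -
  have "Ck_on k UNIV (pderiv l f)" for k
  proof -
    have "Ck_on (Suc k) UNIV f" using assms smooth_on_def by blast
    then obtain f' where f': "\<And>x. (f has_derivative f' x) (at x)" "\<And>v. Ck_on k UNIV (\<lambda>x. f' x v)"
      by auto
    have "pderiv l f = (\<lambda>x. f' x (axis l 1))" using pderiv_eqI[OF f'(1)] by auto
    then show ?thesis using f'(2) by simp
  qed
  then show ?thesis by (simp add: smooth_on_def)
qed

lemma sum_axis: "(\<Sum>j\<in>UNIV. axis l 1 $ j * g j) = (g l :: real)" for l :: "'m::finite"
  by (simp add: axis_def if_distrib if_distribR sum.delta cong: if_cong)

lemma pderiv_const [simp]: "pderiv l (\<lambda>x. c) x = 0"
  by (rule pderiv_eqI[of _ "\<lambda>_. 0", simplified]) (rule has_derivative_const)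

lemma pderiv_add:
  fixes f g :: "real^'m \<Rightarrow> real"
  assumes "smooth f" "smooth g"
  shows "pderiv l (\<lambda>x. f x + g x) x = pderiv l f x + pderiv l g x"
  using pderiv_eqI[OF has_derivative_add[OF smooth_has_derivative[OF assms(1)] smooth_has_derivative[OF assms(2)]]]
  by (simp add: sum_axis)

lemma pderiv_mult:
  fixes f g :: "real^'m \<Rightarrow> real"
  assumes "smooth f" "smooth g"
  shows "pderiv l (\<lambda>x. f x * g x) x = pderiv l f x * g x + f x * pderiv l g x"
  using pderiv_eqI[OF has_derivative_mult[OF smooth_has_derivative[OF assms(1)] smooth_has_derivative[OF assms(2)]]]
  by (simp add: sum_axis)

lemma pderiv_cmult:
  fixes f :: "real^'m \<Rightarrow> real"
  assumes "smooth f"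
  shows "pderiv l (\<lambda>x. c * f x) x = c * pderiv l f x"
  using pderiv_mult[OF smooth_const assms, of l c x] by simp

lemma pderiv_diff:
  fixes f g :: "real^'m \<Rightarrow> real"
  assumes "smooth f" "smooth g"
  shows "pderiv l (\<lambda>x. f x - g x) x = pderiv l f x - pderiv l g x"
  using pderiv_eqI[OF has_derivative_diff[OF smooth_has_derivative[OF assms(1)] smooth_has_derivative[OF assms(2)]]]
  by (simp add: sum_axis)

lemma pderiv_component: "pderiv l (\<lambda>x::real^'m. x $ j) x = (if l = j then 1 else 0)"
proof -
  have "((\<lambda>x::real^'m. x $ j) has_derivative (\<lambda>v. v $ j)) (at x)"
    by (intro bounded_linear_imp_has_derivative bounded_linear_vec_nth)
  from pderiv_eqI[OF this, of l] show ?thesis by (simp add: axis_def)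
qed

lemma pderiv_translate:
  fixes f :: "real^'m \<Rightarrow> real"
  assumes "smooth f"
  shows "pderiv l (\<lambda>x. f (x + a)) x = pderiv l f (x + a)"
proof -
  have "((\<lambda>x. x + a) has_derivative (\<lambda>v. v)) (at x)" by (auto intro!: derivative_eq_intros)
  from has_derivative_compose[OF this smooth_has_derivative[OF assms]]
  have "((\<lambda>x. f (x + a)) has_derivative (\<lambda>v. \<Sum>j\<in>UNIV. v $ j * pderiv j f (x + a))) (at x)" .
  from pderiv_eqI[OF this, of l] show ?thesis by (simp add: sum_axis)
qed

lemma smooth_line_deriv:
  fixes f :: "real^'m \<Rightarrow> real"
  assumes "smooth f"
  shows "((\<lambda>t. f (x + t *\<^sub>R axis l 1)) has_real_derivative pderiv l f (x + t *\<^sub>R axis l 1)) (at t)"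
proof -
  have "((\<lambda>t. x + t *\<^sub>R axis l 1) has_derivative (\<lambda>s. s *\<^sub>R axis l 1)) (at t)"
    by (auto intro!: derivative_eq_intros)
  from has_derivative_compose[OF this smooth_has_derivative[OF assms]]
  have "((\<lambda>t. f (x + t *\<^sub>R axis l 1)) has_derivative
     (\<lambda>s. \<Sum>j\<in>UNIV. (s *\<^sub>R axis l 1) $ j * pderiv j f (x + t *\<^sub>R axis l 1))) (at t)" .
  moreover have "(\<Sum>j\<in>UNIV. (s *\<^sub>R axis l 1) $ j * pderiv j f (x + t *\<^sub>R axis l 1))
     = pderiv l f (x + t *\<^sub>R axis l 1) * s" for s
    by (simp add: mult.assoc sum_distrib_left[symmetric] sum_axis mult.commute)
  ultimately show ?thesis by (simp add: has_field_derivative_def)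
qed

text \<open>Both mixed partials are limits of the same second difference quotient, by two applications
  of the mean value theorem.\<close>
lemma second_difference:
  fixes f :: "real^'m \<Rightarrow> real"
  assumes f: "smooth f" and t: "t > 0"
  shows "\<exists>y. dist y x \<le> 2 * t \<and>
     f (x + t *\<^sub>R axis i 1 + t *\<^sub>R axis j 1) - f (x + t *\<^sub>R axis i 1) - f (x + t *\<^sub>R axis j 1) + f x
       = t * t * pderiv j (pderiv i f) y"
proof -
  define g where "g s = f (x + t *\<^sub>R axis j 1 + s *\<^sub>R axis i 1) - f (x + s *\<^sub>R axis i 1)" for s
  have "\<exists>s. 0 < s \<and> s < t \<and> g t - g 0 = (t - 0) *
     (pderiv i f (x + t *\<^sub>R axis j 1 + s *\<^sub>R axis i 1) - pderiv i f (x + s *\<^sub>R axis i 1))"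
    unfolding g_def
    by (rule MVT2[OF t]) (intro DERIV_diff smooth_line_deriv f)
  then obtain s where s: "0 < s" "s < t" "g t - g 0 = t *
     (pderiv i f (x + t *\<^sub>R axis j 1 + s *\<^sub>R axis i 1) - pderiv i f (x + s *\<^sub>R axis i 1))" by auto
  have "\<exists>r. 0 < r \<and> r < t \<and> pderiv i f (x + s *\<^sub>R axis i 1 + t *\<^sub>R axis j 1)
      - pderiv i f (x + s *\<^sub>R axis i 1 + 0 *\<^sub>R axis j 1)
      = (t - 0) * pderiv j (pderiv i f) (x + s *\<^sub>R axis i 1 + r *\<^sub>R axis j 1)"
    by (rule MVT2[OF t]) (intro smooth_line_deriv smooth_pderiv f)
  then obtain r where r: "0 < r" "r < t" "pderiv i f (x + s *\<^sub>R axis i 1 + t *\<^sub>R axis j 1)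
      - pderiv i f (x + s *\<^sub>R axis i 1)
      = t * pderiv j (pderiv i f) (x + s *\<^sub>R axis i 1 + r *\<^sub>R axis j 1)" by auto
  have "dist (x + s *\<^sub>R axis i 1 + r *\<^sub>R axis j 1) x \<le> norm (s *\<^sub>R (axis i 1::real^'m)) + norm (r *\<^sub>R (axis j 1::real^'m))"
    using norm_triangle_ineq[of "s *\<^sub>R (axis i 1::real^'m)" "r *\<^sub>R (axis j 1::real^'m)"]
    by (simp add: dist_norm add.assoc)
  also have "\<dots> \<le> 2 * t" using s r by (simp add: norm_axis_1)
  finally show ?thesis using s(3) r(3)
    by (intro exI[of _ "x + s *\<^sub>R axis i 1 + r *\<^sub>R axis j 1"])
       (auto simp: g_def algebra_simps)
qed

lemma pderiv_commute:
  fixes f :: "real^'m \<Rightarrow> real"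
  assumes f: "smooth f"
  shows "pderiv i (pderiv j f) x = pderiv j (pderiv i f) x"
proof -
  define t where "t n = 1 / real (Suc n)" for n
  have t: "t n > 0" for n by (simp add: t_def)
  have t0: "(\<lambda>n. 2 * t n) \<longlonglongrightarrow> 0"
    unfolding t_def using tendsto_mult_right_zero[OF LIMSEQ_inverse_real_of_nat, of 2] by (simp add: inverse_eq_divide)
  obtain y where y: "\<And>n. dist (y n) x \<le> 2 * t n" "\<And>n.
     f (x + t n *\<^sub>R axis i 1 + t n *\<^sub>R axis j 1) - f (x + t n *\<^sub>R axis i 1) - f (x + t n *\<^sub>R axis j 1) + f x
       = t n * t n * pderiv j (pderiv i f) (y n)"
    using second_difference[OF f t, of x _ i j] by metis
  obtain z where z: "\<And>n. dist (z n) x \<le> 2 * t n" "\<And>n.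
     f (x + t n *\<^sub>R axis j 1 + t n *\<^sub>R axis i 1) - f (x + t n *\<^sub>R axis j 1) - f (x + t n *\<^sub>R axis i 1) + f x
       = t n * t n * pderiv i (pderiv j f) (z n)"
    using second_difference[OF f t, of x _ j i] by metis
  have "t n * t n * pderiv j (pderiv i f) (y n) = t n * t n * pderiv i (pderiv j f) (z n)" for n
    unfolding y(2)[symmetric] z(2)[symmetric] by (simp add: algebra_simps)
  then have eq: "pderiv j (pderiv i f) (y n) = pderiv i (pderiv j f) (z n)" for n
    using less_imp_neq[OF t[of n]] by (simp add: t_def)
  have "y \<longlonglongrightarrow> x" "z \<longlonglongrightarrow> x"
    using y(1) z(1) t by (auto intro!: metric_tendsto_imp_tendsto[OF t0] always_eventually simp: dist_norm abs_of_pos)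
  moreover have "isCont (pderiv j (pderiv i f)) x" "isCont (pderiv i (pderiv j f)) x"
    using smooth_continuous[OF smooth_pderiv[OF smooth_pderiv[OF f]], of UNIV] by (auto simp: continuous_on_eq_continuous_at)
  ultimately have "(\<lambda>n. pderiv j (pderiv i f) (y n)) \<longlonglongrightarrow> pderiv j (pderiv i f) x"
    "(\<lambda>n. pderiv i (pderiv j f) (z n)) \<longlonglongrightarrow> pderiv i (pderiv j f) x"
    by (auto intro: isCont_tendsto_compose)
  then show ?thesis using LIMSEQ_unique by (simp add: eq)
qed

section \<open>Compactly supported test functions\<close>

lemma test_funI:
  assumes "smooth \<phi>" "compact K" "K \<subseteq> U" "\<And>x. x \<notin> K \<Longrightarrow> \<phi> x = 0"
  shows "test_fun U \<phi>"
proof -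
  have "{x. \<phi> x \<noteq> 0} \<subseteq> K" using assms by auto
  then have "closure {x. \<phi> x \<noteq> 0} \<subseteq> K" by (simp add: closure_minimal compact_imp_closed assms)
  then show ?thesis unfolding test_fun_def using assms
    by (meson closed_closure compact_Int_closed compact_closure bounded_subset closure_subset compact_imp_bounded order_trans)
qed

text \<open>The closed support serves for the function and for its partial derivatives alike: on the
  open complement the function vanishes identically, hence so does its derivative.\<close>

lemma test_funE:
  assumes "test_fun U \<phi>"
  obtains K where "compact K" "K \<subseteq> U" "\<And>x. x \<notin> K \<Longrightarrow> \<phi> x = 0" "\<And>x l. x \<notin> K \<Longrightarrow> pderiv l \<phi> x = 0"
proof (rule that[of "closure {x. \<phi> x \<noteq> 0}"])
  let ?K = "closure {x. \<phi> x \<noteq> 0}"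
  show "compact ?K" "?K \<subseteq> U" using assms by (auto simp: test_fun_def)
  show 1: "\<phi> x = 0" if "x \<notin> ?K" for x
    using that closure_subset[of "{x. \<phi> x \<noteq> 0}"] by auto
  show "pderiv l \<phi> x = 0" if "x \<notin> ?K" for x l
  proof -
    have "(\<phi> has_derivative (\<lambda>v. 0)) (at x)"
    proof (rule has_derivative_transform_within_open[OF has_derivative_const])
      show "open (- ?K)" by (simp add: open_Compl)
      show "x \<in> - ?K" using that by simp
      show "0 = \<phi> y" if "y \<in> - ?K" for y using 1[of y] that by (metis ComplD)
    qed
    from pderiv_eqI[OF this] show ?thesis by simp
  qed
qed

lemma test_fun_supp:
  assumes "test_fun U \<phi>"
  obtains K where "compact K" "K \<subseteq> U" "\<And>x. x \<notin> K \<Longrightarrow> \<phi> x = 0"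
  by (rule test_funE[OF assms]) (erule that, assumption, blast)

lemma test_fun_smooth: "test_fun U \<phi> \<Longrightarrow> smooth \<phi>" by (simp add: test_fun_def)

lemma test_fun_mono: "test_fun U \<phi> \<Longrightarrow> U \<subseteq> V \<Longrightarrow> test_fun V \<phi>" by (auto simp: test_fun_def)

lemma test_fun_ball_mono: "test_fun (ball 0 r) \<phi> \<Longrightarrow> r \<le> R \<Longrightarrow> test_fun (ball 0 R) \<phi>"
  by (erule test_fun_mono) auto

lemma test_fun_mult: "test_fun U \<phi> \<Longrightarrow> smooth f \<Longrightarrow> test_fun U (\<lambda>x. f x * \<phi> x)"
  by (rule test_funE[of U \<phi>], assumption, rule test_funI) (auto intro: smooth_mult simp: test_fun_def)

lemma test_fun_cmult: "test_fun U \<phi> \<Longrightarrow> test_fun U (\<lambda>x. c * \<phi> x)"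
  by (rule test_fun_mult[OF _ smooth_const])

lemma test_fun_zero: "test_fun U (\<lambda>x. 0)"
  by (rule test_funI[of _ "{}"]) (auto intro: smooth_const)

lemma test_fun_add:
  assumes "test_fun U \<phi>" "test_fun U \<psi>" shows "test_fun U (\<lambda>x. \<phi> x + \<psi> x)"
proof -
  from assms(1) obtain K where K: "compact K" "K \<subseteq> U" "\<And>x. x \<notin> K \<Longrightarrow> \<phi> x = 0" by (rule test_fun_supp) (erule that, assumption, blast)
  from assms(2) obtain L where L: "compact L" "L \<subseteq> U" "\<And>x. x \<notin> L \<Longrightarrow> \<psi> x = 0" by (rule test_fun_supp) (erule that, assumption, blast)
  show ?thesis
    by (rule test_funI[of _ "K \<union> L"]) (use K L assms in \<open>auto intro: smooth_add test_fun_smooth\<close>)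
qed

lemma test_fun_diff: "test_fun U \<phi> \<Longrightarrow> test_fun U \<psi> \<Longrightarrow> test_fun U (\<lambda>x. \<phi> x - \<psi> x)"
  using test_fun_add[of U \<phi> "\<lambda>x. -1 * \<psi> x"] test_fun_cmult[of U \<psi> "-1"] by simp

lemma test_fun_pderiv: "test_fun U \<phi> \<Longrightarrow> test_fun U (pderiv l \<phi>)"
  by (rule test_funE[of U \<phi>], assumption, rule test_funI) (auto intro: smooth_pderiv simp: test_fun_def)

lemma test_fun_translate:
  assumes "test_fun (ball 0 r) \<phi>" "r + norm a \<le> R"
  shows "test_fun (ball 0 R) (\<lambda>x. \<phi> (x + a))"
proof -
  from assms(1) obtain K where K: "compact K" "K \<subseteq> ball 0 r" "\<And>x. x \<notin> K \<Longrightarrow> \<phi> x = 0" by (rule test_fun_supp) (erule that, assumption, blast)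
  have "compact ((\<lambda>x. x - a) ` K)" by (intro compact_continuous_image K continuous_intros)
  moreover have "(\<lambda>x. x - a) ` K \<subseteq> ball 0 R"
  proof
    fix y assume "y \<in> (\<lambda>x. x - a) ` K"
    then obtain x where "x \<in> K" "y = x - a" by auto
    then have "norm y \<le> norm x + norm a" "norm x < r" using K(2) norm_triangle_ineq4 by (auto simp: subset_iff)
    then show "y \<in> ball 0 R" using assms(2) by simp
  qed
  moreover have "\<phi> (x + a) = 0" if "x \<notin> (\<lambda>x. x - a) ` K" for x
    using that K(3)[of "x + a"] by (metis add_diff_cancel image_eqI)
  ultimately show ?thesis
    using smooth_translate[OF test_fun_smooth[OF assms(1)]] by (intro test_funI) auto
qed

text \<open>A compact subset of an open ball keeps a positive distance from the sphere. The radius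
  gained leaves room for a cutoff and for estimates that hold only on strictly smaller
  balls.\<close>

lemma test_fun_ball_shrink:
  assumes "test_fun (ball 0 R) (\<phi> :: real^'m \<Rightarrow> real)" "0 < R"
  obtains r where "0 < r" "r < R" "test_fun (ball 0 r) \<phi>"
proof -
  from assms(1) obtain K where K: "compact K" "K \<subseteq> ball 0 R" "\<And>x. x \<notin> K \<Longrightarrow> \<phi> x = 0" by (rule test_fun_supp) (erule that, assumption, blast)
  have "\<exists>r. 0 < r \<and> r < R \<and> K \<subseteq> ball 0 r"
  proof (cases "K = {}")
    case True then show ?thesis using assms(2) dense by auto
  next
    case False
    then obtain x where x: "x \<in> K" "\<And>y. y \<in> K \<Longrightarrow> norm y \<le> norm x"
      using continuous_attains_sup[OF K(1) False, of norm] by (auto intro: continuous_intros)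
    then have "norm x < R" using K(2) by auto
    then obtain r where r: "norm x < r" "r < R" using dense by blast
    then have "0 < r" using norm_ge_zero[of x] by linarith
    then show ?thesis using r x(2) by (intro exI[of _ r]) (force simp: subset_iff)
  qed
  then show ?thesis using that test_funI[OF test_fun_smooth[OF assms(1)] K(1) _ K(3)] by blast
qed

lemma test_fun_bounded:
  assumes "test_fun U \<phi>" obtains M where "0 < M" "\<And>x. \<bar>\<phi> x\<bar> \<le> M"
proof -
  from assms obtain K where K: "compact K" "K \<subseteq> U" "\<And>x. x \<notin> K \<Longrightarrow> \<phi> x = 0" by (rule test_fun_supp) (erule that, assumption, blast)
  have "compact (\<phi> ` K)"
    by (intro compact_continuous_image smooth_continuous test_fun_smooth[OF assms] K)
  then obtain M where M: "\<forall>y\<in>\<phi> ` K. norm y \<le> M"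
    using compact_imp_bounded bounded_iff by metis
  show ?thesis
  proof (rule that[of "\<bar>M\<bar> + 1"])
    show "\<bar>\<phi> x\<bar> \<le> \<bar>M\<bar> + 1" for x
      using M K(3)[of x] by (cases "x \<in> K") force+
  qed simp
qed

lemma test_fun_integrable:
  fixes \<phi> :: "real^'m \<Rightarrow> real"
  assumes "test_fun U \<phi>" shows "integrable lborel \<phi>"
proof -
  from assms obtain K where K: "compact K" "K \<subseteq> U" "\<And>x. x \<notin> K \<Longrightarrow> \<phi> x = 0" by (rule test_fun_supp) (erule that, assumption, blast)
  have "integrable lborel (\<lambda>x. indicator K x *\<^sub>R \<phi> x)"
    by (intro borel_integrable_compact K smooth_continuous test_fun_smooth[OF assms])
  moreover have "(\<lambda>x. indicator K x *\<^sub>R \<phi> x) = \<phi>" using K(3) by (fastforce simp: indicator_def)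
  ultimately show ?thesis by simp
qed

subsection \<open>A smooth bump\<close>

text \<open>The functions \<open>t^(-n) exp(-1/t)\<close>, extended by zero. The whole family is
  needed because differentiation leads from index n to n + 1 and n + 2; smoothness is then one
  induction over all n at once.\<close>

definition flat :: "nat \<Rightarrow> real \<Rightarrow> real" where
  "flat n t = (if t > 0 then (1 / t) ^ n * exp (- (1 / t)) else 0)"

lemma flat_tendsto: "(flat n \<longlongrightarrow> 0) (at 0)"
proof -
  have "((\<lambda>x. x ^ n / exp x) \<longlongrightarrow> (0::real)) at_top" by (rule tendsto_power_div_exp_0)
  then have "((\<lambda>t. (inverse t) ^ n / exp (inverse t)) \<longlongrightarrow> (0::real)) (at_right 0)"
    by (rule filterlim_compose[OF _ filterlim_inverse_at_top_right])
  moreover have "\<forall>\<^sub>F t in at_right 0. (inverse t) ^ n / exp (inverse t) = flat n t"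
    unfolding eventually_at_right_field by (rule exI[of _ 1]) (auto simp: flat_def exp_minus field_simps)
  ultimately have 1: "(flat n \<longlongrightarrow> 0) (at_right 0)" using tendsto_cong by fast
  have "\<forall>\<^sub>F t in at_left 0. 0 = flat n t"
    unfolding eventually_at_left_field by (rule exI[of _ "-1"]) (auto simp: flat_def)
  then have "(flat n \<longlongrightarrow> 0) (at_left 0)" using tendsto_cong tendsto_const by fast
  then show ?thesis using 1 filterlim_split_at by blast
qed

lemma flat_deriv: "(flat n has_real_derivative (flat (n + 2) t - real n * flat (n + 1) t)) (at t)"
proof -
  consider "t > 0" | "t < 0" | "t = 0" by linarith
  then show ?thesis
  proof cases
    case 1
    have "((\<lambda>t. (1 / t) ^ n * exp (- (1 / t))) has_real_derivative (flat (n + 2) t - real n * flat (n + 1) t)) (at t)"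
    proof (cases n)
      case 0
      then show ?thesis using 1
        by (auto intro!: derivative_eq_intros simp: flat_def field_simps power2_eq_square)
    next
      case (Suc j)
      have d: "((\<lambda>t. 1 / t) has_real_derivative - (1 / t)\<^sup>2) (at t)"
        using 1 by (auto intro!: derivative_eq_intros simp: power2_eq_square)
      from DERIV_mult[OF DERIV_power[OF d, of n] DERIV_fun_exp[OF DERIV_minus[OF d]]]
      have "((\<lambda>t. (1 / t) ^ n * exp (- (1 / t))) has_real_derivative
          (real n * ((1 / t) ^ (n - Suc 0) * - (1 / t)\<^sup>2) * exp (- (1 / t)) + exp (- (1 / t)) * (- (- (1 / t)\<^sup>2)) * (1 / t) ^ n)) (at t)"
        by (simp add: algebra_simps)
      moreover have "real n * ((1 / t) ^ (n - Suc 0) * - (1 / t)\<^sup>2) * exp (- (1 / t)) + exp (- (1 / t)) * (- (- (1 / t)\<^sup>2)) * (1 / t) ^ n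
         = flat (n + 2) t - real n * flat (n + 1) t"
        using 1 unfolding Suc by (simp add: flat_def power2_eq_square algebra_simps)
      ultimately show ?thesis by simp
    qed
    then show ?thesis
      by (rule has_field_derivative_transform_within_open[where S="{0<..}"]) (use 1 in \<open>auto simp: flat_def\<close>)
  next
    case 2
    have "((\<lambda>t. 0) has_real_derivative (flat (n + 2) t - real n * flat (n + 1) t)) (at t)"
      using 2 by (auto simp: flat_def)
    then show ?thesis
      by (rule has_field_derivative_transform_within_open[where S="{..<0}"]) (use 2 in \<open>auto simp: flat_def\<close>)
  next
    \<comment> \<open>At the origin the difference quotient of \<open>flat n\<close> is exactly
      \<open>flat (Suc n)\<close>, on both sides.\<close>
    case 3
    have "((\<lambda>h. (flat n (0 + h) - flat n 0) / h) \<longlongrightarrow> 0) (at 0)"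
    proof (rule Lim_transform_eventually[OF flat_tendsto[of "Suc n"]])
      show "\<forall>\<^sub>F h in at 0. flat (Suc n) h = (flat n (0 + h) - flat n 0) / h"
        by (intro always_eventually) (auto simp: flat_def)
    qed
    then show ?thesis using 3 by (simp add: DERIV_def flat_def)
  qed
qed

lemma smooth_flat: "smooth (flat n)"
proof -
  have "Ck_on k UNIV (flat n)" for k
  proof (induction k arbitrary: n)
    case 0
    show ?case using DERIV_isCont[OF flat_deriv] by (simp add: continuous_at_imp_continuous_on)
  next
    case (Suc k)
    show ?case unfolding Ck_on.simps
    proof (intro exI[of _ "\<lambda>t s. (flat (n + 2) t - real n * flat (n + 1) t) * s"] conjI allI ballI)
      show "(flat n has_derivative (*) (flat (n + 2) t - real n * flat (n + 1) t)) (at t)" for t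
        using flat_deriv by (simp add: has_field_derivative_def)
      show "Ck_on k UNIV (\<lambda>t. (flat (n + 2) t - real n * flat (n + 1) t) * s)" for s
        using Ck_on_mult[OF Ck_on_add[OF Suc[of "n+2"] Ck_on_mult[OF Ck_on_const[of k UNIV "- real n"] Suc[of "n+1"]]] Ck_on_const[of k UNIV s]]
        by simp
    qed
  qed
  then show ?thesis by (simp add: smooth_on_def)
qed

text \<open>Supported in a cube instead of a ball: a product over coordinates needs only products
  and affine substitutions of \<open>flat 0\<close>.\<close>

definition bump :: "real \<Rightarrow> real^'m \<Rightarrow> real" where
  "bump e x = (\<Prod>l\<in>UNIV. flat 0 (e + x $ l) * flat 0 (e - x $ l))"

lemma smooth_bump: "smooth (bump e)"
proof -
  have 1: "smooth (\<lambda>x::real^'m. flat 0 (e + x $ l))" for l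
    by (rule smooth_affine[OF bounded_linear_vec_nth smooth_flat])
  have 2: "smooth (\<lambda>x::real^'m. flat 0 (e + - (x $ l)))" for l
    by (rule smooth_affine[OF bounded_linear_minus[OF bounded_linear_vec_nth] smooth_flat])
  show ?thesis unfolding bump_def
    by (rule smooth_prod) (use smooth_mult[OF 1 2] in simp)
qed

lemma flat_nonneg: "flat n t \<ge> 0" by (simp add: flat_def)

lemma bump_nonneg: "bump e x \<ge> 0" by (simp add: bump_def flat_nonneg prod_nonneg)

lemma bump_pos_0: "e > 0 \<Longrightarrow> bump e 0 > 0" by (auto simp: bump_def flat_def intro!: prod_pos)

lemma bump_supp: "bump e x \<noteq> 0 \<Longrightarrow> \<bar>x $ l\<bar> < e"
proof -
  assume "bump e x \<noteq> 0"
  then have "flat 0 (e + x $ l) * flat 0 (e - x $ l) \<noteq> 0" by (auto simp: bump_def)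
  then have "e + x $ l > 0 \<and> e - x $ l > 0" by (auto simp: flat_def split: if_splits)
  then show ?thesis by auto
qed

lemma bump_support:
  assumes "e > 0" "bump e (x::real^'m) \<noteq> 0" shows "norm x \<le> real CARD('m) * e"
proof -
  have "norm x \<le> (\<Sum>l\<in>UNIV. \<bar>x $ l\<bar>)" by (rule norm_le_l1_cart)
  also have "\<dots> \<le> (\<Sum>l\<in>(UNIV::'m set). e)" using bump_supp[OF assms(2)] by (intro sum_mono) (simp add: less_imp_le)
  finally show ?thesis by simp
qed

lemma mollifier_exists:
  assumes "\<delta> > 0"
  obtains \<rho> :: "real^'m \<Rightarrow> real" where "test_fun (ball 0 \<delta>) \<rho>" "\<And>x. \<rho> x \<ge> 0" "(\<integral>x. \<rho> x \<partial>lborel) = 1"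
proof -
  \<comment> \<open>The cube of half-width \<open>e\<close> lies in the ball of radius
    \<open>\<delta> / 2\<close>, since the norm is at most the sum of the absolute
    coordinates.\<close>
  define e where "e = \<delta> / (2 * real CARD('m))"
  have e: "e > 0" using assms by (simp add: e_def)
  have ce: "real CARD('m) * e = \<delta> / 2" by (simp add: e_def)
  let ?b = "bump e :: real^'m \<Rightarrow> real"
  have t: "test_fun (ball 0 \<delta>) ?b"
  proof (rule test_funI[OF smooth_bump, of "cball 0 (\<delta>/2)"])
    show "?b x = 0" if "x \<notin> cball 0 (\<delta> / 2)" for x
      using that bump_support[OF e, of x] ce by auto
  qed (use assms in auto)
  have int: "integrable lborel ?b" by (rule test_fun_integrable[OF t])
  \<comment> \<open>A zero integral would make the nonempty open set where the bump is nonzero a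
    null set.\<close>
  have "(\<integral>x. ?b x \<partial>lborel) \<noteq> 0"
  proof
    assume "(\<integral>x. ?b x \<partial>lborel) = 0"
    then have "AE x in lborel. ?b x = 0"
      using integral_nonneg_eq_0_iff_AE[OF int] bump_nonneg by auto
    moreover have "open {x. ?b x \<noteq> 0}"
      by (rule open_Collect_neq) (auto intro: smooth_continuous smooth_bump)
    moreover have "{x. ?b x \<noteq> 0} \<noteq> {}" using bump_pos_0[OF e] by (metis (mono_tags) empty_iff less_irrefl mem_Collect_eq)
    ultimately show False
      using open_not_negligible[of "{x. ?b x \<noteq> 0}"]
      by (auto simp: AE_iff_null negligible_iff_null_sets intro: null_sets_completionI)
  qed
  moreover have "(\<integral>x. ?b x \<partial>lborel) \<ge> 0" by (simp add: bump_nonneg)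
  ultimately have pos: "(\<integral>x. ?b x \<partial>lborel) > 0" by simp
  show ?thesis
    by (rule that[of "\<lambda>x. inverse (\<integral>x. ?b x \<partial>lborel) * ?b x"])
       (use t pos int in \<open>auto intro: test_fun_cmult simp: bump_nonneg less_imp_le\<close>)
qed

section \<open>Square-integrable functions\<close>

text \<open>Representatives are total Borel functions on the whole space, neither classes nor
  functions on a domain, so translation and convolution need no bookkeeping; locality enters only
  through test functions and cutoffs.\<close>

definition L2 :: "(real^'m \<Rightarrow> real) \<Rightarrow> bool" where
  "L2 f \<longleftrightarrow> f \<in> borel_measurable borel \<and> integrable lborel (\<lambda>x. (f x)\<^sup>2)"

text \<open>The Bochner integral of a non-integrable square is 0, so bounds on \<open>n2\<close>
  carry information only together with \<open>L2\<close>.\<close>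

definition n2 :: "(real^'m \<Rightarrow> real) \<Rightarrow> real" where
  "n2 f = sqrt (\<integral>x. (f x)\<^sup>2 \<partial>lborel)"

lemma L2_measurable [measurable_dest]: "L2 f \<Longrightarrow> f \<in> borel_measurable borel"
  by (simp add: L2_def)

lemma L2_sq: "L2 f \<Longrightarrow> integrable lborel (\<lambda>x. (f x)\<^sup>2)"
  by (simp add: L2_def)

lemma abs_mult_le_sq: "\<bar>a * b\<bar> \<le> a\<^sup>2 + (b\<^sup>2 :: real)"
proof -
  have "0 \<le> (\<bar>a\<bar> - \<bar>b\<bar>)\<^sup>2" by simp
  then have "2 * (\<bar>a\<bar> * \<bar>b\<bar>) \<le> a\<^sup>2 + b\<^sup>2" by (simp add: power2_eq_square algebra_simps)
  moreover have "0 \<le> \<bar>a\<bar> * \<bar>b\<bar>" by simp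
  ultimately show ?thesis unfolding abs_mult by linarith
qed

lemma L2_mult_integrable: "L2 f \<Longrightarrow> L2 g \<Longrightarrow> integrable lborel (\<lambda>x. f x * g x)"
  by (rule Bochner_Integration.integrable_bound[of _ "\<lambda>x. (f x)\<^sup>2 + (g x)\<^sup>2"])
     (auto simp: L2_def abs_mult_le_sq intro!: always_eventually order_trans[OF abs_mult_le_sq])

lemma L2_dom: "L2 g \<Longrightarrow> f \<in> borel_measurable borel \<Longrightarrow> (\<And>x. \<bar>f x\<bar> \<le> \<bar>g x\<bar>) \<Longrightarrow> L2 f"
  unfolding L2_def
  by (auto intro!: Bochner_Integration.integrable_bound[of _ "\<lambda>x. (g x)\<^sup>2"] AE_I2 simp: power2_le_iff_abs_le abs_le_square_iff[symmetric])

lemma L2_zero [simp]: "L2 (\<lambda>x. 0)" by (simp add: L2_def)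

lemma L2_cmult: "L2 f \<Longrightarrow> L2 (\<lambda>x. c * f x)"
  unfolding L2_def by (auto simp: power_mult_distrib)

lemma L2_minus: "L2 f \<Longrightarrow> L2 (\<lambda>x. - f x)"
  using L2_cmult[of f "-1"] by simp

lemma L2_add: assumes "L2 f" "L2 g" shows "L2 (\<lambda>x. f x + g x)"
proof -
  have "(\<lambda>x. (f x + g x)\<^sup>2) = (\<lambda>x. (f x)\<^sup>2 + (g x)\<^sup>2 + 2 * (f x * g x))"
    by (auto simp: power2_eq_square algebra_simps)
  then show ?thesis
    using assms L2_mult_integrable[OF assms] unfolding L2_def by auto
qed

lemma L2_diff: "L2 f \<Longrightarrow> L2 g \<Longrightarrow> L2 (\<lambda>x. f x - g x)"
  using L2_add[of f "\<lambda>x. - g x"] L2_minus by auto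

lemma L2_sum: "(\<And>i. i \<in> I \<Longrightarrow> L2 (f i)) \<Longrightarrow> L2 (\<lambda>x. \<Sum>i\<in>I. f i x)"
  by (induction I rule: infinite_finite_induct) (auto intro: L2_add)

lemma L2_bounded_mult:
  assumes "L2 f" "g \<in> borel_measurable borel" "\<And>x. \<bar>g x\<bar> \<le> M"
  shows "L2 (\<lambda>x. g x * f x)"
proof (rule L2_dom[OF L2_cmult[OF assms(1), of M]])
  show "\<bar>g x * f x\<bar> \<le> \<bar>M * f x\<bar>" for x
    using assms(3)[of x] by (simp add: abs_mult mult_right_mono)
qed (use assms in measurable)

lemma L2_abs: "L2 f \<Longrightarrow> L2 (\<lambda>x. \<bar>f x\<bar>)"
  by (rule L2_dom) auto

lemma n2_nonneg [simp]: "n2 f \<ge> 0" by (simp add: n2_def)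

lemma n2_sq: "(n2 f)\<^sup>2 = (\<integral>x. (f x)\<^sup>2 \<partial>lborel)" by (simp add: n2_def)

lemma n2_cong: "(\<And>x. \<bar>f x\<bar> = \<bar>g x\<bar>) \<Longrightarrow> n2 f = n2 g"
  unfolding n2_def by (metis power2_abs)

lemma n2_mono:
  assumes "L2 g" "f \<in> borel_measurable borel" "\<And>x. \<bar>f x\<bar> \<le> \<bar>g x\<bar>" shows "n2 f \<le> n2 g"
proof -
  have "L2 f" using L2_dom assms by blast
  then show ?thesis unfolding n2_def
    using assms by (auto intro!: integral_mono L2_sq simp: abs_le_square_iff)
qed

text \<open>The squared norm of \<open>f - t g\<close> is a nonnegative quadratic polynomial in t;
  its minimum at \<open>t = c / b\<close> gives the inequality.\<close>

lemma L2_CS: assumes "L2 f" "L2 g" shows "\<bar>\<integral>x. f x * g x \<partial>lborel\<bar> \<le> n2 f * n2 g"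
proof -
  define a b c where "a = (\<integral>x. (f x)\<^sup>2 \<partial>lborel)" "b = (\<integral>x. (g x)\<^sup>2 \<partial>lborel)" "c = (\<integral>x. f x * g x \<partial>lborel)"
  have q: "0 \<le> a - 2 * t * c + t\<^sup>2 * b" for t
  proof -
    have "(\<integral>x. (f x - t * g x)\<^sup>2 \<partial>lborel) = (\<integral>x. (f x)\<^sup>2 - 2 * t * (f x * g x) + t\<^sup>2 * (g x)\<^sup>2 \<partial>lborel)"
      by (rule Bochner_Integration.integral_cong) (auto simp: power2_eq_square algebra_simps)
    also have "\<dots> = a - 2 * t * c + t\<^sup>2 * b"
      using L2_mult_integrable[OF assms] L2_sq[OF assms(1)] L2_sq[OF assms(2)]
      by (simp add: a_b_c_def)
    moreover have "0 \<le> (\<integral>x. (f x - t * g x)\<^sup>2 \<partial>lborel)" by simp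
    ultimately show ?thesis by linarith
  qed
  have b0: "b \<ge> 0" by (simp add: a_b_c_def)
  have "c\<^sup>2 \<le> a * b"
  proof (cases "b = 0")
    case True
    have "c = 0"
    proof (rule ccontr)
      assume "c \<noteq> 0"
      \<comment> \<open>With \<open>b = 0\<close> this value of t makes the polynomial equal to
        -1.\<close>
      then show False using q[of "(a + 1) / (2 * c)"] True by (simp add: field_simps)
    qed
    then show ?thesis using True by simp
  next
    case False
    have "0 \<le> a - c\<^sup>2 / b" using q[of "c / b"] False by (simp add: field_simps power2_eq_square)
    then show ?thesis using False b0 by (simp add: field_simps)
  qed
  then have "sqrt (c\<^sup>2) \<le> sqrt (a * b)" by (rule real_sqrt_le_mono)
  then show ?thesis by (simp add: n2_def a_b_c_def real_sqrt_mult)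
qed

lemma L2_CS_abs: assumes "L2 f" "L2 g" shows "(\<integral>x. \<bar>f x * g x\<bar> \<partial>lborel) \<le> n2 f * n2 g"
proof -
  have "(\<integral>x. \<bar>f x * g x\<bar> \<partial>lborel) = (\<integral>x. \<bar>f x\<bar> * \<bar>g x\<bar> \<partial>lborel)" by (simp add: abs_mult)
  also have "\<dots> \<le> n2 (\<lambda>x. \<bar>f x\<bar>) * n2 (\<lambda>x. \<bar>g x\<bar>)"
    using L2_CS[OF L2_abs[OF assms(1)] L2_abs[OF assms(2)]] by simp
  also have "\<dots> = n2 f * n2 g" by (simp add: n2_def)
  finally show ?thesis .
qed

lemma n2_add: assumes "L2 f" "L2 g" shows "n2 (\<lambda>x. f x + g x) \<le> n2 f + n2 g"
proof (rule power2_le_imp_le)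
  have "(n2 (\<lambda>x. f x + g x))\<^sup>2 = (\<integral>x. (f x)\<^sup>2 + (g x)\<^sup>2 + 2 * (f x * g x) \<partial>lborel)"
    unfolding n2_sq by (rule Bochner_Integration.integral_cong) (auto simp: power2_eq_square algebra_simps)
  also have "\<dots> = (n2 f)\<^sup>2 + (n2 g)\<^sup>2 + 2 * (\<integral>x. f x * g x \<partial>lborel)"
    using L2_mult_integrable[OF assms] L2_sq[OF assms(1)] L2_sq[OF assms(2)] by (simp add: n2_sq)
  also have "\<dots> \<le> (n2 f + n2 g)\<^sup>2"
    using L2_CS[OF assms] by (simp add: power2_eq_square algebra_simps)
  finally show "(n2 (\<lambda>x. f x + g x))\<^sup>2 \<le> (n2 f + n2 g)\<^sup>2" .
qed simp

lemma n2_cmult: "n2 (\<lambda>x. c * f x) = \<bar>c\<bar> * n2 f"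
  by (simp add: n2_def power_mult_distrib real_sqrt_mult)

lemma n2_diff: assumes "L2 f" "L2 g" shows "n2 (\<lambda>x. f x - g x) \<le> n2 f + n2 g"
  using n2_add[OF assms(1) L2_minus[OF assms(2)]] by (simp add: n2_cong[of "\<lambda>x. - g x" g])

lemma n2_diff_commute: "n2 (\<lambda>x. f x - g x) = n2 (\<lambda>x. g x - f x)"
  by (rule n2_cong) simp

lemma n2_triangle3:
  assumes "L2 f" "L2 g" "L2 h" shows "n2 (\<lambda>x. f x - h x) \<le> n2 (\<lambda>x. f x - g x) + n2 (\<lambda>x. g x - h x)"
  using n2_add[OF L2_diff[OF assms(1,2)] L2_diff[OF assms(2,3)]] by simp

section \<open>Translation and reflection invariance of Lebesgue measure\<close>

lemma lborel_translate:
  fixes f :: "real^'m \<Rightarrow> 'b::{banach, second_countable_topology}"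
  shows "(\<integral>x. f (x + a) \<partial>lborel) = (\<integral>x. f x \<partial>lborel)" (is ?A)
    and "integrable lborel (\<lambda>x. f (x + a)) \<longleftrightarrow> integrable lborel f" (is ?B)
proof -
  have B1: "integrable lborel (\<lambda>x. f (x + a))" if "integrable lborel f" for f :: "real^'m \<Rightarrow> 'b" and a
  proof -
    have "integrable (distr lborel borel ((+) a)) f" using that by (simp add: lborel_distr_plus)
    then have "integrable lborel (\<lambda>x. f (a + x))" by (subst (asm) integrable_distr_eq) (use that in auto)
    then show ?thesis by (simp add: add.commute)
  qed
  show ?B using B1[of f a] B1[of "\<lambda>x. f (x + a)" "-a"] by auto
  show ?A
  proof (cases "integrable lborel f")
    case True
    have "(\<integral>x. f x \<partial>lborel) = (\<integral>x. f x \<partial>distr lborel borel ((+) a))" by (simp add: lborel_distr_plus)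
    also have "\<dots> = (\<integral>x. f (a + x) \<partial>lborel)" by (subst integral_distr) (use True in auto)
    finally show ?thesis by (simp add: add.commute)
  next
    case False
    then show ?thesis using \<open>?B\<close> by (simp add: not_integrable_integral_eq)
  qed
qed

lemma nn_lborel_translate:
  fixes f :: "real^'m \<Rightarrow> ennreal"
  assumes "f \<in> borel_measurable borel"
  shows "(\<integral>\<^sup>+x. f (x + a) \<partial>lborel) = (\<integral>\<^sup>+x. f x \<partial>lborel)"
proof -
  have "(\<integral>\<^sup>+x. f x \<partial>lborel) = (\<integral>\<^sup>+x. f x \<partial>distr lborel borel ((+) a))" by (simp add: lborel_distr_plus)
  also have "\<dots> = (\<integral>\<^sup>+x. f (a + x) \<partial>lborel)" by (subst nn_integral_distr) (use assms in auto)
  finally show ?thesis by (simp add: add.commute)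
qed

lemma lborel_reflect:
  fixes f :: "real^'m \<Rightarrow> real"
  assumes "f \<in> borel_measurable borel"
  shows "(\<integral>x. f (a - x) \<partial>lborel) = (\<integral>x. f x \<partial>lborel)"
proof -
  have "lborel = density (distr lborel borel (\<lambda>x::real^'m. a + (-1) *\<^sub>R x)) (\<lambda>_. 1)"
    using lborel_affine[of "-1" a] by simp
  then have "lborel = distr lborel borel (\<lambda>x::real^'m. a + (-1) *\<^sub>R x)"
    by (simp only: density_1)
  then have "(\<integral>x. f x \<partial>lborel) = (\<integral>x. f x \<partial>distr lborel borel (\<lambda>x::real^'m. a + (-1) *\<^sub>R x))"
    by (simp add: density_1)
  also have "\<dots> = (\<integral>x. f (a + (-1) *\<^sub>R x) \<partial>lborel)" by (subst integral_distr) (use assms in auto)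
  finally show ?thesis by simp
qed

lemma L2_translate: "L2 f \<Longrightarrow> L2 (\<lambda>x. f (x + a))"
  unfolding L2_def using lborel_translate(2)[of "\<lambda>x. (f x)\<^sup>2" a] by auto

lemma n2_translate: "n2 (\<lambda>x. f (x + a)) = n2 f"
  unfolding n2_def using lborel_translate(1)[of "\<lambda>x. (f x)\<^sup>2" a] by simp

lemma test_fun_L2: "test_fun U \<phi> \<Longrightarrow> L2 \<phi>"
  using test_fun_integrable[OF test_fun_mult[of U \<phi> \<phi>]] test_fun_smooth
  by (auto simp: L2_def power2_eq_square intro: smooth_measurable)

lemma L2_smooth_test: "L2 f \<Longrightarrow> test_fun U \<phi> \<Longrightarrow> L2 (\<lambda>x. \<phi> x * f x)"
  by (metis L2_bounded_mult smooth_measurable test_fun_smooth test_fun_bounded)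

lemma L2_ip_tendsto:
  assumes "\<And>n. L2 (f n)" "L2 f'" "L2 g" "(\<lambda>n. n2 (\<lambda>x. f n x - f' x)) \<longlonglongrightarrow> 0"
  shows "(\<lambda>n. \<integral>x. f n x * g x \<partial>lborel) \<longlonglongrightarrow> (\<integral>x. f' x * g x \<partial>lborel)"
proof -
  have "(\<lambda>n. (\<integral>x. f n x * g x \<partial>lborel) - (\<integral>x. f' x * g x \<partial>lborel)) \<longlonglongrightarrow> 0"
  proof (rule Lim_null_comparison)
    show "\<forall>\<^sub>F n in sequentially. norm ((\<integral>x. f n x * g x \<partial>lborel) - (\<integral>x. f' x * g x \<partial>lborel))
        \<le> n2 (\<lambda>x. f n x - f' x) * n2 g"
    proof (intro always_eventually allI)
      fix n
      have "(\<integral>x. f n x * g x \<partial>lborel) - (\<integral>x. f' x * g x \<partial>lborel) = (\<integral>x. (f n x - f' x) * g x \<partial>lborel)"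
        using L2_mult_integrable[OF assms(1)[of n] assms(3)] L2_mult_integrable[OF assms(2,3)]
        by (simp add: algebra_simps)
      then show "norm ((\<integral>x. f n x * g x \<partial>lborel) - (\<integral>x. f' x * g x \<partial>lborel)) \<le> n2 (\<lambda>x. f n x - f' x) * n2 g"
        using L2_CS[OF L2_diff[OF assms(1)[of n] assms(2)] assms(3)] by simp
    qed
    show "(\<lambda>n. n2 (\<lambda>x. f n x - f' x) * n2 g) \<longlonglongrightarrow> 0" using tendsto_mult_left_zero[OF assms(4)] by simp
  qed
  then show ?thesis by (rule LIM_zero_cancel)
qed

section \<open>Mollification\<close>

lemma integrable_translate_diff:
  fixes f :: "real^'m \<Rightarrow> real"
  shows "integrable lborel f \<Longrightarrow> integrable lborel (\<lambda>x. \<bar>f (x + a) - f x\<bar>)"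
  using lborel_translate(2)[of f a] by auto

lemma L1_translate_open:
  fixes a :: "nat \<Rightarrow> real^'m"
  assumes U: "open U" "emeasure lborel U < \<infinity>" and a: "a \<longlonglongrightarrow> 0"
  shows "(\<lambda>n. \<integral>x. \<bar>indicat_real U (x + a n) - indicat_real U x\<bar> \<partial>lborel) \<longlonglongrightarrow> 0"
proof -
  let ?i = "indicat_real U"
  have [measurable]: "U \<in> sets borel" using U by auto
  have int: "integrable lborel ?i" using U by (simp add: integrable_real_indicator)
  have int2: "integrable lborel (\<lambda>x. ?i (x + c))" for c using int lborel_translate(2)[of ?i c] by simp
  have int3: "integrable lborel (\<lambda>x. max 0 (?i x - ?i (x + c)))" for c using int int2[of c] by auto
  \<comment> \<open>equal masses: the integral of the absolute value is twice that of the positive part, which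
     tends to 0 pointwise because the set is open\<close>
  have eq: "(\<integral>x. \<bar>?i (x + c) - ?i x\<bar> \<partial>lborel) = 2 * (\<integral>x. max 0 (?i x - ?i (x + c)) \<partial>lborel)" for c
  proof -
    have "(\<integral>x. \<bar>?i (x + c) - ?i x\<bar> \<partial>lborel) = (\<integral>x. 2 * max 0 (?i x - ?i (x + c)) + (?i (x + c) - ?i x) \<partial>lborel)"
      by (rule Bochner_Integration.integral_cong) (auto simp: indicator_def)
    also have "\<dots> = 2 * (\<integral>x. max 0 (?i x - ?i (x + c)) \<partial>lborel) + ((\<integral>x. ?i (x + c) \<partial>lborel) - (\<integral>x. ?i x \<partial>lborel))"
      using int int2[of c] int3[of c] by (subst Bochner_Integration.integral_add) auto
    finally show ?thesis by (simp add: lborel_translate(1)[of ?i c])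
  qed
  have "(\<lambda>n. \<integral>x. max 0 (?i x - ?i (x + a n)) \<partial>lborel) \<longlonglongrightarrow> (\<integral>x. 0 \<partial>(lborel::(real^'m) measure))"
  proof (rule integral_dominated_convergence[where w = ?i])
    show "AE x in lborel. (\<lambda>n. max 0 (?i x - ?i (x + a n))) \<longlonglongrightarrow> 0"
    proof (rule AE_I2)
      fix x :: "real^'m"
      show "(\<lambda>n. max 0 (?i x - ?i (x + a n))) \<longlonglongrightarrow> 0"
      proof (cases "x \<in> U")
        case True
        have "(\<lambda>n. x + a n) \<longlonglongrightarrow> x" using tendsto_add[OF tendsto_const a, of x] by simp
        then have "\<forall>\<^sub>F n in sequentially. x + a n \<in> U" using U(1) True topological_tendstoD by blast
        then have "\<forall>\<^sub>F n in sequentially. 0 = max 0 (?i x - ?i (x + a n))"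
          by eventually_elim (use True in auto)
        then show ?thesis using tendsto_cong tendsto_const by fast
      qed (simp add: indicator_def)
    qed
  qed (use int in \<open>auto simp: indicator_def\<close>)
  then show ?thesis unfolding eq using tendsto_mult_right_zero by fastforce
qed

lemma L1_approx_translate:
  fixes f g :: "real^'m \<Rightarrow> real"
  assumes "integrable lborel f" "integrable lborel g"
  shows "(\<integral>x. \<bar>f (x + c) - f x\<bar> \<partial>lborel) \<le> 2 * (\<integral>x. \<bar>f x - g x\<bar> \<partial>lborel) + (\<integral>x. \<bar>g (x + c) - g x\<bar> \<partial>lborel)"
proof -
  have i: "integrable lborel (\<lambda>x. f (x + c))" "integrable lborel (\<lambda>x. g (x + c))"
    using assms lborel_translate(2)[of f c] lborel_translate(2)[of g c] by auto
  have "(\<integral>x. \<bar>f (x + c) - f x\<bar> \<partial>lborel) \<le> (\<integral>x. \<bar>f (x + c) - g (x + c)\<bar> + \<bar>f x - g x\<bar> + \<bar>g (x + c) - g x\<bar> \<partial>lborel)"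
    using assms i by (intro integral_mono) auto
  also have "\<dots> = (\<integral>x. \<bar>f (x + c) - g (x + c)\<bar> \<partial>lborel) + (\<integral>x. \<bar>f x - g x\<bar> \<partial>lborel) + (\<integral>x. \<bar>g (x + c) - g x\<bar> \<partial>lborel)"
    using assms i by (subst Bochner_Integration.integral_add; (subst Bochner_Integration.integral_add)?) auto
  also have "(\<integral>x. \<bar>f (x + c) - g (x + c)\<bar> \<partial>lborel) = (\<integral>x. \<bar>f x - g x\<bar> \<partial>lborel)"
    by (rule lborel_translate(1)[of "\<lambda>x. \<bar>f x - g x\<bar>"])
  finally show ?thesis by simp
qed

text \<open>Functions with continuous translations are closed under L1 limits, because the
  approximation error is the same before and after the shift.\<close>

lemma L1_translate_limit:
  fixes f :: "real^'m \<Rightarrow> real"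
  assumes f: "integrable lborel f" and a: "a \<longlonglongrightarrow> 0"
    and approx: "\<And>e. e > 0 \<Longrightarrow> \<exists>g. integrable lborel g \<and> (\<integral>x. \<bar>f x - g x\<bar> \<partial>lborel) < e
        \<and> (\<lambda>n. \<integral>x. \<bar>g (x + a n) - g x\<bar> \<partial>lborel) \<longlonglongrightarrow> 0"
  shows "(\<lambda>n. \<integral>x. \<bar>f (x + a n) - f x\<bar> \<partial>lborel) \<longlonglongrightarrow> 0"
proof (rule LIMSEQ_I)
  fix e :: real assume "e > 0"
  then obtain g where g: "integrable lborel g" "(\<integral>x. \<bar>f x - g x\<bar> \<partial>lborel) < e / 4"
    "(\<lambda>n. \<integral>x. \<bar>g (x + a n) - g x\<bar> \<partial>lborel) \<longlonglongrightarrow> 0" using approx[of "e/4"] by auto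
  have "\<exists>N. \<forall>n\<ge>N. norm ((\<integral>x. \<bar>g (x + a n) - g x\<bar> \<partial>lborel) - 0) < e / 2"
    by (rule LIMSEQ_D[OF g(3)]) (use \<open>e > 0\<close> in simp)
  then obtain N where N: "\<And>n. n \<ge> N \<Longrightarrow> \<bar>\<integral>x. \<bar>g (x + a n) - g x\<bar> \<partial>lborel\<bar> < e / 2" by auto
  have "norm ((\<integral>x. \<bar>f (x + a n) - f x\<bar> \<partial>lborel) - 0) < e" if "n \<ge> N" for n
  proof -
    have "0 \<le> (\<integral>x. \<bar>f (x + a n) - f x\<bar> \<partial>lborel)" by simp
    then show ?thesis using L1_approx_translate[OF f g(1), of "a n"] g(2) N[OF that] unfolding real_norm_def by linarith
  qed
  then show "\<exists>N. \<forall>n\<ge>N. norm ((\<integral>x. \<bar>f (x + a n) - f x\<bar> \<partial>lborel) - 0) < e" by blast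
qed

text \<open>Proved along the construction of the integral: indicators are approximated from outside
  by open sets, for which small shifts are controlled pointwise, and sums and dominated limits
  follow.\<close>

lemma L1_translate_continuous:
  fixes f :: "real^'m \<Rightarrow> real"
  assumes f: "integrable lborel f" and a: "a \<longlonglongrightarrow> 0"
  shows "(\<lambda>n. \<integral>x. \<bar>f (x + a n) - f x\<bar> \<partial>lborel) \<longlonglongrightarrow> 0"
  using f
proof (induction rule: integrable_induct)
  case (base A c)
  have [measurable]: "A \<in> sets borel" using base by simp
  have A: "integrable lborel (\<lambda>x. indicat_real A x * c)" using base by (auto simp: integrable_real_indicator)
  have "(\<lambda>n. \<integral>x. \<bar>indicat_real A (x + a n) * c - indicat_real A x * c\<bar> \<partial>lborel) \<longlonglongrightarrow> 0"
  proof (rule L1_translate_limit[OF A a])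
    fix e :: real assume e: "e > 0"
    \<comment> \<open>The summand 1 keeps the tolerance meaningful for \<open>c = 0\<close> and
      makes \<open>\<bar>c\<bar> * ?d\<close> strictly less than \<open>e\<close>.\<close>
    let ?d = "e / (1 + \<bar>c\<bar>)"
    have d: "?d > 0" using e by simp
    obtain U where U: "open U" "A \<subseteq> U" "emeasure lborel (U - A) < ?d"
      using outer_regular_lborel[of A ?d] d base by auto
    have [measurable]: "U \<in> sets borel" using U by auto
    have "emeasure lborel U \<le> emeasure lborel A + emeasure lborel (U - A)"
      using emeasure_subadditive[of A lborel "U - A"] U(2) by (simp add: Un_absorb1)
    also have "\<dots> < \<infinity>" using base U(3) by (auto simp: ennreal_add_less_top less_top order.strict_trans)
    finally have Uf: "emeasure lborel U < \<infinity>" .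
    have iU: "integrable lborel (indicat_real U)" using Uf by (simp add: integrable_real_indicator)
    have "(\<integral>x. \<bar>indicat_real A x * c - indicat_real U x * c\<bar> \<partial>lborel) = (\<integral>x. \<bar>c\<bar> * indicat_real (U - A) x \<partial>lborel)"
      using U(2) by (intro Bochner_Integration.integral_cong) (auto simp: indicator_def)
    also have "\<dots> = \<bar>c\<bar> * measure lborel (U - A)" by simp
    also have "\<dots> \<le> \<bar>c\<bar> * ?d"
    proof (rule mult_left_mono)
      show "measure lborel (U - A) \<le> ?d" using U(3) d by (simp add: measure_def enn2real_leI less_imp_le)
    qed simp
    also have "\<dots> < e" using e by (simp add: field_simps)
    finally have 1: "(\<integral>x. \<bar>indicat_real A x * c - indicat_real U x * c\<bar> \<partial>lborel) < e" .
    have "(\<lambda>n. \<bar>c\<bar> * (\<integral>x. \<bar>indicat_real U (x + a n) - indicat_real U x\<bar> \<partial>lborel)) \<longlonglongrightarrow> 0"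
      using tendsto_mult_right_zero[OF L1_translate_open[OF U(1) Uf a]] .
    then have 2: "(\<lambda>n. \<integral>x. \<bar>indicat_real U (x + a n) * c - indicat_real U x * c\<bar> \<partial>lborel) \<longlonglongrightarrow> 0"
      by (simp add: left_diff_distrib[symmetric] abs_mult mult.commute[of c] mult.commute[of "\<bar>c\<bar>"])
    show "\<exists>g. integrable lborel g \<and> (\<integral>x. \<bar>indicat_real A x * c - g x\<bar> \<partial>lborel) < e
        \<and> (\<lambda>n. \<integral>x. \<bar>g (x + a n) - g x\<bar> \<partial>lborel) \<longlonglongrightarrow> 0"
      using 1 2 iU by (intro exI[of _ "\<lambda>x. indicat_real U x * c"]) auto
  qed
  then show ?case by simp
next
  case (add f g)
  have i: "integrable lborel (\<lambda>x. f (x + c))" "integrable lborel (\<lambda>x. g (x + c))" for c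
    using add lborel_translate(2)[of f c] lborel_translate(2)[of g c] by auto
  show ?case
  proof (rule Lim_null_comparison)
    show "\<forall>\<^sub>F n in sequentially. norm (\<integral>x. \<bar>f (x + a n) + g (x + a n) - (f x + g x)\<bar> \<partial>lborel)
       \<le> (\<integral>x. \<bar>f (x + a n) - f x\<bar> \<partial>lborel) + (\<integral>x. \<bar>g (x + a n) - g x\<bar> \<partial>lborel)"
    proof (intro always_eventually allI)
      fix n
      have "(\<integral>x. \<bar>f (x + a n) + g (x + a n) - (f x + g x)\<bar> \<partial>lborel)
        \<le> (\<integral>x. \<bar>f (x + a n) - f x\<bar> + \<bar>g (x + a n) - g x\<bar> \<partial>lborel)"
        using add i by (intro integral_mono) auto
      then show "norm (\<integral>x. \<bar>f (x + a n) + g (x + a n) - (f x + g x)\<bar> \<partial>lborel)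
        \<le> (\<integral>x. \<bar>f (x + a n) - f x\<bar> \<partial>lborel) + (\<integral>x. \<bar>g (x + a n) - g x\<bar> \<partial>lborel)"
        using add i by simp
    qed
    show "(\<lambda>n. (\<integral>x. \<bar>f (x + a n) - f x\<bar> \<partial>lborel) + (\<integral>x. \<bar>g (x + a n) - g x\<bar> \<partial>lborel)) \<longlonglongrightarrow> 0"
      using tendsto_add[OF add(3,4)] by simp
  qed
next
  case (lim f s)
  have "(\<lambda>i. \<integral>x. \<bar>f x - s i x\<bar> \<partial>lborel) \<longlonglongrightarrow> (\<integral>x. 0 \<partial>(lborel::(real^'m) measure))"
  proof (rule integral_dominated_convergence[where w = "\<lambda>x. 3 * norm (f x)"])
    show "AE x in lborel. (\<lambda>i. \<bar>f x - s i x\<bar>) \<longlonglongrightarrow> 0"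
    proof (rule AE_I2)
      fix x :: "real^'m"
      have "(\<lambda>i. s i x) \<longlonglongrightarrow> f x" using lim by simp
      from tendsto_diff[OF tendsto_const[of "f x"] this]
      have "(\<lambda>i. f x - s i x) \<longlonglongrightarrow> 0" by simp
      then show "(\<lambda>i. \<bar>f x - s i x\<bar>) \<longlonglongrightarrow> 0" by (rule tendsto_rabs_zero)
    qed
    show "\<And>i. AE x in lborel. norm \<bar>f x - s i x\<bar> \<le> 3 * norm (f x)"
    proof (rule AE_I2)
      fix i x show "norm \<bar>f x - s i x\<bar> \<le> 3 * norm (f x)" using lim(3)[of x i] by simp
    qed
  qed (use lim in \<open>auto intro: borel_measurable_integrable\<close>)
  then have to0: "(\<lambda>i. \<integral>x. \<bar>f x - s i x\<bar> \<partial>lborel) \<longlonglongrightarrow> 0" by simp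
  show ?case
  proof (rule L1_translate_limit[OF lim(4) a])
    fix e :: real assume "e > 0"
    then obtain i where "norm ((\<integral>x. \<bar>f x - s i x\<bar> \<partial>lborel) - 0) < e" using LIMSEQ_D[OF to0] by blast
    then show "\<exists>g. integrable lborel g \<and> (\<integral>x. \<bar>f x - g x\<bar> \<partial>lborel) < e
        \<and> (\<lambda>n. \<integral>x. \<bar>g (x + a n) - g x\<bar> \<partial>lborel) \<longlonglongrightarrow> 0"
      using lim(1,5) by (intro exI[of _ "s i"]) auto
  qed
qed

text \<open>The signed square \<open>a * \<bar>a\<bar>\<close> is monotone, so its increments
  control squared increments of \<open>a\<close> also across a change of sign, where those of
  \<open>a^2\<close> would not. It reduces L2 continuity of translations to the L1 statement for
  \<open>f * \<bar>f\<bar>\<close>. The factor 2 is attained at \<open>b = - a\<close>.\<close>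

lemma sq_diff_le: "(a - b)\<^sup>2 \<le> 2 * \<bar>a * \<bar>a\<bar> - b * \<bar>b\<bar>\<bar>" for a b :: real
proof -
  have same: "(a - b)\<^sup>2 \<le> 2 * \<bar>a * a - b * b\<bar>" if "a * b \<ge> 0" for a b :: real
  proof -
    have "(a - b)\<^sup>2 \<le> (a + b)\<^sup>2" using that by (simp add: power2_eq_square algebra_simps)
    then have "\<bar>a - b\<bar> \<le> \<bar>a + b\<bar>" by (simp add: abs_le_square_iff)
    then have "\<bar>a - b\<bar> * \<bar>a - b\<bar> \<le> \<bar>a - b\<bar> * \<bar>a + b\<bar>" by (intro mult_left_mono) auto
    also have "\<dots> = \<bar>a * a - b * b\<bar>" by (simp add: abs_mult[symmetric] algebra_simps)
    also have "\<dots> \<le> 2 * \<bar>a * a - b * b\<bar>" by simp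
    finally show ?thesis by (simp add: power2_eq_square)
  qed
  have opp: "(a + b)\<^sup>2 \<le> 2 * (a * a + b * b)" for a b :: real
    using sum_squares_bound[of a b] by (simp add: power2_eq_square algebra_simps)
  consider "a \<ge> 0" "b \<ge> 0" | "a \<le> 0" "b \<le> 0" | "a \<ge> 0" "b \<le> 0" | "a \<le> 0" "b \<ge> 0" by linarith
  then show ?thesis
  proof cases
    case 1 then show ?thesis using same[of a b] by simp
  next
    case 2 then show ?thesis using same[of a b] by (simp add: mult_nonpos_nonpos abs_minus_commute)
  next
    case 3 then show ?thesis using opp[of a "-b"] by (simp add: abs_of_nonneg)
  next
    case 4
    then have "\<bar>- (a * a) - b * b\<bar> = a * a + b * b" by (smt (verit) zero_le_square)
    then show ?thesis using 4 opp[of a "-b"] by simp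
  qed
qed

lemma L2_translate_continuous:
  fixes f :: "real^'m \<Rightarrow> real"
  assumes f: "L2 f" and a: "a \<longlonglongrightarrow> 0"
  shows "(\<lambda>n. \<integral>x. (f (x + a n) - f x)\<^sup>2 \<partial>lborel) \<longlonglongrightarrow> 0"
proof -
  let ?g = "\<lambda>x. f x * \<bar>f x\<bar>"
  have g: "integrable lborel ?g" by (rule L2_mult_integrable[OF f L2_abs[OF f]])
  show ?thesis
  proof (rule Lim_null_comparison)
    show "\<forall>\<^sub>F n in sequentially. norm (\<integral>x. (f (x + a n) - f x)\<^sup>2 \<partial>lborel) \<le> 2 * (\<integral>x. \<bar>?g (x + a n) - ?g x\<bar> \<partial>lborel)"
    proof (intro always_eventually allI)
      fix n
      have "(\<integral>x. (f (x + a n) - f x)\<^sup>2 \<partial>lborel) \<le> (\<integral>x. 2 * \<bar>?g (x + a n) - ?g x\<bar> \<partial>lborel)"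
        using integrable_translate_diff[OF g, of "a n"] L2_sq[OF L2_diff[OF L2_translate[OF f] f], of "a n"]
        by (intro integral_mono sq_diff_le) auto
      then show "norm (\<integral>x. (f (x + a n) - f x)\<^sup>2 \<partial>lborel) \<le> 2 * (\<integral>x. \<bar>?g (x + a n) - ?g x\<bar> \<partial>lborel)" by simp
    qed
    show "(\<lambda>n. 2 * (\<integral>x. \<bar>?g (x + a n) - ?g x\<bar> \<partial>lborel)) \<longlonglongrightarrow> 0"
      using tendsto_mult_right_zero[OF L1_translate_continuous[OF g a]] .
  qed
qed

section \<open>Smoothness and support of convolutions\<close>

definition conv :: "(real^'m \<Rightarrow> real) \<Rightarrow> (real^'m \<Rightarrow> real) \<Rightarrow> real^'m \<Rightarrow> real" where
  "conv \<rho> f x = (\<integral>y. \<rho> (x - y) * f y \<partial>lborel)"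

lemma bounded_mult_integrable:
  fixes f g :: "real^'m \<Rightarrow> real"
  assumes "integrable lborel f" "g \<in> borel_measurable borel" "\<And>x. \<bar>g x\<bar> \<le> M"
  shows "integrable lborel (\<lambda>x. g x * f x)"
proof (rule Bochner_Integration.integrable_bound[of _ "\<lambda>x. M * f x"])
  show "AE x in lborel. norm (g x * f x) \<le> norm (M * f x)"
  proof (rule AE_I2)
    fix x
    have "\<bar>g x\<bar> \<le> \<bar>M\<bar>" using assms(3)[of x] by linarith
    then show "norm (g x * f x) \<le> norm (M * f x)" by (simp add: abs_mult mult_right_mono)
  qed
qed (use assms in auto)

lemma conv_integrable:
  assumes "test_fun U \<rho>" "integrable lborel f"
  shows "integrable lborel (\<lambda>y. \<rho> (x - y) * f y)"
proof -
  obtain M where M: "\<And>x. \<bar>\<rho> x\<bar> \<le> M" using test_fun_bounded[OF assms(1)] by blast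
  have [measurable]: "\<rho> \<in> borel_measurable borel" using assms(1) by (intro smooth_measurable test_fun_smooth)
  show ?thesis by (rule bounded_mult_integrable[OF assms(2)]) (use M in auto)
qed

lemma test_fun_Lipschitz:
  fixes \<rho> :: "real^'m \<Rightarrow> real"
  assumes "test_fun U \<rho>"
  obtains B where "0 \<le> B" "\<And>x y. \<bar>\<rho> y - \<rho> x\<bar> \<le> B * norm (y - x)"
    "\<And>x v. \<bar>\<Sum>l\<in>UNIV. v $ l * pderiv l \<rho> x\<bar> \<le> B * norm v"
proof -
  have "\<exists>M. 0 < M \<and> (\<forall>x. \<bar>pderiv l \<rho> x\<bar> \<le> M)" for l
    using test_fun_bounded[OF test_fun_pderiv[OF assms]] by metis
  then obtain M where M: "\<And>l. 0 < M l" "\<And>l x. \<bar>pderiv l \<rho> x\<bar> \<le> M l" by metis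
  define B where "B = (\<Sum>l\<in>UNIV. M l)"
  have B0: "0 \<le> B" unfolding B_def by (intro sum_nonneg) (simp add: M(1) less_imp_le)
  have b: "\<bar>\<Sum>l\<in>UNIV. v $ l * pderiv l \<rho> x\<bar> \<le> B * norm v" for x v
  proof -
    have "\<bar>\<Sum>l\<in>UNIV. v $ l * pderiv l \<rho> x\<bar> \<le> (\<Sum>l\<in>UNIV. \<bar>v $ l * pderiv l \<rho> x\<bar>)" by (rule sum_abs)
    also have "\<dots> \<le> (\<Sum>l\<in>UNIV. M l * norm v)"
    proof (rule sum_mono)
      fix l
      have "\<bar>pderiv l \<rho> x\<bar> * \<bar>v $ l\<bar> \<le> M l * norm v"
        using M(2)[of l x] component_le_norm_cart[of v l] M(1)[of l] by (intro mult_mono) auto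
      then show "\<bar>v $ l * pderiv l \<rho> x\<bar> \<le> M l * norm v" by (simp add: abs_mult mult.commute)
    qed
    finally show ?thesis by (simp add: B_def sum_distrib_right)
  qed
  have "norm (\<rho> y - \<rho> x) \<le> B * norm (y - x)" for x y
  proof (rule differentiable_bound[where S=UNIV and f' = "\<lambda>x v. \<Sum>l\<in>UNIV. v $ l * pderiv l \<rho> x"])
    show "onorm (\<lambda>v. \<Sum>l\<in>UNIV. v $ l * pderiv l \<rho> x) \<le> B" for x
      by (rule onorm_bound[OF B0]) (use b in simp)
  qed (use smooth_has_derivative[OF test_fun_smooth[OF assms]] in auto)
  then show ?thesis using that[OF B0] b by simp
qed

text \<open>Dividing the error itself, not its norm, by \<open>norm h\<close> keeps the quotient
  linear in f, so that it can be moved inside an integral.\<close>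

lemma has_derivative_at_scaleR:
  "(f has_derivative D) (at x) \<longleftrightarrow>
     bounded_linear D \<and> ((\<lambda>h. (f (x + h) - f x - D h) /\<^sub>R norm h) \<longlongrightarrow> 0) (at 0)"
proof -
  have eq: "norm ((f (x + h) - f x - D h) /\<^sub>R norm h) = norm (f (x + h) - f x - D h) / norm h" for h
    by (simp add: divide_inverse mult.commute)
  show ?thesis unfolding has_derivative_at eq[symmetric] tendsto_norm_zero_iff ..
qed

text \<open>Differentiation under the integral along arbitrary null sequences of increments. The
  Lipschitz constant of the kernel bounds both the increment and its linear part, so
  \<open>2 * B * \<bar>f y\<bar>\<close> dominates.\<close>

lemma conv_has_derivative:
  fixes f :: "real^'m \<Rightarrow> real"
  assumes \<rho>: "test_fun U \<rho>" and f: "integrable lborel f"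
  shows "(conv \<rho> f has_derivative (\<lambda>v. \<Sum>l\<in>UNIV. v $ l * conv (pderiv l \<rho>) f x)) (at x)"
proof -
  obtain B where B: "0 \<le> B" "\<And>x y. \<bar>\<rho> y - \<rho> x\<bar> \<le> B * norm (y - x)"
    "\<And>x v. \<bar>\<Sum>l\<in>UNIV. v $ l * pderiv l \<rho> x\<bar> \<le> B * norm v" using test_fun_Lipschitz[OF \<rho>] by blast
  let ?L = "\<lambda>v. \<Sum>l\<in>UNIV. v $ l * conv (pderiv l \<rho>) f x"
  let ?D = "\<lambda>y v. \<Sum>l\<in>UNIV. v $ l * pderiv l \<rho> (x - y)"
  note meas = smooth_measurable[OF test_fun_smooth[OF \<rho>]] smooth_measurable[OF test_fun_smooth[OF test_fun_pderiv[OF \<rho>]]]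
  note [measurable] = meas borel_measurable_integrable[OF f]
  have iD: "integrable lborel (\<lambda>y. pderiv l \<rho> (x - y) * f y)" for l
    by (rule conv_integrable[OF test_fun_pderiv[OF \<rho>] f])
  have L: "?L v = (\<integral>y. ?D y v * f y \<partial>lborel)" for v
    using iD by (simp add: conv_def sum_distrib_right mult.assoc Bochner_Integration.integral_sum)
  have iD': "integrable lborel (\<lambda>y. ?D y v * f y)" for v
    using iD by (simp add: sum_distrib_right mult.assoc)
  have lim: "((\<lambda>h. (conv \<rho> f (x + h) - conv \<rho> f x - ?L h) /\<^sub>R norm h) \<longlongrightarrow> 0) (at 0)"
    unfolding tendsto_at_iff_sequentially
  proof (intro allI impI, unfold comp_def)
    fix h :: "nat \<Rightarrow> real^'m" assume h: "\<forall>i. h i \<in> UNIV - {0}" "h \<longlonglongrightarrow> 0"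
    define q where "q n y = (\<rho> (x + h n - y) - \<rho> (x - y) - ?D y (h n)) / norm (h n)" for n y
    have eq: "(conv \<rho> f (x + h n) - conv \<rho> f x - ?L (h n)) /\<^sub>R norm (h n) = (\<integral>y. q n y * f y \<partial>lborel)" for n
    proof -
      have "(\<integral>y. q n y * f y \<partial>lborel) = (\<integral>y. (\<rho> (x + h n - y) * f y - \<rho> (x - y) * f y - ?D y (h n) * f y) / norm (h n) \<partial>lborel)"
        by (rule Bochner_Integration.integral_cong) (auto simp: q_def field_simps)
      also have "\<dots> = (conv \<rho> f (x + h n) - conv \<rho> f x - ?L (h n)) / norm (h n)"
        unfolding L[of "h n"] unfolding conv_def
        using conv_integrable[OF \<rho> f, of "x + h n"] conv_integrable[OF \<rho> f, of x] iD'[of "h n"]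
        by simp
      finally show ?thesis by (simp add: divide_inverse mult.commute)
    qed
    have "(\<lambda>n. \<integral>y. q n y * f y \<partial>lborel) \<longlonglongrightarrow> (\<integral>y. 0 \<partial>(lborel::(real^'m) measure))"
    proof (rule integral_dominated_convergence[where w = "\<lambda>y. 2 * B * \<bar>f y\<bar>"])
      show "AE y in lborel. (\<lambda>n. q n y * f y) \<longlonglongrightarrow> 0"
      proof (rule AE_I2)
        fix y :: "real^'m"
        have "((\<lambda>k. (\<rho> (x - y + k) - \<rho> (x - y) - ?D y k) /\<^sub>R norm k) \<longlongrightarrow> 0) (at 0)"
          using smooth_has_derivative[OF test_fun_smooth[OF \<rho>], of "x - y"] unfolding has_derivative_at_scaleR by blast
        then have "(\<lambda>n. (\<rho> (x - y + h n) - \<rho> (x - y) - ?D y (h n)) /\<^sub>R norm (h n)) \<longlonglongrightarrow> 0"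
          unfolding tendsto_at_iff_sequentially comp_def using h by blast
        moreover have "(\<rho> (x - y + h n) - \<rho> (x - y) - ?D y (h n)) /\<^sub>R norm (h n) = q n y" for n
          by (simp add: q_def divide_inverse mult.commute algebra_simps)
        ultimately have "(\<lambda>n. q n y) \<longlonglongrightarrow> 0" by simp
        then show "(\<lambda>n. q n y * f y) \<longlonglongrightarrow> 0" by (rule tendsto_mult_left_zero)
      qed
      show "AE y in lborel. norm (q n y * f y) \<le> 2 * B * \<bar>f y\<bar>" for n
      proof (rule AE_I2)
        fix y :: "real^'m"
        have "\<bar>\<rho> (x + h n - y) - \<rho> (x - y) - ?D y (h n)\<bar> \<le> B * norm (h n) + B * norm (h n)"
        proof -
          have "x + h n - y - (x - y) = h n" by simp
          then have "\<bar>\<rho> (x + h n - y) - \<rho> (x - y)\<bar> \<le> B * norm (h n)"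
            using B(2)[of "x + h n - y" "x - y"] by simp
          then show ?thesis using B(3)[of "h n" "x - y"] by linarith
        qed
        then have "\<bar>q n y\<bar> \<le> 2 * B" using h(1) by (simp add: q_def field_simps)
        then show "norm (q n y * f y) \<le> 2 * B * \<bar>f y\<bar>" by (simp add: abs_mult mult_right_mono)
      qed
    qed (use f in \<open>auto simp: q_def\<close>)
    then show "(\<lambda>n. (conv \<rho> f (x + h n) - conv \<rho> f x - ?L (h n)) /\<^sub>R norm (h n)) \<longlonglongrightarrow> 0"
      unfolding eq by simp
  qed
  have "bounded_linear ?L"
    by (intro bounded_linear_sum bounded_linear_mult_const bounded_linear_vec_nth)
  then show ?thesis unfolding has_derivative_at_scaleR using lim by blast
qed

lemma Ck_conv:
  fixes f :: "real^'m \<Rightarrow> real"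
  assumes f: "integrable lborel f"
  shows "test_fun U \<rho> \<Longrightarrow> Ck_on k UNIV (conv \<rho> f)"
proof (induction k arbitrary: \<rho>)
  case 0
  then show ?case using conv_has_derivative[OF _ f] has_derivative_continuous continuous_at_imp_continuous_on
    by (metis (no_types, lifting) Ck_on.simps(1))
next
  case (Suc k)
  have "Ck_on k UNIV (\<lambda>x. \<Sum>l\<in>I. v $ l * conv (pderiv l \<rho>) f x)" if "finite I" for v :: "real^'m" and I
    using that
  proof (induction I rule: finite_induct)
    case (insert l I)
    have "Ck_on k UNIV (\<lambda>x. v $ l * conv (pderiv l \<rho>) f x)"
      by (intro Ck_on_mult Ck_on_const Suc.IH test_fun_pderiv Suc.prems)
    then show ?case using insert by (simp add: Ck_on_add)
  qed (simp add: Ck_on_const)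
  then show ?case unfolding Ck_on.simps
    by (intro exI[of _ "\<lambda>x v. \<Sum>l\<in>UNIV. v $ l * conv (pderiv l \<rho>) f x"]) (use conv_has_derivative[OF Suc.prems f] in auto)
qed

lemma conv_smooth: "test_fun U \<rho> \<Longrightarrow> integrable lborel f \<Longrightarrow> smooth (conv \<rho> f)"
  by (simp add: smooth_on_def Ck_conv)

lemma conv_pderiv: "test_fun U \<rho> \<Longrightarrow> integrable lborel f \<Longrightarrow> pderiv l (conv \<rho> f) x = conv (pderiv l \<rho>) f x"
  using pderiv_eqI[OF conv_has_derivative] by (simp add: sum_axis)

lemma conv_support:
  assumes "test_fun (ball 0 d) \<rho>" "\<And>x. x \<notin> ball 0 r \<Longrightarrow> f x = 0" "norm x \<ge> r + d"
  shows "conv \<rho> f x = 0"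
proof -
  have "\<rho> (x - y) * f y = 0" for y
  proof (cases "y \<in> ball 0 r")
    case True
    then have "norm (x - y) \<ge> d" using assms(3) norm_triangle_ineq2[of x y] by simp
    then have "\<rho> (x - y) = 0" using assms(1) by (elim test_fun_supp) (force simp: subset_iff)
    then show ?thesis by simp
  qed (simp add: assms(2))
  then have "(\<lambda>y. \<rho> (x - y) * f y) = (\<lambda>y. 0)" by blast
  then show ?thesis unfolding conv_def by (simp only: Bochner_Integration.integral_zero)
qed

lemma conv_test_fun:
  assumes "test_fun (ball 0 d) \<rho>" "integrable lborel f" "\<And>x. x \<notin> ball 0 r \<Longrightarrow> f x = 0" "r + d < R"
  shows "test_fun (ball 0 R) (conv \<rho> f)"
  by (rule test_funI[of _ "cball 0 (r + d)"])
     (use assms conv_support[OF assms(1,3)] in \<open>auto intro: conv_smooth\<close>)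

text \<open>Reflected translates of the kernel are the test functions through which weak derivatives
  enter a convolution.\<close>

lemma reflect_test_fun:
  assumes "test_fun (ball 0 d) \<rho>" "norm x + d \<le> R"
  shows "test_fun (ball 0 R) (\<lambda>y::real^'m. \<rho> (x - y))"
    and "pderiv l (\<lambda>y. \<rho> (x - y)) y = - pderiv l \<rho> (x - y)"
proof -
  have sm: "smooth \<rho>" by (rule test_fun_smooth[OF assms(1)])
  have s: "smooth (\<lambda>y. \<rho> (x - y))"
    using smooth_affine[OF bounded_linear_minus[OF bounded_linear_ident] sm, of x] by simp
  obtain K where K: "compact K" "K \<subseteq> ball 0 d" "\<And>x. x \<notin> K \<Longrightarrow> \<rho> x = 0"
    using assms(1) by (rule test_fun_supp) (erule that, assumption, blast)
  have "compact ((\<lambda>y. x - y) ` K)" by (intro compact_continuous_image K continuous_intros)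
  moreover have "(\<lambda>y. x - y) ` K \<subseteq> ball 0 R"
  proof
    fix z assume "z \<in> (\<lambda>y. x - y) ` K"
    then obtain y where "y \<in> K" "z = x - y" by auto
    then have "norm z \<le> norm x + norm y" "norm y < d" using K(2) norm_triangle_ineq4 by (auto simp: subset_iff)
    then show "z \<in> ball 0 R" using assms(2) by simp
  qed
  moreover have "\<rho> (x - z) = 0" if "z \<notin> (\<lambda>y. x - y) ` K" for z
  proof -
    have "x - z \<notin> K"
    proof
      assume "x - z \<in> K"
      then have "x - (x - z) \<in> (\<lambda>y. x - y) ` K" by (rule imageI)
      with that show False by simp
    qed
    then show ?thesis by (rule K(3))
  qed
  ultimately show "test_fun (ball 0 R) (\<lambda>y. \<rho> (x - y))" by (intro test_funI[OF s])
  have "((\<lambda>y. x - y) has_derivative (\<lambda>v. - v)) (at y)" by (auto intro!: derivative_eq_intros)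
  from has_derivative_compose[OF this smooth_has_derivative[OF sm]]
  have "((\<lambda>y. \<rho> (x - y)) has_derivative (\<lambda>v. \<Sum>l\<in>UNIV. (- v) $ l * pderiv l \<rho> (x - y))) (at y)" .
  from pderiv_eqI[OF this, of l] show "pderiv l (\<lambda>y. \<rho> (x - y)) y = - pderiv l \<rho> (x - y)"
    by (simp add: sum_negf sum_axis)
qed

section \<open>Convergence of mollifications\<close>

definition mollifier :: "real \<Rightarrow> (real^'m \<Rightarrow> real) \<Rightarrow> bool" where
  "mollifier d \<rho> \<longleftrightarrow> test_fun (ball 0 d) \<rho> \<and> (\<forall>x. \<rho> x \<ge> 0) \<and> (\<integral>x. \<rho> x \<partial>lborel) = 1"

text \<open>As the kernel has mass one, the mollification error is an average of increments of f,
  which reduces convergence to the continuity of translations.\<close>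

lemma conv_alt:
  fixes f :: "real^'m \<Rightarrow> real"
  assumes "mollifier d \<rho>" "integrable lborel f"
  shows "integrable lborel (\<lambda>y. \<rho> y * (f (x - y) - f x))"
    and "conv \<rho> f x - f x = (\<integral>y. \<rho> y * (f (x - y) - f x) \<partial>lborel)"
proof -
  have t: "test_fun (ball 0 d) \<rho>" "(\<integral>x. \<rho> x \<partial>lborel) = 1" using assms by (auto simp: mollifier_def)
  have [measurable]: "\<rho> \<in> borel_measurable borel" "f \<in> borel_measurable borel"
    using t assms by (auto intro: smooth_measurable test_fun_smooth)
  obtain M where M: "\<And>x. \<bar>\<rho> x\<bar> \<le> M" using test_fun_bounded[OF t(1)] by blast
  have if': "integrable lborel (\<lambda>y. f (x - y))"
  proof -
    have "integrable lborel (\<lambda>y. f (- y))"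
    proof -
      have "lborel = distr lborel borel (\<lambda>y::real^'m. 0 + (-1) *\<^sub>R y)"
        using lborel_affine[of "-1" "0::real^'m"] by (simp add: density_1)
      then have "integrable (distr lborel borel (\<lambda>y::real^'m. 0 + (-1) *\<^sub>R y)) f" using assms(2) by simp
      then show ?thesis by (subst (asm) integrable_distr_eq) auto
    qed
    from lborel_translate(2)[of "\<lambda>y. f (- y)" "- x"] this show ?thesis by (simp add: add.commute)
  qed
  have i1: "integrable lborel (\<lambda>y. \<rho> y * f (x - y))" by (rule bounded_mult_integrable[OF if']) (use M in auto)
  have i2: "integrable lborel \<rho>" by (rule test_fun_integrable[OF t(1)])
  show "integrable lborel (\<lambda>y. \<rho> y * (f (x - y) - f x))" using i1 i2 by (simp add: right_diff_distrib)
  have "conv \<rho> f x = (\<integral>y. \<rho> y * f (x - y) \<partial>lborel)"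
    unfolding conv_def using lborel_reflect[of "\<lambda>y. \<rho> y * f (x - y)" x] by simp
  then show "conv \<rho> f x - f x = (\<integral>y. \<rho> y * (f (x - y) - f x) \<partial>lborel)"
    using i1 i2 t(2) by (simp add: right_diff_distrib)
qed

lemma mollifier_nn:
  assumes "mollifier d \<rho>"
  shows "(\<integral>\<^sup>+y. ennreal (\<rho> y) \<partial>lborel) = 1"
  using assms test_fun_integrable unfolding mollifier_def
  by (subst nn_integral_eq_integral) auto

text \<open>Tonelli's theorem once for both applications, \<open>g\<close> being the absolute value
  and the square: a uniform bound for shifts of length below \<open>d\<close> survives averaging
  against the kernel.\<close>

lemma nn_reflect_translate:
  fixes f :: "real^'m \<Rightarrow> real" and g :: "real \<Rightarrow> real"
  assumes "mollifier d \<rho>" and f: "f \<in> borel_measurable borel" and g: "g \<in> borel_measurable borel"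
    and bd: "\<And>y. norm y < d \<Longrightarrow> (\<integral>\<^sup>+x. ennreal (g (f (x + y) - f x)) \<partial>lborel) \<le> ennreal e"
    and e: "e \<ge> 0"
  shows "(\<integral>\<^sup>+x. (\<integral>\<^sup>+y. ennreal (\<rho> y) * ennreal (g (f (x - y) - f x)) \<partial>lborel) \<partial>(lborel::(real^'m) measure)) \<le> ennreal e"
proof -
  have t: "test_fun (ball 0 d) \<rho>" using assms(1) by (auto simp: mollifier_def)
  note [measurable] = smooth_measurable[OF test_fun_smooth[OF t]] f g
  have m0: "(\<lambda>z::(real^'m) \<times> (real^'m). f (fst z - snd z) - f (fst z)) \<in> borel_measurable (borel \<Otimes>\<^sub>M borel)"
    by (intro borel_measurable_diff measurable_compose[OF _ f]; measurable)
  have m0': "(\<lambda>z::(real^'m) \<times> (real^'m). f (snd z - fst z) - f (snd z)) \<in> borel_measurable (borel \<Otimes>\<^sub>M borel)"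
    by (intro borel_measurable_diff measurable_compose[OF _ f]; measurable)
  note [measurable] = measurable_compose[OF m0 g] measurable_compose[OF m0' g]
  have "(\<integral>\<^sup>+x. (\<integral>\<^sup>+y. ennreal (\<rho> y) * ennreal (g (f (x - y) - f x)) \<partial>lborel) \<partial>(lborel::(real^'m) measure))
      = (\<integral>\<^sup>+y. (\<integral>\<^sup>+x. ennreal (\<rho> y) * ennreal (g (f (x - y) - f x)) \<partial>lborel) \<partial>(lborel::(real^'m) measure))"
    by (rule lborel_pair.Fubini') measurable
  also have "\<dots> = (\<integral>\<^sup>+y. ennreal (\<rho> y) * (\<integral>\<^sup>+x. ennreal (g (f (x - y) - f x)) \<partial>lborel) \<partial>(lborel::(real^'m) measure))"
    by (intro nn_integral_cong nn_integral_cmult) measurable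
  also have "\<dots> \<le> (\<integral>\<^sup>+y. ennreal (\<rho> y) * ennreal e \<partial>(lborel::(real^'m) measure))"
  proof (rule nn_integral_mono)
    fix y :: "real^'m"
    show "ennreal (\<rho> y) * (\<integral>\<^sup>+x. ennreal (g (f (x - y) - f x)) \<partial>lborel) \<le> ennreal (\<rho> y) * ennreal e"
    proof (cases "norm y < d")
      case True
      then show ?thesis using bd[of "- y"] by (intro mult_left_mono) auto
    next
      case False
      then have "\<rho> y = 0" using t by (elim test_fun_supp) (force simp: subset_iff)
      then show ?thesis by simp
    qed
  qed
  also have "\<dots> = ennreal e" using mollifier_nn[OF assms(1)] by (simp add: nn_integral_multc)
  finally show ?thesis .
qed

lemma conv_L1_bound:
  assumes m: "mollifier d \<rho>" and f: "integrable lborel f"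
    and bd: "\<And>y. norm y < d \<Longrightarrow> (\<integral>x. \<bar>f (x + y) - f x\<bar> \<partial>lborel) \<le> e" and e: "e \<ge> 0"
  shows "(\<integral>\<^sup>+x. ennreal \<bar>conv \<rho> f x - f x\<bar> \<partial>lborel) \<le> ennreal e"
proof -
  have pos: "\<rho> x \<ge> 0" for x using m by (auto simp: mollifier_def)
  have "(\<integral>\<^sup>+x. ennreal \<bar>conv \<rho> f x - f x\<bar> \<partial>lborel)
     \<le> (\<integral>\<^sup>+x. (\<integral>\<^sup>+y. ennreal (\<rho> y) * ennreal \<bar>f (x - y) - f x\<bar> \<partial>lborel) \<partial>lborel)"
  proof (rule nn_integral_mono)
    fix x
    have "ennreal \<bar>conv \<rho> f x - f x\<bar> \<le> (\<integral>\<^sup>+y. ennreal (norm (\<rho> y * (f (x - y) - f x))) \<partial>lborel)"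
      unfolding conv_alt(2)[OF m f] using integral_norm_bound_ennreal[OF conv_alt(1)[OF m f]] by simp
    then show "ennreal \<bar>conv \<rho> f x - f x\<bar> \<le> (\<integral>\<^sup>+y. ennreal (\<rho> y) * ennreal \<bar>f (x - y) - f x\<bar> \<partial>lborel)"
      using pos by (simp add: abs_mult ennreal_mult')
  qed
  also have "\<dots> \<le> ennreal e"
  proof (rule nn_reflect_translate[OF m _ _ _ e])
    show "(\<integral>\<^sup>+x. ennreal \<bar>f (x + y) - f x\<bar> \<partial>lborel) \<le> ennreal e" if "norm y < d" for y
      using bd[OF that] by (subst nn_integral_eq_integral[OF integrable_translate_diff[OF f]]) (auto intro: ennreal_leI)
  qed (use f in auto)
  finally show ?thesis .
qed

lemma conv_L2_bound:
  assumes m: "mollifier d \<rho>" and f: "integrable lborel f" and f2: "L2 f"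
    and bd: "\<And>y. norm y < d \<Longrightarrow> (\<integral>x. (f (x + y) - f x)\<^sup>2 \<partial>lborel) \<le> e" and e: "e \<ge> 0"
  shows "(\<integral>\<^sup>+x. ennreal ((conv \<rho> f x - f x)\<^sup>2) \<partial>lborel) \<le> ennreal e"
proof -
  have pos: "\<rho> x \<ge> 0" for x using m by (auto simp: mollifier_def)
  have t: "test_fun (ball 0 d) \<rho>" using m by (auto simp: mollifier_def)
  note [measurable] = smooth_measurable[OF test_fun_smooth[OF t]] L2_measurable[OF f2]
  have "(\<integral>\<^sup>+x. ennreal ((conv \<rho> f x - f x)\<^sup>2) \<partial>lborel)
     \<le> (\<integral>\<^sup>+x. (\<integral>\<^sup>+y. ennreal (\<rho> y) * ennreal ((f (x - y) - f x)\<^sup>2) \<partial>lborel) \<partial>lborel)"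
  proof (rule nn_integral_mono)
    fix x
    let ?g = "\<lambda>y. f (x - y) - f x"
    have "ennreal \<bar>conv \<rho> f x - f x\<bar> \<le> (\<integral>\<^sup>+y. ennreal (norm (\<rho> y * ?g y)) \<partial>lborel)"
      unfolding conv_alt(2)[OF m f] using integral_norm_bound_ennreal[OF conv_alt(1)[OF m f]] by simp
    \<comment> \<open>Jensen's inequality for the probability density \<open>\<rho>\<close>, by
      Cauchy--Schwarz with the density split evenly into square roots.\<close>
    also have "\<dots> = (\<integral>\<^sup>+y. ennreal (sqrt (\<rho> y)) * ennreal (sqrt (\<rho> y) * \<bar>?g y\<bar>) \<partial>lborel)"
    proof (intro nn_integral_cong)
      fix y
      have "norm (\<rho> y * ?g y) = sqrt (\<rho> y) * (sqrt (\<rho> y) * \<bar>?g y\<bar>)"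
        using pos[of y] by (simp add: abs_mult mult.assoc[symmetric])
      then show "ennreal (norm (\<rho> y * ?g y)) = ennreal (sqrt (\<rho> y)) * ennreal (sqrt (\<rho> y) * \<bar>?g y\<bar>)"
        using pos[of y] by (simp add: ennreal_mult'[symmetric])
    qed
    finally have "(ennreal \<bar>conv \<rho> f x - f x\<bar>)\<^sup>2 \<le> (\<integral>\<^sup>+y. ennreal (sqrt (\<rho> y)) * ennreal (sqrt (\<rho> y) * \<bar>?g y\<bar>) \<partial>lborel)\<^sup>2"
      by (simp add: power_mono)
    also have "\<dots> \<le> (\<integral>\<^sup>+y. (ennreal (sqrt (\<rho> y)))\<^sup>2 \<partial>lborel) * (\<integral>\<^sup>+y. (ennreal (sqrt (\<rho> y) * \<bar>?g y\<bar>))\<^sup>2 \<partial>lborel)"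
      by (rule Cauchy_Schwarz_nn_integral) measurable
    also have "(\<integral>\<^sup>+y. (ennreal (sqrt (\<rho> y)))\<^sup>2 \<partial>lborel) = 1"
      using pos mollifier_nn[OF m] by (simp add: ennreal_power)
    also have "(\<integral>\<^sup>+y. (ennreal (sqrt (\<rho> y) * \<bar>?g y\<bar>))\<^sup>2 \<partial>lborel) = (\<integral>\<^sup>+y. ennreal (\<rho> y) * ennreal ((?g y)\<^sup>2) \<partial>lborel)"
      using pos by (intro nn_integral_cong) (simp add: ennreal_power power_mult_distrib ennreal_mult')
    finally show "ennreal ((conv \<rho> f x - f x)\<^sup>2) \<le> (\<integral>\<^sup>+y. ennreal (\<rho> y) * ennreal ((?g y)\<^sup>2) \<partial>lborel)"
      by (simp add: ennreal_power)
  qed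
  also have "\<dots> \<le> ennreal e"
  proof (rule nn_reflect_translate[OF m _ _ _ e])
    show "(\<integral>\<^sup>+x. ennreal ((f (x + y) - f x)\<^sup>2) \<partial>lborel) \<le> ennreal e" if "norm y < d" for y
      using bd[OF that] by (subst nn_integral_eq_integral[OF L2_sq[OF L2_diff[OF L2_translate[OF f2] f2]]]) (auto intro: ennreal_leI)
  qed auto
  finally show ?thesis .
qed

definition moll :: "nat \<Rightarrow> real^'m \<Rightarrow> real" where
  "moll n = (SOME \<rho>. mollifier (1 / real (Suc n)) \<rho>)"

lemma moll: "mollifier (1 / real (Suc n)) (moll n :: real^'m \<Rightarrow> real)"
proof -
  have "0 < 1 / real (Suc n)" by simp
  then obtain \<rho> :: "real^'m \<Rightarrow> real" where "mollifier (1 / real (Suc n)) \<rho>"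
    unfolding mollifier_def using mollifier_exists by metis
  then show ?thesis unfolding moll_def by (rule someI[of "mollifier (1 / real (Suc n))"])
qed

lemma moll_test: "test_fun (ball 0 (1 / real (Suc n))) (moll n)"
  using moll[of n] unfolding mollifier_def by blast

text \<open>A limit along every null sequence is uniform on shrinking balls: otherwise the points
  violating the bound would form a null sequence themselves.\<close>

lemma unif_of_seq:
  fixes F :: "real^'m \<Rightarrow> real"
  assumes "\<And>a. a \<longlonglongrightarrow> 0 \<Longrightarrow> (\<lambda>n. F (a n)) \<longlonglongrightarrow> 0" "e > 0"
  shows "\<forall>\<^sub>F n in sequentially. \<forall>y. norm y < 1 / real (Suc n) \<longrightarrow> F y \<le> e"
proof (rule ccontr)
  assume "\<not> ?thesis"
  then have "\<exists>\<^sub>F n in sequentially. \<exists>y. norm y < 1 / real (Suc n) \<and> F y > e"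
    by (simp add: not_eventually not_le)
  then have inf: "infinite {n. \<exists>y. norm y < 1 / real (Suc n) \<and> F y > e}"
    by (simp add: frequently_cofinite[symmetric] cofinite_eq_sequentially)
  define bad where "bad n y \<longleftrightarrow> norm y < 1 / real (Suc n) \<and> F y > e" for n and y :: "real^'m"
  \<comment> \<open>Bad points are known for infinitely many indices only, but one for a later index
    k also lies in the larger ball of index n, so every index has one.\<close>
  have "\<exists>y. bad n y" for n
  proof -
    obtain k where "k \<ge> n" "\<exists>y. bad k y"
      using inf unfolding infinite_nat_iff_unbounded_le bad_def by blast
    moreover have "1 / real (Suc k) \<le> 1 / real (Suc n)" using \<open>k \<ge> n\<close> by (simp add: frac_le)
    ultimately show ?thesis unfolding bad_def by (meson less_le_trans)
  qed
  then obtain a where a: "\<And>n. bad n (a n)" by metis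
  have "a \<longlonglongrightarrow> 0"
    by (rule Lim_null_comparison[OF _ LIMSEQ_inverse_real_of_nat])
       (use a in \<open>auto simp: bad_def inverse_eq_divide less_imp_le intro!: always_eventually\<close>)
  from assms(1)[OF this] have "\<exists>N. \<forall>n\<ge>N. norm (F (a n) - 0) < e" using assms(2) LIMSEQ_D by blast
  then obtain n where "norm (F (a n)) < e" by auto
  then show False using a[of n] by (auto simp: bad_def)
qed

lemma moll_L1:
  assumes "integrable lborel f"
  shows "(\<lambda>n. \<integral>x. \<bar>conv (moll n) f x - f x\<bar> \<partial>lborel) \<longlonglongrightarrow> 0"
    and "\<forall>\<^sub>F n in sequentially. integrable lborel (\<lambda>x. conv (moll n) f x - f x)"
proof -
  have ev: "\<forall>\<^sub>F n in sequentially. (\<integral>\<^sup>+x. ennreal \<bar>conv (moll n) f x - f x\<bar> \<partial>lborel) \<le> ennreal e" if "e > 0" for e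
  proof -
    have "\<forall>\<^sub>F n in sequentially. \<forall>y. norm y < 1 / real (Suc n) \<longrightarrow> (\<integral>x. \<bar>f (x + y) - f x\<bar> \<partial>lborel) \<le> e"
      by (rule unif_of_seq[OF _ that]) (rule L1_translate_continuous[OF assms])
    then show ?thesis
    proof eventually_elim
    case (elim n)
    show ?case by (rule conv_L1_bound[OF moll assms]) (use elim that in auto)
    qed
  qed
  have m: "(\<lambda>x. conv (moll n) f x - f x) \<in> borel_measurable borel" for n
    using smooth_measurable[OF conv_smooth[OF moll_test assms]] assms by measurable
  show "\<forall>\<^sub>F n in sequentially. integrable lborel (\<lambda>x. conv (moll n) f x - f x)"
    using ev[of 1, simplified]
  proof eventually_elim
    case (elim n)
    then show ?case using m[of n] by (auto simp: integrable_iff_bounded intro: le_less_trans)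
  qed
  show "(\<lambda>n. \<integral>x. \<bar>conv (moll n) f x - f x\<bar> \<partial>lborel) \<longlonglongrightarrow> 0"
  proof (rule tendstoI)
    fix e :: real assume "e > 0"
    show "\<forall>\<^sub>F n in sequentially. dist (\<integral>x. \<bar>conv (moll n) f x - f x\<bar> \<partial>lborel) 0 < e"
      using ev[of "e/2", OF half_gt_zero[OF \<open>e > 0\<close>]]
    proof eventually_elim
      case (elim n)
      have "(\<integral>x. \<bar>conv (moll n) f x - f x\<bar> \<partial>lborel) = enn2real (\<integral>\<^sup>+x. ennreal \<bar>conv (moll n) f x - f x\<bar> \<partial>lborel)"
        using m[of n] by (subst integral_eq_nn_integral) auto
      also have "\<dots> \<le> e / 2" using elim \<open>e > 0\<close> by (intro enn2real_leI) auto
      finally show ?case using \<open>e > 0\<close> by simp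
    qed
  qed
qed

lemma moll_L2:
  assumes "integrable lborel f" "L2 f"
  shows "(\<lambda>n. n2 (\<lambda>x. conv (moll n) f x - f x)) \<longlonglongrightarrow> 0"
proof -
  have ev: "\<forall>\<^sub>F n in sequentially. (\<integral>\<^sup>+x. ennreal ((conv (moll n) f x - f x)\<^sup>2) \<partial>lborel) \<le> ennreal e" if "e > 0" for e
  proof -
    have "\<forall>\<^sub>F n in sequentially. \<forall>y. norm y < 1 / real (Suc n) \<longrightarrow> (\<integral>x. (f (x + y) - f x)\<^sup>2 \<partial>lborel) \<le> e"
      by (rule unif_of_seq[OF _ that]) (rule L2_translate_continuous[OF assms(2)])
    then show ?thesis
    proof eventually_elim
    case (elim n)
    show ?case by (rule conv_L2_bound[OF moll assms]) (use elim that in auto)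
    qed
  qed
  have m: "(\<lambda>x. (conv (moll n) f x - f x)\<^sup>2) \<in> borel_measurable borel" for n
    using smooth_measurable[OF conv_smooth[OF moll_test assms(1)]] assms(1) by measurable
  have "(\<lambda>n. \<integral>x. (conv (moll n) f x - f x)\<^sup>2 \<partial>lborel) \<longlonglongrightarrow> 0"
  proof (rule tendstoI)
    fix e :: real assume "e > 0"
    show "\<forall>\<^sub>F n in sequentially. dist (\<integral>x. (conv (moll n) f x - f x)\<^sup>2 \<partial>lborel) 0 < e"
      using ev[of "e/2", OF half_gt_zero[OF \<open>e > 0\<close>]]
    proof eventually_elim
      case (elim n)
      have "(\<integral>x. (conv (moll n) f x - f x)\<^sup>2 \<partial>lborel) = enn2real (\<integral>\<^sup>+x. ennreal ((conv (moll n) f x - f x)\<^sup>2) \<partial>lborel)"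
        using m[of n] by (subst integral_eq_nn_integral) auto
      also have "\<dots> \<le> e / 2" using elim \<open>e > 0\<close> by (intro enn2real_leI) auto
      finally show ?case using \<open>e > 0\<close> by simp
    qed
  qed
  from tendsto_real_sqrt[OF this] show ?thesis by (simp add: n2_def)
qed

section \<open>Weak derivatives\<close>

text \<open>Functions on the ball of radius \<open>R\<close> are represented by globally square-integrable
  functions; only test functions supported in the ball are used, so values outside are irrelevant.\<close>
definition wd :: "real \<Rightarrow> 'm::finite \<Rightarrow> (real^'m \<Rightarrow> real) \<Rightarrow> (real^'m \<Rightarrow> real) \<Rightarrow> bool" where
  "wd R l u v \<longleftrightarrow> L2 u \<and> L2 v \<and> (\<forall>\<phi>. test_fun (ball 0 R) \<phi> \<longrightarrow>
     (\<integral>x. pderiv l \<phi> x * u x \<partial>lborel) = - (\<integral>x. \<phi> x * v x \<partial>lborel))"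

text \<open>W^{1,2} functions with zero boundary values, the gradient being carried as data.
  Vanishing outside the ball is pointwise and the identity is tested on the whole space; this rules
  out a jump at the sphere and lets translation and mollification act freely.\<close>

definition W0 :: "real \<Rightarrow> (real^'m::finite \<Rightarrow> real) \<Rightarrow> ('m \<Rightarrow> real^'m \<Rightarrow> real) \<Rightarrow> bool" where
  "W0 r u d \<longleftrightarrow> L2 u \<and> (\<forall>l. L2 (d l)) \<and> (\<forall>x. x \<notin> ball 0 r \<longrightarrow> u x = 0 \<and> (\<forall>l. d l x = 0)) \<and>
     (\<forall>l \<phi>. test_fun UNIV \<phi> \<longrightarrow> (\<integral>x. pderiv l \<phi> x * u x \<partial>lborel) = - (\<integral>x. \<phi> x * d l x \<partial>lborel))"

lemma wd_L2: "wd R l u v \<Longrightarrow> L2 u" "wd R l u v \<Longrightarrow> L2 v" by (auto simp: wd_def)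
lemma wdD: "wd R l u v \<Longrightarrow> test_fun (ball 0 R) \<phi> \<Longrightarrow>
     (\<integral>x. pderiv l \<phi> x * u x \<partial>lborel) = - (\<integral>x. \<phi> x * v x \<partial>lborel)" by (auto simp: wd_def)
lemma wd_mono: "wd R l u v \<Longrightarrow> r \<le> R \<Longrightarrow> wd r l u v" unfolding wd_def using test_fun_ball_mono by blast
lemma W0_L2: "W0 r u d \<Longrightarrow> L2 u" "W0 r u d \<Longrightarrow> L2 (d l)" by (auto simp: W0_def)
lemma W0D: "W0 r u d \<Longrightarrow> test_fun UNIV \<phi> \<Longrightarrow>
     (\<integral>x. pderiv l \<phi> x * u x \<partial>lborel) = - (\<integral>x. \<phi> x * d l x \<partial>lborel)" by (auto simp: W0_def)
lemma W0_outside: "W0 r u d \<Longrightarrow> x \<notin> ball 0 r \<Longrightarrow> u x = 0" "W0 r u d \<Longrightarrow> x \<notin> ball 0 r \<Longrightarrow> d l x = 0"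
  by (auto simp: W0_def)

lemma W0_wd: "W0 r u d \<Longrightarrow> wd R l u (d l)"
  unfolding W0_def wd_def using test_fun_mono[OF _ subset_UNIV] by blast

lemma W0_mono: "W0 r u d \<Longrightarrow> r \<le> R \<Longrightarrow> W0 R u d"
  unfolding W0_def by auto

lemma test_fun_outside: "test_fun U \<phi> \<Longrightarrow> x \<notin> U \<Longrightarrow> \<phi> x = 0" "test_fun U \<phi> \<Longrightarrow> x \<notin> U \<Longrightarrow> pderiv l \<phi> x = 0"
  by (erule test_funE; blast)+

lemma pderiv_locally_const:
  fixes \<phi> :: "real^'m \<Rightarrow> real"
  assumes "open S" "x \<in> S" "\<And>y. y \<in> S \<Longrightarrow> \<phi> y = c"
  shows "pderiv l \<phi> x = 0"
proof -
  have "(\<phi> has_derivative (\<lambda>v. 0)) (at x)"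
    by (rule has_derivative_transform_within_open[OF has_derivative_const assms(1,2)]) (simp add: assms(3))
  from pderiv_eqI[OF this] show ?thesis by simp
qed

lemma integrable_indicator_ball: "integrable lborel (indicat_real (ball (0::real^'m) r))"
  using emeasure_lborel_ball_finite[of "0::real^'m" r] by (simp add: integrable_real_indicator)

lemma L2_indicator_ball: "L2 (indicat_real (ball (0::real^'m) r))"
proof -
  have "(\<lambda>x. (indicat_real (ball (0::real^'m) r) x)\<^sup>2) = indicat_real (ball 0 r)" by (auto simp: indicator_def)
  then show ?thesis by (simp add: L2_def integrable_indicator_ball borel_measurable_indicator)
qed

lemma L2_integrable_ball:
  assumes "L2 (f :: real^'m \<Rightarrow> real)" shows "integrable lborel (\<lambda>x. indicat_real (ball 0 r) x * f x)"
  by (rule L2_mult_integrable[OF L2_indicator_ball assms])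

lemma L2_integrable:
  assumes "L2 (f :: real^'m \<Rightarrow> real)" "\<And>x. x \<notin> ball 0 r \<Longrightarrow> f x = 0" shows "integrable lborel f"
proof -
  have "(\<lambda>x. indicat_real (ball 0 r) x * f x) = f" using assms(2) by (fastforce simp: indicator_def)
  then show ?thesis using L2_integrable_ball[OF assms(1), of r] by simp
qed

lemma W0_integrable: "W0 r u d \<Longrightarrow> integrable lborel u" "W0 r u d \<Longrightarrow> integrable lborel (d l)"
  using L2_integrable W0_L2 W0_outside by blast+

text \<open>The difference quotients of a test function have integral zero by translation
  invariance, and they converge dominatedly to the derivative.\<close>

lemma integral_pderiv_zero:
  fixes \<phi> :: "real^'m \<Rightarrow> real"
  assumes t: "test_fun U \<phi>" shows "(\<integral>x. pderiv l \<phi> x \<partial>lborel) = 0"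
proof -
  obtain B where B: "0 \<le> B" "\<And>x y. \<bar>\<phi> y - \<phi> x\<bar> \<le> B * norm (y - x)" using test_fun_Lipschitz[OF t] by metis
  obtain K where K: "compact K" "K \<subseteq> U" "\<And>x. x \<notin> K \<Longrightarrow> \<phi> x = 0"
    using t by (rule test_fun_supp) (erule that, assumption, blast)
  obtain r where r: "K \<subseteq> ball 0 r" using K(1) compact_imp_bounded bounded_subset_ballD by metis
  let ?e = "axis l 1 :: real^'m"
  define t where "t n = 1 / real (Suc n)" for n
  have t01: "0 < t n" "t n \<le> 1" for n by (auto simp: t_def)
  have t0: "t \<longlonglongrightarrow> 0" unfolding t_def using LIMSEQ_inverse_real_of_nat by (simp add: inverse_eq_divide)
  note [measurable] = smooth_measurable[OF test_fun_smooth[OF assms]] smooth_measurable[OF test_fun_smooth[OF test_fun_pderiv[OF assms]]]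
  have "(\<lambda>n. \<integral>x. (\<phi> (x + t n *\<^sub>R ?e) - \<phi> x) / t n \<partial>lborel) \<longlonglongrightarrow> (\<integral>x. pderiv l \<phi> x \<partial>lborel)"
  proof (rule integral_dominated_convergence[where w = "\<lambda>x. B * indicat_real (ball 0 (r + 1)) x"])
    show "integrable lborel (\<lambda>x. B * indicat_real (ball (0::real^'m) (r + 1)) x)"
      by (rule integrable_mult_right[OF integrable_indicator_ball])
    show "AE x in lborel. (\<lambda>n. (\<phi> (x + t n *\<^sub>R ?e) - \<phi> x) / t n) \<longlonglongrightarrow> pderiv l \<phi> x"
    proof (rule AE_I2)
      fix x
      have "((\<lambda>h. (\<phi> (x + (0 + h) *\<^sub>R ?e) - \<phi> (x + 0 *\<^sub>R ?e)) / h) \<longlongrightarrow> pderiv l \<phi> (x + 0 *\<^sub>R ?e)) (at 0)"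
        using smooth_line_deriv[OF test_fun_smooth[OF assms], of x l 0] unfolding DERIV_def .
      then have "((\<lambda>h. (\<phi> (x + h *\<^sub>R ?e) - \<phi> x) / h) \<longlongrightarrow> pderiv l \<phi> x) (at 0)" by simp
      moreover have "\<forall>i. t i \<in> UNIV - {0}" using t01(1) by (auto simp: t_def)
      ultimately show "(\<lambda>n. (\<phi> (x + t n *\<^sub>R ?e) - \<phi> x) / t n) \<longlonglongrightarrow> pderiv l \<phi> x"
        unfolding tendsto_at_iff_sequentially comp_def using t0 by blast
    qed
    show "AE x in lborel. norm ((\<phi> (x + t n *\<^sub>R ?e) - \<phi> x) / t n) \<le> B * indicat_real (ball 0 (r + 1)) x" for n
    proof (rule AE_I2)
      fix x
      show "norm ((\<phi> (x + t n *\<^sub>R ?e) - \<phi> x) / t n) \<le> B * indicat_real (ball 0 (r + 1)) x"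
      proof (cases "x \<in> ball 0 (r + 1)")
        case True
        have "\<bar>\<phi> (x + t n *\<^sub>R ?e) - \<phi> x\<bar> \<le> B * t n"
          using B(2)[of "x + t n *\<^sub>R ?e" x] t01(1)[of n] by (simp add: norm_axis_1)
        then show ?thesis using True t01(1)[of n] by (simp add: field_simps)
      next
        case False
        have "norm x \<le> norm (x + t n *\<^sub>R ?e) + norm (t n *\<^sub>R ?e)" using norm_triangle_ineq4[of "x + t n *\<^sub>R ?e" "t n *\<^sub>R ?e"] by simp
        then have "norm (x + t n *\<^sub>R ?e) \<ge> r" "norm x \<ge> r" using False t01[of n] by (auto simp: norm_axis_1)
        then have "\<phi> (x + t n *\<^sub>R ?e) = 0" "\<phi> x = 0" using r K(3) by (auto simp: subset_iff not_le[symmetric])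
        then show ?thesis using False by simp
      qed
    qed
  qed auto
  moreover have "(\<integral>x. (\<phi> (x + t n *\<^sub>R ?e) - \<phi> x) / t n \<partial>lborel) = 0" for n
    using test_fun_integrable[OF assms] lborel_translate[of \<phi> "t n *\<^sub>R ?e"] by simp
  ultimately have "(\<lambda>n::nat. 0::real) \<longlonglongrightarrow> (\<integral>x. pderiv l \<phi> x \<partial>lborel)" by (simp only:)
  then show ?thesis by (simp add: LIMSEQ_const_iff)
qed

lemma test_fun_by_parts:
  fixes \<phi> \<psi> :: "real^'m \<Rightarrow> real"
  assumes "smooth \<psi>" "test_fun U \<phi>"
  shows "(\<integral>x. pderiv l \<phi> x * \<psi> x \<partial>lborel) = - (\<integral>x. \<phi> x * pderiv l \<psi> x \<partial>lborel)"
proof -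
  have t: "test_fun U (\<lambda>x. \<psi> x * \<phi> x)" "test_fun U (\<lambda>x. \<psi> x * pderiv l \<phi> x)" "test_fun U (\<lambda>x. pderiv l \<psi> x * \<phi> x)"
    using assms by (auto intro: test_fun_mult test_fun_pderiv smooth_pderiv)
  have "0 = (\<integral>x. pderiv l (\<lambda>x. \<psi> x * \<phi> x) x \<partial>lborel)" using integral_pderiv_zero[OF t(1)] by simp
  also have "\<dots> = (\<integral>x. pderiv l \<psi> x * \<phi> x + \<psi> x * pderiv l \<phi> x \<partial>lborel)"
    by (simp add: pderiv_mult assms test_fun_smooth[OF assms(2)])
  also have "\<dots> = (\<integral>x. pderiv l \<psi> x * \<phi> x \<partial>lborel) + (\<integral>x. \<psi> x * pderiv l \<phi> x \<partial>lborel)"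
    using test_fun_integrable t by (intro Bochner_Integration.integral_add) auto
  finally show ?thesis by (simp add: mult.commute)
qed

lemma test_fun_W0:
  assumes "test_fun (ball 0 r) \<phi>" shows "W0 r \<phi> (\<lambda>l. pderiv l \<phi>)"
  unfolding W0_def using assms test_fun_outside[OF assms]
  by (auto intro: test_fun_L2 test_fun_pderiv test_fun_by_parts[OF test_fun_smooth])

lemma conv_weak:
  assumes "W0 r u d" "test_fun (ball 0 \<delta>) \<rho>"
  shows "conv (pderiv l \<rho>) u x = conv \<rho> (d l) x"
proof -
  have t: "test_fun UNIV (\<lambda>y. \<rho> (x - y))"
    using reflect_test_fun(1)[OF assms(2) order_refl, of x] by (rule test_fun_mono) simp
  have "(\<integral>y. pderiv l (\<lambda>y. \<rho> (x - y)) y * u y \<partial>lborel) = - (\<integral>y. \<rho> (x - y) * d l y \<partial>lborel)"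
    by (rule W0D[OF assms(1) t])
  then show ?thesis by (simp add: reflect_test_fun(2)[OF assms(2) order_refl] conv_def)
qed

lemma W0_approx:
  assumes W: "W0 r u d" and "r < R"
  shows "\<exists>\<phi>. (\<forall>n. test_fun (ball 0 R) (\<phi> n)) \<and> (\<lambda>n. n2 (\<lambda>x. \<phi> n x - u x)) \<longlonglongrightarrow> 0
    \<and> (\<forall>l. (\<lambda>n. n2 (\<lambda>x. pderiv l (\<phi> n) x - d l x)) \<longlonglongrightarrow> 0)"
proof -
  \<comment> \<open>Early kernels are discarded: only once their radius is below
    \<open>R - r\<close> do the mollifications stay supported in the larger ball.\<close>
  obtain N where N: "1 / real (Suc N) < R - r"
    using assms(2) nat_approx_posE[of "R - r"] by auto
  define \<phi> where "\<phi> n = conv (moll (n + N)) u" for n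
  have small: "1 / real (Suc (n + N)) < R - r" for n
    using N frac_le[of 1 1 "real (Suc N)" "real (Suc (n + N))"] by simp
  have t: "test_fun (ball 0 R) (\<phi> n)" for n
    unfolding \<phi>_def by (rule conv_test_fun[OF moll_test W0_integrable(1)[OF W], of r]) (use W0_outside[OF W] small[of n] in auto)
  have "(\<lambda>n. n2 (\<lambda>x. \<phi> n x - u x)) \<longlonglongrightarrow> 0"
    unfolding \<phi>_def using LIMSEQ_ignore_initial_segment[OF moll_L2[OF W0_integrable(1)[OF W] W0_L2(1)[OF W]], of N] .
  moreover have "(\<lambda>n. n2 (\<lambda>x. pderiv l (\<phi> n) x - d l x)) \<longlonglongrightarrow> 0" for l
  proof -
    have "pderiv l (\<phi> n) x = conv (moll (n + N)) (d l) x" for n x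
      unfolding \<phi>_def conv_pderiv[OF moll_test W0_integrable(1)[OF W]] by (rule conv_weak[OF W moll_test])
    then show ?thesis
      using LIMSEQ_ignore_initial_segment[OF moll_L2[OF W0_integrable(2)[OF W] W0_L2(2)[OF W]], of N] by simp
  qed
  ultimately show ?thesis using t by blast
qed

text \<open>Truncation to a slightly larger ball makes \<open>w\<close> integrable without affecting
  its mollifications further inside. These vanish, being integrals against test functions, and yet
  converge in L1 to the truncated function.\<close>

lemma fundamental_lemma:
  fixes w :: "real^'m \<Rightarrow> real"
  assumes int: "\<And>r. r < R \<Longrightarrow> integrable lborel (\<lambda>x. indicat_real (ball 0 r) x * w x)"
    and zero: "\<And>\<phi>. test_fun (ball 0 R) \<phi> \<Longrightarrow> (\<integral>x. \<phi> x * w x \<partial>lborel) = 0"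
  shows "AE x in lborel. x \<in> ball 0 R \<longrightarrow> w x = 0"
proof -
  have main: "AE x in lborel. x \<in> ball 0 r \<longrightarrow> w x = 0" if "r < R" for r
  proof -
    define r' where "r' = (r + R) / 2"
    have r': "r < r'" "r' < R" using that by (auto simp: r'_def)
    define f where "f x = indicat_real (ball 0 r') x * w x" for x
    have f: "integrable lborel f" unfolding f_def using int r' by blast
    have z: "conv (moll n) f x = 0" if "x \<in> ball 0 r" "1 / real (Suc n) < r' - r" for n x
    proof -
      have "norm x + 1 / real (Suc n) \<le> R" using that r' by simp
      note t = reflect_test_fun(1)[OF moll_test this]
      have "moll n (x - y) * f y = moll n (x - y) * w y" for y
      proof (cases "y \<in> ball 0 r'")
        case False
        then have "norm (x - y) \<ge> 1 / real (Suc n)"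
          using that norm_triangle_ineq3[of y x] norm_minus_commute[of x y] by simp
        then have "x - y \<notin> ball 0 (1 / real (Suc n))" by simp
        from test_fun_outside(1)[OF moll_test this] show ?thesis by simp
      qed (simp add: f_def)
      then have "conv (moll n) f x = (\<integral>y. moll n (x - y) * w y \<partial>lborel)"
        unfolding conv_def by (simp only:)
      also have "\<dots> = 0" by (rule zero[OF t])
      finally show ?thesis .
    qed
    have i: "integrable lborel (\<lambda>x. indicat_real (ball 0 r) x * \<bar>f x\<bar>)"
      by (rule bounded_mult_integrable[of _ _ 1]) (use f in \<open>auto simp: indicator_def\<close>)
    have ev1: "\<forall>\<^sub>F n in sequentially. 1 / real (Suc n) < r' - r"
      using order_tendstoD(2)[OF LIMSEQ_inverse_real_of_nat, of "r' - r"] r' by (simp add: inverse_eq_divide)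
    have "\<forall>\<^sub>F n in sequentially. (\<integral>x. indicat_real (ball 0 r) x * \<bar>f x\<bar> \<partial>lborel) \<le> (\<integral>x. \<bar>conv (moll n) f x - f x\<bar> \<partial>lborel)"
      using ev1 moll_L1(2)[OF f]
    proof eventually_elim
      case (elim n)
      show ?case
      proof (rule integral_mono[OF i])
        show "integrable lborel (\<lambda>x. \<bar>conv (moll n) f x - f x\<bar>)" using elim by auto
        show "indicat_real (ball 0 r) x * \<bar>f x\<bar> \<le> \<bar>conv (moll n) f x - f x\<bar>" for x
          using z[OF _ elim(1), of x] by (cases "x \<in> ball 0 r") auto
      qed
    qed
    then have "(\<integral>x. indicat_real (ball 0 r) x * \<bar>f x\<bar> \<partial>lborel) \<le> 0"
      by (intro tendsto_lowerbound[OF moll_L1(1)[OF f]]) auto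
    moreover have "(\<integral>x. indicat_real (ball 0 r) x * \<bar>f x\<bar> \<partial>lborel) \<ge> 0" by simp
    ultimately have "(\<integral>x. indicat_real (ball 0 r) x * \<bar>f x\<bar> \<partial>lborel) = 0" by linarith
    then have "AE x in lborel. indicat_real (ball 0 r) x * \<bar>f x\<bar> = 0"
      using integral_nonneg_eq_0_iff_AE[OF i] by auto
    then show ?thesis
      by eventually_elim (use r' in \<open>auto simp: f_def indicator_def split: if_splits\<close>)
  qed
  have "AE x in lborel. \<forall>n. x \<in> ball 0 (R - 1 / real (Suc n)) \<longrightarrow> w x = 0"
    unfolding AE_all_countable using main by auto
  then show ?thesis
  proof eventually_elim
    case (elim x)
    show ?case
    proof
      assume "x \<in> ball 0 R"
      then obtain n where "1 / real (Suc n) < R - norm x" using nat_approx_posE[of "R - norm x"] by auto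
      then show "w x = 0" using elim[rule_format, of n] by simp
    qed
  qed
qed

lemma cutoff_exists:
  assumes "0 < r" "r < R"
  obtains \<eta> :: "real^'m \<Rightarrow> real" where "test_fun (ball 0 R) \<eta>" "\<And>x. 0 \<le> \<eta> x" "\<And>x. \<eta> x \<le> 1"
    "\<And>x. x \<in> ball 0 r \<Longrightarrow> \<eta> x = 1" "\<And>x l. x \<in> ball 0 r \<Longrightarrow> pderiv l \<eta> x = 0"
proof -
  \<comment> \<open>\<open>r'\<close> is the midpoint and \<open>\<delta>\<close> half of the gap on
    either side of it, so the mollified indicator is still 1 on the small ball and supported in the
    large one.\<close>
  define r' \<delta> where "r' = (r + R) / 2" and "\<delta> = (R - r) / 4"
  have \<delta>: "\<delta> > 0" "r + \<delta> < r'" "r' + \<delta> < R" using assms by (auto simp: r'_def \<delta>_def field_simps)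
  obtain \<rho> :: "real^'m \<Rightarrow> real" where \<rho>: "test_fun (ball 0 \<delta>) \<rho>" "\<And>x. \<rho> x \<ge> 0" "(\<integral>x. \<rho> x \<partial>lborel) = 1"
    using mollifier_exists[OF \<delta>(1)] by metis
  note [measurable] = smooth_measurable[OF test_fun_smooth[OF \<rho>(1)]]
  let ?f = "indicat_real (ball (0::real^'m) r')"
  define \<eta> where "\<eta> = conv \<rho> ?f"
  have t: "test_fun (ball 0 R) \<eta>" unfolding \<eta>_def
    by (rule conv_test_fun[OF \<rho>(1) integrable_indicator_ball]) (use \<delta> in auto)
  have one: "(\<integral>y. \<rho> (x - y) \<partial>lborel) = 1" for x using lborel_reflect[of \<rho> x] \<rho>(3) by simp
  have ir: "integrable lborel (\<lambda>y. \<rho> (x - y))" for x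
    using test_fun_integrable[OF reflect_test_fun(1)[OF \<rho>(1) order_refl]] .
  have 1: "\<eta> x = 1" if "x \<in> ball 0 r" for x
  proof -
    have "\<rho> (x - y) * ?f y = \<rho> (x - y)" for y
    proof (cases "y \<in> ball 0 r'")
      case False
      then have "norm (x - y) \<ge> \<delta>" using that \<delta> norm_triangle_ineq3[of y x] norm_minus_commute[of x y] by simp
      then have "x - y \<notin> ball 0 \<delta>" by simp
      from test_fun_outside(1)[OF \<rho>(1) this] show ?thesis by simp
    qed simp
    then have "\<eta> x = (\<integral>y. \<rho> (x - y) \<partial>lborel)" unfolding \<eta>_def conv_def by (simp only:)
    then show ?thesis by (simp only: one)
  qed
  have 2: "0 \<le> \<eta> x" for x unfolding \<eta>_def conv_def by (intro integral_nonneg_AE) (simp add: \<rho>(2))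
  have 3: "\<eta> x \<le> 1" for x
  proof -
    have "\<eta> x \<le> (\<integral>y. \<rho> (x - y) \<partial>lborel)" unfolding \<eta>_def conv_def
      using conv_integrable[OF \<rho>(1) integrable_indicator_ball] ir \<rho>(2)
      by (intro integral_mono) (auto simp: indicator_def)
    then show ?thesis by (simp add: one)
  qed
  show ?thesis
    by (rule that[OF t 2 3 1]) (auto intro!: pderiv_locally_const[OF open_ball _ 1])
qed

text \<open>Leibniz' rule, by moving the cutoff into the test function. This is the passage from
  functions on a ball to functions on the whole space.\<close>

lemma W0_cutoff:
  assumes "\<And>l. wd R l u (d l)" "test_fun (ball 0 r) \<eta>" "r \<le> R"
  shows "W0 r (\<lambda>x. \<eta> x * u x) (\<lambda>l x. pderiv l \<eta> x * u x + \<eta> x * d l x)"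
proof -
  have u: "L2 u" "\<And>l. L2 (d l)" using assms(1) wd_L2 by blast+
  have \<eta>R: "test_fun (ball 0 R) \<eta>" using assms test_fun_ball_mono by blast
  have l2: "L2 (\<lambda>x. \<eta> x * u x)" "\<And>l. L2 (\<lambda>x. pderiv l \<eta> x * u x)" "\<And>l. L2 (\<lambda>x. \<eta> x * d l x)"
    using L2_smooth_test[OF u(1) assms(2)] L2_smooth_test[OF u(1) test_fun_pderiv[OF assms(2)]] L2_smooth_test[OF u(2) assms(2)] by auto
  have w: "(\<integral>x. pderiv l \<phi> x * (\<eta> x * u x) \<partial>lborel) = - (\<integral>x. \<phi> x * (pderiv l \<eta> x * u x + \<eta> x * d l x) \<partial>lborel)"
    if t: "test_fun UNIV \<phi>" for l \<phi>
  proof -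
    have sm: "smooth \<phi>" "smooth \<eta>" using t assms test_fun_smooth by auto
    have t2: "test_fun (ball 0 R) (\<lambda>x. \<phi> x * \<eta> x)" by (rule test_fun_mult[OF \<eta>R sm(1)])
    have L: "L2 \<phi>" "L2 (pderiv l \<phi>)" using t test_fun_L2 test_fun_pderiv by blast+
    have i: "integrable lborel (\<lambda>x. pderiv l \<phi> x * (\<eta> x * u x))" "integrable lborel (\<lambda>x. \<phi> x * (pderiv l \<eta> x * u x))"
      "integrable lborel (\<lambda>x. \<phi> x * (\<eta> x * d l x))"
      by (rule L2_mult_integrable[OF L(2) l2(1)] L2_mult_integrable[OF L(1) l2(2)] L2_mult_integrable[OF L(1) l2(3)])+
    have "(\<integral>x. pderiv l \<phi> x * (\<eta> x * u x) + \<phi> x * (pderiv l \<eta> x * u x) \<partial>lborel)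
       = (\<integral>x. pderiv l (\<lambda>x. \<phi> x * \<eta> x) x * u x \<partial>lborel)"
      by (rule Bochner_Integration.integral_cong) (auto simp: pderiv_mult sm algebra_simps)
    also have "\<dots> = - (\<integral>x. \<phi> x * (\<eta> x * d l x) \<partial>lborel)"
      using wdD[OF assms(1) t2] by (simp add: mult.assoc)
    finally show ?thesis using i by (simp add: distrib_left)
  qed
  have out: "\<eta> x = 0" "pderiv l \<eta> x = 0" if "x \<notin> ball 0 r" for x l
    using test_fun_outside[OF assms(2) that] by auto
  show ?thesis unfolding W0_def using l2 L2_add w out by auto
qed

text \<open>The product and its derivative are in general only integrable on the support of the test
  function, so the rule is an integral identity and not a \<open>wd\<close> statement.\<close>

lemma product_rule:
  fixes u v :: "real^'m \<Rightarrow> real"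
  assumes u: "\<And>l. wd R l u (du l)" and v: "wd R l v v'" and t: "test_fun (ball 0 R) \<phi>"
  shows "(\<integral>x. pderiv l \<phi> x * (u x * v x) \<partial>lborel) = - (\<integral>x. \<phi> x * (du l x * v x + u x * v' x) \<partial>lborel)"
    and "integrable lborel (\<lambda>x. pderiv l \<phi> x * (u x * v x))"
    and "integrable lborel (\<lambda>x. \<phi> x * (du l x * v x + u x * v' x))"
proof -
  have L: "L2 u" "\<And>l. L2 (du l)" "L2 v" "L2 v'" using u v wd_L2 by blast+
  have i: "integrable lborel (\<lambda>x. pderiv l \<phi> x * (u x * v x))" "integrable lborel (\<lambda>x. \<phi> x * (du l x * v x))"
    "integrable lborel (\<lambda>x. \<phi> x * (u x * v' x))"
    using L2_mult_integrable[OF L2_smooth_test[OF L(1) test_fun_pderiv[OF t]] L(3), of l]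
      L2_mult_integrable[OF L2_smooth_test[OF L(2) t] L(3), of l] L2_mult_integrable[OF L2_smooth_test[OF L(1) t] L(4)]
    by (auto simp: mult.assoc)
  then show "integrable lborel (\<lambda>x. pderiv l \<phi> x * (u x * v x))"
     "integrable lborel (\<lambda>x. \<phi> x * (du l x * v x + u x * v' x))" by (auto simp: distrib_left)
  show "(\<integral>x. pderiv l \<phi> x * (u x * v x) \<partial>lborel) = - (\<integral>x. \<phi> x * (du l x * v x + u x * v' x) \<partial>lborel)"
  proof (cases "R > 0")
    case False
    then have "x \<notin> ball 0 R" for x :: "real^'m" using norm_ge_zero[of x] by (auto simp del: norm_ge_zero)
    then have "\<phi> x = 0" "pderiv l \<phi> x = 0" for x using test_fun_outside[OF t] by blast+
    then show ?thesis by simp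
  next
    case True
    obtain r where r: "0 < r" "r < R" "test_fun (ball 0 r) \<phi>" using test_fun_ball_shrink[OF t True] by metis
    obtain r2 where r2: "r < r2" "r2 < R" using dense r by blast
    obtain \<eta> :: "real^'m \<Rightarrow> real" where \<eta>: "test_fun (ball 0 r2) \<eta>"
      "\<And>x. x \<in> ball 0 r \<Longrightarrow> \<eta> x = 1" "\<And>x l. x \<in> ball 0 r \<Longrightarrow> pderiv l \<eta> x = 0"
      using cutoff_exists[OF r(1) r2(1)] by metis
    have W: "W0 r2 (\<lambda>x. \<eta> x * u x) (\<lambda>l x. pderiv l \<eta> x * u x + \<eta> x * du l x)"
      using W0_cutoff[OF u \<eta>(1)] r2 by simp
    obtain \<psi> where \<psi>: "\<And>n. test_fun (ball 0 R) (\<psi> n)" "(\<lambda>n. n2 (\<lambda>x. \<psi> n x - \<eta> x * u x)) \<longlonglongrightarrow> 0"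
      "\<And>l. (\<lambda>n. n2 (\<lambda>x. pderiv l (\<psi> n) x - (pderiv l \<eta> x * u x + \<eta> x * du l x))) \<longlonglongrightarrow> 0"
      using W0_approx[OF W r2(2)] by blast
    have sm: "smooth \<phi>" "\<And>n. smooth (\<psi> n)" using t \<psi>(1) test_fun_smooth by auto
    have Lp: "L2 (\<psi> n)" "L2 (pderiv l (\<psi> n))" for n using \<psi>(1) test_fun_L2 test_fun_pderiv by blast+
    \<comment> \<open>Only one factor is smoothed: the identity is then the weak derivative of
      \<open>v\<close> tested with \<open>\<phi> * \<psi> n\<close>, and every limit below pairs an
      L2-convergent sequence with a fixed L2 function.\<close>
    have eq: "(\<integral>x. \<psi> n x * (pderiv l \<phi> x * v x) \<partial>lborel) + (\<integral>x. pderiv l (\<psi> n) x * (\<phi> x * v x) \<partial>lborel)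
       = - (\<integral>x. \<psi> n x * (\<phi> x * v' x) \<partial>lborel)" for n
    proof -
      have "(\<integral>x. pderiv l (\<lambda>x. \<phi> x * \<psi> n x) x * v x \<partial>lborel) = - (\<integral>x. \<phi> x * \<psi> n x * v' x \<partial>lborel)"
        by (rule wdD[OF v test_fun_mult[OF \<psi>(1) sm(1)]])
      moreover have "(\<integral>x. pderiv l (\<lambda>x. \<phi> x * \<psi> n x) x * v x \<partial>lborel)
         = (\<integral>x. \<psi> n x * (pderiv l \<phi> x * v x) + pderiv l (\<psi> n) x * (\<phi> x * v x) \<partial>lborel)"
        by (rule Bochner_Integration.integral_cong) (auto simp: pderiv_mult sm algebra_simps)
      moreover have "\<dots> = (\<integral>x. \<psi> n x * (pderiv l \<phi> x * v x) \<partial>lborel) + (\<integral>x. pderiv l (\<psi> n) x * (\<phi> x * v x) \<partial>lborel)"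
        by (intro Bochner_Integration.integral_add L2_mult_integrable Lp L2_smooth_test[OF L(3) t] L2_smooth_test[OF L(3) test_fun_pderiv[OF t]])
      ultimately show ?thesis by (simp add: algebra_simps)
    qed
    have lim1: "(\<lambda>n. \<integral>x. \<psi> n x * (pderiv l \<phi> x * v x) \<partial>lborel) \<longlonglongrightarrow> (\<integral>x. (\<eta> x * u x) * (pderiv l \<phi> x * v x) \<partial>lborel)"
      by (rule L2_ip_tendsto[OF Lp(1) W0_L2(1)[OF W] L2_smooth_test[OF L(3) test_fun_pderiv[OF t]] \<psi>(2)])
    have lim2: "(\<lambda>n. \<integral>x. pderiv l (\<psi> n) x * (\<phi> x * v x) \<partial>lborel) \<longlonglongrightarrow> (\<integral>x. (pderiv l \<eta> x * u x + \<eta> x * du l x) * (\<phi> x * v x) \<partial>lborel)"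
      by (rule L2_ip_tendsto[OF Lp(2) W0_L2(2)[OF W] L2_smooth_test[OF L(3) t] \<psi>(3)])
    have lim3: "(\<lambda>n. \<integral>x. \<psi> n x * (\<phi> x * v' x) \<partial>lborel) \<longlonglongrightarrow> (\<integral>x. (\<eta> x * u x) * (\<phi> x * v' x) \<partial>lborel)"
      by (rule L2_ip_tendsto[OF Lp(1) W0_L2(1)[OF W] L2_smooth_test[OF L(4) t] \<psi>(2)])
    have fin: "(\<integral>x. (\<eta> x * u x) * (pderiv l \<phi> x * v x) \<partial>lborel) + (\<integral>x. (pderiv l \<eta> x * u x + \<eta> x * du l x) * (\<phi> x * v x) \<partial>lborel)
        = - (\<integral>x. (\<eta> x * u x) * (\<phi> x * v' x) \<partial>lborel)"
      using LIMSEQ_unique[OF tendsto_add[OF lim1 lim2] tendsto_minus[OF lim3, folded eq]] .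
    have supp: "\<phi> x = 0" "pderiv l \<phi> x = 0" if "x \<notin> ball 0 r" for x
      using test_fun_outside[OF r(3) that] by auto
    have e1: "(\<eta> x * u x) * (pderiv l \<phi> x * v x) = pderiv l \<phi> x * (u x * v x)"
      and e2: "(pderiv l \<eta> x * u x + \<eta> x * du l x) * (\<phi> x * v x) = \<phi> x * (du l x * v x)"
      and e3: "(\<eta> x * u x) * (\<phi> x * v' x) = \<phi> x * (u x * v' x)" for x
      using \<eta>(2,3)[of x] supp[of x] by (cases "x \<in> ball 0 r"; simp)+
    show ?thesis using fin i unfolding e1 e2 e3 by (simp add: distrib_left)
  qed
qed

section \<open>Completeness and representation\<close>

text \<open>Completeness for rapidly Cauchy sequences, which suffice for the minimising sequences
  below. The limit is built pointwise from the telescoping series.\<close>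

lemma L2_complete:
  fixes f :: "nat \<Rightarrow> real^'m \<Rightarrow> real"
  assumes f: "\<And>n. L2 (f n)" and c: "\<And>n. n2 (\<lambda>x. f (Suc n) x - f n x) \<le> (1/2)^n"
  shows "\<exists>g. L2 g \<and> (\<lambda>n. n2 (\<lambda>x. f n x - g x)) \<longlonglongrightarrow> 0"
proof -
  note [measurable] = L2_measurable[OF f]
  define h where "h n x = f (Suc n) x - f n x" for n x
  have hL: "L2 (h n)" for n unfolding h_def by (rule L2_diff[OF f f])
  note [measurable] = L2_measurable[OF hL]
  \<comment> \<open>The weight \<open>2^n\<close> is affordable since the squared norms of the
    increments are at most \<open>4^(-n)\<close>; it is what makes the increments themselves
    summable.\<close>
  have "(\<integral>\<^sup>+x. (\<Sum>n. ennreal (2^n * (h n x)\<^sup>2)) \<partial>lborel) = (\<Sum>n. \<integral>\<^sup>+x. ennreal (2^n * (h n x)\<^sup>2) \<partial>lborel)"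
    by (rule nn_integral_suminf) measurable
  also have "\<dots> \<le> (\<Sum>n. ennreal ((1/2)^n))"
  proof (intro suminf_le summableI)
    fix n
    have "(\<integral>\<^sup>+x. ennreal (2^n * (h n x)\<^sup>2) \<partial>lborel) = ennreal (2^n * (n2 (h n))\<^sup>2)"
      using L2_sq[OF hL] by (subst nn_integral_eq_integral) (auto simp: n2_sq)
    also have "\<dots> \<le> ennreal ((1/2)^n)"
    proof (rule ennreal_leI)
      have "(n2 (h n))\<^sup>2 \<le> ((1/2)^n)\<^sup>2" using c[of n] unfolding h_def by (intro power_mono) auto
      then have "2^n * (n2 (h n))\<^sup>2 \<le> 2^n * ((1/2)^n)\<^sup>2" by (intro mult_left_mono) auto
      also have "\<dots> = (1/2::real)^n" by (simp add: power2_eq_square power_one_over field_simps)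
      finally show "2^n * (n2 (h n))\<^sup>2 \<le> (1/2)^n" .
    qed
    finally show "(\<integral>\<^sup>+x. ennreal (2^n * (h n x)\<^sup>2) \<partial>lborel) \<le> ennreal ((1/2)^n)" .
  qed
  also have "\<dots> < \<infinity>" by (subst suminf_ennreal2) (auto simp: summable_geometric)
  finally have "AE x in lborel. (\<Sum>n. ennreal (2^n * (h n x)\<^sup>2)) \<noteq> \<infinity>"
    by (intro nn_integral_noteq_infinite) auto
  then have conv: "AE x in lborel. convergent (\<lambda>n. f n x)"
  proof eventually_elim
    case (elim x)
    have s1: "summable (\<lambda>n. 2^n * (h n x)\<^sup>2)" by (rule summable_suminf_not_top) (use elim in auto)
    have s2: "summable (\<lambda>n. (1/2::real)^n)" by (simp add: summable_geometric)
    have "summable (\<lambda>n. h n x)"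
    proof (rule summable_comparison_test'[OF summable_add[OF s1 s2], of 0])
      fix n
      \<comment> \<open>Splitting off \<open>sqrt 2 ^ n\<close> bounds the increment by the weighted
        square plus a geometric term.\<close>
      have "\<bar>h n x\<bar> = \<bar>(sqrt 2 ^ n * h n x) * (1 / sqrt 2 ^ n)\<bar>" by (simp add: abs_mult)
      also have "\<dots> \<le> (sqrt 2 ^ n * h n x)\<^sup>2 + (1 / sqrt 2 ^ n)\<^sup>2" by (rule abs_mult_le_sq)
      also have "\<dots> = 2^n * (h n x)\<^sup>2 + (1/2)^n"
        by (simp add: power_mult_distrib power_divide power_one_over real_sqrt_power[symmetric] power_mult[symmetric] mult.commute) (simp add: power_mult)
      finally show "norm (h n x) \<le> 2^n * (h n x)\<^sup>2 + (1/2)^n" by simp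
    qed
    then have "convergent (\<lambda>n. \<Sum>k<n. h k x)" by (simp add: summable_iff_convergent)
    moreover have "(\<Sum>k<n. h k x) = f n x - f 0 x" for n unfolding h_def by (rule sum_lessThan_telescope)
    ultimately have "convergent (\<lambda>n. (f n x - f 0 x) + f 0 x)" by (intro convergent_add convergent_const) simp
    then show ?case by simp
  qed
  define g where "g x = lim (\<lambda>n. f n x)" for x
  have [measurable]: "g \<in> borel_measurable borel" unfolding g_def by measurable
  have gl: "AE x in lborel. (\<lambda>n. f n x) \<longlonglongrightarrow> g x"
    using conv by eventually_elim (simp add: g_def convergent_LIMSEQ_iff)
  have d: "n2 (\<lambda>x. f (n + k) x - f n x) \<le> 2 * (1/2)^n - (1/2)^(n+k) * 2" for n k
  proof (induction k)
    case 0 show ?case by (simp add: n2_def)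
  next
    case (Suc k)
    have "n2 (\<lambda>x. f (n + Suc k) x - f n x) \<le> n2 (\<lambda>x. f (Suc (n + k)) x - f (n + k) x) + n2 (\<lambda>x. f (n + k) x - f n x)"
      using n2_triangle3[OF f[of "Suc (n + k)"] f[of "n + k"] f[of n]] by simp
    also have "\<dots> \<le> (1/2)^(n+k) + (2 * (1/2)^n - (1/2)^(n+k) * 2)" using c[of "n+k"] Suc by simp
    finally show ?case by simp
  qed
  have bound: "(\<integral>\<^sup>+x. ennreal ((f n x - g x)\<^sup>2) \<partial>lborel) \<le> ennreal ((2 * (1/2)^n)\<^sup>2)" for n
  proof -
    \<comment> \<open>Fatou's lemma carries the bound on \<open>f (n + k) - f n\<close> to the limit
      in k.\<close>
    have "(\<integral>\<^sup>+x. ennreal ((f n x - g x)\<^sup>2) \<partial>lborel) = (\<integral>\<^sup>+x. liminf (\<lambda>k. ennreal ((f (n + k) x - f n x)\<^sup>2)) \<partial>lborel)"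
    proof (rule nn_integral_cong_AE)
      show "AE x in lborel. ennreal ((f n x - g x)\<^sup>2) = liminf (\<lambda>k. ennreal ((f (n + k) x - f n x)\<^sup>2))"
        using gl
      proof eventually_elim
        case (elim x)
        have "(\<lambda>k. f (k + n) x) \<longlonglongrightarrow> g x" by (rule LIMSEQ_ignore_initial_segment[OF elim])
        then have "(\<lambda>k. f (n + k) x) \<longlonglongrightarrow> g x" by (simp add: add.commute)
        then have "(\<lambda>k. ennreal ((f (n + k) x - f n x)\<^sup>2)) \<longlonglongrightarrow> ennreal ((g x - f n x)\<^sup>2)"
          by (intro tendsto_ennrealI tendsto_power tendsto_diff tendsto_const)
        then have "liminf (\<lambda>k. ennreal ((f (n + k) x - f n x)\<^sup>2)) = ennreal ((g x - f n x)\<^sup>2)"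
          by (rule lim_imp_Liminf[OF trivial_limit_sequentially])
        then show ?case by (simp only: power2_commute[of "f n x" "g x"])
      qed
    qed
    also have "\<dots> \<le> liminf (\<lambda>k. \<integral>\<^sup>+x. ennreal ((f (n + k) x - f n x)\<^sup>2) \<partial>lborel)"
      by (rule nn_integral_liminf) measurable
    also have "\<dots> \<le> liminf (\<lambda>k::nat. ennreal ((2 * (1/2)^n)\<^sup>2))"
    proof (intro Liminf_mono always_eventually allI)
      fix k
      have "(\<integral>\<^sup>+x. ennreal ((f (n + k) x - f n x)\<^sup>2) \<partial>lborel) = ennreal ((n2 (\<lambda>x. f (n + k) x - f n x))\<^sup>2)"
        using L2_sq[OF L2_diff[OF f f]] by (subst nn_integral_eq_integral) (auto simp: n2_sq)
      also have "\<dots> \<le> ennreal ((2 * (1/2)^n)\<^sup>2)"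
      proof (intro ennreal_leI power_mono)
        have "(0::real) \<le> (1/2)^(n+k) * 2" by simp
        then show "n2 (\<lambda>x. f (n + k) x - f n x) \<le> 2 * (1/2)^n" using d[of n k] by linarith
      qed simp
      finally show "(\<integral>\<^sup>+x. ennreal ((f (n + k) x - f n x)\<^sup>2) \<partial>lborel) \<le> ennreal ((2 * (1/2)^n)\<^sup>2)" .
    qed
    also have "\<dots> = ennreal ((2 * (1/2)^n)\<^sup>2)" by (simp add: Liminf_const)
    finally show ?thesis .
  qed
  have fg: "L2 (\<lambda>x. f n x - g x)" for n unfolding L2_def
    using bound[of n] by (auto simp: integrable_iff_bounded intro: le_less_trans)
  have "L2 (\<lambda>x. f 0 x - (f 0 x - g x))" by (rule L2_diff[OF f fg])
  then have g: "L2 g" by simp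
  have b2: "n2 (\<lambda>x. f n x - g x) \<le> 2 * (1/2)^n" for n
  proof (rule power2_le_imp_le)
    have "ennreal ((n2 (\<lambda>x. f n x - g x))\<^sup>2) = (\<integral>\<^sup>+x. ennreal ((f n x - g x)\<^sup>2) \<partial>lborel)"
      using L2_sq[OF fg] by (subst nn_integral_eq_integral) (auto simp: n2_sq)
    then show "(n2 (\<lambda>x. f n x - g x))\<^sup>2 \<le> (2 * (1/2)^n)\<^sup>2" 
      using bound[of n] ennreal_le_iff[of "(2 * (1/2)^n)\<^sup>2" "(n2 (\<lambda>x. f n x - g x))\<^sup>2"] by (simp only: zero_le_power2)
  qed simp
  have "(\<lambda>n. n2 (\<lambda>x. f n x - g x)) \<longlonglongrightarrow> 0"
  proof (rule Lim_null_comparison)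
    show "\<forall>\<^sub>F n in sequentially. norm (n2 (\<lambda>x. f n x - g x)) \<le> 2 * (1/2)^n" using b2 by (intro always_eventually) auto
    show "(\<lambda>n. 2 * (1/2::real)^n) \<longlonglongrightarrow> 0" by (intro tendsto_mult_right_zero LIMSEQ_realpow_zero) auto
  qed
  then show ?thesis using g by blast
qed

text \<open>First-order condition at a minimum. Taking \<open>b + 1\<close> instead of
  \<open>b\<close> in the step size covers the case \<open>b = 0\<close>.\<close>

lemma linear_quadratic_zero:
  fixes a b :: real
  assumes q: "\<And>s. 0 \<le> s * a + s\<^sup>2 * b / 2" and "b \<ge> 0"
  shows "a = 0"
proof (rule ccontr)
  assume a: "a \<noteq> 0"
  define s where "s = - (a / (b + 1))"
  have sa: "s * (b + 1) = - a" using assms(2) by (simp add: s_def)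
  have "s \<noteq> 0" using a assms(2) by (simp add: s_def)
  then have s2: "s\<^sup>2 * (b + 1) > 0" using assms(2) by simp
  have "s * a = - (s\<^sup>2 * (b + 1))" using sa by (simp add: power2_eq_square mult.assoc)
  then have "0 \<le> - (s\<^sup>2 * (b + 1)) + s\<^sup>2 * b / 2" using q[of s] by simp
  moreover have "s\<^sup>2 * b / 2 \<le> s\<^sup>2 * (b + 1) / 2" by (intro divide_right_mono mult_left_mono) auto
  ultimately show False using s2 by linarith
qed

text \<open>Riesz representation on the (incomplete) space of test functions: minimise
  \<open>(n2 \<phi>)\<^sup>2 / 2 - L \<phi>\<close>; the parallelogram law makes minimising sequences Cauchy.\<close>
lemma riesz_test_functions:
  fixes L :: "(real^'m \<Rightarrow> real) \<Rightarrow> real"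
  assumes add: "\<And>\<phi> \<psi>. test_fun U \<phi> \<Longrightarrow> test_fun U \<psi> \<Longrightarrow> L (\<lambda>x. \<phi> x + \<psi> x) = L \<phi> + L \<psi>"
    and cm: "\<And>\<phi> c. test_fun U \<phi> \<Longrightarrow> L (\<lambda>x. c * \<phi> x) = c * L \<phi>"
    and bd: "\<And>\<phi>. test_fun U \<phi> \<Longrightarrow> \<bar>L \<phi>\<bar> \<le> C * n2 \<phi>"
  shows "\<exists>v. L2 v \<and> (\<forall>\<phi>. test_fun U \<phi> \<longrightarrow> L \<phi> = (\<integral>x. \<phi> x * v x \<partial>lborel))"
proof -
  define J where "J \<phi> = (n2 \<phi>)\<^sup>2 / 2 - L \<phi>" for \<phi>
  define S where "S = J ` {\<phi>. test_fun U \<phi>}"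
  have lower: "- (C\<^sup>2 / 2) \<le> J \<phi>" if "test_fun U \<phi>" for \<phi>
  proof -
    have "0 \<le> (n2 \<phi> - C)\<^sup>2" by simp
    then have "C * n2 \<phi> \<le> (n2 \<phi>)\<^sup>2 / 2 + C\<^sup>2 / 2" by (simp add: power2_eq_square algebra_simps)
    then show ?thesis using bd[OF that] unfolding J_def by linarith
  qed
  have bb: "bdd_below S" unfolding S_def bdd_below_def using lower by auto
  define I where "I = Inf S"
  have I: "I \<le> J \<phi>" if "test_fun U \<phi>" for \<phi>
    unfolding I_def by (rule cInf_lower[OF _ bb]) (auto simp: S_def that)
  have "\<exists>\<phi>. test_fun U \<phi> \<and> J \<phi> < I + e" if "e > 0" for e
  proof -
    have "S \<noteq> {}" unfolding S_def using test_fun_zero by auto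
    moreover have "Inf S < I + e" using that by (simp add: I_def)
    ultimately obtain s where "s \<in> S" "s < I + e" using cInf_lessD[of S "I + e"] by blast
    then show ?thesis by (auto simp: S_def)
  qed
  \<comment> \<open>With this precision the midpoint argument gives squared increments at most
    \<open>(1/4)^n\<close>, the rate that \<open>L2_complete\<close> asks for.\<close>
  then have "\<exists>\<phi>. test_fun U \<phi> \<and> J \<phi> < I + (1/4)^n / 16" for n by simp
  then obtain \<phi> where \<phi>: "\<And>n. test_fun U (\<phi> n)" "\<And>n. J (\<phi> n) < I + (1/4)^n / 16" by metis
  have expand: "J (\<lambda>x. \<phi> x + t * \<psi> x) = J \<phi> + t * ((\<integral>x. \<phi> x * \<psi> x \<partial>lborel) - L \<psi>) + t\<^sup>2 * (n2 \<psi>)\<^sup>2 / 2"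
    if "test_fun U \<phi>" "test_fun U \<psi>" for \<phi> \<psi> t
  proof -
    have L2: "L2 \<phi>" "L2 \<psi>" using that test_fun_L2 by auto
    have "(n2 (\<lambda>x. \<phi> x + t * \<psi> x))\<^sup>2 = (\<integral>x. (\<phi> x)\<^sup>2 + 2 * t * (\<phi> x * \<psi> x) + t\<^sup>2 * (\<psi> x)\<^sup>2 \<partial>lborel)"
      unfolding n2_sq by (rule Bochner_Integration.integral_cong) (auto simp: power2_eq_square algebra_simps)
    also have "\<dots> = (n2 \<phi>)\<^sup>2 + 2 * t * (\<integral>x. \<phi> x * \<psi> x \<partial>lborel) + t\<^sup>2 * (n2 \<psi>)\<^sup>2"
      using L2_mult_integrable[OF L2] L2_sq[OF L2(1)] L2_sq[OF L2(2)] by (simp add: n2_sq)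
    finally show ?thesis
      using add[OF that(1) test_fun_cmult[OF that(2)], of t] cm[OF that(2), of t] by (simp add: J_def algebra_simps add_divide_distrib)
  qed
  have cauchy: "n2 (\<lambda>x. \<phi> (Suc n) x - \<phi> n x) \<le> (1/2)^n" for n
  proof (rule power2_le_imp_le)
    define \<psi> where "\<psi> x = \<phi> (Suc n) x - \<phi> n x" for x
    have t\<psi>: "test_fun U \<psi>" unfolding \<psi>_def by (rule test_fun_diff[OF \<phi>(1) \<phi>(1)])
    have e1: "J (\<phi> (Suc n)) = J (\<phi> n) + 1 * ((\<integral>x. \<phi> n x * \<psi> x \<partial>lborel) - L \<psi>) + 1\<^sup>2 * (n2 \<psi>)\<^sup>2 / 2"
      using expand[OF \<phi>(1)[of n] t\<psi>, of 1] by (simp add: \<psi>_def)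
    \<comment> \<open>Comparing the functional at the midpoint with its infimum bounds the distance
      of two points by their excess over the infimum.\<close>
    have "test_fun U (\<lambda>x. \<phi> n x + (1/2) * \<psi> x)" by (intro test_fun_add \<phi>(1) test_fun_cmult t\<psi>)
    from I[OF this] have "I \<le> J (\<phi> n) + (1/2) * ((\<integral>x. \<phi> n x * \<psi> x \<partial>lborel) - L \<psi>) + (1/2)\<^sup>2 * (n2 \<psi>)\<^sup>2 / 2"
      using expand[OF \<phi>(1)[of n] t\<psi>, of "1/2"] by simp
    then have "(n2 \<psi>)\<^sup>2 \<le> 4 * (J (\<phi> n) - I) + 4 * (J (\<phi> (Suc n)) - I)"
      using e1 by (simp add: power2_eq_square field_simps)
    also have "\<dots> \<le> 4 * ((1/4)^n / 16) + 4 * ((1/4)^Suc n / 16)" 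
      by (intro add_mono mult_left_mono) (use \<phi>(2)[of n] \<phi>(2)[of "Suc n"] in \<open>simp_all del: power_Suc\<close>)
    also have "\<dots> \<le> (1/4)^n" by simp
    also have "\<dots> = ((1/2::real)^n)\<^sup>2" by (simp add: power_mult[symmetric] mult.commute[of n]) (simp add: power_mult power2_eq_square)
    finally show "(n2 (\<lambda>x. \<phi> (Suc n) x - \<phi> n x))\<^sup>2 \<le> ((1/2)^n)\<^sup>2" unfolding \<psi>_def .
  qed simp
  obtain v where v: "L2 v" "(\<lambda>n. n2 (\<lambda>x. \<phi> n x - v x)) \<longlonglongrightarrow> 0"
    using L2_complete[OF test_fun_L2[OF \<phi>(1)] cauchy] by blast
  have "L \<psi> = (\<integral>x. \<psi> x * v x \<partial>lborel)" if t: "test_fun U \<psi>" for \<psi>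
  proof -
    let ?a = "(\<integral>x. v x * \<psi> x \<partial>lborel) - L \<psi>"
    have lim: "(\<lambda>n. \<integral>x. \<phi> n x * \<psi> x \<partial>lborel) \<longlonglongrightarrow> (\<integral>x. v x * \<psi> x \<partial>lborel)"
      by (rule L2_ip_tendsto[OF test_fun_L2[OF \<phi>(1)] v(1) test_fun_L2[OF t] v(2)])
    have q: "0 \<le> s * ?a + s\<^sup>2 * (n2 \<psi>)\<^sup>2 / 2" for s
    proof (rule tendsto_lowerbound)
      show "(\<lambda>n. s * ((\<integral>x. \<phi> n x * \<psi> x \<partial>lborel) - L \<psi>) + s\<^sup>2 * (n2 \<psi>)\<^sup>2 / 2 + (1/4)^n / 16) \<longlonglongrightarrow> s * ?a + s\<^sup>2 * (n2 \<psi>)\<^sup>2 / 2"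
      proof -
        have "(\<lambda>n. (1/4::real)^n / 16) \<longlonglongrightarrow> 0" by (intro tendsto_divide_zero LIMSEQ_realpow_zero) auto
        from tendsto_add[OF tendsto_add[OF tendsto_mult_left[OF tendsto_diff[OF lim tendsto_const]] tendsto_const] this]
        show ?thesis by simp
      qed
      show "\<forall>\<^sub>F n in sequentially. 0 \<le> s * ((\<integral>x. \<phi> n x * \<psi> x \<partial>lborel) - L \<psi>) + s\<^sup>2 * (n2 \<psi>)\<^sup>2 / 2 + (1/4)^n / 16"
      proof (intro always_eventually allI)
        fix n
        have "I \<le> J (\<lambda>x. \<phi> n x + s * \<psi> x)" by (intro I test_fun_add \<phi>(1) test_fun_cmult t)
        then show "0 \<le> s * ((\<integral>x. \<phi> n x * \<psi> x \<partial>lborel) - L \<psi>) + s\<^sup>2 * (n2 \<psi>)\<^sup>2 / 2 + (1/4)^n / 16"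
          using expand[OF \<phi>(1)[of n] t, of s] \<phi>(2)[of n] by linarith
      qed
    qed simp
    have "?a = 0" by (rule linear_quadratic_zero[OF q]) simp
    then show ?thesis by (simp add: mult.commute)
  qed
  then show ?thesis using v(1) by blast
qed

text \<open>The source of new weak derivatives: a distributional derivative that is bounded by the
  L2 norm of the test function is represented by an L2 function.\<close>

lemma wd_from_bound:
  fixes u :: "real^'m \<Rightarrow> real"
  assumes u: "L2 u" and bd: "\<And>\<phi>. test_fun (ball 0 R) \<phi> \<Longrightarrow> \<bar>\<integral>x. pderiv l \<phi> x * u x \<partial>lborel\<bar> \<le> C * n2 \<phi>"
  shows "\<exists>v. wd R l u v"
proof -
  have i: "integrable lborel (\<lambda>x. pderiv l \<phi> x * u x)" if "test_fun (ball 0 R) \<phi>" for \<phi>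
    by (rule L2_mult_integrable[OF test_fun_L2[OF test_fun_pderiv[OF that]] u])
  let ?L = "\<lambda>\<phi>. - (\<integral>x. pderiv l \<phi> x * u x \<partial>lborel)"
  have "\<exists>v. L2 v \<and> (\<forall>\<phi>. test_fun (ball 0 R) \<phi> \<longrightarrow> ?L \<phi> = (\<integral>x. \<phi> x * v x \<partial>lborel))"
  proof (rule riesz_test_functions[of "ball 0 R" ?L C])
    show "?L (\<lambda>x. \<phi> x + \<psi> x) = ?L \<phi> + ?L \<psi>" if "test_fun (ball 0 R) \<phi>" "test_fun (ball 0 R) \<psi>" for \<phi> \<psi>
      using i[OF that(1)] i[OF that(2)] that[THEN test_fun_smooth] by (simp add: pderiv_add distrib_right)
    show "?L (\<lambda>x. c * \<phi> x) = c * ?L \<phi>" if "test_fun (ball 0 R) \<phi>" for \<phi> c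
      using i[OF that] that[THEN test_fun_smooth] by (simp add: pderiv_cmult mult.assoc)
  qed (use bd in auto)
  then show ?thesis unfolding wd_def using u by (auto simp: minus_equation_iff)
qed

section \<open>The Sobolev inequality in dimension at most four\<close>

definition croot :: "ennreal \<Rightarrow> ennreal" where
  "croot a = (if a = top then top else ennreal (root 3 (enn2real a)))"

lemma croot_cube: "(croot a)^3 = a"
proof (cases a)
  case (real r)
  have "root 3 r ^ 3 = r" using real by (intro real_root_pow_pos2) auto
  then show ?thesis using real by (simp add: croot_def ennreal_power real_root_ge_zero)
qed (simp add: croot_def)

lemma croot_ennreal_cube: "x \<ge> 0 \<Longrightarrow> croot (ennreal (x^3)) = ennreal x"
  by (simp add: croot_def real_root_power_cancel)

lemma ennreal_cube_le: "a^3 \<le> b^3 \<Longrightarrow> a \<le> (b::ennreal)"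
proof (cases a; cases b)
  fix x y assume "a^3 \<le> b^3" "a = ennreal x" "b = ennreal y" "0 \<le> x" "0 \<le> y"
  then have "x^3 \<le> y^3" by (simp add: ennreal_power)
  then have "x \<le> y" using \<open>0 \<le> y\<close> power_mono_iff[of x y 3] \<open>0 \<le> x\<close> by simp
  then show "a \<le> b" using \<open>a = ennreal x\<close> \<open>b = ennreal y\<close> by (simp add: ennreal_leI)
qed (auto simp: ennreal_power top_unique power3_eq_cube ennreal_mult[symmetric])

lemma croot_mono: "a \<le> b \<Longrightarrow> croot a \<le> croot b"
  by (rule ennreal_cube_le) (simp add: croot_cube)

lemma croot_measurable [measurable]: "croot \<in> borel_measurable borel"
  unfolding croot_def by measurable

lemma amgm3: fixes p q r :: real assumes "0 \<le> p" "0 \<le> q" "0 \<le> r" shows "3 * (p * q * r) \<le> p^3 + q^3 + r^3"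
proof -
  have "p^3 + q^3 + r^3 - 3 * (p * q * r) = (p + q + r) * ((p - q)\<^sup>2 + (q - r)\<^sup>2 + (r - p)\<^sup>2) / 2"
    by (simp add: power2_eq_square power3_eq_cube algebra_simps)
  moreover have "\<dots> \<ge> 0" using assms by simp
  ultimately show ?thesis by linarith
qed

lemma amgm3_weighted:
  fixes x y z :: real
  assumes "0 \<le> x" "0 \<le> y" "0 \<le> z" "0 < \<alpha>" "0 < \<beta>" "0 < \<gamma>"
  shows "x * y * z \<le> \<alpha> * \<beta> * \<gamma> / 3 / \<alpha>^3 * x^3 + \<alpha> * \<beta> * \<gamma> / 3 / \<beta>^3 * y^3 + \<alpha> * \<beta> * \<gamma> / 3 / \<gamma>^3 * z^3"
proof -
  have "3 * ((x/\<alpha>) * (y/\<beta>) * (z/\<gamma>)) \<le> (x/\<alpha>)^3 + (y/\<beta>)^3 + (z/\<gamma>)^3"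
    by (rule amgm3) (use assms in auto)
  then have "(\<alpha> * \<beta> * \<gamma> / 3) * (3 * ((x/\<alpha>) * (y/\<beta>) * (z/\<gamma>))) \<le> (\<alpha> * \<beta> * \<gamma> / 3) * ((x/\<alpha>)^3 + (y/\<beta>)^3 + (z/\<gamma>)^3)"
    using assms by (intro mult_left_mono) auto
  moreover have "(\<alpha> * \<beta> * \<gamma> / 3) * (3 * ((x/\<alpha>) * (y/\<beta>) * (z/\<gamma>))) = x * y * z"
    using assms by (simp add: field_simps)
  ultimately show ?thesis using assms by (simp add: power_divide distrib_left)
qed

text \<open>Stated in cubes so that no roots of possibly infinite integrals appear. Three factors
  are what remains when one of four slots is constant along the line of integration.\<close>

lemma holder3:
  assumes [measurable]: "f \<in> borel_measurable M" "g \<in> borel_measurable M" "h \<in> borel_measurable M"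
  shows "(\<integral>\<^sup>+x. f x * g x * h x \<partial>M)^3 \<le> (\<integral>\<^sup>+x. (f x)^3 \<partial>M) * (\<integral>\<^sup>+x. (g x)^3 \<partial>M) * (\<integral>\<^sup>+x. (h x)^3 \<partial>M)"
proof -
  define A B C where "A = (\<integral>\<^sup>+x. (f x)^3 \<partial>M)" "B = (\<integral>\<^sup>+x. (g x)^3 \<partial>M)" "C = (\<integral>\<^sup>+x. (h x)^3 \<partial>M)"
  show ?thesis
  proof (cases "A = 0 \<or> B = 0 \<or> C = 0")
    case True
    then have "(AE x in M. (f x)^3 = 0) \<or> (AE x in M. (g x)^3 = 0) \<or> (AE x in M. (h x)^3 = 0)"
      unfolding A_B_C_def by (subst (asm) (1 2 3) nn_integral_0_iff_AE) auto
    then have "AE x in M. f x * g x * h x = 0"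
    proof (elim disjE)
      assume "AE x in M. (f x)^3 = 0" then show ?thesis by eventually_elim simp
    next
      assume "AE x in M. (g x)^3 = 0" then show ?thesis by eventually_elim simp
    next
      assume "AE x in M. (h x)^3 = 0" then show ?thesis by eventually_elim simp
    qed
    then have "(\<integral>\<^sup>+x. f x * g x * h x \<partial>M) = (\<integral>\<^sup>+x. 0 \<partial>M)" by (intro nn_integral_cong_AE)
    then show ?thesis by simp
  next
    case nz: False
    show ?thesis
    proof (cases "A = top \<or> B = top \<or> C = top")
      case True
      then have "A * B * C = top" using nz by (auto simp: ennreal_mult_eq_top_iff)
      then show ?thesis unfolding A_B_C_def[symmetric] by simp
    next
      case False
      then obtain a b c where abc: "A = ennreal a" "B = ennreal b" "C = ennreal c" "a \<ge> 0" "b \<ge> 0" "c \<ge> 0"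
        by (cases A; cases B; cases C) auto
      then have pos: "a > 0" "b > 0" "c > 0" using nz by (auto simp: less_le)
      define \<alpha> \<beta> \<gamma> where "\<alpha> = root 3 a" "\<beta> = root 3 b" "\<gamma> = root 3 c"
      have r: "\<alpha> > 0" "\<beta> > 0" "\<gamma> > 0" "\<alpha>^3 = a" "\<beta>^3 = b" "\<gamma>^3 = c"
        using pos by (auto simp: \<alpha>_\<beta>_\<gamma>_def)
      \<comment> \<open>Pointwise AM-GM for factors normalised to unit L3 norm: each of the three
        terms integrates to \<open>k\<close>, and \<open>3 * k\<close> is the product of the
        norms.\<close>
      define k where "k = \<alpha> * \<beta> * \<gamma> / 3"
      have k: "k > 0" using r by (simp add: k_def)
      have pt: "f x * g x * h x \<le> ennreal (k / a) * (f x)^3 + ennreal (k / b) * (g x)^3 + ennreal (k / c) * (h x)^3" for x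
      proof (cases "f x = top \<or> g x = top \<or> h x = top")
        case True
        then have "ennreal (k / a) * (f x)^3 + ennreal (k / b) * (g x)^3 + ennreal (k / c) * (h x)^3 = top"
          using k pos by (auto simp: ennreal_mult_eq_top_iff ennreal_add_eq_top power3_eq_cube)
        then show ?thesis by (simp only: top_greatest)
      next
        case False
        obtain u where u: "f x = ennreal u" "u \<ge> 0" using False by (cases "f x") auto
        obtain v where v: "g x = ennreal v" "v \<ge> 0" using False by (cases "g x") auto
        obtain w where w: "h x = ennreal w" "w \<ge> 0" using False by (cases "h x") auto
        note uvw = u(1) v(1) w(1) u(2) v(2) w(2)
        have "u * v * w \<le> k / a * u^3 + k / b * v^3 + k / c * w^3"
          using amgm3_weighted[OF uvw(4-6) r(1-3)] r unfolding k_def by simp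
        then show ?thesis using uvw k pos
          by (simp add: ennreal_power ennreal_mult[symmetric] ennreal_plus[symmetric] ennreal_leI del: ennreal_plus)
      qed
      have "(\<integral>\<^sup>+x. f x * g x * h x \<partial>M) \<le> (\<integral>\<^sup>+x. ennreal (k / a) * (f x)^3 + ennreal (k / b) * (g x)^3 + ennreal (k / c) * (h x)^3 \<partial>M)"
        by (rule nn_integral_mono) (rule pt)
      also have "\<dots> = ennreal (k / a) * A + ennreal (k / b) * B + ennreal (k / c) * C"
        unfolding A_B_C_def by (simp add: nn_integral_add nn_integral_cmult)
      also have "\<dots> = ennreal (\<alpha> * \<beta> * \<gamma>)"
        using abc pos k by (simp add: ennreal_mult[symmetric] ennreal_plus[symmetric] del: ennreal_plus) (simp add: k_def)
      finally have "(\<integral>\<^sup>+x. f x * g x * h x \<partial>M)^3 \<le> (ennreal (\<alpha> * \<beta> * \<gamma>))^3" by (simp add: power_mono)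
      also have "\<dots> = A * B * C"
        using abc r by (simp add: ennreal_power power_mult_distrib ennreal_mult)
      finally show ?thesis unfolding A_B_C_def .
    qed
  qed
qed

lemma ennreal_prod_mono: "(\<And>i. i \<in> I \<Longrightarrow> f i \<le> g i) \<Longrightarrow> (\<Prod>i\<in>I. f i) \<le> (\<Prod>i\<in>I. g i :: ennreal)"
  by (induction I rule: infinite_finite_induct) (auto intro: mult_mono)

subsection \<open>Iterated coordinate integrals\<close>

abbreviation PM :: "('m::finite \<Rightarrow> real) measure" where
  "PM \<equiv> PiM UNIV (\<lambda>_. lborel)"

text \<open>The integrated coordinate remains an argument on which the result no longer depends;
  that independence is what the four-slot inequality exploits.\<close>

definition T1 :: "'m::finite \<Rightarrow> (('m \<Rightarrow> real) \<Rightarrow> ennreal) \<Rightarrow> ('m \<Rightarrow> real) \<Rightarrow> ennreal" where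
  "T1 i F z = (\<integral>\<^sup>+t. F (z(i := t)) \<partial>lborel)"

fun Tl :: "'m::finite list \<Rightarrow> (('m \<Rightarrow> real) \<Rightarrow> ennreal) \<Rightarrow> ('m \<Rightarrow> real) \<Rightarrow> ennreal" where
  "Tl [] F = F"
| "Tl (x # xs) F = Tl xs (T1 x F)"

lemma measurable_upd: "(\<lambda>(z, t). z(i := t)) \<in> measurable (PM \<Otimes>\<^sub>M lborel) (PM :: ('m::finite \<Rightarrow> real) measure)"
  using measurable_add_dim[of i UNIV "\<lambda>_. lborel :: real measure"] by simp

lemma T1_measurable:
  assumes "F \<in> borel_measurable PM" shows "T1 i F \<in> borel_measurable PM"
proof -
  have "(\<lambda>p. F ((\<lambda>(z, t). z(i := t)) p)) \<in> borel_measurable (PM \<Otimes>\<^sub>M lborel)"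
    by (rule measurable_compose[OF measurable_upd assms])
  then have "case_prod (\<lambda>z t. F (z(i := t))) \<in> borel_measurable (PM \<Otimes>\<^sub>M lborel)" by (simp add: case_prod_unfold)
  from lborel.borel_measurable_nn_integral[OF this] show ?thesis by (simp add: T1_def[abs_def])
qed

lemma space_PM: "space (PM :: ('m::finite \<Rightarrow> real) measure) = UNIV"
  by (simp add: space_PiM)

lemma upd_measurable: "(\<lambda>t. z(i := t)) \<in> measurable lborel (PM :: ('m::finite \<Rightarrow> real) measure)"
  using measurable_compose[OF measurable_Pair1'[of z PM lborel] measurable_upd[of i]] by (simp add: space_PM)

lemma T1_mono: "(\<And>z. F z \<le> G z) \<Longrightarrow> T1 i F z \<le> T1 i G z"
  by (simp add: T1_def nn_integral_mono)

lemma Tl_mono: "(\<And>z. F z \<le> G z) \<Longrightarrow> Tl xs F z \<le> Tl xs G z"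
proof (induction xs arbitrary: F G)
  case (Cons x xs)
  show ?case unfolding Tl.simps by (intro Cons.IH T1_mono Cons.prems)
qed simp

text \<open>Tonelli's theorem, with \<open>z\<close> supplying the coordinates that are not
  integrated.\<close>

lemma Tl_eq_PiM:
  fixes F :: "('m::finite \<Rightarrow> real) \<Rightarrow> ennreal"
  assumes "F \<in> borel_measurable PM" "distinct xs"
  shows "Tl xs F z = (\<integral>\<^sup>+y. F (\<lambda>j. if j \<in> set xs then y j else z j) \<partial>PiM (set xs) (\<lambda>_. lborel))"
  using assms
proof (induction xs arbitrary: F)
  case Nil
  then show ?case by (simp add: nn_integral_count_space_finite PiM_empty)
next
  case (Cons x xs)
  interpret product_sigma_finite "\<lambda>_::'m. lborel :: real measure" by unfold_locales
  let ?f = "\<lambda>y. F (\<lambda>j. if j \<in> insert x (set xs) then y j else z j)"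
  have "(\<lambda>y j. if j \<in> insert x (set xs) then y j else z j) \<in> measurable (PiM (insert x (set xs)) (\<lambda>_. lborel)) PM"
  proof (rule measurable_PiM_single')
    show "(\<lambda>y. if j \<in> insert x (set xs) then y j else z j) \<in> measurable (PiM (insert x (set xs)) (\<lambda>_. lborel)) lborel" for j
      by (cases "j \<in> insert x (set xs)") auto
  qed auto
  from measurable_compose[OF this Cons.prems(1)]
  have m: "?f \<in> borel_measurable (PiM (insert x (set xs)) (\<lambda>_. lborel))" .
  have "(\<integral>\<^sup>+y. ?f y \<partial>PiM (insert x (set xs)) (\<lambda>_. lborel)) = (\<integral>\<^sup>+y. (\<integral>\<^sup>+t. ?f (y(x := t)) \<partial>lborel) \<partial>PiM (set xs) (\<lambda>_. lborel))"
    by (rule product_nn_integral_insert[OF _ _ m]) (use Cons.prems in auto)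
  also have "\<dots> = (\<integral>\<^sup>+y. T1 x F (\<lambda>j. if j \<in> set xs then y j else z j) \<partial>PiM (set xs) (\<lambda>_. lborel))"
  proof (rule nn_integral_cong)
    fix y
    have "(\<lambda>j. if j \<in> insert x (set xs) then (y(x := t)) j else z j) = (\<lambda>j. if j \<in> set xs then y j else z j)(x := t)" for t
      using Cons.prems by auto
    then show "(\<integral>\<^sup>+t. ?f (y(x := t)) \<partial>lborel) = T1 x F (\<lambda>j. if j \<in> set xs then y j else z j)"
      by (simp only: T1_def)
  qed
  also have "\<dots> = Tl (x # xs) F z"
    using Cons.IH[OF T1_measurable[OF Cons.prems(1)]] Cons.prems by simp
  finally show ?case by simp
qed

lemma vec_lambda_measurable: "vec_lambda \<in> measurable PM (borel :: (real^'m::finite) measure)"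
proof -
  have "(\<lambda>z. vec_lambda z \<bullet> b) \<in> borel_measurable PM" if b: "b \<in> Basis" for b :: "real^'m"
  proof -
    obtain i where "b = axis i 1" using b by (auto simp: Basis_vec_def)
    then have "(\<lambda>z. vec_lambda z \<bullet> b) = (\<lambda>z. z i)" by (auto simp: inner_axis)
    then show ?thesis by simp
  qed
  then show ?thesis by (subst borel_measurable_euclidean_space) auto
qed

text \<open>Both measures give a box the product of its side lengths, and this determines Lebesgue
  measure.\<close>

lemma lborel_vec: "(lborel :: (real^'m::finite) measure) = distr PM borel vec_lambda"
proof (rule lborel_eqI)
  interpret product_sigma_finite "\<lambda>_::'m. lborel :: real measure" by unfold_locales
  fix l u :: "real^'m" assume le: "\<And>b. b \<in> Basis \<Longrightarrow> l \<bullet> b \<le> u \<bullet> b"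
  have le': "l $ i \<le> u $ i" for i using le[of "axis i 1"] by (simp add: inner_axis axis_in_Basis_iff)
  have "vec_lambda -` box l u \<inter> space PM = PiE UNIV (\<lambda>i. {l $ i <..< u $ i})"
    by (auto simp: space_PM mem_box_cart PiE_iff)
  then have "emeasure (distr PM borel vec_lambda) (box l u) = emeasure PM (PiE UNIV (\<lambda>i::'m. {l $ i <..< u $ i}))"
    by (subst emeasure_distr[OF vec_lambda_measurable]) auto
  also have "\<dots> = (\<Prod>i\<in>UNIV. emeasure lborel {l $ i <..< u $ i})" by (subst emeasure_PiM) auto
  also have "\<dots> = (\<Prod>i\<in>UNIV. ennreal (u $ i - l $ i))" using le' by simp
  also have "\<dots> = ennreal (\<Prod>i\<in>UNIV. u $ i - l $ i)" using le' by (intro prod_ennreal) simp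
  also have "(\<Prod>i\<in>UNIV. u $ i - l $ i) = (\<Prod>b\<in>Basis. (u - l) \<bullet> b)"
  proof -
    have B: "(Basis :: (real^'m) set) = (\<lambda>i. axis i 1) ` UNIV" by (auto simp: Basis_vec_def)
    have "inj (\<lambda>i::'m. axis i (1::real))" by (auto simp: inj_on_def axis_eq_axis)
    then show ?thesis unfolding B by (subst prod.reindex) (auto simp: inner_axis)
  qed
  finally show "emeasure (distr PM borel vec_lambda) (box l u) = ennreal (\<Prod>b\<in>Basis. (u - l) \<bullet> b)" .
qed simp

lemma Tl_lborel:
  fixes f :: "real^'m::finite \<Rightarrow> ennreal"
  assumes "f \<in> borel_measurable borel" "distinct xs" "set xs = UNIV"
  shows "Tl xs (\<lambda>z. f (vec_lambda z)) z = (\<integral>\<^sup>+x. f x \<partial>lborel)"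
proof -
  have m: "(\<lambda>z. f (vec_lambda z)) \<in> borel_measurable PM" by (rule measurable_compose[OF vec_lambda_measurable assms(1)])
  have "(\<integral>\<^sup>+x. f x \<partial>lborel) = (\<integral>\<^sup>+z. f (vec_lambda z) \<partial>PM)"
    unfolding lborel_vec by (rule nn_integral_distr[OF vec_lambda_measurable]) (use assms in simp)
  then show ?thesis using Tl_eq_PiM[OF m assms(2), of z] assms(3) by simp
qed

text \<open>Loomis--Whitney with four slots: slot \<open>e i\<close> carries a function independent of
  coordinate \<open>i\<close>; slots outside the range of \<open>e\<close> carry functions of all coordinates.\<close>
lemma loomis_whitney_step:
  fixes F :: "nat \<Rightarrow> ('m::finite \<Rightarrow> real) \<Rightarrow> ennreal"
  assumes "s0 < 4" and m: "\<And>s. F s \<in> borel_measurable PM"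
    and ind: "\<And>t. F s0 (z(x := t)) = F s0 z"
  shows "T1 x (\<lambda>z. \<Prod>s<4. croot (F s z)) z \<le> (\<Prod>s<4. croot (if s = s0 then F s z else T1 x (F s) z))"
proof -
  have "card ({..<4} - {s0}) = 3" using assms(1) by simp
  then obtain a b c where abc: "{..<4} - {s0} = {a, b, c}" "a \<noteq> b" "a \<noteq> c" "b \<noteq> c"
    using card_3_iff[of "{..<4} - {s0}"] by auto
  then have ne: "a \<noteq> s0" "b \<noteq> s0" "c \<noteq> s0" by auto
  have pr: "(\<Prod>s<4. f s) = f s0 * (f a * f b * f c)" for f :: "nat \<Rightarrow> ennreal"
    using prod.remove[of "{..<4}" s0 f] abc assms(1) by (simp add: mult_ac)
  have m': "(\<lambda>t. croot (F s (z(x := t)))) \<in> borel_measurable lborel" for s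
    using measurable_compose[OF measurable_compose[OF upd_measurable m] croot_measurable] .
  \<comment> \<open>The slot that is constant in coordinate x leaves the integral; exactly three
    factors remain for \<open>holder3\<close>.\<close>
  have "T1 x (\<lambda>z. \<Prod>s<4. croot (F s z)) z
     = croot (F s0 z) * (\<integral>\<^sup>+t. croot (F a (z(x := t))) * croot (F b (z(x := t))) * croot (F c (z(x := t))) \<partial>lborel)"
    unfolding T1_def pr ind using m' by (subst nn_integral_cmult) auto
  also have "\<dots> \<le> croot (F s0 z) * (croot (T1 x (F a) z) * croot (T1 x (F b) z) * croot (T1 x (F c) z))"
  proof (rule mult_left_mono[OF ennreal_cube_le])
    show "(\<integral>\<^sup>+t. croot (F a (z(x := t))) * croot (F b (z(x := t))) * croot (F c (z(x := t))) \<partial>lborel)^3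
       \<le> (croot (T1 x (F a) z) * croot (T1 x (F b) z) * croot (T1 x (F c) z))^3"
      using holder3[OF m'[of a] m'[of b] m'[of c]] unfolding power_mult_distrib croot_cube T1_def .
  qed simp
  also have "\<dots> = (\<Prod>s<4. croot (if s = s0 then F s z else T1 x (F s) z))"
    unfolding pr using ne by simp
  finally show ?thesis .
qed

text \<open>Integrating a coordinate passes the integral to all slots but its own. At the end slot
  \<open>e i\<close> has been integrated over every listed coordinate except i, and a spare slot
  over all of them. Injectivity of \<open>e\<close> preserves the independence of the slots not yet
  treated.\<close>

lemma loomis_whitney:
  fixes F :: "nat \<Rightarrow> ('m::finite \<Rightarrow> real) \<Rightarrow> ennreal" and e :: "'m \<Rightarrow> nat"
  assumes e: "inj e" "\<And>i. e i < 4" and "distinct xs" and "\<And>s. F s \<in> borel_measurable PM"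
    and "\<And>i z t. i \<in> set xs \<Longrightarrow> F (e i) (z(i := t)) = F (e i) z"
  shows "Tl xs (\<lambda>z. \<Prod>s<4. croot (F s z)) z \<le> (\<Prod>s<4. croot (Tl (filter (\<lambda>x. e x \<noteq> s) xs) (F s) z))"
  using assms(3-)
proof (induction xs arbitrary: F)
  case (Cons x xs)
  define F' where "F' s = (if s = e x then F s else T1 x (F s))" for s
  have "Tl (x # xs) (\<lambda>z. \<Prod>s<4. croot (F s z)) z \<le> Tl xs (\<lambda>z. \<Prod>s<4. croot (F' s z)) z"
    unfolding Tl.simps
  proof (rule Tl_mono)
    fix z
    have "T1 x (\<lambda>z. \<Prod>s<4. croot (F s z)) z \<le> (\<Prod>s<4. croot (if s = e x then F s z else T1 x (F s) z))"
      by (rule loomis_whitney_step[OF e(2) Cons.prems(2)]) (rule Cons.prems(3), simp)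
    then show "T1 x (\<lambda>z. \<Prod>s<4. croot (F s z)) z \<le> (\<Prod>s<4. croot (F' s z))"
      by (simp add: F'_def if_distrib[of "\<lambda>f. f z"])
  qed
  also have "\<dots> \<le> (\<Prod>s<4. croot (Tl (filter (\<lambda>x. e x \<noteq> s) xs) (F' s) z))"
  proof (rule Cons.IH)
    show "distinct xs" using Cons.prems by simp
    show "F' s \<in> borel_measurable PM" for s using Cons.prems(2) T1_measurable by (auto simp: F'_def)
    show "F' (e i) (z(i := t)) = F' (e i) z" if "i \<in> set xs" for i z t
    proof -
      have "i \<noteq> x" using that Cons.prems(1) by auto
      then have "e i \<noteq> e x" using e(1) by (auto simp: inj_on_def)
      moreover have "F (e i) (z(i := t, x := s)) = F (e i) (z(x := s))" for s
        unfolding fun_upd_twist[OF \<open>i \<noteq> x\<close>] by (rule Cons.prems(3)) (simp add: that)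
      then have "T1 x (F (e i)) (z(i := t)) = T1 x (F (e i)) z" by (simp only: T1_def)
      ultimately show ?thesis by (simp add: F'_def)
    qed
  qed
  also have "\<dots> = (\<Prod>s<4. croot (Tl (filter (\<lambda>x. e x \<noteq> s) (x # xs)) (F s) z))"
    by (rule prod.cong) (auto simp: F'_def)
  finally show ?case .
qed simp

section \<open>The Gagliardo--Nirenberg argument for test functions\<close>

lemma line_bound:
  fixes w :: "real^'m \<Rightarrow> real"
  assumes t: "test_fun U w"
  shows "ennreal \<bar>w (vec_lambda z)\<bar> \<le> T1 i (\<lambda>z. ennreal \<bar>pderiv i w (vec_lambda z)\<bar>) z"
proof -
  obtain K where K: "compact K" "\<And>x. x \<notin> K \<Longrightarrow> w x = 0"
    using t by (rule test_fun_supp) (erule that, blast)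
  obtain r where r: "r > 0" "K \<subseteq> ball 0 r" using K(1) compact_imp_bounded bounded_subset_ballD by metis
  have upd: "vec_lambda (z(i := s)) = vec_lambda (z(i := 0)) + s *\<^sub>R axis i 1" for s
    by (auto simp: vec_eq_iff axis_def)
  let ?g = "\<lambda>s. w (vec_lambda (z(i := 0)) + s *\<^sub>R axis i 1)"
  let ?g' = "\<lambda>s. pderiv i w (vec_lambda (z(i := 0)) + s *\<^sub>R axis i 1)"
  \<comment> \<open>At or left of both \<open>z i\<close> and the support, so the integral runs in
    the positive direction and starts where \<open>w\<close> vanishes.\<close>
  define a where "a = min (z i) (- r)"
  have der: "(?g has_vector_derivative ?g' s) (at s within S)" for s S
    using smooth_line_deriv[OF test_fun_smooth[OF t], of "vec_lambda (z(i := 0))" i s]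
    unfolding has_real_derivative_iff_has_vector_derivative by (rule has_vector_derivative_at_within)
  have cont: "continuous_on S ?g'" for S
    by (rule continuous_on_compose2[OF smooth_continuous[OF smooth_pderiv[OF test_fun_smooth[OF t]], of UNIV]])
       (auto intro!: continuous_intros)
  have "integral\<^sup>L lborel (\<lambda>x. indicator {a .. z i} x *\<^sub>R ?g' x) = ?g (z i) - ?g a"
    by (rule integral_FTC_atLeastAtMost[OF _ der cont]) (simp add: a_def)
  moreover have "?g a = 0"
  proof -
    have "\<bar>(vec_lambda (z(i := 0)) + a *\<^sub>R axis i 1 :: real^'m) $ i\<bar> \<ge> r"
      using r by (auto simp: a_def axis_def)
    then have "norm (vec_lambda (z(i := 0)) + a *\<^sub>R axis i 1 :: real^'m) \<ge> r"
      using component_le_norm_cart order_trans by blast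
    then show ?thesis using r(2) by (intro K(2)) auto
  qed
  moreover have "?g (z i) = w (vec_lambda z)" using upd[of "z i"] by simp
  ultimately have "\<bar>w (vec_lambda z)\<bar> = \<bar>integral\<^sup>L lborel (\<lambda>x. indicator {a .. z i} x *\<^sub>R ?g' x)\<bar>" by simp
  then have "ennreal \<bar>w (vec_lambda z)\<bar> \<le> (\<integral>\<^sup>+x. ennreal (norm (indicator {a .. z i} x *\<^sub>R ?g' x)) \<partial>lborel)"
    using integral_norm_bound_ennreal[of lborel "\<lambda>x. indicator {a .. z i} x *\<^sub>R ?g' x"]
      borel_integrable_atLeastAtMost'[OF cont] by (simp add: set_integrable_def)
  also have "\<dots> \<le> (\<integral>\<^sup>+s. ennreal \<bar>?g' s\<bar> \<partial>lborel)"
    by (rule nn_integral_mono) (auto simp: indicator_def)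
  also have "\<dots> = T1 i (\<lambda>z. ennreal \<bar>pderiv i w (vec_lambda z)\<bar>) z"
    by (simp only: T1_def upd[symmetric])
  finally show ?thesis .
qed

lemma nn_integral_product_le:
  assumes "L2 f" "L2 g" shows "(\<integral>\<^sup>+x. ennreal \<bar>f x * g x\<bar> \<partial>lborel) \<le> ennreal (n2 f * n2 g)"
  using L2_mult_integrable[OF assms] L2_CS_abs[OF assms]
  by (subst nn_integral_eq_integral) (auto intro: ennreal_leI)

definition En :: "('m::finite \<Rightarrow> real^'m \<Rightarrow> real) \<Rightarrow> real" where
  "En d = (\<Sum>l\<in>UNIV. (n2 (d l))\<^sup>2)"

lemma En_nonneg: "En d \<ge> 0" by (simp add: En_def sum_nonneg)

lemma n2_le_En: "n2 (d l) \<le> sqrt (En d)"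
proof -
  have "(n2 (d l))\<^sup>2 \<le> En d" unfolding En_def by (rule member_le_sum) auto
  then show ?thesis by (simp add: real_le_rsqrt)
qed

text \<open>Integrate the i-th derivative of \<open>x $ i * \<phi>^2\<close>; on the unit ball the
  factor \<open>x $ i\<close> is at most 1 in absolute value.\<close>

lemma poincare:
  fixes \<phi> :: "real^'m \<Rightarrow> real"
  assumes t: "test_fun (ball 0 1) \<phi>"
  shows "n2 \<phi> \<le> 2 * n2 (pderiv i \<phi>)"
proof -
  have sm: "smooth \<phi>" by (rule test_fun_smooth[OF t])
  have L: "L2 \<phi>" "L2 (pderiv i \<phi>)" using t test_fun_L2 test_fun_pderiv by blast+
  have tt: "test_fun (ball 0 1) (\<lambda>x. (x $ i * \<phi> x) * \<phi> x)"
    by (intro test_fun_mult t smooth_mult smooth_component sm)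
  have p: "pderiv i (\<lambda>x. (x $ i * \<phi> x) * \<phi> x) x = (\<phi> x)\<^sup>2 + 2 * ((x $ i * \<phi> x) * pderiv i \<phi> x)" for x
    by (simp add: pderiv_mult smooth_mult smooth_component sm pderiv_component power2_eq_square algebra_simps)
  have Lx: "L2 (\<lambda>x. x $ i * \<phi> x)" by (rule test_fun_L2[OF test_fun_mult[OF t smooth_component]])
  have "0 = (\<integral>x. (\<phi> x)\<^sup>2 + 2 * ((x $ i * \<phi> x) * pderiv i \<phi> x) \<partial>lborel)"
    using integral_pderiv_zero[OF tt, of i] by (simp add: p)
  also have "\<dots> = (n2 \<phi>)\<^sup>2 + 2 * (\<integral>x. (x $ i * \<phi> x) * pderiv i \<phi> x \<partial>lborel)"
    using L2_sq[OF L(1)] L2_mult_integrable[OF Lx L(2)] by (simp add: n2_sq)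
  finally have "(n2 \<phi>)\<^sup>2 \<le> 2 * \<bar>\<integral>x. (x $ i * \<phi> x) * pderiv i \<phi> x \<partial>lborel\<bar>" by linarith
  also have "\<dots> \<le> 2 * (n2 (\<lambda>x. x $ i * \<phi> x) * n2 (pderiv i \<phi>))" using L2_CS[OF Lx L(2)] by simp
  also have "\<dots> \<le> 2 * (n2 \<phi> * n2 (pderiv i \<phi>))"
  proof -
    have "n2 (\<lambda>x. x $ i * \<phi> x) \<le> n2 \<phi>"
    proof (rule n2_mono[OF L(1) L2_measurable[OF Lx]])
      fix x
      show "\<bar>x $ i * \<phi> x\<bar> \<le> \<bar>\<phi> x\<bar>"
      proof (cases "x \<in> ball 0 1")
        case True
        then have "\<bar>x $ i\<bar> \<le> 1" using component_le_norm_cart[of x i] by simp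
        then show ?thesis by (simp add: abs_mult mult_left_le_one_le)
      qed (simp add: test_fun_outside(1)[OF t])
    qed
    then show ?thesis by (intro mult_left_mono mult_right_mono) auto
  qed
  finally have "n2 \<phi> * n2 \<phi> \<le> n2 \<phi> * (2 * n2 (pderiv i \<phi>))" by (simp add: power2_eq_square)
  then show ?thesis
  proof (cases "n2 \<phi> = 0")
    case False
    then show ?thesis using \<open>n2 \<phi> * n2 \<phi> \<le> _\<close> by (simp add: less_le)
  qed simp
qed

text \<open>The four-slot inequality is applied to \<open>w = \<phi>^3\<close>, with
  \<open>\<bar>w\<bar>\<close> bounded by the line integrals of its derivatives. With N and K as
  defined below every slot is at most \<open>3 * (N * K)\<close>, so
  \<open>N^6 \<le> (3 * (N * K))^4\<close>, whence the constant 9. Below dimension four the spare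
  slots hold \<open>\<bar>w\<bar>\<close> itself and are bounded through
  \<open>poincare\<close>.\<close>

lemma sobolev_test:
  fixes \<phi> :: "real^'m \<Rightarrow> real"
  assumes dim: "CARD('m::finite) \<le> 4" and t: "test_fun (ball 0 1) \<phi>"
  shows "n2 (\<lambda>x. (\<phi> x)\<^sup>2) \<le> 9 * En (\<lambda>l. pderiv l \<phi>)"
proof -
  have "\<exists>e. e ` (UNIV::'m set) \<subseteq> {..<4::nat} \<and> inj e"
    by (rule card_le_inj) (use dim in auto)
  then obtain e :: "'m \<Rightarrow> nat" where e: "inj e" "\<And>i. e i < 4" by (auto simp: subset_iff)
  obtain xs where xs: "set xs = (UNIV::'m set)" "distinct xs" using finite_distinct_list[of "UNIV::'m set"] by auto
  have sm: "smooth \<phi>" by (rule test_fun_smooth[OF t])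
  have t2: "test_fun (ball 0 1) (\<lambda>x. \<phi> x * \<phi> x)" by (rule test_fun_mult[OF t sm])
  define w where "w x = \<phi> x * (\<phi> x * \<phi> x)" for x
  have tw: "test_fun (ball 0 1) w" unfolding w_def by (rule test_fun_mult[OF t2 sm])
  have pw: "pderiv i w x = 3 * ((\<phi> x)\<^sup>2 * pderiv i \<phi> x)" for i x
    unfolding w_def by (simp add: pderiv_mult sm smooth_mult power2_eq_square algebra_simps)
  note [measurable] = smooth_measurable[OF sm] smooth_measurable[OF smooth_pderiv[OF sm]] smooth_measurable[OF test_fun_smooth[OF tw]]
    smooth_measurable[OF smooth_pderiv[OF test_fun_smooth[OF tw]]]
  have L: "L2 \<phi>" "L2 (\<lambda>x. (\<phi> x)\<^sup>2)" "\<And>i. L2 (pderiv i \<phi>)"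
    using test_fun_L2[OF t] test_fun_L2[OF t2] test_fun_L2[OF test_fun_pderiv[OF t]] by (auto simp: power2_eq_square)
  define N K where "N = n2 (\<lambda>x. (\<phi> x)\<^sup>2)" and "K = sqrt (En (\<lambda>l. pderiv l \<phi>))"
  have NK: "N \<ge> 0" "K \<ge> 0" by (auto simp: N_def K_def En_nonneg)
  have pK: "n2 (pderiv i \<phi>) \<le> K" for i unfolding K_def by (rule n2_le_En)
  define G where "G i = T1 i (\<lambda>z. ennreal \<bar>pderiv i w (vec_lambda z)\<bar>)" for i
  define F where "F s = (if s \<in> range e then G (inv e s) else (\<lambda>z. ennreal \<bar>w (vec_lambda z)\<bar>))" for s
  have Fe: "F (e i) = G i" for i by (simp add: F_def inv_f_f[OF e(1)])
  have mG: "G i \<in> borel_measurable PM" for i unfolding G_def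
    by (rule T1_measurable) (rule measurable_compose[OF vec_lambda_measurable]; measurable)
  have mF: "F s \<in> borel_measurable PM" for s unfolding F_def
    using mG by (auto intro: measurable_compose[OF vec_lambda_measurable])
  have ge: "ennreal \<bar>w (vec_lambda z)\<bar> \<le> F s z" for s z
    unfolding F_def G_def using line_bound[OF tw] by auto
  have phi4: "ennreal ((\<phi> x)^4) = (\<Prod>s<4::nat. croot (ennreal \<bar>w x\<bar>))" for x
  proof -
    have "\<bar>w x\<bar> = \<bar>\<phi> x\<bar>^3" by (simp add: w_def abs_mult power3_eq_cube mult.assoc)
    then have "croot (ennreal \<bar>w x\<bar>) = ennreal \<bar>\<phi> x\<bar>" by (simp add: croot_ennreal_cube)
    then show ?thesis by (simp add: ennreal_power)
  qed
  have "(\<integral>\<^sup>+x. ennreal ((\<phi> x)^4) \<partial>lborel) = Tl xs (\<lambda>z. ennreal ((\<phi> (vec_lambda z))^4)) (\<lambda>_. 0)"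
    by (rule Tl_lborel[OF _ xs(2,1), symmetric]) measurable
  also have "\<dots> \<le> Tl xs (\<lambda>z. \<Prod>s<4. croot (F s z)) (\<lambda>_. 0)"
  proof (rule Tl_mono)
    fix z :: "'m \<Rightarrow> real"
    show "ennreal ((\<phi> (vec_lambda z))^4) \<le> (\<Prod>s<4. croot (F s z))"
      unfolding phi4 by (intro ennreal_prod_mono croot_mono ge)
  qed
  also have "\<dots> \<le> (\<Prod>s<4. croot (Tl (filter (\<lambda>x. e x \<noteq> s) xs) (F s) (\<lambda>_. 0)))"
  proof (rule loomis_whitney[OF e xs(2) mF])
    show "F (e i) (z(i := t)) = F (e i) z" for i z t unfolding Fe G_def T1_def by simp
  qed
  finally have main: "(\<integral>\<^sup>+x. ennreal ((\<phi> x)^4) \<partial>lborel) \<le> (\<Prod>s<4. croot (Tl (filter (\<lambda>x. e x \<noteq> s) xs) (F s) (\<lambda>_. 0)))" .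
  have slot: "Tl (filter (\<lambda>x. e x \<noteq> s) xs) (F s) (\<lambda>_. 0) \<le> ennreal (3 * (N * K))" for s
  proof (cases "s \<in> range e")
    case True
    then obtain i where i: "s = e i" by auto
    have fl: "filter (\<lambda>x. e x \<noteq> s) xs = filter (\<lambda>x. x \<noteq> i) xs" using e(1) by (auto simp: i inj_eq)
    have "Tl (filter (\<lambda>x. x \<noteq> i) xs) (G i) (\<lambda>_. 0) = Tl (i # filter (\<lambda>x. x \<noteq> i) xs) (\<lambda>z. ennreal \<bar>pderiv i w (vec_lambda z)\<bar>) (\<lambda>_. 0)"
      by (simp add: G_def)
    also have "\<dots> = (\<integral>\<^sup>+x. ennreal \<bar>pderiv i w x\<bar> \<partial>lborel)"
      by (rule Tl_lborel) (use xs in auto)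
    also have "\<dots> = (\<integral>\<^sup>+x. ennreal \<bar>(\<phi> x)\<^sup>2 * (3 * pderiv i \<phi> x)\<bar> \<partial>lborel)" by (simp add: pw mult_ac)
    also have "\<dots> \<le> ennreal (n2 (\<lambda>x. (\<phi> x)\<^sup>2) * n2 (\<lambda>x. 3 * pderiv i \<phi> x))"
      by (rule nn_integral_product_le[OF L(2) L2_cmult[OF L(3)]])
    also have "\<dots> \<le> ennreal (3 * (N * K))"
      using mult_left_mono[OF pK[of i] NK(1)] by (intro ennreal_leI) (simp add: n2_cmult N_def mult.commute)
    finally show ?thesis unfolding fl unfolding i Fe .
  next
    case False
    then have "filter (\<lambda>x. e x \<noteq> s) xs = xs" by (auto simp: filter_id_conv)
    then have "Tl (filter (\<lambda>x. e x \<noteq> s) xs) (F s) (\<lambda>_. 0) = (\<integral>\<^sup>+x. ennreal \<bar>w x\<bar> \<partial>lborel)"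
      using False by (simp only: F_def if_False) (rule Tl_lborel[OF _ xs(2,1)], measurable)
    also have "\<dots> = (\<integral>\<^sup>+x. ennreal \<bar>(\<phi> x)\<^sup>2 * \<phi> x\<bar> \<partial>lborel)" by (simp add: w_def power2_eq_square mult_ac)
    also have "\<dots> \<le> ennreal (N * n2 \<phi>)" unfolding N_def by (rule nn_integral_product_le[OF L(2,1)])
    also have "\<dots> \<le> ennreal (3 * (N * K))"
    proof (rule ennreal_leI)
      \<comment> \<open>\<open>undefined\<close> stands for an arbitrary coordinate; the index type
        is inhabited.\<close>
      have "n2 \<phi> \<le> 2 * K" using poincare[OF t, of undefined] pK[of undefined] by linarith
      then have "N * n2 \<phi> \<le> N * (3 * K)" using NK by (intro mult_left_mono) auto
      then show "N * n2 \<phi> \<le> 3 * (N * K)" by simp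
    qed
    finally show ?thesis .
  qed
  have N2: "(\<integral>\<^sup>+x. ennreal ((\<phi> x)^4) \<partial>lborel) = ennreal (N\<^sup>2)"
  proof -
    have "integrable lborel (\<lambda>x. (\<phi> x)^4)" using L2_sq[OF L(2)] by (simp add: power_mult[symmetric])
    then show ?thesis by (subst nn_integral_eq_integral) (auto simp: N_def n2_sq power_mult[symmetric])
  qed
  have "ennreal (N\<^sup>2) \<le> (\<Prod>s<4::nat. croot (ennreal (3 * (N * K))))"
    using main unfolding N2 by (rule order_trans) (intro ennreal_prod_mono croot_mono slot)
  then have "ennreal (N\<^sup>2) \<le> (croot (ennreal (3 * (N * K))))^4" by simp
  then have "(ennreal (N\<^sup>2))^3 \<le> ((croot (ennreal (3 * (N * K))))^4)^3" by (rule power_mono) simp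
  also have "\<dots> = ((croot (ennreal (3 * (N * K))))^3)^4" by (simp add: power_mult[symmetric])
  also have "\<dots> = ennreal ((3 * (N * K))^4)" using NK by (simp add: croot_cube ennreal_power)
  finally have "(N\<^sup>2)^3 \<le> (3 * (N * K))^4" using NK by (simp add: ennreal_power)
  then have ineq: "N^4 * N\<^sup>2 \<le> N^4 * (9 * K\<^sup>2)\<^sup>2" by (simp add: power_mult_distrib power_mult[symmetric] power_add[symmetric])
  have "N \<le> 9 * K\<^sup>2"
  proof (cases "N = 0")
    case False
    then have "N^4 > 0" using NK by simp
    then have "N\<^sup>2 \<le> (9 * K\<^sup>2)\<^sup>2" using ineq mult_le_cancel_left_pos by blast
    then show ?thesis by (rule power2_le_imp_le) simp
  qed simp
  then show ?thesis by (simp add: N_def K_def En_nonneg)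
qed

section \<open>From test functions to \<open>W0\<close>, and the critical estimate\<close>

lemma n2_tendsto:
  assumes "\<And>n. L2 (f n)" "L2 g" "(\<lambda>n. n2 (\<lambda>x. f n x - g x)) \<longlonglongrightarrow> 0"
  shows "(\<lambda>n. n2 (f n)) \<longlonglongrightarrow> n2 g"
proof -
  have "(\<lambda>n. n2 (f n) - n2 g) \<longlonglongrightarrow> 0"
  proof (rule Lim_null_comparison[OF _ assms(3)], intro always_eventually allI)
    fix n
    have "n2 (\<lambda>x. (f n x - g x) + g x) \<le> n2 (\<lambda>x. f n x - g x) + n2 g" by (rule n2_add[OF L2_diff[OF assms(1,2)] assms(2)])
    moreover have "n2 (\<lambda>x. (g x - f n x) + f n x) \<le> n2 (\<lambda>x. g x - f n x) + n2 (f n)" by (rule n2_add[OF L2_diff[OF assms(2,1)] assms(1)])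
    moreover have "n2 (\<lambda>x. g x - f n x) = n2 (\<lambda>x. f n x - g x)" by (rule n2_diff_commute)
    ultimately show "norm (n2 (f n) - n2 g) \<le> n2 (\<lambda>x. f n x - g x)" by simp
  qed
  then show ?thesis by (rule LIM_zero_cancel)
qed

lemma L2_AE_subseq:
  fixes f :: "nat \<Rightarrow> real^'m \<Rightarrow> real"
  assumes "\<And>n. L2 (f n)" "L2 g" "(\<lambda>n. n2 (\<lambda>x. f n x - g x)) \<longlonglongrightarrow> 0"
  shows "\<exists>r. strict_mono r \<and> (AE x in lborel. (\<lambda>n. f (r n) x) \<longlonglongrightarrow> g x)"
proof -
  have "(\<lambda>n. (n2 (\<lambda>x. f n x - g x))\<^sup>2) \<longlonglongrightarrow> 0\<^sup>2" by (rule tendsto_power[OF assms(3)])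
  then have "(\<lambda>n. \<integral>x. norm ((f n x - g x)\<^sup>2) \<partial>lborel) \<longlonglongrightarrow> 0" by (simp add: n2_sq)
  from tendsto_L1_AE_subseq[OF L2_sq[OF L2_diff[OF assms(1,2)]] this]
  obtain r where r: "strict_mono r" "AE x in lborel. (\<lambda>n. (f (r n) x - g x)\<^sup>2) \<longlonglongrightarrow> 0" by blast
  have "AE x in lborel. (\<lambda>n. f (r n) x) \<longlonglongrightarrow> g x"
    using r(2)
  proof eventually_elim
    case (elim x)
    have "(\<lambda>n. sqrt ((f (r n) x - g x)\<^sup>2)) \<longlonglongrightarrow> sqrt 0" by (rule tendsto_real_sqrt[OF elim])
    then have "(\<lambda>n. \<bar>f (r n) x - g x\<bar>) \<longlonglongrightarrow> 0" by simp
    then have "(\<lambda>n. f (r n) x - g x) \<longlonglongrightarrow> 0" by (rule tendsto_rabs_zero_cancel)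
    then show ?case by (rule LIM_zero_cancel)
  qed
  then show ?thesis using r(1) by blast
qed

text \<open>Fatou's lemma along an approximating subsequence that converges almost everywhere; the
  bound is stable because the energies converge.\<close>

lemma sobolev_W0:
  fixes u :: "real^'m \<Rightarrow> real"
  assumes dim: "CARD('m::finite) \<le> 4" and W: "W0 r u d" "r < 1"
  shows "L2 (\<lambda>x. (u x)\<^sup>2)" and "n2 (\<lambda>x. (u x)\<^sup>2) \<le> 9 * En d"
proof -
  note [measurable] = L2_measurable[OF W0_L2(1)[OF W(1)]]
  obtain \<phi> where \<phi>: "\<And>n. test_fun (ball 0 1) (\<phi> n)" "(\<lambda>n. n2 (\<lambda>x. \<phi> n x - u x)) \<longlonglongrightarrow> 0"
      "\<And>l. (\<lambda>n. n2 (\<lambda>x. pderiv l (\<phi> n) x - d l x)) \<longlonglongrightarrow> 0"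
    using W0_approx[OF W] by blast
  have L: "L2 (\<phi> n)" "L2 (pderiv l (\<phi> n))" for n l using \<phi>(1) test_fun_L2 test_fun_pderiv by blast+
  note [measurable] = L2_measurable[OF L(1)]
  obtain r where r: "strict_mono r" "AE x in lborel. (\<lambda>n. \<phi> (r n) x) \<longlonglongrightarrow> u x"
    using L2_AE_subseq[OF L(1) W0_L2(1)[OF W(1)] \<phi>(2)] by blast
  have En: "(\<lambda>n. En (\<lambda>l. pderiv l (\<phi> n))) \<longlonglongrightarrow> En d" unfolding En_def
    by (intro tendsto_sum tendsto_power n2_tendsto L W0_L2(2)[OF W(1)] \<phi>(3))
  have "(\<integral>\<^sup>+x. ennreal ((u x)^4) \<partial>lborel) = (\<integral>\<^sup>+x. liminf (\<lambda>n. ennreal ((\<phi> (r n) x)^4)) \<partial>lborel)"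
  proof (rule nn_integral_cong_AE)
    show "AE x in lborel. ennreal ((u x)^4) = liminf (\<lambda>n. ennreal ((\<phi> (r n) x)^4))"
      using r(2)
    proof eventually_elim
      case (elim x)
      have "(\<lambda>n. ennreal ((\<phi> (r n) x)^4)) \<longlonglongrightarrow> ennreal ((u x)^4)"
        by (intro tendsto_ennrealI tendsto_power elim)
      from lim_imp_Liminf[OF trivial_limit_sequentially this] show ?case by simp
    qed
  qed
  also have "\<dots> \<le> liminf (\<lambda>n. \<integral>\<^sup>+x. ennreal ((\<phi> (r n) x)^4) \<partial>lborel)"
    by (rule nn_integral_liminf) measurable
  also have "\<dots> \<le> liminf (\<lambda>n. ennreal ((9 * En (\<lambda>l. pderiv l (\<phi> (r n))))\<^sup>2))"
  proof (intro Liminf_mono always_eventually allI)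
    fix n
    have L4: "L2 (\<lambda>x. (\<phi> (r n) x)\<^sup>2)"
      using test_fun_L2[OF test_fun_mult[OF \<phi>(1) test_fun_smooth[OF \<phi>(1)]]] by (simp add: power2_eq_square)
    have "integrable lborel (\<lambda>x. (\<phi> (r n) x)^4)" using L2_sq[OF L4] by (simp add: power_mult[symmetric])
    then have "(\<integral>\<^sup>+x. ennreal ((\<phi> (r n) x)^4) \<partial>lborel) = ennreal ((n2 (\<lambda>x. (\<phi> (r n) x)\<^sup>2))\<^sup>2)"
      by (subst nn_integral_eq_integral) (auto simp: n2_sq power_mult[symmetric])
    also have "\<dots> \<le> ennreal ((9 * En (\<lambda>l. pderiv l (\<phi> (r n))))\<^sup>2)"
      using sobolev_test[OF dim \<phi>(1)] by (intro ennreal_leI power_mono) auto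
    finally show "(\<integral>\<^sup>+x. ennreal ((\<phi> (r n) x)^4) \<partial>lborel) \<le> ennreal ((9 * En (\<lambda>l. pderiv l (\<phi> (r n))))\<^sup>2)" .
  qed
  also have "\<dots> = ennreal ((9 * En d)\<^sup>2)"
  proof (rule lim_imp_Liminf)
    show "(\<lambda>n. ennreal ((9 * En (\<lambda>l. pderiv l (\<phi> (r n))))\<^sup>2)) \<longlonglongrightarrow> ennreal ((9 * En d)\<^sup>2)"
      using LIMSEQ_subseq_LIMSEQ[OF En r(1)] by (intro tendsto_ennrealI tendsto_power tendsto_mult tendsto_const) (simp add: comp_def)
  qed simp
  finally have le: "(\<integral>\<^sup>+x. ennreal ((u x)^4) \<partial>lborel) \<le> ennreal ((9 * En d)\<^sup>2)" .
  then have int: "integrable lborel (\<lambda>x. (u x)^4)"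
    by (auto simp: integrable_iff_bounded intro: le_less_trans)
  then show L4: "L2 (\<lambda>x. (u x)\<^sup>2)" by (simp add: L2_def power_mult[symmetric])
  show "n2 (\<lambda>x. (u x)\<^sup>2) \<le> 9 * En d"
  proof (rule power2_le_imp_le)
    have "ennreal ((n2 (\<lambda>x. (u x)\<^sup>2))\<^sup>2) = (\<integral>\<^sup>+x. ennreal ((u x)^4) \<partial>lborel)"
      using int by (subst nn_integral_eq_integral) (auto simp: n2_sq power_mult[symmetric])
    then show "(n2 (\<lambda>x. (u x)\<^sup>2))\<^sup>2 \<le> (9 * En d)\<^sup>2"
      using le ennreal_le_iff[of "(9 * En d)\<^sup>2" "(n2 (\<lambda>x. (u x)\<^sup>2))\<^sup>2"] by (simp only: zero_le_power2)
  qed (simp add: En_nonneg)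
qed

text \<open>The critical estimate: a square-integrable coefficient is a small one plus a bounded one,
  so no smallness of the domain is needed.  It is uniform under translation of the coefficient.\<close>
lemma absorb:
  fixes p :: "real^'m \<Rightarrow> real"
  assumes dim: "CARD('m::finite) \<le> 4" and p: "L2 p" and e: "e > 0"
  shows "\<exists>C\<ge>0. \<forall>r u d h. W0 r u d \<longrightarrow> r < 1 \<longrightarrow>
     integrable lborel (\<lambda>x. \<bar>p (x + h)\<bar> * (u x)\<^sup>2) \<and>
     (\<integral>x. \<bar>p (x + h)\<bar> * (u x)\<^sup>2 \<partial>lborel) \<le> e * En d + C * (n2 u)\<^sup>2"
proof -
  note [measurable] = L2_measurable[OF p]
  \<comment> \<open>\<open>q n\<close> is the part of the coefficient above height n. Its norm tends
    to 0 by dominated convergence, hence without a rate: the resulting constant depends on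
    \<open>p\<close> itself and not only on its norm.\<close>
  define q where "q n x = (if \<bar>p x\<bar> > real n then p x else 0)" for n x
  have [measurable]: "q n \<in> borel_measurable borel" for n unfolding q_def by measurable
  have qL: "L2 (q n)" for n by (rule L2_dom[OF p]) (auto simp: q_def)
  have "(\<lambda>n. \<integral>x. (q n x)\<^sup>2 \<partial>lborel) \<longlonglongrightarrow> (\<integral>x. 0 \<partial>(lborel::(real^'m) measure))"
  proof (rule integral_dominated_convergence[where w = "\<lambda>x. (p x)\<^sup>2"])
    show "AE x in lborel. (\<lambda>n. (q n x)\<^sup>2) \<longlonglongrightarrow> 0"
    proof (rule AE_I2)
      fix x
      obtain N where "\<bar>p x\<bar> \<le> real N" using real_arch_simple by blast
      then have "\<forall>\<^sub>F n in sequentially. 0 = (q n x)\<^sup>2"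
        unfolding eventually_sequentially by (intro exI[of _ N]) (auto simp: q_def)
      then show "(\<lambda>n. (q n x)\<^sup>2) \<longlonglongrightarrow> 0" using tendsto_cong tendsto_const by fast
    qed
  qed (use L2_sq[OF p] in \<open>auto simp: q_def\<close>)
  from tendsto_real_sqrt[OF this] have "(\<lambda>n. n2 (q n)) \<longlonglongrightarrow> 0" by (simp add: n2_def)
  \<comment> \<open>The 9 cancels the constant of \<open>sobolev_W0\<close>.\<close>
  from LIMSEQ_D[OF this, of "e / 9"] e obtain M where M: "n2 (q M) < e / 9" by auto
  show ?thesis
  proof (intro exI[of _ "real M"] conjI allI impI)
    fix r d and u :: "real^'m \<Rightarrow> real" and h :: "real^'m" assume W: "W0 r u d" "r < 1"
    note S = sobolev_W0[OF dim W]
    note u = W0_L2(1)[OF W(1)]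
    have i1: "integrable lborel (\<lambda>x. \<bar>p (x + h)\<bar> * (u x)\<^sup>2)"
      by (rule L2_mult_integrable[OF L2_abs[OF L2_translate[OF p]] S(1)])
    have i2: "integrable lborel (\<lambda>x. \<bar>q M (x + h) * (u x)\<^sup>2\<bar>)"
      using L2_mult_integrable[OF L2_translate[OF qL] S(1)] by auto
    show "integrable lborel (\<lambda>x. \<bar>p (x + h)\<bar> * (u x)\<^sup>2)" by (rule i1)
    have "(\<integral>x. \<bar>p (x + h)\<bar> * (u x)\<^sup>2 \<partial>lborel) \<le> (\<integral>x. \<bar>q M (x + h) * (u x)\<^sup>2\<bar> + real M * (u x)\<^sup>2 \<partial>lborel)"
    proof (rule integral_mono[OF i1])
      show "integrable lborel (\<lambda>x. \<bar>q M (x + h) * (u x)\<^sup>2\<bar> + real M * (u x)\<^sup>2)" using i2 L2_sq[OF u] by simp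
      show "\<bar>p (x + h)\<bar> * (u x)\<^sup>2 \<le> \<bar>q M (x + h) * (u x)\<^sup>2\<bar> + real M * (u x)\<^sup>2" for x
      proof -
        have "\<bar>p (x + h)\<bar> \<le> \<bar>q M (x + h)\<bar> + real M" by (auto simp: q_def)
        then have "\<bar>p (x + h)\<bar> * (u x)\<^sup>2 \<le> (\<bar>q M (x + h)\<bar> + real M) * (u x)\<^sup>2" by (rule mult_right_mono) simp
        then show ?thesis by (simp add: abs_mult distrib_right)
      qed
    qed
    also have "\<dots> = (\<integral>x. \<bar>q M (x + h) * (u x)\<^sup>2\<bar> \<partial>lborel) + real M * (n2 u)\<^sup>2"
      using i2 L2_sq[OF u] by (simp add: n2_sq)
    also have "(\<integral>x. \<bar>q M (x + h) * (u x)\<^sup>2\<bar> \<partial>lborel) \<le> n2 (\<lambda>x. q M (x + h)) * n2 (\<lambda>x. (u x)\<^sup>2)"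
      by (rule L2_CS_abs[OF L2_translate[OF qL] S(1)])
    also have "\<dots> \<le> (e / 9) * (9 * En d)" using M S(2) using e by (intro mult_mono) (auto simp: n2_translate)
    finally show "(\<integral>x. \<bar>p (x + h)\<bar> * (u x)\<^sup>2 \<partial>lborel) \<le> e * En d + real M * (n2 u)\<^sup>2" by simp
  qed simp
qed

section \<open>Difference quotients and admissible right-hand sides\<close>

definition Dq :: "real \<Rightarrow> 'm::finite \<Rightarrow> (real^'m \<Rightarrow> real) \<Rightarrow> real^'m \<Rightarrow> real" where
  "Dq h k u x = (u (x + h *\<^sub>R axis k 1) - u x) / h"

lemma L2_Dq: "L2 u \<Longrightarrow> L2 (Dq h k u)"
  using L2_cmult[OF L2_diff[OF L2_translate[of u "h *\<^sub>R axis k 1"], of u], of "1/h"] by (simp add: Dq_def[abs_def])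

text \<open>The shift falls on one factor only, which is why estimates must be uniform under
  translated coefficients. At \<open>h = 0\<close> both sides vanish, as division by zero gives
  0.\<close>

lemma Dq_mult: "Dq h k (\<lambda>x. u x * v x) x = Dq h k u x * v (x + h *\<^sub>R axis k 1) + u x * Dq h k v x"
  by (cases "h = 0") (simp_all add: Dq_def field_simps)

section \<open>Operations on weakly differentiable functions\<close>

lemma wd_translate:
  fixes a :: "real^'m"
  assumes "wd R l u v" shows "wd (R - norm a) l (\<lambda>x. u (x + a)) (\<lambda>x. v (x + a))"
proof -
  have "(\<integral>x. pderiv l \<phi> x * u (x + a) \<partial>lborel) = - (\<integral>x. \<phi> x * v (x + a) \<partial>lborel)"
    if t: "test_fun (ball 0 (R - norm a)) \<phi>" for \<phi>
  proof -
    have t': "test_fun (ball 0 R) (\<lambda>x. \<phi> (x + (- a)))" by (rule test_fun_translate[OF t]) simp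
    have "(\<integral>x. pderiv l (\<lambda>x. \<phi> (x + (- a))) x * u x \<partial>lborel) = - (\<integral>x. \<phi> (x + (- a)) * v x \<partial>lborel)"
      by (rule wdD[OF assms t'])
    then have "(\<integral>x. pderiv l \<phi> (x + (- a)) * u x \<partial>lborel) = - (\<integral>x. \<phi> (x + (- a)) * v x \<partial>lborel)"
      by (simp only: pderiv_translate[OF test_fun_smooth[OF t]])
    then show ?thesis
      using lborel_translate(1)[of "\<lambda>x. pderiv l \<phi> (x + (- a)) * u x" a] lborel_translate(1)[of "\<lambda>x. \<phi> (x + (- a)) * v x" a]
      by simp
  qed
  then show ?thesis using assms L2_translate unfolding wd_def by blast
qed

lemma wd_add:
  assumes "wd R l u v" "wd R l u' v'" shows "wd R l (\<lambda>x. u x + u' x) (\<lambda>x. v x + v' x)"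
proof -
  note L = wd_L2(1)[OF assms(1)] wd_L2(2)[OF assms(1)] wd_L2(1)[OF assms(2)] wd_L2(2)[OF assms(2)]
  have "(\<integral>x. pderiv l \<phi> x * (u x + u' x) \<partial>lborel) = - (\<integral>x. \<phi> x * (v x + v' x) \<partial>lborel)"
    if t: "test_fun (ball 0 R) \<phi>" for \<phi>
  proof -
    note L' = test_fun_L2[OF t] test_fun_L2[OF test_fun_pderiv[OF t], of l]
    show ?thesis
      using wdD[OF assms(1) t] wdD[OF assms(2) t] L2_mult_integrable[OF L'(2) L(1)] L2_mult_integrable[OF L'(2) L(3)]
        L2_mult_integrable[OF L'(1) L(2)] L2_mult_integrable[OF L'(1) L(4)]
      by (simp add: distrib_left)
  qed
  then show ?thesis using L unfolding wd_def by (auto intro: L2_add)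
qed

lemma wd_cmult: assumes "wd R l u v" shows "wd R l (\<lambda>x. c * u x) (\<lambda>x. c * v x)"
proof -
  have "(\<integral>x. pderiv l \<phi> x * (c * u x) \<partial>lborel) = - (\<integral>x. \<phi> x * (c * v x) \<partial>lborel)"
    if t: "test_fun (ball 0 R) \<phi>" for \<phi>
    using wdD[OF assms t] by (simp add: mult.left_commute[of _ c])
  then show ?thesis using assms unfolding wd_def by (auto intro: L2_cmult)
qed

lemma wd_diff: "wd R l u v \<Longrightarrow> wd R l u' v' \<Longrightarrow> wd R l (\<lambda>x. u x - u' x) (\<lambda>x. v x - v' x)"
  using wd_add[of R l u v "\<lambda>x. -1 * u' x" "\<lambda>x. -1 * v' x"] wd_cmult[of R l u' v' "-1"] by simp

lemma wd_Dq:
  fixes u v :: "real^'m \<Rightarrow> real"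
  assumes "wd R l u v" shows "wd (R - \<bar>h\<bar>) l (Dq h k u) (Dq h k v)"
proof -
  have n: "norm (h *\<^sub>R (axis k 1 :: real^'m)) = \<bar>h\<bar>" by (simp add: norm_axis_1)
  have 1: "wd (R - \<bar>h\<bar>) l (\<lambda>x. u (x + h *\<^sub>R axis k 1)) (\<lambda>x. v (x + h *\<^sub>R axis k 1))"
    using wd_translate[OF assms, of "h *\<^sub>R axis k 1"] n by simp
  have 2: "wd (R - \<bar>h\<bar>) l u v" by (rule wd_mono[OF assms]) simp
  show ?thesis using wd_cmult[OF wd_diff[OF 1 2], of "1/h"] by (simp add: Dq_def[abs_def])
qed

lemma W0_translate:
  fixes a :: "real^'m"
  assumes W: "W0 r u d" shows "W0 (r + norm a) (\<lambda>x. u (x + a)) (\<lambda>l x. d l (x + a))"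
proof -
  have "(\<integral>x. pderiv l \<phi> x * u (x + a) \<partial>lborel) = - (\<integral>x. \<phi> x * d l (x + a) \<partial>lborel)"
    if t: "test_fun UNIV \<phi>" for \<phi> l
  proof -
    obtain K where K: "compact K" "\<And>x. x \<notin> K \<Longrightarrow> \<phi> x = 0" using t by (rule test_fun_supp) (erule that, blast)
    obtain s where s: "K \<subseteq> ball 0 s" using K(1) compact_imp_bounded bounded_subset_ballD by metis
    have ts: "test_fun (ball 0 s) \<phi>" by (rule test_funI[OF test_fun_smooth[OF t] K(1) s K(2)])
    have t': "test_fun UNIV (\<lambda>x. \<phi> (x + (- a)))"
      by (rule test_fun_mono[OF test_fun_translate[OF ts order_refl]]) simp
    have "(\<integral>x. pderiv l (\<lambda>x. \<phi> (x + (- a))) x * u x \<partial>lborel) = - (\<integral>x. \<phi> (x + (- a)) * d l x \<partial>lborel)"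
      by (rule W0D[OF W t'])
    then have "(\<integral>x. pderiv l \<phi> (x + (- a)) * u x \<partial>lborel) = - (\<integral>x. \<phi> (x + (- a)) * d l x \<partial>lborel)"
      by (simp only: pderiv_translate[OF test_fun_smooth[OF t]])
    then show ?thesis
      using lborel_translate(1)[of "\<lambda>x. pderiv l \<phi> (x + (- a)) * u x" a] lborel_translate(1)[of "\<lambda>x. \<phi> (x + (- a)) * d l x" a]
      by simp
  qed
  moreover have "x + a \<notin> ball 0 r" if "x \<notin> ball 0 (r + norm a)" for x
  proof -
    have "norm x \<le> norm (x + a) + norm a" using norm_triangle_ineq4[of "x + a" a] by simp
    then show ?thesis using that by simp
  qed
  ultimately show ?thesis using W L2_translate unfolding W0_def by blast
qed

lemma W0_diff:
  assumes "W0 r u d" "W0 r v e" shows "W0 r (\<lambda>x. u x - v x) (\<lambda>l x. d l x - e l x)"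
proof -
  note L = W0_L2(1)[OF assms(1)] W0_L2(2)[OF assms(1)] W0_L2(1)[OF assms(2)] W0_L2(2)[OF assms(2)]
  have "(\<integral>x. pderiv l \<phi> x * (u x - v x) \<partial>lborel) = - (\<integral>x. \<phi> x * (d l x - e l x) \<partial>lborel)"
    if t: "test_fun UNIV \<phi>" for \<phi> l
  proof -
    note L' = test_fun_L2[OF t] test_fun_L2[OF test_fun_pderiv[OF t], of l]
    show ?thesis
      using W0D[OF assms(1) t, of l] W0D[OF assms(2) t, of l] L2_mult_integrable[OF L'(2) L(1)] L2_mult_integrable[OF L'(2) L(3)]
        L2_mult_integrable[OF L'(1) L(2)] L2_mult_integrable[OF L'(1) L(4)]
      by (simp add: right_diff_distrib)
  qed
  then show ?thesis using assms L unfolding W0_def by (auto intro: L2_diff)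
qed

section \<open>Difference quotients versus weak derivatives\<close>

lemma dq_test_bound:
  fixes \<phi> :: "real^'m \<Rightarrow> real"
  assumes t: "test_fun U \<phi>"
  shows "\<exists>B r. 0 \<le> B \<and> (\<forall>h x. h \<noteq> 0 \<longrightarrow> \<bar>h\<bar> \<le> 1 \<longrightarrow> \<bar>Dq h k \<phi> x\<bar> \<le> B * indicat_real (ball 0 r) x)"
proof -
  obtain B where B: "0 \<le> B" "\<And>x y. \<bar>\<phi> y - \<phi> x\<bar> \<le> B * norm (y - x)" using test_fun_Lipschitz[OF t] by metis
  obtain K where K: "compact K" "\<And>x. x \<notin> K \<Longrightarrow> \<phi> x = 0" using t by (rule test_fun_supp) (erule that, blast)
  obtain s where s: "K \<subseteq> ball 0 s" using K(1) compact_imp_bounded bounded_subset_ballD by metis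
  have "\<bar>Dq h k \<phi> x\<bar> \<le> B * indicat_real (ball 0 (s + 1)) x" if h: "h \<noteq> 0" "\<bar>h\<bar> \<le> 1" for h x
  proof (cases "x \<in> ball 0 (s + 1)")
    case True
    have "\<bar>\<phi> (x + h *\<^sub>R axis k 1) - \<phi> x\<bar> \<le> B * \<bar>h\<bar>"
      using B(2)[of "x + h *\<^sub>R axis k 1" x] by (simp add: norm_axis_1)
    then show ?thesis using True h(1) by (simp add: Dq_def field_simps)
  next
    case False
    have "norm x \<le> norm (x + h *\<^sub>R axis k 1) + norm (h *\<^sub>R (axis k 1 :: real^'m))"
      using norm_triangle_ineq4[of "x + h *\<^sub>R axis k 1" "h *\<^sub>R axis k 1"] by simp
    then have "norm (x + h *\<^sub>R axis k 1) \<ge> s" "norm x \<ge> s" using False h by (auto simp: norm_axis_1)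
    then have "x + h *\<^sub>R axis k 1 \<notin> K" "x \<notin> K" using s by auto
    then show ?thesis using False K(2) by (simp add: Dq_def)
  qed
  then show ?thesis using B(1) by blast
qed

lemma dq_test_tendsto:
  fixes \<phi> :: "real^'m \<Rightarrow> real"
  assumes t: "test_fun U \<phi>" and g: "L2 g" and h: "\<And>n. h n \<noteq> 0" "\<And>n. \<bar>h n\<bar> \<le> 1" "h \<longlonglongrightarrow> 0"
  shows "(\<lambda>n. \<integral>x. Dq (h n) k \<phi> x * g x \<partial>lborel) \<longlonglongrightarrow> (\<integral>x. pderiv k \<phi> x * g x \<partial>lborel)"
proof -
  obtain B r where B: "0 \<le> B" "\<forall>h x. h \<noteq> 0 \<longrightarrow> \<bar>h\<bar> \<le> 1 \<longrightarrow> \<bar>Dq h k \<phi> x\<bar> \<le> B * indicat_real (ball 0 r) x"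
    using dq_test_bound[OF t, of k] by blast
  note [measurable] = L2_measurable[OF L2_Dq[OF test_fun_L2[OF t]]] L2_measurable[OF g] L2_measurable[OF test_fun_L2[OF test_fun_pderiv[OF t]]]
  show ?thesis
  proof (rule integral_dominated_convergence[where w = "\<lambda>x. B * \<bar>indicat_real (ball 0 r) x * g x\<bar>"])
    show "integrable lborel (\<lambda>x. B * \<bar>indicat_real (ball 0 r) x * g x\<bar>)"
      using L2_integrable_ball[OF g] by simp
    show "AE x in lborel. (\<lambda>n. Dq (h n) k \<phi> x * g x) \<longlonglongrightarrow> pderiv k \<phi> x * g x"
    proof (rule AE_I2)
      fix x
      have "((\<lambda>s. (\<phi> (x + (0 + s) *\<^sub>R axis k 1) - \<phi> (x + 0 *\<^sub>R axis k 1)) / s) \<longlongrightarrow> pderiv k \<phi> (x + 0 *\<^sub>R axis k 1)) (at 0)"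
        using smooth_line_deriv[OF test_fun_smooth[OF t], of x k 0] unfolding DERIV_def .
      then have "((\<lambda>s. Dq s k \<phi> x) \<longlongrightarrow> pderiv k \<phi> x) (at 0)" by (simp add: Dq_def[abs_def])
      moreover have "\<forall>i. h i \<in> UNIV - {0}" using h(1) by simp
      ultimately have "(\<lambda>n. Dq (h n) k \<phi> x) \<longlonglongrightarrow> pderiv k \<phi> x"
        unfolding tendsto_at_iff_sequentially comp_def using h(3) by blast
      then show "(\<lambda>n. Dq (h n) k \<phi> x * g x) \<longlonglongrightarrow> pderiv k \<phi> x * g x" by (intro tendsto_mult tendsto_const)
    qed
    show "AE x in lborel. norm (Dq (h n) k \<phi> x * g x) \<le> B * \<bar>indicat_real (ball 0 r) x * g x\<bar>" for n
    proof (rule AE_I2)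
      fix x
      have "\<bar>Dq (h n) k \<phi> x\<bar> \<le> B * indicat_real (ball 0 r) x" using B(2) h(1,2) by blast
      then have "\<bar>Dq (h n) k \<phi> x\<bar> * \<bar>g x\<bar> \<le> (B * indicat_real (ball 0 r) x) * \<bar>g x\<bar>" by (rule mult_right_mono) simp
      then show "norm (Dq (h n) k \<phi> x * g x) \<le> B * \<bar>indicat_real (ball 0 r) x * g x\<bar>" by (simp add: abs_mult)
    qed
  qed measurable
qed

lemma dq_by_parts:
  fixes f g :: "real^'m \<Rightarrow> real"
  assumes "L2 g" "L2 f"
  shows "(\<integral>x. Dq h k f x * g x \<partial>lborel) = - (\<integral>x. f x * Dq (- h) k g x \<partial>lborel)"
proof -
  let ?a = "h *\<^sub>R axis k 1 :: real^'m"
  have i: "integrable lborel (\<lambda>x. f (x + ?a) * g x)" "integrable lborel (\<lambda>x. f x * g x)" "integrable lborel (\<lambda>x. f x * g (x - ?a))"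
    using L2_mult_integrable[OF L2_translate[OF assms(2)] assms(1)] L2_mult_integrable[OF assms(2,1)]
      L2_mult_integrable[OF assms(2) L2_translate[OF assms(1), of "- ?a"]] by auto
  have "(\<integral>x. f (x + ?a) * g x \<partial>lborel) = (\<integral>x. f x * g (x - ?a) \<partial>lborel)"
    using lborel_translate(1)[of "\<lambda>x. f x * g (x - ?a)" ?a] by simp
  moreover have "(\<integral>x. Dq h k f x * g x \<partial>lborel) = ((\<integral>x. f (x + ?a) * g x \<partial>lborel) - (\<integral>x. f x * g x \<partial>lborel)) / h"
    using i by (simp add: Dq_def left_diff_distrib diff_divide_distrib)
  moreover have "(\<integral>x. f x * Dq (- h) k g x \<partial>lborel) = - (((\<integral>x. f x * g (x - ?a) \<partial>lborel) - (\<integral>x. f x * g x \<partial>lborel)) / h)"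
    using i by (simp add: Dq_def right_diff_distrib diff_divide_distrib)
  ultimately show ?thesis by simp
qed

text \<open>A difference quotient is the average over s of translated derivatives. Jensen's
  inequality holds pointwise, and Tonelli's theorem then removes the translations.\<close>

lemma dq_test_le:
  fixes \<phi> :: "real^'m \<Rightarrow> real"
  assumes t: "test_fun U \<phi>" and h: "h \<noteq> 0"
  shows "n2 (Dq h k \<phi>) \<le> n2 (pderiv k \<phi>)"
proof -
  let ?e = "axis k 1 :: real^'m"
  have sm: "smooth \<phi>" by (rule test_fun_smooth[OF t])
  let ?i = "\<lambda>s::real. indicat_real {0..1} s"
  let ?g = "\<lambda>x s. pderiv k \<phi> (x + (s * h) *\<^sub>R ?e)"
  note [measurable] = smooth_measurable[OF smooth_pderiv[OF sm, of k]]
  have m: "(\<lambda>(x, s). ?g x s) \<in> borel_measurable (lborel \<Otimes>\<^sub>M lborel)"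
    by (subst case_prod_unfold, rule measurable_compose[OF _ smooth_measurable[OF smooth_pderiv[OF sm, of k]]]) measurable
  have m': "?g x \<in> borel_measurable borel" for x
    by (rule measurable_compose[OF _ smooth_measurable[OF smooth_pderiv[OF sm, of k]]]) measurable
  have pt: "ennreal ((Dq h k \<phi> x)\<^sup>2) \<le> (\<integral>\<^sup>+s. ennreal (?i s) * ennreal ((?g x s)\<^sup>2) \<partial>lborel)" for x
  proof -
    have der: "((\<lambda>s. \<phi> (x + (s * h) *\<^sub>R ?e)) has_vector_derivative ?g x s * h) (at s within S)" for s S
    proof -
      have "((\<lambda>s. \<phi> (x + (s * h) *\<^sub>R ?e)) has_real_derivative ?g x s * h) (at s)"
        by (rule DERIV_chain2[where g = "\<lambda>s. s * h", OF smooth_line_deriv[OF sm]]) (auto intro!: derivative_eq_intros)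
      then show ?thesis unfolding has_real_derivative_iff_has_vector_derivative
        by (rule has_vector_derivative_at_within)
    qed
    have cont: "continuous_on S (\<lambda>s. ?g x s * h)" for S
      by (intro continuous_intros continuous_on_compose2[OF smooth_continuous[OF smooth_pderiv[OF sm], of UNIV]]) auto
    have "integral\<^sup>L lborel (\<lambda>s. indicator {0..1} s *\<^sub>R (?g x s * h)) = \<phi> (x + (1 * h) *\<^sub>R ?e) - \<phi> (x + (0 * h) *\<^sub>R ?e)"
      by (rule integral_FTC_atLeastAtMost[OF _ der cont]) simp
    then have "Dq h k \<phi> x = (\<integral>s. ?i s *\<^sub>R ?g x s \<partial>lborel)"
      using h by (simp add: Dq_def mult.assoc[symmetric] divide_eq_eq)
    moreover have "integrable lborel (\<lambda>s. ?i s *\<^sub>R ?g x s)"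
    proof -
      have "continuous_on {0..1} (?g x)"
        by (intro continuous_on_compose2[OF smooth_continuous[OF smooth_pderiv[OF sm], of UNIV]] continuous_intros) auto
      from borel_integrable_atLeastAtMost'[OF this] show ?thesis by (simp add: set_integrable_def)
    qed
    ultimately have "ennreal \<bar>Dq h k \<phi> x\<bar> \<le> (\<integral>\<^sup>+s. ennreal (norm (?i s *\<^sub>R ?g x s)) \<partial>lborel)"
      using integral_norm_bound_ennreal by fastforce
    also have "\<dots> = (\<integral>\<^sup>+s. ennreal (?i s) * ennreal (?i s * \<bar>?g x s\<bar>) \<partial>lborel)"
      by (intro nn_integral_cong) (auto simp: indicator_def)
    finally have "(ennreal \<bar>Dq h k \<phi> x\<bar>)\<^sup>2 \<le> (\<integral>\<^sup>+s. ennreal (?i s) * ennreal (?i s * \<bar>?g x s\<bar>) \<partial>lborel)\<^sup>2"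
      by (rule power_mono) simp
    also have "\<dots> \<le> (\<integral>\<^sup>+s. (ennreal (?i s))\<^sup>2 \<partial>lborel) * (\<integral>\<^sup>+s. (ennreal (?i s * \<bar>?g x s\<bar>))\<^sup>2 \<partial>lborel)"
      by (rule Cauchy_Schwarz_nn_integral) (use m'[of x] in auto)
    also have "(\<integral>\<^sup>+s. (ennreal (?i s))\<^sup>2 \<partial>lborel) = (\<integral>\<^sup>+s. indicator {0..1::real} s \<partial>lborel)"
      by (intro nn_integral_cong) (auto simp: indicator_def)
    also have "\<dots> = 1" by simp
    also have "(\<integral>\<^sup>+s. (ennreal (?i s * \<bar>?g x s\<bar>))\<^sup>2 \<partial>lborel) = (\<integral>\<^sup>+s. ennreal (?i s) * ennreal ((?g x s)\<^sup>2) \<partial>lborel)"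
      by (intro nn_integral_cong) (auto simp: indicator_def ennreal_power)
    finally show ?thesis by (simp add: ennreal_power)
  qed
  have iD: "L2 (Dq h k \<phi>)" "L2 (pderiv k \<phi>)" using L2_Dq test_fun_L2[OF t] test_fun_L2[OF test_fun_pderiv[OF t]] by blast+
  have "ennreal ((n2 (Dq h k \<phi>))\<^sup>2) = (\<integral>\<^sup>+x. ennreal ((Dq h k \<phi> x)\<^sup>2) \<partial>lborel)"
    using L2_sq[OF iD(1)] by (subst nn_integral_eq_integral) (auto simp: n2_sq)
  also have "\<dots> \<le> (\<integral>\<^sup>+x. (\<integral>\<^sup>+s. ennreal (?i s) * ennreal ((?g x s)\<^sup>2) \<partial>lborel) \<partial>lborel)"
    by (rule nn_integral_mono) (rule pt)
  also have "\<dots> = (\<integral>\<^sup>+s. (\<integral>\<^sup>+x. ennreal (?i s) * ennreal ((?g x s)\<^sup>2) \<partial>lborel) \<partial>lborel)"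
  proof (rule lborel_pair.Fubini'[symmetric])
    have [measurable]: "(\<lambda>z. ?g (fst z) (snd z)) \<in> borel_measurable (lborel \<Otimes>\<^sub>M lborel)"
      using m by (simp add: case_prod_unfold)
    show "(\<lambda>(x, s). ennreal (?i s) * ennreal ((?g x s)\<^sup>2)) \<in> borel_measurable (lborel \<Otimes>\<^sub>M lborel)"
      by (subst case_prod_unfold) measurable
  qed
  also have "\<dots> = (\<integral>\<^sup>+s. ennreal (?i s) * ennreal ((n2 (pderiv k \<phi>))\<^sup>2) \<partial>lborel)"
  proof (rule nn_integral_cong)
    fix s
    have ms: "(\<lambda>x. ennreal ((?g x s)\<^sup>2)) \<in> borel_measurable borel" by measurable
    have "(\<integral>\<^sup>+x. ennreal (?i s) * ennreal ((?g x s)\<^sup>2) \<partial>lborel) = ennreal (?i s) * (\<integral>\<^sup>+x. ennreal ((?g x s)\<^sup>2) \<partial>lborel)"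
      using ms by (intro nn_integral_cmult) simp
    also have "(\<integral>\<^sup>+x. ennreal ((?g x s)\<^sup>2) \<partial>lborel) = (\<integral>\<^sup>+x. ennreal ((pderiv k \<phi> x)\<^sup>2) \<partial>lborel)"
      by (rule nn_lborel_translate[of "\<lambda>x. ennreal ((pderiv k \<phi> x)\<^sup>2)"]) measurable
    also have "\<dots> = ennreal ((n2 (pderiv k \<phi>))\<^sup>2)"
      using L2_sq[OF iD(2)] by (subst nn_integral_eq_integral) (auto simp: n2_sq)
    finally show "(\<integral>\<^sup>+x. ennreal (?i s) * ennreal ((?g x s)\<^sup>2) \<partial>lborel) = ennreal (?i s) * ennreal ((n2 (pderiv k \<phi>))\<^sup>2)" .
  qed
  also have "\<dots> = (\<integral>\<^sup>+s. ennreal ((n2 (pderiv k \<phi>))\<^sup>2) * indicator {0..1::real} s \<partial>lborel)"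
    by (intro nn_integral_cong) (auto simp: indicator_def)
  also have "\<dots> = ennreal ((n2 (pderiv k \<phi>))\<^sup>2)" by (subst nn_integral_cmult_indicator) auto
  finally have "(n2 (Dq h k \<phi>))\<^sup>2 \<le> (n2 (pderiv k \<phi>))\<^sup>2"
    using ennreal_le_iff[of "(n2 (pderiv k \<phi>))\<^sup>2"] by (simp only: zero_le_power2)
  then show ?thesis by (rule power2_le_imp_le) simp
qed

lemma dq_W0_le:
  assumes W: "W0 r u d" and h: "h \<noteq> 0"
  shows "n2 (Dq h k u) \<le> n2 (d k)"
proof -
  obtain \<phi> where \<phi>: "\<And>n. test_fun (ball 0 (r + 1)) (\<phi> n)" "(\<lambda>n. n2 (\<lambda>x. \<phi> n x - u x)) \<longlonglongrightarrow> 0"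
      "\<And>l. (\<lambda>n. n2 (\<lambda>x. pderiv l (\<phi> n) x - d l x)) \<longlonglongrightarrow> 0"
    using W0_approx[OF W, of "r + 1"] by auto
  note L = test_fun_L2[OF \<phi>(1)] test_fun_L2[OF test_fun_pderiv[OF \<phi>(1)]] W0_L2[OF W]
  have "(\<lambda>n. n2 (\<lambda>x. Dq h k (\<phi> n) x - Dq h k u x)) \<longlonglongrightarrow> 0"
  proof (rule Lim_null_comparison)
    \<comment> \<open>For fixed \<open>h\<close> the difference quotient is a bounded operator on
      L2. Its bound \<open>2 / \<bar>h\<bar>\<close> degenerates for small \<open>h\<close>, but
      only the limit in n is taken here.\<close>
    show "\<forall>\<^sub>F n in sequentially. norm (n2 (\<lambda>x. Dq h k (\<phi> n) x - Dq h k u x)) \<le> 2 / \<bar>h\<bar> * n2 (\<lambda>x. \<phi> n x - u x)"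
    proof (intro always_eventually allI)
      fix n
      let ?w = "\<lambda>x. \<phi> n x - u x"
      have w: "L2 ?w" by (rule L2_diff[OF L(1,3)])
      have "n2 (\<lambda>x. Dq h k (\<phi> n) x - Dq h k u x) = n2 (\<lambda>x. (1/h) * (?w (x + h *\<^sub>R axis k 1) - ?w x))"
        by (simp add: Dq_def diff_divide_distrib algebra_simps)
      also have "\<dots> \<le> \<bar>1/h\<bar> * (n2 (\<lambda>x. ?w (x + h *\<^sub>R axis k 1)) + n2 ?w)"
        unfolding n2_cmult by (intro mult_left_mono n2_diff L2_translate[OF w] w) simp
      also have "n2 (\<lambda>x. ?w (x + h *\<^sub>R axis k 1)) = n2 ?w" by (rule n2_translate)
      finally show "norm (n2 (\<lambda>x. Dq h k (\<phi> n) x - Dq h k u x)) \<le> 2 / \<bar>h\<bar> * n2 ?w" by simp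
    qed
    show "(\<lambda>n. 2 / \<bar>h\<bar> * n2 (\<lambda>x. \<phi> n x - u x)) \<longlonglongrightarrow> 0" using tendsto_mult_right_zero[OF \<phi>(2)] .
  qed
  from n2_tendsto[OF L2_Dq[OF L(1)] L2_Dq[OF L(3)] this]
  have 1: "(\<lambda>n. n2 (Dq h k (\<phi> n))) \<longlonglongrightarrow> n2 (Dq h k u)" .
  have 2: "(\<lambda>n. n2 (pderiv k (\<phi> n))) \<longlonglongrightarrow> n2 (d k)" by (rule n2_tendsto[OF L(2) L(4) \<phi>(3)])
  show ?thesis
    by (rule tendsto_le[OF _ 2 1]) (auto intro!: always_eventually dq_test_le[OF \<phi>(1) h])
qed

lemma dq_local_bound:
  fixes u :: "real^'m \<Rightarrow> real"
  assumes u: "\<And>l. wd R l u (d l)" and r: "0 < r1" "r1 + \<delta> < R" "0 < \<delta>" and z: "test_fun (ball 0 r1) \<zeta>"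
  shows "\<exists>C\<ge>0. \<forall>h. h \<noteq> 0 \<longrightarrow> \<bar>h\<bar> < \<delta> \<longrightarrow> n2 (\<lambda>x. \<zeta> x * Dq h k u x) \<le> C"
proof -
  obtain r3 where r3: "r1 + \<delta> < r3" "r3 < R" using dense r by blast
  have "0 < r1 + \<delta>" using r by simp
  \<comment> \<open>\<open>\<theta>\<close> equals 1 on everything that a shift shorter than
    \<open>\<delta>\<close> can reach from the support of \<open>\<zeta>\<close>, so
    \<open>u\<close> may be replaced by the compactly supported \<open>v\<close>.\<close>
  obtain \<theta> :: "real^'m \<Rightarrow> real" where \<theta>: "test_fun (ball 0 r3) \<theta>" "\<And>x. x \<in> ball 0 (r1 + \<delta>) \<Longrightarrow> \<theta> x = 1"
    using cutoff_exists[OF \<open>0 < r1 + \<delta>\<close> r3(1)] by metis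
  define v where "v x = \<theta> x * u x" for x
  have W: "W0 r3 v (\<lambda>l x. pderiv l \<theta> x * u x + \<theta> x * d l x)"
    unfolding v_def using W0_cutoff[OF u \<theta>(1)] r3 by simp
  obtain M where M: "0 < M" "\<And>x. \<bar>\<zeta> x\<bar> \<le> M" using test_fun_bounded[OF z] by blast
  have Lv: "L2 v" by (rule W0_L2(1)[OF W])
  show ?thesis
  proof (intro exI[of _ "M * n2 (\<lambda>x. pderiv k \<theta> x * u x + \<theta> x * d k x)"] conjI allI impI)
    fix h :: real assume h: "h \<noteq> 0" "\<bar>h\<bar> < \<delta>"
    have eq: "\<zeta> x * Dq h k u x = \<zeta> x * Dq h k v x" for x
    proof (cases "x \<in> ball 0 r1")
      case True
      have "norm (x + h *\<^sub>R axis k 1) \<le> norm x + \<bar>h\<bar>"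
        using norm_triangle_ineq[of x "h *\<^sub>R axis k 1"] by (simp add: norm_axis_1)
      then have "\<theta> (x + h *\<^sub>R axis k 1) = 1" "\<theta> x = 1" using True h r by (auto intro!: \<theta>(2))
      then show ?thesis by (simp add: Dq_def v_def)
    qed (simp add: test_fun_outside(1)[OF z])
    have "n2 (\<lambda>x. \<zeta> x * Dq h k v x) \<le> n2 (\<lambda>x. M * Dq h k v x)"
    proof (rule n2_mono[OF L2_cmult[OF L2_Dq[OF Lv]] L2_measurable[OF L2_smooth_test[OF L2_Dq[OF Lv] z]]])
      show "\<bar>\<zeta> x * Dq h k v x\<bar> \<le> \<bar>M * Dq h k v x\<bar>" for x
        using M(1) mult_right_mono[OF M(2)[of x], of "\<bar>Dq h k v x\<bar>"] by (simp add: abs_mult)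
    qed
    also have "\<dots> \<le> M * n2 (\<lambda>x. pderiv k \<theta> x * u x + \<theta> x * d k x)"
      unfolding n2_cmult using dq_W0_le[OF W h(1), of k] M(1) by (simp add: mult_left_mono)
    finally show "n2 (\<lambda>x. \<zeta> x * Dq h k u x) \<le> M * n2 (\<lambda>x. pderiv k \<theta> x * u x + \<theta> x * d k x)" by (simp add: eq)
  qed (use M(1) in simp)
qed

text \<open>Nirenberg's criterion. Summation by parts moves the quotient between g and the test
  function, so the uniform bound for g passes to the limit as a bound on its distributional
  derivative.\<close>

lemma wd_from_dq_bound:
  fixes g :: "real^'m \<Rightarrow> real"
  assumes g: "L2 g" and \<delta>: "\<delta> > 0" and \<eta>: "\<And>x. x \<in> ball 0 r \<Longrightarrow> \<eta> x = (1::real)"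
    and L: "\<And>h. L2 (\<lambda>x. \<eta> x * Dq h k g x)"
    and bd: "\<And>h. h \<noteq> 0 \<Longrightarrow> \<bar>h\<bar> < \<delta> \<Longrightarrow> n2 (\<lambda>x. \<eta> x * Dq h k g x) \<le> C"
  shows "\<exists>v. wd r k g v"
proof (rule wd_from_bound[OF g, of r k C])
  fix \<phi> :: "real^'m \<Rightarrow> real" assume t: "test_fun (ball 0 r) \<phi>"
  \<comment> \<open>Steps of absolute value at most 1 keep the quotients of the test function in a
    fixed ball; starting at \<open>Suc (Suc n)\<close> makes them strictly shorter than
    \<open>\<delta>\<close>.\<close>
  define h where "h n = - (min \<delta> 1) / real (Suc (Suc n))" for n
  have h: "h n \<noteq> 0" "\<bar>h n\<bar> < \<delta>" "\<bar>h n\<bar> \<le> 1" for n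
  proof -
    have a: "\<bar>h n\<bar> = min \<delta> 1 / real (Suc (Suc n))" using \<delta> by (simp add: h_def)
    have "min \<delta> 1 / real (Suc (Suc n)) < min \<delta> 1 / 1" using \<delta> by (intro divide_strict_left_mono) auto
    then show "\<bar>h n\<bar> < \<delta>" "\<bar>h n\<bar> \<le> 1" unfolding a by auto
    show "h n \<noteq> 0" using \<delta> by (simp add: h_def)
  qed
  have h0: "h \<longlonglongrightarrow> 0"
  proof -
    have "(\<lambda>n. - min \<delta> 1 * (1 / real (Suc (n + 1)))) \<longlonglongrightarrow> - min \<delta> 1 * 0"
      by (intro tendsto_mult tendsto_const LIMSEQ_ignore_initial_segment[OF lim_1_over_n[THEN LIMSEQ_Suc], of 1])
    then show ?thesis by (simp add: h_def[abs_def])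
  qed
  have "(\<lambda>n. \<bar>\<integral>x. Dq (h n) k \<phi> x * g x \<partial>lborel\<bar>) \<longlonglongrightarrow> \<bar>\<integral>x. pderiv k \<phi> x * g x \<partial>lborel\<bar>"
    by (intro tendsto_rabs dq_test_tendsto[OF t g h(1,3) h0])
  moreover have "\<bar>\<integral>x. Dq (h n) k \<phi> x * g x \<partial>lborel\<bar> \<le> C * n2 \<phi>" for n
  proof -
    have "(\<integral>x. Dq (h n) k \<phi> x * g x \<partial>lborel) = - (\<integral>x. \<phi> x * Dq (- h n) k g x \<partial>lborel)"
      by (rule dq_by_parts[OF g test_fun_L2[OF t]])
    also have "(\<integral>x. \<phi> x * Dq (- h n) k g x \<partial>lborel) = (\<integral>x. \<phi> x * (\<eta> x * Dq (- h n) k g x) \<partial>lborel)"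
    proof (rule Bochner_Integration.integral_cong[OF refl])
      fix x show "\<phi> x * Dq (- h n) k g x = \<phi> x * (\<eta> x * Dq (- h n) k g x)"
        using \<eta>[of x] test_fun_outside(1)[OF t, of x] by (cases "x \<in> ball 0 r") auto
    qed
    finally have "\<bar>\<integral>x. Dq (h n) k \<phi> x * g x \<partial>lborel\<bar> \<le> n2 \<phi> * n2 (\<lambda>x. \<eta> x * Dq (- h n) k g x)"
      using L2_CS[OF test_fun_L2[OF t] L[of "- h n"]] by simp
    also have "\<dots> \<le> n2 \<phi> * C" using bd[of "- h n"] h by (intro mult_left_mono) auto
    finally show ?thesis by (simp add: mult.commute)
  qed
  ultimately show "\<bar>\<integral>x. pderiv k \<phi> x * g x \<partial>lborel\<bar> \<le> C * n2 \<phi>"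
    by (intro tendsto_upperbound) (auto intro: always_eventually)
qed

text \<open>Admissible right-hand sides: locally in the dual of \<open>W0\<close> under the Dirichlet norm.\<close>
definition adm :: "real \<Rightarrow> (real^'m::finite \<Rightarrow> real) \<Rightarrow> bool" where
  "adm R f \<longleftrightarrow> f \<in> borel_measurable borel \<and> (\<forall>r<R. \<exists>C\<ge>0. \<forall>u d. W0 r u d \<longrightarrow>
     integrable lborel (\<lambda>x. u x * f x) \<and> (\<integral>x. \<bar>u x * f x\<bar> \<partial>lborel) \<le> C * sqrt (En d))"

lemma admD:
  assumes "adm R f" "r < R"
  shows "\<exists>C\<ge>0. \<forall>u d. W0 r u d \<longrightarrow> integrable lborel (\<lambda>x. u x * f x) \<and> (\<integral>x. \<bar>u x * f x\<bar> \<partial>lborel) \<le> C * sqrt (En d)"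
  using assms by (auto simp: adm_def)

lemma adm_integrable: "adm R f \<Longrightarrow> r < R \<Longrightarrow> W0 r u d \<Longrightarrow> integrable lborel (\<lambda>x. u x * f x)"
  using admD by blast

lemma adm_mono: "adm R f \<Longrightarrow> R' \<le> R \<Longrightarrow> adm R' f"
  unfolding adm_def by (meson less_le_trans)

lemma adm_add: fixes f g :: "real^'m::finite \<Rightarrow> real" assumes "adm R f" "adm R g" shows "adm R (\<lambda>x. f x + g x)"
  unfolding adm_def
proof (intro conjI allI impI)
  show "(\<lambda>x. f x + g x) \<in> borel_measurable borel" using assms by (auto simp: adm_def)
  fix r assume r: "r < R"
  obtain C where C: "C \<ge> 0" "\<And>u d. W0 r u d \<Longrightarrow> integrable lborel (\<lambda>x. u x * f x) \<and> (\<integral>x. \<bar>u x * f x\<bar> \<partial>lborel) \<le> C * sqrt (En d)"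
    using admD[OF assms(1) r] by blast
  obtain D where D: "D \<ge> 0" "\<And>u d. W0 r u d \<Longrightarrow> integrable lborel (\<lambda>x. u x * g x) \<and> (\<integral>x. \<bar>u x * g x\<bar> \<partial>lborel) \<le> D * sqrt (En d)"
    using admD[OF assms(2) r] by blast
  show "\<exists>C\<ge>0. \<forall>u d. W0 r u d \<longrightarrow> integrable lborel (\<lambda>x. u x * (f x + g x)) \<and> (\<integral>x. \<bar>u x * (f x + g x)\<bar> \<partial>lborel) \<le> C * sqrt (En d)"
  proof (intro exI[of _ "C + D"] conjI allI impI)
    fix u :: "real^'m \<Rightarrow> real" and d assume W: "W0 r u d"
    have i: "integrable lborel (\<lambda>x. u x * f x)" "integrable lborel (\<lambda>x. u x * g x)" using C(2)[OF W] D(2)[OF W] by auto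
    then show "integrable lborel (\<lambda>x. u x * (f x + g x))" by (simp add: distrib_left)
    have "(\<integral>x. \<bar>u x * (f x + g x)\<bar> \<partial>lborel) \<le> (\<integral>x. \<bar>u x * f x\<bar> + \<bar>u x * g x\<bar> \<partial>lborel)"
      using i by (intro integral_mono) (auto simp: distrib_left)
    also have "\<dots> \<le> C * sqrt (En d) + D * sqrt (En d)" using i C(2)[OF W] D(2)[OF W] by simp
    finally show "(\<integral>x. \<bar>u x * (f x + g x)\<bar> \<partial>lborel) \<le> (C + D) * sqrt (En d)" by (simp add: distrib_right)
  qed (use C D in simp)
qed

lemma adm_bounded_mult:
  fixes f g :: "real^'m::finite \<Rightarrow> real"
  assumes f: "adm R f" and g: "g \<in> borel_measurable borel" "\<And>x. \<bar>g x\<bar> \<le> M"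
  shows "adm R (\<lambda>x. g x * f x)"
  unfolding adm_def
proof (intro conjI allI impI)
  show "(\<lambda>x. g x * f x) \<in> borel_measurable borel" using assms by (auto simp: adm_def)
  have M: "M \<ge> 0" using g(2)[of undefined] by linarith
  fix r assume r: "r < R"
  obtain C where C: "C \<ge> 0" "\<And>u d. W0 r u d \<Longrightarrow> integrable lborel (\<lambda>x. u x * f x) \<and> (\<integral>x. \<bar>u x * f x\<bar> \<partial>lborel) \<le> C * sqrt (En d)"
    using admD[OF f r] by blast
  show "\<exists>C\<ge>0. \<forall>u d. W0 r u d \<longrightarrow> integrable lborel (\<lambda>x. u x * (g x * f x)) \<and> (\<integral>x. \<bar>u x * (g x * f x)\<bar> \<partial>lborel) \<le> C * sqrt (En d)"
  proof (intro exI[of _ "M * C"] conjI allI impI)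
    fix u :: "real^'m \<Rightarrow> real" and d assume W: "W0 r u d"
    have i: "integrable lborel (\<lambda>x. u x * f x)" using C(2)[OF W] by auto
    have i2: "integrable lborel (\<lambda>x. g x * (u x * f x))" by (rule bounded_mult_integrable[OF i g])
    then show "integrable lborel (\<lambda>x. u x * (g x * f x))" by (simp add: mult.left_commute)
    have "(\<integral>x. \<bar>u x * (g x * f x)\<bar> \<partial>lborel) \<le> (\<integral>x. M * \<bar>u x * f x\<bar> \<partial>lborel)"
    proof (rule integral_mono)
      show "\<bar>u x * (g x * f x)\<bar> \<le> M * \<bar>u x * f x\<bar>" for x
        using mult_right_mono[OF g(2)[of x], of "\<bar>u x * f x\<bar>"] by (simp add: abs_mult mult_ac)
    qed (use i i2 in \<open>auto simp: mult.left_commute\<close>)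
    also have "\<dots> \<le> M * (C * sqrt (En d))" using C(2)[OF W] M by (simp add: mult_left_mono)
    finally show "(\<integral>x. \<bar>u x * (g x * f x)\<bar> \<partial>lborel) \<le> M * C * sqrt (En d)" by simp
  qed (use C M in simp)
qed

lemma adm_cmult: "adm R f \<Longrightarrow> adm R (\<lambda>x. c * f x)"
  by (rule adm_bounded_mult[of R f "\<lambda>_. c" "\<bar>c\<bar>"]) auto

lemma adm_zero: "adm R (\<lambda>x. 0)"
  unfolding adm_def by (auto intro!: exI[of _ 0])

lemma adm_diff: "adm R f \<Longrightarrow> adm R g \<Longrightarrow> adm R (\<lambda>x. f x - g x)"
  using adm_add[of R f "\<lambda>x. -1 * g x"] adm_cmult[of R g "-1"] by simp

lemma adm_sum: "(\<And>i. i \<in> I \<Longrightarrow> adm R (f i)) \<Longrightarrow> adm R (\<lambda>x. \<Sum>i\<in>I. f i x)"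
  by (induction I rule: infinite_finite_induct) (auto intro: adm_zero adm_add)

lemma adm_translate:
  fixes a :: "real^'m::finite"
  assumes f: "adm R f" shows "adm (R - norm a) (\<lambda>x. f (x + a))"
  unfolding adm_def
proof (intro conjI allI impI)
  show "(\<lambda>x. f (x + a)) \<in> borel_measurable borel" using f by (auto simp: adm_def)
  fix r assume "r < R - norm a"
  then have r: "r + norm (- a) < R" by simp
  obtain C where C: "C \<ge> 0" "\<And>u d. W0 (r + norm (- a)) u d \<Longrightarrow> integrable lborel (\<lambda>x. u x * f x) \<and> (\<integral>x. \<bar>u x * f x\<bar> \<partial>lborel) \<le> C * sqrt (En d)"
    using admD[OF f r] by blast
  show "\<exists>C\<ge>0. \<forall>u d. W0 r u d \<longrightarrow> integrable lborel (\<lambda>x. u x * f (x + a)) \<and> (\<integral>x. \<bar>u x * f (x + a)\<bar> \<partial>lborel) \<le> C * sqrt (En d)"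
  proof (intro exI[of _ C] conjI allI impI)
    fix u :: "real^'m \<Rightarrow> real" and d assume W: "W0 r u d"
    note W' = C(2)[OF W0_translate[OF W, of "- a"]]
    show "integrable lborel (\<lambda>x. u x * f (x + a))"
      using W' lborel_translate(2)[of "\<lambda>x. u (x + - a) * f x" a] by simp
    show "(\<integral>x. \<bar>u x * f (x + a)\<bar> \<partial>lborel) \<le> C * sqrt (En d)"
      using W' lborel_translate(1)[of "\<lambda>x. \<bar>u (x + - a) * f x\<bar>" a] by (simp add: En_def n2_translate[of _ "- a", simplified])
  qed (use C in simp)
qed

lemma adm_Dq: assumes "adm R f" shows "adm (R - \<bar>h\<bar>) (Dq h k f)"
proof -
  have "adm (R - \<bar>h\<bar>) (\<lambda>x. f (x + h *\<^sub>R axis k 1))"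
    using adm_translate[OF assms, of "h *\<^sub>R axis k 1"] by (simp add: norm_axis_1)
  moreover have "adm (R - \<bar>h\<bar>) f" by (rule adm_mono[OF assms]) simp
  ultimately show ?thesis using adm_cmult[OF adm_diff, of "R - \<bar>h\<bar>" "\<lambda>x. f (x + h *\<^sub>R axis k 1)" f "1/h"]
    by (simp add: Dq_def[abs_def])
qed

section \<open>Products of Sobolev functions as right-hand sides\<close>

lemma L2_prod4:
  fixes a b :: "real^'m \<Rightarrow> real"
  assumes "L2 (\<lambda>x. (a x)\<^sup>2)" "L2 (\<lambda>x. (b x)\<^sup>2)" "a \<in> borel_measurable borel" "b \<in> borel_measurable borel"
  shows "L2 (\<lambda>x. a x * b x)" "(n2 (\<lambda>x. a x * b x))\<^sup>2 \<le> n2 (\<lambda>x. (a x)\<^sup>2) * n2 (\<lambda>x. (b x)\<^sup>2)"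
proof -
  have eq: "(a x * b x)\<^sup>2 = (a x)\<^sup>2 * (b x)\<^sup>2" for x by (simp add: power_mult_distrib)
  show "L2 (\<lambda>x. a x * b x)" unfolding L2_def eq using L2_mult_integrable[OF assms(1,2)] assms(3,4) by auto
  show "(n2 (\<lambda>x. a x * b x))\<^sup>2 \<le> n2 (\<lambda>x. (a x)\<^sup>2) * n2 (\<lambda>x. (b x)\<^sup>2)"
    unfolding n2_sq eq using L2_CS[OF assms(1,2)] by linarith
qed

lemma local_W0:
  fixes u :: "real^'m \<Rightarrow> real"
  assumes dim: "CARD('m::finite) \<le> 4" and u: "\<And>l. wd R l u (d l)" and R: "R \<le> 1" "0 < r" "r < R"
  shows "\<exists>\<theta> r2 e. W0 r2 (\<lambda>x. \<theta> x * u x) e \<and> r2 < 1 \<and> (\<forall>x\<in>ball 0 r. \<theta> x = 1) \<and> L2 (\<lambda>x. (\<theta> x * u x)\<^sup>2)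
     \<and> (\<lambda>x. \<theta> x * u x) \<in> borel_measurable borel"
proof -
  obtain r2 where r2: "r < r2" "r2 < R" using dense R by blast
  obtain \<theta> :: "real^'m \<Rightarrow> real" where \<theta>: "test_fun (ball 0 r2) \<theta>" "\<And>x. x \<in> ball 0 r \<Longrightarrow> \<theta> x = 1"
    using cutoff_exists[OF R(2) r2(1)] by metis
  have "r2 < 1" using r2 R by simp
  have W: "W0 r2 (\<lambda>x. \<theta> x * u x) (\<lambda>l x. pderiv l \<theta> x * u x + \<theta> x * d l x)"
    using W0_cutoff[OF u \<theta>(1)] r2 by simp
  show ?thesis using W \<open>r2 < 1\<close> \<theta>(2) sobolev_W0(1)[OF dim W \<open>r2 < 1\<close>] L2_measurable[OF W0_L2(1)[OF W]] by blast
qed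

text \<open>Hoelder's inequality with exponents 4, 4, 2: the testing function and the cut-off
  \<open>u\<close> are in L4 by Sobolev, and \<open>v\<close> is locally in L2. This covers the
  quadratic terms and, with \<open>v\<close> a product of two unknowns, the cubic ones.\<close>

lemma adm_mult:
  fixes u :: "real^'m \<Rightarrow> real"
  assumes dim: "CARD('m::finite) \<le> 4" and u: "\<And>l. wd R l u (d l)" and R: "R \<le> 1"
    and v: "v \<in> borel_measurable borel" "\<And>r. 0 < r \<Longrightarrow> r < R \<Longrightarrow> L2 (\<lambda>x. indicat_real (ball 0 r) x * v x)"
  shows "adm R (\<lambda>x. u x * v x)"
  unfolding adm_def
proof (intro conjI allI impI)
  show "(\<lambda>x. u x * v x) \<in> borel_measurable borel" using L2_measurable[OF wd_L2(1)[OF u]] v(1) by simp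
  fix r assume r: "r < R"
  show "\<exists>C\<ge>0. \<forall>z e. W0 r z e \<longrightarrow> integrable lborel (\<lambda>x. z x * (u x * v x)) \<and> (\<integral>x. \<bar>z x * (u x * v x)\<bar> \<partial>lborel) \<le> C * sqrt (En e)"
  proof (cases "0 < r")
    case False
    \<comment> \<open>For a nonpositive radius the ball is empty and every \<open>W0\<close>
      function vanishes.\<close>
    have z0: "z x = 0" if "W0 r z e" for z :: "real^'m \<Rightarrow> real" and e x
      using W0_outside(1)[OF that, of x] False norm_ge_zero[of x] by (simp add: not_less del: norm_ge_zero)
    show ?thesis by (intro exI[of _ 0]) (simp add: z0)
  next
    case True
    obtain \<theta> r2 e' where \<theta>: "W0 r2 (\<lambda>x. \<theta> x * u x) e'" "r2 < 1" "\<And>x. x\<in>ball 0 r \<Longrightarrow> \<theta> x = 1"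
       "L2 (\<lambda>x. (\<theta> x * u x)\<^sup>2)" "(\<lambda>x. \<theta> x * u x) \<in> borel_measurable borel"
      using local_W0[OF dim u R True r] by blast
    let ?u = "\<lambda>x. \<theta> x * u x" and ?v = "\<lambda>x. indicat_real (ball 0 r) x * v x"
    note Lv = v(2)[OF True r]
    let ?N = "n2 (\<lambda>x. (?u x)\<^sup>2)"
    show ?thesis
    proof (intro exI[of _ "sqrt (9 * ?N) * n2 ?v"] conjI allI impI)
      fix z :: "real^'m \<Rightarrow> real" and e assume W: "W0 r z e"
      have "r < 1" using r R by simp
      note S = sobolev_W0[OF dim W this]
      note P = L2_prod4[OF S(1) \<theta>(4) L2_measurable[OF W0_L2(1)[OF W]] \<theta>(5)]
      have eq: "z x * (u x * v x) = (z x * ?u x) * ?v x" for x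
        using \<theta>(3)[of x] W0_outside(1)[OF W, of x] by (cases "x \<in> ball 0 r") auto
      show "integrable lborel (\<lambda>x. z x * (u x * v x))" unfolding eq by (rule L2_mult_integrable[OF P(1) Lv])
      have "(n2 (\<lambda>x. z x * ?u x))\<^sup>2 \<le> 9 * ?N * En e"
        using P(2) mult_right_mono[OF S(2), of ?N] by (simp add: mult_ac)
      then have "n2 (\<lambda>x. z x * ?u x) \<le> sqrt (9 * ?N * En e)" by (simp add: real_le_rsqrt)
      also have "\<dots> = sqrt (9 * ?N) * sqrt (En e)" by (rule real_sqrt_mult)
      finally have "n2 (\<lambda>x. z x * ?u x) * n2 ?v \<le> sqrt (9 * ?N) * sqrt (En e) * n2 ?v" by (rule mult_right_mono) simp
      then show "(\<integral>x. \<bar>z x * (u x * v x)\<bar> \<partial>lborel) \<le> sqrt (9 * ?N) * n2 ?v * sqrt (En e)"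
        unfolding eq using L2_CS_abs[OF P(1) Lv] by (simp add: mult_ac)
    qed simp
  qed
qed

lemma L2_local_mult:
  fixes u v :: "real^'m \<Rightarrow> real"
  assumes dim: "CARD('m::finite) \<le> 4" and u: "\<And>l. wd R l u (d l)" and v: "\<And>l. wd R l v (e l)" and R: "R \<le> 1" "0 < r" "r < R"
  shows "L2 (\<lambda>x. indicat_real (ball 0 r) x * (u x * v x))"
proof -
  obtain \<theta> where \<theta>: "\<And>x. x\<in>ball 0 r \<Longrightarrow> \<theta> x = (1::real)" "L2 (\<lambda>x. (\<theta> x * u x)\<^sup>2)" "(\<lambda>x. \<theta> x * u x) \<in> borel_measurable borel"
    using local_W0[OF dim u R] by blast
  obtain \<xi> where \<xi>: "\<And>x. x\<in>ball 0 r \<Longrightarrow> \<xi> x = (1::real)" "L2 (\<lambda>x. (\<xi> x * v x)\<^sup>2)" "(\<lambda>x. \<xi> x * v x) \<in> borel_measurable borel"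
    using local_W0[OF dim v R] by blast
  have "L2 (\<lambda>x. (\<theta> x * u x) * (\<xi> x * v x))" by (rule L2_prod4(1)[OF \<theta>(2) \<xi>(2) \<theta>(3) \<xi>(3)])
  then show ?thesis
  proof (rule L2_dom)
    show "(\<lambda>x. indicat_real (ball 0 r) x * (u x * v x)) \<in> borel_measurable borel"
      by (intro borel_measurable_times borel_measurable_indicator L2_measurable[OF wd_L2(1)[OF u]] L2_measurable[OF wd_L2(1)[OF v]]) simp
    show "\<bar>indicat_real (ball 0 r) x * (u x * v x)\<bar> \<le> \<bar>(\<theta> x * u x) * (\<xi> x * v x)\<bar>" for x
      using \<theta>(1)[of x] \<xi>(1)[of x] by (cases "x \<in> ball 0 r") auto
  qed
qed

text \<open>Weak equations may be tested with \<open>W0\<close> functions: the gradient side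
  converges in L2, and admissibility is exactly the continuity required of the other side.\<close>

lemma extended_testing:
  fixes g :: "'m::finite \<Rightarrow> real^'m \<Rightarrow> real"
  assumes g: "\<And>l. L2 (g l)" and f: "adm R f"
    and eq: "\<And>\<phi>. test_fun (ball 0 R) \<phi> \<Longrightarrow> (\<Sum>l\<in>UNIV. \<integral>x. pderiv l \<phi> x * g l x \<partial>lborel) = - (\<integral>x. \<phi> x * f x \<partial>lborel)"
    and W: "W0 r u d" and r: "r < R"
  shows "(\<Sum>l\<in>UNIV. \<integral>x. d l x * g l x \<partial>lborel) = - (\<integral>x. u x * f x \<partial>lborel)"
proof -
  obtain R' where R': "r < R'" "R' < R" using dense r by blast
  obtain \<phi> where \<phi>: "\<And>n. test_fun (ball 0 R') (\<phi> n)" "(\<lambda>n. n2 (\<lambda>x. \<phi> n x - u x)) \<longlonglongrightarrow> 0"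
      "\<And>l. (\<lambda>n. n2 (\<lambda>x. pderiv l (\<phi> n) x - d l x)) \<longlonglongrightarrow> 0"
    using W0_approx[OF W R'(1)] by blast
  note L = test_fun_L2[OF \<phi>(1)] test_fun_L2[OF test_fun_pderiv[OF \<phi>(1)]] W0_L2[OF W]
  have W': "W0 R' u d" by (rule W0_mono[OF W]) (use R' in simp)
  obtain C where C: "C \<ge> 0" "\<And>u d. W0 R' u d \<Longrightarrow> integrable lborel (\<lambda>x. u x * f x) \<and> (\<integral>x. \<bar>u x * f x\<bar> \<partial>lborel) \<le> C * sqrt (En d)"
    using admD[OF f R'(2)] by blast
  have lim1: "(\<lambda>n. \<Sum>l\<in>UNIV. \<integral>x. pderiv l (\<phi> n) x * g l x \<partial>lborel) \<longlonglongrightarrow> (\<Sum>l\<in>UNIV. \<integral>x. d l x * g l x \<partial>lborel)"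
    by (intro tendsto_sum L2_ip_tendsto[OF L(2) L(4) g \<phi>(3)])
  have lim2: "(\<lambda>n. \<integral>x. \<phi> n x * f x \<partial>lborel) \<longlonglongrightarrow> (\<integral>x. u x * f x \<partial>lborel)"
  proof (rule LIM_zero_cancel, rule Lim_null_comparison)
    show "\<forall>\<^sub>F n in sequentially. norm ((\<integral>x. \<phi> n x * f x \<partial>lborel) - (\<integral>x. u x * f x \<partial>lborel)) \<le> C * sqrt (En (\<lambda>l x. pderiv l (\<phi> n) x - d l x))"
    proof (intro always_eventually allI)
      fix n
      have i: "integrable lborel (\<lambda>x. \<phi> n x * f x)" "integrable lborel (\<lambda>x. u x * f x)"
        using C(2)[OF test_fun_W0[OF \<phi>(1)]] C(2)[OF W'] by auto
      have "(\<integral>x. \<phi> n x * f x \<partial>lborel) - (\<integral>x. u x * f x \<partial>lborel) = (\<integral>x. (\<phi> n x - u x) * f x \<partial>lborel)"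
        using i by (simp add: left_diff_distrib)
      also have "norm \<dots> \<le> (\<integral>x. \<bar>(\<phi> n x - u x) * f x\<bar> \<partial>lborel)"
        using integral_norm_bound[of lborel "\<lambda>x. (\<phi> n x - u x) * f x"] by simp
      also have "\<dots> \<le> C * sqrt (En (\<lambda>l x. pderiv l (\<phi> n) x - d l x))"
        using C(2)[OF W0_diff[OF test_fun_W0[OF \<phi>(1)] W']] by blast
      finally show "norm ((\<integral>x. \<phi> n x * f x \<partial>lborel) - (\<integral>x. u x * f x \<partial>lborel)) \<le> C * sqrt (En (\<lambda>l x. pderiv l (\<phi> n) x - d l x))" .
    qed
    have "(\<lambda>n. En (\<lambda>l x. pderiv l (\<phi> n) x - d l x)) \<longlonglongrightarrow> (\<Sum>l\<in>(UNIV::'m set). 0\<^sup>2)"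
      unfolding En_def by (intro tendsto_sum tendsto_power \<phi>(3))
    from tendsto_mult_right_zero[OF tendsto_real_sqrt[OF this, simplified]]
    show "(\<lambda>n. C * sqrt (En (\<lambda>l x. pderiv l (\<phi> n) x - d l x))) \<longlonglongrightarrow> 0" by simp
  qed
  have "test_fun (ball 0 R) (\<phi> n)" for n by (rule test_fun_ball_mono[OF \<phi>(1)]) (use R' in simp)
  from eq[OF this] have "(\<lambda>n. \<Sum>l\<in>UNIV. \<integral>x. pderiv l (\<phi> n) x * g l x \<partial>lborel) = (\<lambda>n. - (\<integral>x. \<phi> n x * f x \<partial>lborel))" by auto
  then show ?thesis using LIMSEQ_unique[OF lim1] tendsto_minus[OF lim2] by simp
qed

section \<open>One step of the bootstrap\<close>

text \<open>This class of nonlinearities is closed under differentiation once the derivatives of the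
  unknowns are themselves added to the unknowns.\<close>
inductive NL :: "(real^'m::finite \<Rightarrow> real) set \<Rightarrow> ((real^'m \<Rightarrow> real) \<Rightarrow> 'm \<Rightarrow> real^'m \<Rightarrow> real) \<Rightarrow> (real^'m \<Rightarrow> real) \<Rightarrow> bool"
  for U d where
  zero: "NL U d (\<lambda>x. 0)"
| add: "NL U d f \<Longrightarrow> NL U d g \<Longrightarrow> NL U d (\<lambda>x. f x + g x)"
| cmult: "NL U d f \<Longrightarrow> NL U d (\<lambda>x. c * f x)"
| quad: "u \<in> U \<Longrightarrow> v \<in> U \<Longrightarrow> NL U d (\<lambda>x. u x * d v l x)"
| cub: "u \<in> U \<Longrightarrow> v \<in> U \<Longrightarrow> w \<in> U \<Longrightarrow> NL U d (\<lambda>x. u x * v x * w x)"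

lemma NL_adm:
  fixes U :: "(real^'m::finite \<Rightarrow> real) set"
  assumes dim: "CARD('m) \<le> 4" and wd: "\<And>u l. u \<in> U \<Longrightarrow> wd R l u (d u l)" and R: "R \<le> 1"
    and "NL U d f"
  shows "adm R f"
  using assms(4)
proof induction
  case (quad u v l)
  have v: "L2 (d v l)" by (rule wd_L2(2)[OF wd[OF quad(2)]])
  show ?case
    by (rule adm_mult[OF dim wd[OF quad(1)] R L2_measurable[OF v]])
       (rule L2_bounded_mult[OF v, of _ 1]; auto simp: indicator_def)
next
  case (cub u v w)
  have m: "(\<lambda>x. v x * w x) \<in> borel_measurable borel"
    using L2_measurable[OF wd_L2(1)[OF wd[OF cub(2)]]] L2_measurable[OF wd_L2(1)[OF wd[OF cub(3)]]] by simp
  show ?case unfolding mult.assoc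
    by (rule adm_mult[OF dim wd[OF cub(1)] R m]) (rule L2_local_mult[OF dim wd[OF cub(2)] wd[OF cub(3)] R])
qed (auto intro: adm_zero adm_add adm_cmult)

section \<open>The a priori estimate for difference quotients\<close>

locale step_setup =
  fixes U :: "(real^'m::finite \<Rightarrow> real) set" and d :: "(real^'m \<Rightarrow> real) \<Rightarrow> 'm \<Rightarrow> real^'m \<Rightarrow> real"
    and R r1 \<delta> :: real and k :: 'm and \<eta> :: "real^'m \<Rightarrow> real"
  assumes dim: "CARD('m) \<le> 4" and fin: "finite U" and wd: "\<And>u l. u \<in> U \<Longrightarrow> wd R l u (d u l)"
    and R1: "R \<le> 1" and r1: "0 < r1" and \<delta>: "0 < \<delta>" and r1\<delta>: "r1 + \<delta> < R" and \<eta>: "test_fun (ball 0 r1) \<eta>"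
begin

definition W :: "real \<Rightarrow> (real^'m \<Rightarrow> real) \<Rightarrow> real^'m \<Rightarrow> real" where
  "W h u x = \<eta> x * Dq h k u x"

definition dW :: "real \<Rightarrow> (real^'m \<Rightarrow> real) \<Rightarrow> 'm \<Rightarrow> real^'m \<Rightarrow> real" where
  "dW h u l x = pderiv l \<eta> x * Dq h k u x + \<eta> x * Dq h k (d u l) x"

text \<open>All unknowns are summed because the equation of each one involves the others; smallness
  relative to a single energy would not close the estimate.\<close>

definition E :: "real \<Rightarrow> real" where "E h = (\<Sum>u\<in>U. En (dW h u))"

text \<open>The nonzero steps whose shifts keep the ball of radius \<open>r1\<close> inside the ball
  of radius \<open>r1 + \<delta>\<close>, still within the domain of the equation.\<close>

definition ok :: "real \<Rightarrow> bool" where "ok h \<longleftrightarrow> h \<noteq> 0 \<and> \<bar>h\<bar> < \<delta>"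

lemma E_nonneg: "E h \<ge> 0" unfolding E_def by (intro sum_nonneg En_nonneg)

lemma En_le_E: "u \<in> U \<Longrightarrow> En (dW h u) \<le> E h"
  unfolding E_def by (rule member_le_sum) (auto simp: En_nonneg fin)

lemma W_W0: assumes "u \<in> U" "ok h" shows "W0 r1 (W h u) (dW h u)"
proof -
  have "r1 \<le> R - \<bar>h\<bar>" using assms(2) r1\<delta> by (simp add: ok_def)
  then show ?thesis
    using W0_cutoff[OF wd_Dq[OF wd[OF assms(1)]] \<eta>] by (simp add: W_def[abs_def] dW_def[abs_def])
qed

lemma r1_lt: "r1 < 1" using R1 r1\<delta> \<delta> by linarith

lemma Dq_bound:
  assumes "test_fun (ball 0 r1) \<zeta>"
  shows "\<exists>C\<ge>0. \<forall>h u. u \<in> U \<longrightarrow> ok h \<longrightarrow> n2 (\<lambda>x. \<zeta> x * Dq h k u x) \<le> C"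
proof -
  have "\<forall>u\<in>U. \<exists>C\<ge>0. \<forall>h. h \<noteq> 0 \<longrightarrow> \<bar>h\<bar> < \<delta> \<longrightarrow> n2 (\<lambda>x. \<zeta> x * Dq h k u x) \<le> C"
    using dq_local_bound[OF wd r1 r1\<delta> \<delta> assms] by blast
  from bchoice[OF this] obtain C where C: "\<And>u. u \<in> U \<Longrightarrow> C u \<ge> 0"
    "\<And>u h. u \<in> U \<Longrightarrow> h \<noteq> 0 \<Longrightarrow> \<bar>h\<bar> < \<delta> \<Longrightarrow> n2 (\<lambda>x. \<zeta> x * Dq h k u x) \<le> C u" by blast
  have "n2 (\<lambda>x. \<zeta> x * Dq h k u x) \<le> sum C U" if "u \<in> U" "ok h" for u h
  proof -
    have "C u \<le> sum C U" by (rule member_le_sum) (auto simp: fin that C(1))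
    then show ?thesis using C(2)[OF that(1)] that(2) by (force simp: ok_def)
  qed
  moreover have "sum C U \<ge> 0" by (intro sum_nonneg C(1))
  ultimately show ?thesis by blast
qed

text \<open>Absorbable terms: an arbitrarily small part of the total energy plus a constant that
  does not depend on the step.\<close>

definition good :: "(real \<Rightarrow> real^'m \<Rightarrow> real) \<Rightarrow> bool" where
  "good G \<longleftrightarrow> (\<forall>e>0. \<exists>C. \<forall>h. ok h \<longrightarrow> integrable lborel (G h) \<and> (\<integral>x. \<bar>G h x\<bar> \<partial>lborel) \<le> e * E h + C)"

lemma goodD: "good G \<Longrightarrow> e > 0 \<Longrightarrow> \<exists>C. \<forall>h. ok h \<longrightarrow> integrable lborel (G h) \<and> (\<integral>x. \<bar>G h x\<bar> \<partial>lborel) \<le> e * E h + C"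
  by (simp add: good_def)

lemma good_zero: "good (\<lambda>h x. 0)"
  unfolding good_def using E_nonneg by (auto intro!: exI[of _ 0])

lemma good_add: assumes "good G" "good H" shows "good (\<lambda>h x. G h x + H h x)"
  unfolding good_def
proof (intro allI impI)
  fix e :: real assume e: "e > 0"
  then have e2: "e / 2 > 0" by simp
  obtain C where C: "\<And>h. ok h \<Longrightarrow> integrable lborel (G h) \<and> (\<integral>x. \<bar>G h x\<bar> \<partial>lborel) \<le> e/2 * E h + C"
    using goodD[OF assms(1) e2] by blast
  obtain D where D: "\<And>h. ok h \<Longrightarrow> integrable lborel (H h) \<and> (\<integral>x. \<bar>H h x\<bar> \<partial>lborel) \<le> e/2 * E h + D"
    using goodD[OF assms(2) e2] by blast
  show "\<exists>C. \<forall>h. ok h \<longrightarrow> integrable lborel (\<lambda>x. G h x + H h x) \<and> (\<integral>x. \<bar>G h x + H h x\<bar> \<partial>lborel) \<le> e * E h + C"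
  proof (intro exI[of _ "C + D"] allI impI conjI)
    fix h assume h: "ok h"
    have i: "integrable lborel (G h)" "integrable lborel (H h)" using C[OF h] D[OF h] by auto
    then show "integrable lborel (\<lambda>x. G h x + H h x)" by simp
    have "(\<integral>x. \<bar>G h x + H h x\<bar> \<partial>lborel) \<le> (\<integral>x. \<bar>G h x\<bar> + \<bar>H h x\<bar> \<partial>lborel)"
      using i by (intro integral_mono) auto
    also have "\<dots> \<le> (e/2 * E h + C) + (e/2 * E h + D)" using i C[OF h] D[OF h] by simp
    finally show "(\<integral>x. \<bar>G h x + H h x\<bar> \<partial>lborel) \<le> e * E h + (C + D)" by simp
  qed
qed

lemma good_dom:
  assumes "good H" "\<And>h. ok h \<Longrightarrow> G h \<in> borel_measurable borel" "\<And>h x. ok h \<Longrightarrow> \<bar>G h x\<bar> \<le> \<bar>H h x\<bar>"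
  shows "good G"
  unfolding good_def
proof (intro allI impI)
  fix e :: real assume e: "e > 0"
  obtain C where C: "\<And>h. ok h \<Longrightarrow> integrable lborel (H h) \<and> (\<integral>x. \<bar>H h x\<bar> \<partial>lborel) \<le> e * E h + C"
    using goodD[OF assms(1) e] by blast
  show "\<exists>C. \<forall>h. ok h \<longrightarrow> integrable lborel (G h) \<and> (\<integral>x. \<bar>G h x\<bar> \<partial>lborel) \<le> e * E h + C"
  proof (intro exI[of _ C] allI impI conjI)
    fix h assume h: "ok h"
    have i: "integrable lborel (H h)" using C[OF h] by auto
    show i2: "integrable lborel (G h)"
      by (rule Bochner_Integration.integrable_bound[OF i]) (use assms(2,3)[OF h] in auto)
    have "(\<integral>x. \<bar>G h x\<bar> \<partial>lborel) \<le> (\<integral>x. \<bar>H h x\<bar> \<partial>lborel)"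
      using i i2 assms(3)[OF h] by (intro integral_mono) auto
    then show "(\<integral>x. \<bar>G h x\<bar> \<partial>lborel) \<le> e * E h + C" using C[OF h] by linarith
  qed
qed

lemma good_cmult: assumes "good G" shows "good (\<lambda>h x. c * G h x)"
  unfolding good_def
proof (intro allI impI)
  fix e :: real assume e: "e > 0"
  then have e2: "e / (\<bar>c\<bar> + 1) > 0" by (intro divide_pos_pos) auto
  obtain C where C: "\<And>h. ok h \<Longrightarrow> integrable lborel (G h) \<and> (\<integral>x. \<bar>G h x\<bar> \<partial>lborel) \<le> e / (\<bar>c\<bar> + 1) * E h + C"
    using goodD[OF assms e2] by blast
  show "\<exists>C. \<forall>h. ok h \<longrightarrow> integrable lborel (\<lambda>x. c * G h x) \<and> (\<integral>x. \<bar>c * G h x\<bar> \<partial>lborel) \<le> e * E h + C"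
  proof (intro exI[of _ "(\<bar>c\<bar> + 1) * \<bar>C\<bar>"] allI impI conjI)
    fix h assume h: "ok h"
    show "integrable lborel (\<lambda>x. c * G h x)" using C[OF h] by simp
    have I: "(\<integral>x. \<bar>G h x\<bar> \<partial>lborel) \<ge> 0" by simp
    have "(\<integral>x. \<bar>c * G h x\<bar> \<partial>lborel) = \<bar>c\<bar> * (\<integral>x. \<bar>G h x\<bar> \<partial>lborel)" by (simp add: abs_mult)
    also have "\<dots> \<le> (\<bar>c\<bar> + 1) * (\<integral>x. \<bar>G h x\<bar> \<partial>lborel)" by (intro mult_right_mono I) simp
    also have "\<dots> \<le> (\<bar>c\<bar> + 1) * (e / (\<bar>c\<bar> + 1) * E h + \<bar>C\<bar>)" using C[OF h] by (intro mult_left_mono) auto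
    also have "\<dots> = e * E h + (\<bar>c\<bar> + 1) * \<bar>C\<bar>"
    proof -
      have "\<bar>c\<bar> + 1 \<noteq> 0" by linarith
      then show ?thesis by (simp add: distrib_left)
    qed
    finally show "(\<integral>x. \<bar>c * G h x\<bar> \<partial>lborel) \<le> e * E h + (\<bar>c\<bar> + 1) * \<bar>C\<bar>" .
  qed
qed

text \<open>\<open>absorb\<close> applied to one unknown; the remaining L2 norm of
  \<open>W h w\<close> is bounded independently of the step because \<open>w\<close> has weak
  derivatives. The shift \<open>a h\<close> may vary with the step.\<close>

lemma good_base:
  assumes p: "L2 p" and w: "w \<in> U"
  shows "good (\<lambda>h x. \<bar>p (x + a h)\<bar> * (W h w x)\<^sup>2)"
  unfolding good_def
proof (intro allI impI)
  fix e :: real assume e: "e > 0"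
  obtain C where C: "C \<ge> 0" "\<forall>r u d h. W0 r u d \<longrightarrow> r < 1 \<longrightarrow> integrable lborel (\<lambda>x. \<bar>p (x + h)\<bar> * (u x)\<^sup>2) \<and>
     (\<integral>x. \<bar>p (x + h)\<bar> * (u x)\<^sup>2 \<partial>lborel) \<le> e * En d + C * (n2 u)\<^sup>2" using absorb[OF dim p e] by blast
  obtain B where B: "B \<ge> 0" "\<And>h u. u \<in> U \<Longrightarrow> ok h \<Longrightarrow> n2 (\<lambda>x. \<eta> x * Dq h k u x) \<le> B" using Dq_bound[OF \<eta>] by blast
  show "\<exists>C. \<forall>h. ok h \<longrightarrow> integrable lborel (\<lambda>x. \<bar>p (x + a h)\<bar> * (W h w x)\<^sup>2) \<and>
     (\<integral>x. \<bar>\<bar>p (x + a h)\<bar> * (W h w x)\<^sup>2\<bar> \<partial>lborel) \<le> e * E h + C"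
  proof (intro exI[of _ "C * B\<^sup>2"] allI impI conjI)
    fix h assume h: "ok h"
    note K = C(2)[rule_format, OF W_W0[OF w h] r1_lt, of "a h"]
    show "integrable lborel (\<lambda>x. \<bar>p (x + a h)\<bar> * (W h w x)\<^sup>2)" using K by blast
    have "(\<integral>x. \<bar>\<bar>p (x + a h)\<bar> * (W h w x)\<^sup>2\<bar> \<partial>lborel) = (\<integral>x. \<bar>p (x + a h)\<bar> * (W h w x)\<^sup>2 \<partial>lborel)"
      by (simp add: abs_mult)
    also have "\<dots> \<le> e * En (dW h w) + C * (n2 (W h w))\<^sup>2" using K by blast
    also have "\<dots> \<le> e * E h + C * B\<^sup>2"
      using En_le_E[OF w, of h] B(2)[OF w h] e C(1)
      by (intro add_mono mult_left_mono power_mono) (auto simp: W_def[abs_def])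
    finally show "(\<integral>x. \<bar>\<bar>p (x + a h)\<bar> * (W h w x)\<^sup>2\<bar> \<partial>lborel) \<le> e * E h + C * B\<^sup>2" .
  qed
qed

text \<open>The product estimates ask for squares in L2 on the whole space; a cutoff provides this
  without changing \<open>u\<close> on the ball that shifts can reach.\<close>

lemma local_rep:
  assumes "u \<in> U"
  shows "\<exists>v. v \<in> borel_measurable borel \<and> L2 (\<lambda>x. (v x)\<^sup>2) \<and> (\<forall>x\<in>ball 0 (r1 + \<delta>). v x = u x)"
proof -
  have "0 < r1 + \<delta>" using r1 \<delta> by simp
  from local_W0[OF dim wd[OF assms] R1 this r1\<delta>]
  obtain \<theta> where "\<And>x. x \<in> ball 0 (r1 + \<delta>) \<Longrightarrow> \<theta> x = 1" "L2 (\<lambda>x. (\<theta> x * u x)\<^sup>2)" "(\<lambda>x. \<theta> x * u x) \<in> borel_measurable borel"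
    by blast
  then show ?thesis by (intro exI[of _ "\<lambda>x. \<theta> x * u x"]) auto
qed

lemma W_outside: "x \<notin> ball 0 r1 \<Longrightarrow> W h u x = 0"
  using test_fun_outside(1)[OF \<eta>] by (simp add: W_def)

lemma shift_in: fixes x :: "real^'m" assumes "x \<in> ball 0 r1" "ok h" shows "x + h *\<^sub>R axis k 1 \<in> ball 0 (r1 + \<delta>)" "x \<in> ball 0 (r1 + \<delta>)"
proof -
  have "norm (x + h *\<^sub>R axis k 1) \<le> norm x + \<bar>h\<bar>"
    using norm_triangle_ineq[of x "h *\<^sub>R axis k 1"] by (simp add: norm_axis_1)
  then show "x + h *\<^sub>R axis k 1 \<in> ball 0 (r1 + \<delta>)" "x \<in> ball 0 (r1 + \<delta>)" using assms \<delta> by (auto simp: ok_def)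
qed

lemma L2_U: "u \<in> U \<Longrightarrow> L2 u" "u \<in> U \<Longrightarrow> L2 (d u l)" using wd wd_L2 by blast+

lemma W_measurable: "u \<in> U \<Longrightarrow> ok h \<Longrightarrow> W h u \<in> borel_measurable borel"
  using W_W0 W0_L2(1) L2_measurable by blast

lemma \<eta>_measurable: "\<eta> \<in> borel_measurable borel" by (rule smooth_measurable[OF test_fun_smooth[OF \<eta>]])

text \<open>Bounding each product by squares separates the two differenced factors from the two
  coefficients and leaves terms for \<open>good_base\<close> with the L2 coefficients
  \<open>p^2\<close> and \<open>q^2\<close>.\<close>

lemma good_cub:
  assumes w: "w1 \<in> U" "w2 \<in> U" and p: "L2 (\<lambda>x. (p x)\<^sup>2)" and q: "L2 (\<lambda>x. (q x)\<^sup>2)"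
    and m: "\<And>h. ok h \<Longrightarrow> G h \<in> borel_measurable borel"
    and bd: "\<And>h x. ok h \<Longrightarrow> \<bar>G h x\<bar> \<le> \<bar>W h w1 x * W h w2 x\<bar> * \<bar>p (x + a h) * q (x + b h)\<bar>"
  shows "good G"
proof (rule good_dom[OF _ m])
  let ?P = "\<lambda>h x. \<bar>(p (x + a h))\<^sup>2\<bar>" and ?Q = "\<lambda>h x. \<bar>(q (x + b h))\<^sup>2\<bar>"
  show "good (\<lambda>h x. (?P h x * (W h w1 x)\<^sup>2 + ?P h x * (W h w2 x)\<^sup>2) + (?Q h x * (W h w1 x)\<^sup>2 + ?Q h x * (W h w2 x)\<^sup>2))"
    by (intro good_add good_base[OF p] good_base[OF q] w)
  fix h x assume h: "ok h"
  have "\<bar>G h x\<bar> \<le> \<bar>W h w1 x * W h w2 x\<bar> * \<bar>p (x + a h) * q (x + b h)\<bar>" by (rule bd[OF h])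
  also have "\<dots> \<le> ((W h w1 x)\<^sup>2 + (W h w2 x)\<^sup>2) * ((p (x + a h))\<^sup>2 + (q (x + b h))\<^sup>2)"
    by (intro mult_mono abs_mult_le_sq) auto
  also have "\<dots> = (?P h x * (W h w1 x)\<^sup>2 + ?P h x * (W h w2 x)\<^sup>2) + (?Q h x * (W h w1 x)\<^sup>2 + ?Q h x * (W h w2 x)\<^sup>2)"
    by (simp add: algebra_simps)
  also have "\<dots> \<le> \<bar>\<dots>\<bar>" by simp
  finally show "\<bar>G h x\<bar> \<le> \<bar>(?P h x * (W h w1 x)\<^sup>2 + ?P h x * (W h w2 x)\<^sup>2) + (?Q h x * (W h w1 x)\<^sup>2 + ?Q h x * (W h w2 x)\<^sup>2)\<bar>" .
qed

lemma good_quad1: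
  assumes w: "w \<in> U" "u \<in> U" "v \<in> U"
  shows "good (\<lambda>h x. W h w x * W h u x * d v l (x + h *\<^sub>R axis k 1))"
proof (rule good_dom)
  let ?P = "\<lambda>h x. \<bar>d v l (x + h *\<^sub>R axis k 1)\<bar>"
  show "good (\<lambda>h x. ?P h x * (W h w x)\<^sup>2 + ?P h x * (W h u x)\<^sup>2)"
    by (intro good_add good_base L2_U w)
  fix h x assume h: "ok h"
  have "\<bar>W h w x * W h u x\<bar> * ?P h x \<le> ((W h w x)\<^sup>2 + (W h u x)\<^sup>2) * ?P h x"
    by (intro mult_right_mono abs_mult_le_sq) auto
  then show "\<bar>W h w x * W h u x * d v l (x + h *\<^sub>R axis k 1)\<bar> \<le> \<bar>?P h x * (W h w x)\<^sup>2 + ?P h x * (W h u x)\<^sup>2\<bar>"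
    by (simp add: abs_mult algebra_simps)
next
  fix h assume h: "ok h"
  show "(\<lambda>x. W h w x * W h u x * d v l (x + h *\<^sub>R axis k 1)) \<in> borel_measurable borel"
    by (intro borel_measurable_times W_measurable w h L2_measurable[OF L2_translate[OF L2_U(2)]])
qed

text \<open>Here the difference quotient falls on a derivative, a factor whose square is comparable
  to the energy. Young's inequality pairs it with \<open>W h w * u\<close>, whose square has the L2
  coefficient \<open>u^2\<close> and is absorbable with any small factor.\<close>

lemma good_quad2:
  assumes w: "w \<in> U" "u \<in> U" "v \<in> U"
  shows "good (\<lambda>h x. W h w x * u x * (\<eta> x * Dq h k (d v l) x))"
  unfolding good_def
proof (intro allI impI)
  fix e :: real assume e: "e > 0"
  obtain u' where u': "u' \<in> borel_measurable borel" "L2 (\<lambda>x. (u' x)\<^sup>2)" "\<And>x. x\<in>ball 0 (r1 + \<delta>) \<Longrightarrow> u' x = u x"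
    using local_rep[OF w(2)] by blast
  \<comment> \<open>Two halves of \<open>e\<close>: the bound \<open>2 * E h\<close> multiplied by
    \<open>s\<close> gives \<open>e / 2\<close>, and the smallness \<open>s * (e / 2)\<close>
    requested below is divided by \<open>s\<close> in Young's inequality.\<close>
  define s where "s = e / 4"
  have s: "s > 0" using e by (simp add: s_def)
  have "s * (e / 2) > 0" using s e by simp
  from goodD[OF good_base[OF u'(2) w(1), of "\<lambda>h. 0"] this]
  obtain C where C: "\<And>h. ok h \<Longrightarrow> integrable lborel (\<lambda>x. \<bar>(u' (x + 0))\<^sup>2\<bar> * (W h w x)\<^sup>2)"
     "\<And>h. ok h \<Longrightarrow> (\<integral>x. \<bar>\<bar>(u' (x + 0))\<^sup>2\<bar> * (W h w x)\<^sup>2\<bar> \<partial>lborel) \<le> s * (e / 2) * E h + C" by blast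
  obtain B where B: "B \<ge> 0" "\<And>h u. u \<in> U \<Longrightarrow> ok h \<Longrightarrow> n2 (\<lambda>x. pderiv l \<eta> x * Dq h k u x) \<le> B"
    using Dq_bound[OF test_fun_pderiv[OF \<eta>, of l]] by blast
  let ?S = "\<lambda>h x. W h w x * u x * (\<eta> x * Dq h k (d v l) x)"
  show "\<exists>C. \<forall>h. ok h \<longrightarrow> integrable lborel (?S h) \<and> (\<integral>x. \<bar>?S h x\<bar> \<partial>lborel) \<le> e * E h + C"
  proof (intro exI[of _ "C / s + s * (2 * B\<^sup>2)"] allI impI)
    fix h assume h: "ok h"
    let ?a = "\<lambda>x. W h w x * u' x" and ?b = "\<lambda>x. \<eta> x * Dq h k (d v l) x"
    have eqa: "(?a x)\<^sup>2 = \<bar>\<bar>(u' (x + 0))\<^sup>2\<bar> * (W h w x)\<^sup>2\<bar>" for x by (simp add: power_mult_distrib mult.commute)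
    have a: "L2 ?a" unfolding L2_def eqa using C(1)[OF h] W_measurable[OF w(1) h] u'(1) by auto
    have a2: "(n2 ?a)\<^sup>2 \<le> s * (e / 2) * E h + C" unfolding n2_sq eqa by (rule C(2)[OF h])
    have b: "L2 ?b" by (rule L2_smooth_test[OF L2_Dq[OF L2_U(2)[OF w(3)]] \<eta>])
    let ?z = "\<lambda>x. pderiv l \<eta> x * Dq h k v x"
    have z: "L2 ?z" by (rule L2_smooth_test[OF L2_Dq[OF L2_U(1)[OF w(3)]] test_fun_pderiv[OF \<eta>]])
    have dWL: "L2 (dW h v l)" by (rule W0_L2(2)[OF W_W0[OF w(3) h]])
    have "?b = (\<lambda>x. dW h v l x - ?z x)" by (simp add: dW_def)
    then have "n2 ?b \<le> n2 (dW h v l) + n2 ?z" using n2_diff[OF dWL z] by simp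
    also have "\<dots> \<le> sqrt (E h) + B"
      using B(2)[OF w(3) h] n2_le_En[of "dW h v" l] En_le_E[OF w(3), of h] by (intro add_mono) (auto intro: order_trans)
    finally have "(n2 ?b)\<^sup>2 \<le> (sqrt (E h) + B)\<^sup>2" by (rule power_mono) simp
    also have "\<dots> \<le> 2 * E h + 2 * B\<^sup>2"
      using sum_squares_bound[of "sqrt (E h)" B] E_nonneg[of h] by (simp add: power2_sum)
    finally have b2: "(n2 ?b)\<^sup>2 \<le> 2 * E h + 2 * B\<^sup>2" .
    have eqS: "?S h x = ?a x * ?b x" for x
      using u'(3)[of x] shift_in(2)[OF _ h, of x] W_outside[of x h w] by (cases "x \<in> ball 0 r1") auto
    have iS: "integrable lborel (?S h)" unfolding eqS by (rule L2_mult_integrable[OF a b])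
    moreover have "(\<integral>x. \<bar>?S h x\<bar> \<partial>lborel) \<le> e * E h + (C / s + s * (2 * B\<^sup>2))"
    proof -
      have "(\<integral>x. \<bar>?S h x\<bar> \<partial>lborel) \<le> (\<integral>x. (?a x)\<^sup>2 / s + s * (?b x)\<^sup>2 \<partial>lborel)"
      proof (rule integral_mono)
        fix x
        have "\<bar>?a x * ?b x\<bar> = \<bar>(?a x / sqrt s) * (sqrt s * ?b x)\<bar>" using s by simp
        also have "\<dots> \<le> (?a x / sqrt s)\<^sup>2 + (sqrt s * ?b x)\<^sup>2" by (rule abs_mult_le_sq)
        also have "\<dots> = (?a x)\<^sup>2 / s + s * (?b x)\<^sup>2" using s unfolding power_divide power_mult_distrib by simp
        finally show "\<bar>?S h x\<bar> \<le> (?a x)\<^sup>2 / s + s * (?b x)\<^sup>2" unfolding eqS .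
      qed (use iS L2_sq[OF a] L2_sq[OF b] in auto)
      also have "\<dots> = (n2 ?a)\<^sup>2 / s + s * (n2 ?b)\<^sup>2"
        unfolding n2_sq using L2_sq[OF a] L2_sq[OF b] by (subst Bochner_Integration.integral_add) auto
      also have "\<dots> \<le> (s * (e / 2) * E h + C) / s + s * (2 * E h + 2 * B\<^sup>2)"
        using a2 b2 s by (intro add_mono divide_right_mono mult_left_mono) auto
      also have "\<dots> = e * E h + (C / s + s * (2 * B\<^sup>2))"
        using s by (simp add: add_divide_distrib distrib_left) (simp add: s_def)
      finally show ?thesis .
    qed
    ultimately show "integrable lborel (?S h) \<and> (\<integral>x. \<bar>?S h x\<bar> \<partial>lborel) \<le> e * E h + (C / s + s * (2 * B\<^sup>2))" ..
  qed
qed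

text \<open>Discrete Leibniz rule. The testing function \<open>\<eta> * W h z\<close> carries the
  cutoff twice; the extra \<open>\<eta>\<close> is spent on the second differenced factor, so that
  both differenced factors in every product are cut off.\<close>

lemma good_NL:
  assumes "NL U d f" and z: "z \<in> U"
  shows "good (\<lambda>h x. \<eta> x * W h z x * Dq h k f x)"
  using assms(1)
proof induction
  case zero
  then show ?case by (simp add: Dq_def good_zero)
next
  case (add f g)
  have "(\<lambda>h x. \<eta> x * W h z x * Dq h k (\<lambda>x. f x + g x) x) = (\<lambda>h x. \<eta> x * W h z x * Dq h k f x + \<eta> x * W h z x * Dq h k g x)"
    by (simp add: Dq_def fun_eq_iff add_divide_distrib[symmetric] distrib_left[symmetric])
  then show ?case using good_add[OF add.IH] by simp
next
  case (cmult f c)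
  have "(\<lambda>h x. \<eta> x * W h z x * Dq h k (\<lambda>x. c * f x) x) = (\<lambda>h x. c * (\<eta> x * W h z x * Dq h k f x))"
    by (simp add: Dq_def fun_eq_iff right_diff_distrib[symmetric])
  then show ?case using good_cmult[OF cmult.IH] by simp
next
  case (quad u v l)
  have "(\<lambda>h x. \<eta> x * W h z x * Dq h k (\<lambda>x. u x * d v l x) x)
     = (\<lambda>h x. W h z x * W h u x * d v l (x + h *\<^sub>R axis k 1) + W h z x * u x * (\<eta> x * Dq h k (d v l) x))"
    by (simp add: Dq_mult fun_eq_iff W_def algebra_simps)
  then show ?case using good_add[OF good_quad1[OF z quad] good_quad2[OF z quad]] by simp
next
  case (cub u v w)
  obtain u' where u': "u' \<in> borel_measurable borel" "L2 (\<lambda>x. (u' x)\<^sup>2)" "\<And>x. x\<in>ball 0 (r1 + \<delta>) \<Longrightarrow> u' x = u x"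
    using local_rep[OF cub(1)] by blast
  obtain v' where v': "v' \<in> borel_measurable borel" "L2 (\<lambda>x. (v' x)\<^sup>2)" "\<And>x. x\<in>ball 0 (r1 + \<delta>) \<Longrightarrow> v' x = v x"
    using local_rep[OF cub(2)] by blast
  obtain w' where w': "w' \<in> borel_measurable borel" "L2 (\<lambda>x. (w' x)\<^sup>2)" "\<And>x. x\<in>ball 0 (r1 + \<delta>) \<Longrightarrow> w' x = w x"
    using local_rep[OF cub(3)] by blast
  let ?t = "\<lambda>h. h *\<^sub>R axis k 1 :: real^'m"
  have m: "u \<in> borel_measurable borel" "v \<in> borel_measurable borel" "w \<in> borel_measurable borel"
    "(\<lambda>x. v (x + a)) \<in> borel_measurable borel" "(\<lambda>x. w (x + a)) \<in> borel_measurable borel" for a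
    using L2_U(1)[OF cub(1)] L2_U(1)[OF cub(2)] L2_U(1)[OF cub(3)] L2_translate L2_measurable by blast+
  have g1: "good (\<lambda>h x. W h z x * W h u x * (v (x + ?t h) * w (x + ?t h)))"
  proof (rule good_cub[OF z cub(1) v'(2) w'(2)])
    show "\<bar>W h z x * W h u x * (v (x + ?t h) * w (x + ?t h))\<bar> \<le> \<bar>W h z x * W h u x\<bar> * \<bar>v' (x + ?t h) * w' (x + ?t h)\<bar>"
      if "ok h" for h x
      using that v'(3)[of "x + ?t h"] w'(3)[of "x + ?t h"] shift_in(1)[of x h] W_outside[of x h z]
      by (cases "x \<in> ball 0 r1") (auto simp: abs_mult)
  qed (intro borel_measurable_times W_measurable z cub m)
  have g2: "good (\<lambda>h x. W h z x * W h v x * (u x * w (x + ?t h)))"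
  proof (rule good_cub[OF z cub(2) u'(2) w'(2), where a = "\<lambda>_. 0"])
    show "\<bar>W h z x * W h v x * (u x * w (x + ?t h))\<bar> \<le> \<bar>W h z x * W h v x\<bar> * \<bar>u' (x + 0) * w' (x + ?t h)\<bar>"
      if "ok h" for h x
      using that u'(3)[of x] w'(3)[of "x + ?t h"] shift_in[of x h] W_outside[of x h z]
      by (cases "x \<in> ball 0 r1") (auto simp: abs_mult)
  qed (intro borel_measurable_times W_measurable z cub m)
  have g3: "good (\<lambda>h x. W h z x * W h w x * (u x * v x))"
  proof (rule good_cub[OF z cub(3) u'(2) v'(2), where a = "\<lambda>_. 0" and b = "\<lambda>_. 0"])
    show "\<bar>W h z x * W h w x * (u x * v x)\<bar> \<le> \<bar>W h z x * W h w x\<bar> * \<bar>u' (x + 0) * v' (x + 0)\<bar>"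
      if "ok h" for h x
      using that u'(3)[of x] v'(3)[of x] shift_in[of x h] W_outside[of x h z]
      by (cases "x \<in> ball 0 r1") (auto simp: abs_mult)
  qed (intro borel_measurable_times W_measurable z cub m)
  have "(\<lambda>h x. \<eta> x * W h z x * Dq h k (\<lambda>x. u x * v x * w x) x)
     = (\<lambda>h x. W h z x * W h u x * (v (x + ?t h) * w (x + ?t h)) + W h z x * W h v x * (u x * w (x + ?t h))
        + W h z x * W h w x * (u x * v x))"
    by (simp add: Dq_mult fun_eq_iff W_def algebra_simps)
  then show ?case using good_add[OF good_add[OF g1 g2] g3] by simp
qed

text \<open>The left-hand operator has constant coefficients, so translated data satisfy the
  translated equation on a smaller ball, and the difference divided by h remains.\<close>

lemma Dq_equation:
  assumes u: "u \<in> U" and f: "adm R f"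
    and eq: "\<And>\<phi>. test_fun (ball 0 R) \<phi> \<Longrightarrow> (\<Sum>l\<in>UNIV. \<integral>x. pderiv l \<phi> x * d u l x \<partial>lborel) = - (\<integral>x. \<phi> x * f x \<partial>lborel)"
    and t: "test_fun (ball 0 (R - \<bar>h\<bar>)) \<phi>"
  shows "(\<Sum>l\<in>UNIV. \<integral>x. pderiv l \<phi> x * Dq h k (d u l) x \<partial>lborel) = - (\<integral>x. \<phi> x * Dq h k f x \<partial>lborel)"
proof (cases "R - \<bar>h\<bar> > 0")
  case False
  then have "x \<notin> ball 0 (R - \<bar>h\<bar>)" for x :: "real^'m" using norm_ge_zero[of x] by (auto simp del: norm_ge_zero)
  then have "\<phi> x = 0" "pderiv l \<phi> x = 0" for x l using test_fun_outside[OF t] by blast+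
  then show ?thesis by simp
next
  case True
  let ?a = "h *\<^sub>R axis k 1 :: real^'m"
  have na: "norm ?a = \<bar>h\<bar>" by (simp add: norm_axis_1)
  have t1: "test_fun (ball 0 R) \<phi>" by (rule test_fun_ball_mono[OF t]) simp
  have t2: "test_fun (ball 0 R) (\<lambda>x. \<phi> (x + (- ?a)))" by (rule test_fun_translate[OF t]) (use na in simp)
  obtain s where s: "0 < s" "s < R - \<bar>h\<bar>" "test_fun (ball 0 s) \<phi>" using test_fun_ball_shrink[OF t True] by metis
  have sR: "s < R" "s + \<bar>h\<bar> < R" using s by auto
  have i1: "integrable lborel (\<lambda>x. \<phi> x * f x)" by (rule adm_integrable[OF f sR(1) test_fun_W0[OF s(3)]])
  have i2: "integrable lborel (\<lambda>x. \<phi> x * f (x + ?a))"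
  proof -
    have "integrable lborel (\<lambda>x. \<phi> (x + (- ?a)) * f x)"
      by (rule adm_integrable[OF f sR(2) test_fun_W0]) (rule test_fun_translate[OF s(3)], simp only: norm_minus_cancel na)
    from iffD2[OF lborel_translate(2) this, of ?a] show ?thesis by simp
  qed
  note L = L2_U(2)[OF u] test_fun_L2[OF test_fun_pderiv[OF t]]
  have j: "integrable lborel (\<lambda>x. pderiv l \<phi> x * d u l x)" "integrable lborel (\<lambda>x. pderiv l \<phi> x * d u l (x + ?a))" for l
    by (rule L2_mult_integrable[OF L(2) L(1)] L2_mult_integrable[OF L(2) L2_translate[OF L(1)]])+
  have "(\<Sum>l\<in>UNIV. \<integral>x. pderiv l \<phi> x * d u l (x + ?a) \<partial>lborel) = - (\<integral>x. \<phi> x * f (x + ?a) \<partial>lborel)"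
    using eq[OF t2] lborel_translate(1)[of "\<lambda>x. pderiv _ \<phi> (x + - ?a) * d u _ x" ?a] lborel_translate(1)[of "\<lambda>x. \<phi> (x + - ?a) * f x" ?a]
    by (simp add: pderiv_translate[OF test_fun_smooth[OF t], of _ "- ?a", simplified])
  then have "(\<Sum>l\<in>UNIV. \<integral>x. pderiv l \<phi> x * d u l (x + ?a) \<partial>lborel) - (\<Sum>l\<in>UNIV. \<integral>x. pderiv l \<phi> x * d u l x \<partial>lborel)
     = - (\<integral>x. \<phi> x * f (x + ?a) \<partial>lborel) + (\<integral>x. \<phi> x * f x \<partial>lborel)" using eq[OF t1] by simp
  moreover have "(\<integral>x. pderiv l \<phi> x * Dq h k (d u l) x \<partial>lborel)
     = ((\<integral>x. pderiv l \<phi> x * d u l (x + ?a) \<partial>lborel) - (\<integral>x. pderiv l \<phi> x * d u l x \<partial>lborel)) / h" for l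
    using j[of l] by (simp add: Dq_def right_diff_distrib diff_divide_distrib)
  moreover have "(\<integral>x. \<phi> x * Dq h k f x \<partial>lborel) = ((\<integral>x. \<phi> x * f (x + ?a) \<partial>lborel) - (\<integral>x. \<phi> x * f x \<partial>lborel)) / h"
    using i1 i2 by (simp add: Dq_def right_diff_distrib diff_divide_distrib)
  ultimately show ?thesis
    by (simp add: sum_divide_distrib[symmetric] sum_subtractf minus_divide_left)
qed

text \<open>The differenced equation is tested with \<open>\<eta> * W h u\<close>, that is, with the
  difference quotient times the squared cutoff.\<close>

lemma energy_identity:
  assumes u: "u \<in> U" and f: "NL U d f" and h: "ok h"
    and eq: "\<And>\<phi>. test_fun (ball 0 R) \<phi> \<Longrightarrow> (\<Sum>l\<in>UNIV. \<integral>x. pderiv l \<phi> x * d u l x \<partial>lborel) = - (\<integral>x. \<phi> x * f x \<partial>lborel)"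
  shows "En (dW h u) = (\<Sum>l\<in>UNIV. (n2 (\<lambda>x. pderiv l \<eta> x * Dq h k u x))\<^sup>2) - (\<integral>x. \<eta> x * W h u x * Dq h k f x \<partial>lborel)"
proof -
  have f': "adm R f" by (rule NL_adm[OF dim wd R1 f])
  have rh: "r1 < R - \<bar>h\<bar>" using h r1\<delta> by (simp add: ok_def)
  note W = W_W0[OF u h]
  have W2: "W0 r1 (\<lambda>x. \<eta> x * W h u x) (\<lambda>l x. pderiv l \<eta> x * W h u x + \<eta> x * dW h u l x)"
    by (rule W0_cutoff[OF W0_wd[OF W] \<eta> order_refl])
  have "(\<Sum>l\<in>UNIV. \<integral>x. (pderiv l \<eta> x * W h u x + \<eta> x * dW h u l x) * Dq h k (d u l) x \<partial>lborel)
      = - (\<integral>x. \<eta> x * W h u x * Dq h k f x \<partial>lborel)"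
    by (rule extended_testing[OF L2_Dq[OF L2_U(2)[OF u]] adm_Dq[OF f'] Dq_equation[OF u f' eq] W2 rh])
  \<comment> \<open>With \<open>a\<close> the term containing the derivative of the cutoff and
    \<open>b\<close> the cut-off difference quotient of the gradient,
    \<open>a * b + (a + b) * b = (a + b)^2 - a^2\<close>, so no mixed term has to be
    estimated.\<close>
  moreover have "(\<integral>x. (pderiv l \<eta> x * W h u x + \<eta> x * dW h u l x) * Dq h k (d u l) x \<partial>lborel)
      = (n2 (dW h u l))\<^sup>2 - (n2 (\<lambda>x. pderiv l \<eta> x * Dq h k u x))\<^sup>2" for l
  proof -
    have z: "L2 (\<lambda>x. pderiv l \<eta> x * Dq h k u x)"
      by (rule L2_smooth_test[OF L2_Dq[OF L2_U(1)[OF u]] test_fun_pderiv[OF \<eta>]])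
    have "(\<integral>x. (pderiv l \<eta> x * W h u x + \<eta> x * dW h u l x) * Dq h k (d u l) x \<partial>lborel)
      = (\<integral>x. (dW h u l x)\<^sup>2 - (pderiv l \<eta> x * Dq h k u x)\<^sup>2 \<partial>lborel)"
      by (rule Bochner_Integration.integral_cong) (auto simp: dW_def W_def power2_eq_square algebra_simps)
    then show ?thesis unfolding n2_sq using L2_sq[OF z] L2_sq[OF W0_L2(2)[OF W]] by simp
  qed
  ultimately show ?thesis by (simp add: En_def sum_subtractf)
qed

end

text \<open>The integral identity is the weak form of \<open>Laplace u = f\<close>, with
  \<open>d u\<close> as the gradient of \<open>u\<close>.\<close>

definition esys :: "real \<Rightarrow> (real^'m::finite \<Rightarrow> real) set \<Rightarrow> ((real^'m \<Rightarrow> real) \<Rightarrow> 'm \<Rightarrow> real^'m \<Rightarrow> real) \<Rightarrow> bool" where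
  "esys R U d \<longleftrightarrow> finite U \<and> (\<forall>u\<in>U. \<forall>l. wd R l u (d u l)) \<and>
     (\<forall>u\<in>U. \<exists>f. NL U d f \<and> (\<forall>\<phi>. test_fun (ball 0 R) \<phi> \<longrightarrow>
        (\<Sum>l\<in>UNIV. \<integral>x. pderiv l \<phi> x * d u l x \<partial>lborel) = - (\<integral>x. \<phi> x * f x \<partial>lborel)))"

theorem second_derivatives:
  fixes U :: "(real^'m::finite \<Rightarrow> real) set"
  assumes dim: "CARD('m) \<le> 4" and sys: "esys R U d" and r: "0 < r" "r < R" "R \<le> 1" and u: "u \<in> U"
  shows "\<exists>v. wd r k (d u l) v"
proof -
  define \<delta> where "\<delta> = (R - r) / 3"
  define r1 where "r1 = r + \<delta>"
  have \<delta>': "\<delta> > 0" "r < r1" "r1 + \<delta> < R" "0 < r1" using r by (auto simp: \<delta>_def r1_def field_simps)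
  obtain \<eta> :: "real^'m \<Rightarrow> real" where cut: "test_fun (ball 0 r1) \<eta>" "\<And>x. x \<in> ball 0 r \<Longrightarrow> \<eta> x = 1"
    using cutoff_exists[OF r(1) \<delta>'(2)] by metis
  interpret step_setup U d R r1 \<delta> k \<eta>
    by unfold_locales (use dim sys r \<delta>' cut in \<open>auto simp: esys_def\<close>)
  have "\<forall>u\<in>U. \<exists>f. NL U d f \<and> (\<forall>\<phi>. test_fun (ball 0 R) \<phi> \<longrightarrow>
        (\<Sum>l\<in>UNIV. \<integral>x. pderiv l \<phi> x * d u l x \<partial>lborel) = - (\<integral>x. \<phi> x * f x \<partial>lborel))" using sys by (simp add: esys_def)
  from bchoice[OF this] obtain f where f: "\<And>u. u \<in> U \<Longrightarrow> NL U d (f u)"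
    "\<And>u \<phi>. u \<in> U \<Longrightarrow> test_fun (ball 0 R) \<phi> \<Longrightarrow> (\<Sum>l\<in>UNIV. \<integral>x. pderiv l \<phi> x * d u l x \<partial>lborel) = - (\<integral>x. \<phi> x * f u x \<partial>lborel)"
    by blast
  have "\<forall>l. \<exists>B. B\<ge>0 \<and> (\<forall>h u. u \<in> U \<longrightarrow> ok h \<longrightarrow> n2 (\<lambda>x. pderiv l \<eta> x * Dq h k u x) \<le> B)"
    using Dq_bound[OF test_fun_pderiv[OF cut(1)]] by blast
  from choice[OF this] obtain B where B: "\<And>l. B l \<ge> 0" "\<And>l h u. u \<in> U \<Longrightarrow> ok h \<Longrightarrow> n2 (\<lambda>x. pderiv l \<eta> x * Dq h k u x) \<le> B l"
    by blast
  \<comment> \<open>Summed over \<open>U\<close>, these multiples of the total energy add up to at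
    most half of it.\<close>
  define e where "e = 1 / (2 * (real (card U) + 1))"
  have e: "e > 0" by (simp add: e_def)
  have "\<forall>w\<in>U. \<exists>C. \<forall>h. ok h \<longrightarrow> (\<integral>x. \<bar>\<eta> x * W h w x * Dq h k (f w) x\<bar> \<partial>lborel) \<le> e * E h + C"
  proof
    fix w assume w: "w \<in> U"
    from goodD[OF good_NL[OF f(1)[OF w] w] e]
    show "\<exists>C. \<forall>h. ok h \<longrightarrow> (\<integral>x. \<bar>\<eta> x * W h w x * Dq h k (f w) x\<bar> \<partial>lborel) \<le> e * E h + C" by blast
  qed
  from bchoice[OF this] obtain C where
    C: "\<And>w h. w \<in> U \<Longrightarrow> ok h \<Longrightarrow> (\<integral>x. \<bar>\<eta> x * W h w x * Dq h k (f w) x\<bar> \<partial>lborel) \<le> e * E h + C w" by blast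
  define M where "M = (\<Sum>w\<in>U. (\<Sum>l\<in>UNIV. (B l)\<^sup>2) + C w)"
  have Eb: "E h \<le> 2 * M" if h: "ok h" for h
  proof -
    have "En (dW h w) \<le> ((\<Sum>l\<in>UNIV. (B l)\<^sup>2) + C w) + e * E h" if w: "w \<in> U" for w
    proof -
      have "(\<Sum>l\<in>UNIV. (n2 (\<lambda>x. pderiv l \<eta> x * Dq h k w x))\<^sup>2) \<le> (\<Sum>l\<in>UNIV. (B l)\<^sup>2)"
        using B(2)[OF w h] by (intro sum_mono power_mono) auto
      moreover have "- (\<integral>x. \<eta> x * W h w x * Dq h k (f w) x \<partial>lborel) \<le> (\<integral>x. \<bar>\<eta> x * W h w x * Dq h k (f w) x\<bar> \<partial>lborel)"
        using integral_abs_bound[of lborel "\<lambda>x. \<eta> x * W h w x * Dq h k (f w) x"] by linarith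
      ultimately show ?thesis
        using energy_identity[OF w f(1)[OF w] h f(2)[OF w]] C[OF w h] by linarith
    qed
    then have "E h \<le> (\<Sum>w\<in>U. ((\<Sum>l\<in>UNIV. (B l)\<^sup>2) + C w) + e * E h)"
      unfolding E_def[of h] by (rule sum_mono)
    also have "\<dots> = M + (real (card U) * e) * E h" by (simp add: M_def sum.distrib)
    also have "\<dots> \<le> M + (1 / 2) * E h"
    proof -
      have "real (card U) * e \<le> 1 / 2" by (simp add: e_def field_simps)
      then show ?thesis by (intro add_left_mono mult_right_mono E_nonneg)
    qed
    \<comment> \<open>\<open>E h\<close> is a real number for each fixed step, so half of it may be
      subtracted; the resulting bound is uniform in the step.\<close>
    finally show ?thesis by simp
  qed
  show ?thesis
  proof (rule wd_from_dq_bound[OF L2_U(2)[OF u] \<delta>'(1) cut(2)])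
    show "L2 (\<lambda>x. \<eta> x * Dq h k (d u l) x)" for h by (rule L2_smooth_test[OF L2_Dq[OF L2_U(2)[OF u]] cut(1)])
    fix h :: real assume "h \<noteq> 0" "\<bar>h\<bar> < \<delta>"
    then have h: "ok h" by (simp add: ok_def)
    have z: "L2 (\<lambda>x. pderiv l \<eta> x * Dq h k u x)"
      by (rule L2_smooth_test[OF L2_Dq[OF L2_U(1)[OF u]] test_fun_pderiv[OF cut(1)]])
    have "n2 (\<lambda>x. \<eta> x * Dq h k (d u l) x) = n2 (\<lambda>x. dW h u l x - pderiv l \<eta> x * Dq h k u x)"
      by (simp add: dW_def)
    also have "\<dots> \<le> n2 (dW h u l) + n2 (\<lambda>x. pderiv l \<eta> x * Dq h k u x)"
      by (rule n2_diff[OF W0_L2(2)[OF W_W0[OF u h]] z])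
    also have "\<dots> \<le> sqrt (2 * M) + B l"
    proof (rule add_mono[OF order_trans[OF n2_le_En] B(2)[OF u h]])
      show "sqrt (En (dW h u)) \<le> sqrt (2 * M)" using En_le_E[OF u, of h] Eb[OF h] by simp
    qed
    finally show "n2 (\<lambda>x. \<eta> x * Dq h k (d u l) x) \<le> sqrt (2 * M) + B l" .
  qed
qed

section \<open>Bootstrap to smoothness\<close>

lemma NL_mono:
  assumes "NL U d f" "U \<subseteq> U'" "\<And>u l. u \<in> U \<Longrightarrow> d' u l = d u l"
  shows "NL U' d' f"
  using assms(1)
proof induction
  case (quad u v l)
  have "NL U' d' (\<lambda>x. u x * d' v l x)" using quad assms(2) by (intro NL.quad) auto
  then show ?case using assms(3)[OF quad(2)] by simp
qed (use assms(2) in \<open>auto intro: NL.intros\<close>)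

text \<open>A derivative of \<open>u * d v l\<close> contains a second derivative of
  \<open>v\<close>, but \<open>d v l\<close> belongs to the enlarged set, so both Leibniz terms are
  again quadratic. Cubic terms stay cubic.\<close>

lemma NL_derivative:
  fixes U :: "(real^'m::finite \<Rightarrow> real) set"
  assumes dim: "CARD('m) \<le> 4" and UU: "U \<subseteq> U'" "\<And>u l. u \<in> U \<Longrightarrow> d u l \<in> U'" "\<And>u l. u \<in> U \<Longrightarrow> d' u l = d u l"
    and wd: "\<And>u l. u \<in> U' \<Longrightarrow> wd R l u (d' u l)" and R: "R \<le> 1" "0 < r" "r < R"
    and f: "NL U d f"
  shows "\<exists>g. NL U' d' g \<and> (\<forall>\<phi>. test_fun (ball 0 r) \<phi> \<longrightarrow> (\<integral>x. pderiv k \<phi> x * f x \<partial>lborel) = - (\<integral>x. \<phi> x * g x \<partial>lborel))"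
  using f
proof induction
  case zero
  show ?case by (intro exI[of _ "\<lambda>x. 0"] conjI NL.zero) simp
next
  case (add f1 f2)
  obtain g1 where g1: "NL U' d' g1" "\<And>\<phi>. test_fun (ball 0 r) \<phi> \<Longrightarrow> (\<integral>x. pderiv k \<phi> x * f1 x \<partial>lborel) = - (\<integral>x. \<phi> x * g1 x \<partial>lborel)"
    using add.IH(1) by blast
  obtain g2 where g2: "NL U' d' g2" "\<And>\<phi>. test_fun (ball 0 r) \<phi> \<Longrightarrow> (\<integral>x. pderiv k \<phi> x * f2 x \<partial>lborel) = - (\<integral>x. \<phi> x * g2 x \<partial>lborel)"
    using add.IH(2) by blast
  have a: "adm R h" if "NL U d h \<or> NL U' d' h" for h
  proof -
    have "NL U' d' h" using that
    proof
      assume "NL U d h"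
      then show ?thesis by (rule NL_mono) (use UU in auto)
    qed
    from NL_adm[where U = U' and d = d', OF dim wd R(1) this] show ?thesis by blast
  qed
  show ?case
  proof (intro exI[of _ "\<lambda>x. g1 x + g2 x"] conjI NL.add g1 g2 allI impI)
    fix \<phi> :: "real^'m \<Rightarrow> real" assume t: "test_fun (ball 0 r) \<phi>"
    note W = test_fun_W0[OF t] test_fun_W0[OF test_fun_pderiv[OF t], of k]
    note i = adm_integrable[OF a R(3) W(1)] adm_integrable[OF a R(3) W(2)]
    show "(\<integral>x. pderiv k \<phi> x * (f1 x + f2 x) \<partial>lborel) = - (\<integral>x. \<phi> x * (g1 x + g2 x) \<partial>lborel)"
      using g1(2)[OF t] g2(2)[OF t] i(1)[of g1] i(1)[of g2] i(2)[of f1] i(2)[of f2] add.hyps g1(1) g2(1)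
      by (simp add: distrib_left)
  qed
next
  case (cmult f c)
  then obtain g where g: "NL U' d' g" "\<And>\<phi>. test_fun (ball 0 r) \<phi> \<Longrightarrow> (\<integral>x. pderiv k \<phi> x * f x \<partial>lborel) = - (\<integral>x. \<phi> x * g x \<partial>lborel)"
    by blast
  show ?case
    by (intro exI[of _ "\<lambda>x. c * g x"] conjI NL.cmult g allI impI) (simp add: mult.left_commute[of _ c] g(2))
next
  case (quad u v l)
  have u: "\<And>l. wd r l u (d u l)" using wd_mono[OF wd] quad(1) UU(1,3) R by (metis less_imp_le subsetD)
  have v: "wd r k (d v l) (d' (d v l) k)" using wd_mono[OF wd[OF UU(2)[OF quad(2)]]] R by simp
  show ?case
  proof (intro exI[of _ "\<lambda>x. d u k x * d' v l x + u x * d' (d v l) k x"] conjI allI impI)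
    show "NL U' d' (\<lambda>x. d u k x * d' v l x + u x * d' (d v l) k x)"
      using quad UU(1) by (intro NL.add NL.quad UU(2)) auto
    show "(\<integral>x. pderiv k \<phi> x * (u x * d v l x) \<partial>lborel) = - (\<integral>x. \<phi> x * (d u k x * d' v l x + u x * d' (d v l) k x) \<partial>lborel)"
      if "test_fun (ball 0 r) \<phi>" for \<phi>
      using product_rule(1)[OF u v that] UU(3)[OF quad(2)] by simp
  qed
next
  case (cub u v w)
  have inU': "u \<in> U'" "v \<in> U'" "w \<in> U'" "\<And>l. d u l \<in> U'" "\<And>l. d v l \<in> U'" "\<And>l. d w l \<in> U'"
    using cub UU(1,2) by auto
  have eqd: "d' u = d u" "d' v = d v" "d' w = d w" using UU(3) cub by auto
  have w1: "\<And>l. wd R l u (d u l)" "\<And>l. wd R l v (d v l)" "\<And>l. wd R l w (d w l)"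
    using wd[OF inU'(1)] wd[OF inU'(2)] wd[OF inU'(3)] eqd by auto
  let ?I = "indicat_real (ball (0::real^'m) r)"
  \<comment> \<open>\<open>product_rule\<close> takes two Sobolev factors, so \<open>u * v\<close>
    must first become one. Its derivative is locally in L2 because the components of
    \<open>d u\<close> and \<open>d v\<close> are themselves unknowns with weak derivatives, hence
    locally in L4.\<close>
  define p where "p x = ?I x * (u x * v x)" for x
  define p' where "p' l x = ?I x * (d u l x * v x) + ?I x * (u x * d v l x)" for l x
  have pw: "wd r l p (p' l)" for l
    unfolding wd_def
  proof (intro conjI allI impI)
    show "L2 p" unfolding p_def by (rule L2_local_mult[OF dim w1(1) w1(2) R])
    show "L2 (p' l)" unfolding p'_def
      by (intro L2_add L2_local_mult[OF dim wd[OF inU'(4)] w1(2) R] L2_local_mult[OF dim w1(1) wd[OF inU'(5)] R])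
    fix \<phi> :: "real^'m \<Rightarrow> real" assume t: "test_fun (ball 0 r) \<phi>"
    have tR: "test_fun (ball 0 R) \<phi>" by (rule test_fun_ball_mono[OF t]) (use R in simp)
    have "pderiv l \<phi> x * p x = pderiv l \<phi> x * (u x * v x)" "\<phi> x * p' l x = \<phi> x * (d u l x * v x + u x * d v l x)" for x
      using test_fun_outside[OF t, of x] by (cases "x \<in> ball 0 r"; simp add: p_def p'_def)+
    then show "(\<integral>x. pderiv l \<phi> x * p x \<partial>lborel) = - (\<integral>x. \<phi> x * p' l x \<partial>lborel)"
      using product_rule(1)[OF w1(1) w1(2) tR] by (simp only:)
  qed
  have w2: "wd r k w (d w k)" using wd_mono[OF w1(3)] R by simp
  show ?case
  proof (intro exI[of _ "\<lambda>x. (d u k x * v x * w x + u x * d v k x * w x) + u x * v x * d w k x"] conjI allI impI)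
    show "NL U' d' (\<lambda>x. (d u k x * v x * w x + u x * d v k x * w x) + u x * v x * d w k x)"
      by (intro NL.add NL.cub inU')
    fix \<phi> :: "real^'m \<Rightarrow> real" assume t: "test_fun (ball 0 r) \<phi>"
    have "pderiv k \<phi> x * (p x * w x) = pderiv k \<phi> x * (u x * v x * w x)"
      "\<phi> x * (p' k x * w x + p x * d w k x) = \<phi> x * ((d u k x * v x * w x + u x * d v k x * w x) + u x * v x * d w k x)" for x
      using test_fun_outside[OF t, of x] by (cases "x \<in> ball 0 r"; simp add: p_def p'_def distrib_right)+
    then show "(\<integral>x. pderiv k \<phi> x * (u x * v x * w x) \<partial>lborel)
       = - (\<integral>x. \<phi> x * ((d u k x * v x * w x + u x * d v k x * w x) + u x * v x * d w k x) \<partial>lborel)"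
      using product_rule(1)[OF pw w2 t] by (simp only:)
  qed
qed

lemma pderiv_commute_fun: "smooth f \<Longrightarrow> pderiv i (pderiv j f) = pderiv j (pderiv i f)"
  by (rule ext) (rule pderiv_commute)

text \<open>The equation for \<open>d u k\<close> arises by testing the one for \<open>u\<close>
  with derivatives of test functions. Each step loses some radius, both for the second derivatives
  and for the products in the new nonlinearity.\<close>

lemma esys_step:
  fixes U :: "(real^'m::finite \<Rightarrow> real) set"
  assumes dim: "CARD('m) \<le> 4" and sys: "esys R U d" and r: "0 < r" "r < R" "R \<le> 1"
  shows "\<exists>U' d'. esys r U' d' \<and> U \<subseteq> U' \<and> (\<forall>u\<in>U. \<forall>l. d u l \<in> U')"
proof -
  define rm where "rm = (r + R) / 2"
  have rm: "0 < rm" "rm < R" "r < rm" "rm \<le> 1" using r by (auto simp: rm_def)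
  define U' where "U' = U \<union> (\<Union>u\<in>U. range (d u))"
  \<comment> \<open>Gradients of old unknowns are kept, so their nonlinearities remain literally
    valid; gradients of the new ones are chosen.\<close>
  define d' where "d' w l = (if w \<in> U then d w l else (SOME v. wd rm l w v))" for w l
  have fin: "finite U'" using sys by (auto simp: U'_def esys_def)
  have wdU: "wd R l u (d u l)" if "u \<in> U" for u l using sys that by (auto simp: esys_def)
  have UU: "U \<subseteq> U'" "\<And>u l. u \<in> U \<Longrightarrow> d u l \<in> U'" "\<And>u l. u \<in> U \<Longrightarrow> d' u l = d u l"
    by (auto simp: U'_def d'_def)
  have wd': "wd rm l w (d' w l)" if w: "w \<in> U'" for w l
  proof (cases "w \<in> U")
    case True
    then show ?thesis using wd_mono[OF wdU[OF True]] rm UU(3) by simp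
  next
    case False
    then obtain u j where u: "u \<in> U" "w = d u j" using w by (auto simp: U'_def)
    have "\<exists>v. wd rm l w v" unfolding u(2) by (rule second_derivatives[OF dim sys rm(1,2) r(3) u(1)])
    then have "wd rm l w (SOME v. wd rm l w v)" by (rule someI_ex)
    then show ?thesis using False by (simp add: d'_def)
  qed
  have "\<exists>f. NL U' d' f \<and> (\<forall>\<phi>. test_fun (ball 0 r) \<phi> \<longrightarrow> (\<Sum>l\<in>UNIV. \<integral>x. pderiv l \<phi> x * d' w l x \<partial>lborel) = - (\<integral>x. \<phi> x * f x \<partial>lborel))"
    if w: "w \<in> U'" for w
  proof (cases "w \<in> U")
    case True
    then obtain f where f: "NL U d f" "\<And>\<phi>. test_fun (ball 0 R) \<phi> \<Longrightarrow> (\<Sum>l\<in>UNIV. \<integral>x. pderiv l \<phi> x * d w l x \<partial>lborel) = - (\<integral>x. \<phi> x * f x \<partial>lborel)"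
      using sys by (auto simp: esys_def)
    have "(\<Sum>l\<in>UNIV. \<integral>x. pderiv l \<phi> x * d' w l x \<partial>lborel) = - (\<integral>x. \<phi> x * f x \<partial>lborel)" if t: "test_fun (ball 0 r) \<phi>" for \<phi>
      using f(2)[OF test_fun_ball_mono[OF t]] r UU(3)[OF True] by simp
    then show ?thesis using NL_mono[OF f(1) UU(1,3)] by blast
  next
    case False
    then obtain u k where u: "u \<in> U" "w = d u k" using w by (auto simp: U'_def)
    then obtain f where f: "NL U d f" "\<And>\<phi>. test_fun (ball 0 R) \<phi> \<Longrightarrow> (\<Sum>l\<in>UNIV. \<integral>x. pderiv l \<phi> x * d u l x \<partial>lborel) = - (\<integral>x. \<phi> x * f x \<partial>lborel)"
      using sys by (auto simp: esys_def)
    obtain g where g: "NL U' d' g" "\<And>\<phi>. test_fun (ball 0 r) \<phi> \<Longrightarrow> (\<integral>x. pderiv k \<phi> x * f x \<partial>lborel) = - (\<integral>x. \<phi> x * g x \<partial>lborel)"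
      using NL_derivative[OF dim UU wd' rm(4) r(1) rm(3) f(1), of k] by blast
    have "(\<Sum>l\<in>UNIV. \<integral>x. pderiv l \<phi> x * d' w l x \<partial>lborel) = - (\<integral>x. \<phi> x * g x \<partial>lborel)" if t: "test_fun (ball 0 r) \<phi>" for \<phi>
    proof -
      have tR: "test_fun (ball 0 R) \<phi>" by (rule test_fun_ball_mono[OF t]) (use r in simp)
      have trm: "test_fun (ball 0 rm) \<phi>" by (rule test_fun_ball_mono[OF t]) (use rm in simp)
      have sm: "smooth \<phi>" by (rule test_fun_smooth[OF t])
      have "(\<integral>x. pderiv l \<phi> x * d' w l x \<partial>lborel) = - (\<integral>x. pderiv l (pderiv k \<phi>) x * d u l x \<partial>lborel)" for l
      proof -
        \<comment> \<open>All derivatives are first moved onto the test function, where they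
          commute.\<close>
        have 1: "(\<integral>x. pderiv l (pderiv l \<phi>) x * w x \<partial>lborel) = - (\<integral>x. pderiv l \<phi> x * d' w l x \<partial>lborel)"
          by (rule wdD[OF wd'[OF w] test_fun_pderiv[OF trm]])
        have 2: "(\<integral>x. pderiv k (pderiv l (pderiv l \<phi>)) x * u x \<partial>lborel) = - (\<integral>x. pderiv l (pderiv l \<phi>) x * w x \<partial>lborel)"
          unfolding u(2) by (rule wdD[OF wdU[OF u(1)] test_fun_pderiv[OF test_fun_pderiv[OF tR]]])
        have 3: "(\<integral>x. pderiv l (pderiv l (pderiv k \<phi>)) x * u x \<partial>lborel) = - (\<integral>x. pderiv l (pderiv k \<phi>) x * d u l x \<partial>lborel)"
          by (rule wdD[OF wdU[OF u(1)] test_fun_pderiv[OF test_fun_pderiv[OF tR]]])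
        have "pderiv k (pderiv l (pderiv l \<phi>)) = pderiv l (pderiv l (pderiv k \<phi>))"
          using pderiv_commute_fun[OF smooth_pderiv[OF sm], of k l l] pderiv_commute_fun[OF sm, of k l] by simp
        then show ?thesis using 1 2 3 by simp
      qed
      then have "(\<Sum>l\<in>UNIV. \<integral>x. pderiv l \<phi> x * d' w l x \<partial>lborel) = - (\<Sum>l\<in>UNIV. \<integral>x. pderiv l (pderiv k \<phi>) x * d u l x \<partial>lborel)"
        by (simp add: sum_negf)
      also have "\<dots> = (\<integral>x. pderiv k \<phi> x * f x \<partial>lborel)" using f(2)[OF test_fun_pderiv[OF tR]] by simp
      also have "\<dots> = - (\<integral>x. \<phi> x * g x \<partial>lborel)" by (rule g(2)[OF t])
      finally show ?thesis .
    qed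
    then show ?thesis using g(1) by blast
  qed
  then have "esys r U' d'" unfolding esys_def using fin wd_mono[OF wd'] rm by auto
  then show ?thesis using UU by blast
qed

lemma bootstrap:
  fixes U :: "(real^'m::finite \<Rightarrow> real) set"
  assumes dim: "CARD('m) \<le> 4" and sys: "esys R U d" and r: "0 < r" "r < R" "R \<le> 1"
  shows "\<exists>S. U \<subseteq> S \<and> (\<forall>u\<in>S. \<forall>l. \<exists>v\<in>S. wd r l u v)"
proof -
  \<comment> \<open>Infinitely many steps share the collar between \<open>r\<close> and
    \<open>R\<close>: the radii decrease strictly but never reach \<open>r\<close>.\<close>
  define \<rho> where "\<rho> n = r + (R - r) / 2 ^ n" for n :: nat
  have \<rho>: "r < \<rho> n" "\<rho> n \<le> 1" "\<rho> (Suc n) < \<rho> n" for n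
  proof -
    show "r < \<rho> n" using r by (simp add: \<rho>_def)
    have "(R - r) / 2 ^ n \<le> R - r" using r by (simp add: divide_le_eq mult_le_cancel_left1)
    then show "\<rho> n \<le> 1" using r by (simp add: \<rho>_def)
    show "\<rho> (Suc n) < \<rho> n" using r by (simp add: \<rho>_def divide_strict_left_mono)
  qed
  have "\<exists>F. \<forall>n. esys (\<rho> n) (fst (F n)) (snd (F n)) \<and> (n = 0 \<longrightarrow> F n = (U, d)) \<and>
      (fst (F n) \<subseteq> fst (F (Suc n)) \<and> (\<forall>u\<in>fst (F n). \<forall>l. snd (F n) u l \<in> fst (F (Suc n))))"
  proof -
    have "\<exists>F. \<forall>n. (esys (\<rho> n) (fst (F n)) (snd (F n)) \<and> (n = 0 \<longrightarrow> F n = (U, d))) \<and>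
      (fst (F n) \<subseteq> fst (F (Suc n)) \<and> (\<forall>u\<in>fst (F n). \<forall>l. snd (F n) u l \<in> fst (F (Suc n))))"
    proof (rule dependent_nat_choice)
      show "\<exists>x. esys (\<rho> 0) (fst x) (snd x) \<and> (0 = (0::nat) \<longrightarrow> x = (U, d))"
        using sys by (intro exI[of _ "(U, d)"]) (simp add: \<rho>_def)
      fix x :: "(real^'m \<Rightarrow> real) set \<times> ((real^'m \<Rightarrow> real) \<Rightarrow> 'm \<Rightarrow> real^'m \<Rightarrow> real)" and n
      assume "esys (\<rho> n) (fst x) (snd x) \<and> (n = 0 \<longrightarrow> x = (U, d))"
      then have "esys (\<rho> n) (fst x) (snd x)" ..
      from esys_step[OF dim this _ \<rho>(3) \<rho>(2)] \<rho>(1)[of "Suc n"] r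
      obtain U' d' where "esys (\<rho> (Suc n)) U' d'" "fst x \<subseteq> U'" "\<forall>u\<in>fst x. \<forall>l. snd x u l \<in> U'" by auto
      then show "\<exists>y. (esys (\<rho> (Suc n)) (fst y) (snd y) \<and> (Suc n = 0 \<longrightarrow> y = (U, d))) \<and>
         fst x \<subseteq> fst y \<and> (\<forall>u\<in>fst x. \<forall>l. snd x u l \<in> fst y)"
        by (intro exI[of _ "(U', d')"]) simp
    qed
    then show ?thesis by (simp only: conj_assoc)
  qed
  then obtain F where F: "\<And>n. esys (\<rho> n) (fst (F n)) (snd (F n))" "F 0 = (U, d)"
    "\<And>n u l. u \<in> fst (F n) \<Longrightarrow> snd (F n) u l \<in> fst (F (Suc n))" by blast
  show ?thesis
  proof (intro exI[of _ "\<Union>n. fst (F n)"] conjI ballI allI)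
    show "U \<subseteq> (\<Union>n. fst (F n))"
    proof
      fix u assume "u \<in> U"
      then have "u \<in> fst (F 0)" using F(2) by simp
      then show "u \<in> (\<Union>n. fst (F n))" by blast
    qed
    fix u l assume "u \<in> (\<Union>n. fst (F n))"
    then obtain n where n: "u \<in> fst (F n)" by blast
    have "wd (\<rho> n) l u (snd (F n) u l)" using F(1)[of n] n by (simp add: esys_def)
    then have "wd r l u (snd (F n) u l)" by (rule wd_mono) (use \<rho>(1)[of n] in simp)
    moreover have "snd (F n) u l \<in> (\<Union>n. fst (F n))" using F(3)[OF n] by blast
    ultimately show "\<exists>v\<in>(\<Union>n. fst (F n)). wd r l u v" by blast
  qed
qed

lemma W0_add:
  assumes "W0 r u d" "W0 r v e" shows "W0 r (\<lambda>x. u x + v x) (\<lambda>l x. d l x + e l x)"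
proof -
  have "W0 r (\<lambda>x. 0 - v x) (\<lambda>l x. 0 - e l x)"
    by (rule W0_diff[OF _ assms(2)]) (simp add: W0_def)
  from W0_diff[OF assms(1) this] show ?thesis by simp
qed

section \<open>From integral bounds on mixed derivatives to smoothness\<close>

lemma mixed_derivative_bound:
  fixes f :: "real^'m::finite \<Rightarrow> real"
  assumes "test_fun U f"
  shows "ennreal \<bar>f (vec_lambda z)\<bar> \<le> Tl xs (\<lambda>z. ennreal \<bar>foldr pderiv xs f (vec_lambda z)\<bar>) z"
proof (induction xs)
  case (Cons x xs)
  have t: "test_fun U (foldr pderiv xs f)" by (induction xs) (auto intro: assms test_fun_pderiv)
  have "Tl xs (\<lambda>z. ennreal \<bar>foldr pderiv xs f (vec_lambda z)\<bar>) z
     \<le> Tl xs (T1 x (\<lambda>z. ennreal \<bar>pderiv x (foldr pderiv xs f) (vec_lambda z)\<bar>)) z"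
    by (rule Tl_mono) (rule line_bound[OF t])
  then show ?case using Cons.IH by simp
qed simp

text \<open>The line bound is iterated over all coordinates. Losing as many derivatives as there are
  dimensions is harmless here, since derivatives of every order are available.\<close>

lemma sup_bound:
  fixes f :: "real^'m::finite \<Rightarrow> real"
  assumes t: "test_fun U f" and xs: "distinct xs" "set xs = UNIV"
  shows "\<bar>f x\<bar> \<le> (\<integral>y. \<bar>foldr pderiv xs f y\<bar> \<partial>lborel)"
proof -
  have tx: "test_fun U (foldr pderiv xs f)" by (induction xs) (auto intro: t test_fun_pderiv)
  note [measurable] = smooth_measurable[OF test_fun_smooth[OF tx]]
  have "ennreal \<bar>f (vec_lambda (vec_nth x))\<bar> \<le> Tl xs (\<lambda>z. ennreal \<bar>foldr pderiv xs f (vec_lambda z)\<bar>) (vec_nth x)"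
    by (rule mixed_derivative_bound[OF t])
  also have "\<dots> = (\<integral>\<^sup>+y. ennreal \<bar>foldr pderiv xs f y\<bar> \<partial>lborel)" by (rule Tl_lborel[OF _ xs]) measurable
  also have "\<dots> = ennreal (\<integral>y. \<bar>foldr pderiv xs f y\<bar> \<partial>lborel)"
    using test_fun_integrable[OF tx] by (subst nn_integral_eq_integral) auto
  finally show ?thesis by simp
qed

text \<open>The mollifications converge uniformly together with all their derivatives.\<close>
lemma smooth_of_closed_family:
  fixes T :: "(real^'m::finite \<Rightarrow> real) set"
  assumes D: "\<And>t. t \<in> T \<Longrightarrow> W0 r t (D t)" "\<And>t l. t \<in> T \<Longrightarrow> D t l \<in> T" and t: "t \<in> T"
  shows "\<exists>w. smooth w \<and> (AE x in lborel. t x = w x)"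
proof -
  let ?c = "\<lambda>n t. conv (moll n) t"
  have int: "integrable lborel t" if "t \<in> T" for t using W0_integrable(1)[OF D(1)[OF that]] .
  have test: "test_fun (ball 0 (r + 2)) (?c n t)" if "t \<in> T" for n t
  proof (rule conv_test_fun[OF moll_test int[OF that]])
    show "t x = 0" if "x \<notin> ball 0 r" for x using W0_outside(1)[OF D(1)[OF \<open>t \<in> T\<close>] that] .
    have "1 / real (Suc n) \<le> 1" by simp
    then show "r + 1 / real (Suc n) < r + 2" by linarith
  qed
  have pd: "pderiv l (?c n t) = ?c n (D t l)" if "t \<in> T" for n t l
    using conv_pderiv[OF moll_test int[OF that]] conv_weak[OF D(1)[OF that] moll_test] by (intro ext) simp
  obtain xs where xs: "distinct xs" "set xs = (UNIV::'m set)" using finite_distinct_list[of "UNIV::'m set"] by auto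
  have cauchy: "\<exists>N. \<forall>n\<ge>N. \<forall>k\<ge>N. \<forall>x. \<bar>?c n t x - ?c k t x\<bar> < e" if tT: "t \<in> T" and e: "e > 0" for t e
  proof -
    \<comment> \<open>One derivative in each coordinate direction: the L1 convergence of its
      mollifications controls those of \<open>t\<close> uniformly.\<close>
    define t' where "t' = foldr (\<lambda>l t. D t l) xs t"
    have st: "foldr (\<lambda>l t. D t l) ys t \<in> T" for ys by (induction ys) (auto intro: tT D(2))
    then have t'T: "t' \<in> T" by (simp add: t'_def)
    have fo: "foldr pderiv ys (\<lambda>x. ?c n t x - ?c k t x) = (\<lambda>x. ?c n (foldr (\<lambda>l t. D t l) ys t) x - ?c k (foldr (\<lambda>l t. D t l) ys t) x)" for ys n k
    proof (induction ys)
      case (Cons y ys)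
      let ?s = "foldr (\<lambda>l t. D t l) ys t"
      have "pderiv y (\<lambda>x. ?c n ?s x - ?c k ?s x) = (\<lambda>x. pderiv y (?c n ?s) x - pderiv y (?c k ?s) x)"
        by (rule ext) (rule pderiv_diff[OF test_fun_smooth[OF test[OF st]] test_fun_smooth[OF test[OF st]]])
      then show ?case using Cons.IH pd[OF st] by simp
    qed simp
    have "\<forall>\<^sub>F n in sequentially. (\<integral>x. \<bar>?c n t' x - t' x\<bar> \<partial>lborel) < e / 2"
      using order_tendstoD(2)[OF moll_L1(1)[OF int[OF t'T]], of "e/2"] e by simp
    then have "\<forall>\<^sub>F n in sequentially. (\<integral>x. \<bar>?c n t' x - t' x\<bar> \<partial>lborel) < e / 2 \<and> integrable lborel (\<lambda>x. ?c n t' x - t' x)"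
      using moll_L1(2)[OF int[OF t'T]] by (rule eventually_conj)
    then obtain N where N: "\<And>n. n \<ge> N \<Longrightarrow> (\<integral>x. \<bar>?c n t' x - t' x\<bar> \<partial>lborel) < e / 2"
       "\<And>n. n \<ge> N \<Longrightarrow> integrable lborel (\<lambda>x. ?c n t' x - t' x)"
      unfolding eventually_sequentially by blast
    have "\<bar>?c n t x - ?c k t x\<bar> < e" if nk: "n \<ge> N" "k \<ge> N" for n k x
    proof -
      have "\<bar>?c n t x - ?c k t x\<bar> \<le> (\<integral>y. \<bar>?c n t' y - ?c k t' y\<bar> \<partial>lborel)"
        using sup_bound[OF test_fun_diff[OF test[OF tT, of n] test[OF tT, of k]] xs, of x] unfolding fo t'_def .
      also have "\<dots> \<le> (\<integral>y. \<bar>?c n t' y - t' y\<bar> + \<bar>?c k t' y - t' y\<bar> \<partial>lborel)"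
      proof (rule integral_mono)
        show "integrable lborel (\<lambda>y. \<bar>?c n t' y - ?c k t' y\<bar>)"
          using test_fun_integrable[OF test_fun_diff[OF test[OF t'T, of n] test[OF t'T, of k]]] by simp
      qed (use N(2)[OF nk(1)] N(2)[OF nk(2)] in auto)
      also have "\<dots> < e" using N(1)[OF nk(1)] N(1)[OF nk(2)] N(2)[OF nk(1)] N(2)[OF nk(2)] by simp
      finally show ?thesis .
    qed
    then show ?thesis by blast
  qed
  define F where "F t x = lim (\<lambda>n. ?c n t x)" for t :: "real^'m \<Rightarrow> real" and x
  have Fl: "(\<lambda>n. ?c n t x) \<longlonglongrightarrow> F t x" if tT: "t \<in> T" for t x
  proof -
    have "Cauchy (\<lambda>n. ?c n t x)"
    proof (rule metric_CauchyI)
      fix e :: real assume "0 < e"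
      then show "\<exists>M. \<forall>m\<ge>M. \<forall>n\<ge>M. dist (?c m t x) (?c n t x) < e"
        using cauchy[OF tT] by (simp add: dist_real_def) blast
    qed
    then show ?thesis unfolding F_def using Cauchy_convergent_iff convergent_LIMSEQ_iff by blast
  qed
  have unif: "\<exists>N. \<forall>n\<ge>N. \<forall>x. \<bar>?c n t x - F t x\<bar> \<le> e" if tT: "t \<in> T" and e: "e > 0" for t e
  proof -
    obtain N where N: "\<And>n k x. n \<ge> N \<Longrightarrow> k \<ge> N \<Longrightarrow> \<bar>?c n t x - ?c k t x\<bar> < e" using cauchy[OF tT e] by blast
    have "\<bar>?c n t x - F t x\<bar> \<le> e" if n: "n \<ge> N" for n x
    proof (rule tendsto_upperbound)
      show "(\<lambda>k. \<bar>?c n t x - ?c k t x\<bar>) \<longlonglongrightarrow> \<bar>?c n t x - F t x\<bar>"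
        by (intro tendsto_rabs tendsto_diff tendsto_const Fl[OF tT])
      show "\<forall>\<^sub>F k in sequentially. \<bar>?c n t x - ?c k t x\<bar> \<le> e"
        unfolding eventually_sequentially using N[OF n] by (intro exI[of _ N]) (auto intro: less_imp_le)
    qed simp
    then show ?thesis by blast
  qed
  have der: "(F t has_derivative (\<lambda>v. \<Sum>l\<in>UNIV. v $ l * F (D t l) x)) (at x)" if tT: "t \<in> T" for t x
  proof -
    have "\<exists>g. \<forall>x\<in>UNIV. (\<lambda>n. ?c n t x) \<longlonglongrightarrow> g x \<and> (g has_derivative (\<lambda>v. \<Sum>l\<in>UNIV. v $ l * F (D t l) x)) (at x within UNIV)"
    proof (rule has_derivative_sequence[where f' = "\<lambda>n x v. \<Sum>l\<in>UNIV. v $ l * ?c n (D t l) x"])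
      show "(?c n t has_derivative (\<lambda>v. \<Sum>l\<in>UNIV. v $ l * ?c n (D t l) x)) (at x within UNIV)" for n x
        using smooth_has_derivative[OF test_fun_smooth[OF test[OF tT]], of n x] by (simp add: pd[OF tT])
      show "(\<lambda>n. ?c n t 0) \<longlonglongrightarrow> F t 0" by (rule Fl[OF tT])
      fix e :: real assume e: "e > 0"
      let ?e = "e / real CARD('m)"
      have e': "?e > 0" using e by simp
      have "\<forall>l. \<exists>N. \<forall>n\<ge>N. \<forall>x. \<bar>?c n (D t l) x - F (D t l) x\<bar> \<le> ?e" using unif[OF D(2)[OF tT] e'] by blast
      from choice[OF this] obtain N where N: "\<And>l n x. n \<ge> N l \<Longrightarrow> \<bar>?c n (D t l) x - F (D t l) x\<bar> \<le> ?e" by blast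
      show "\<forall>\<^sub>F n in sequentially. \<forall>x\<in>UNIV. \<forall>h. norm ((\<Sum>l\<in>UNIV. h $ l * ?c n (D t l) x) - (\<Sum>l\<in>UNIV. h $ l * F (D t l) x)) \<le> e * norm h"
        unfolding eventually_sequentially
      proof (intro exI[of _ "Max (range N)"] allI impI ballI)
        fix n and x h :: "real^'m" assume n: "Max (range N) \<le> n"
        have Nl: "N l \<le> n" for l using n Max_ge[of "range N" "N l"] by simp
        have "norm ((\<Sum>l\<in>UNIV. h $ l * ?c n (D t l) x) - (\<Sum>l\<in>UNIV. h $ l * F (D t l) x))
           = \<bar>\<Sum>l\<in>UNIV. h $ l * (?c n (D t l) x - F (D t l) x)\<bar>"
          by (simp add: sum_subtractf right_diff_distrib)
        also have "\<dots> \<le> (\<Sum>l\<in>UNIV. \<bar>h $ l * (?c n (D t l) x - F (D t l) x)\<bar>)" by (rule sum_abs)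
        also have "\<dots> \<le> (\<Sum>l\<in>(UNIV::'m set). norm h * ?e)"
        proof (rule sum_mono)
          fix l
          show "\<bar>h $ l * (?c n (D t l) x - F (D t l) x)\<bar> \<le> norm h * ?e"
            unfolding abs_mult by (intro mult_mono component_le_norm_cart N[OF Nl]) auto
        qed
        also have "\<dots> = e * norm h" by simp
        finally show "norm ((\<Sum>l\<in>UNIV. h $ l * ?c n (D t l) x) - (\<Sum>l\<in>UNIV. h $ l * F (D t l) x)) \<le> e * norm h" .
      qed
    qed auto
    then obtain g where g: "\<And>x. (\<lambda>n. ?c n t x) \<longlonglongrightarrow> g x"
      "\<And>x. (g has_derivative (\<lambda>v. \<Sum>l\<in>UNIV. v $ l * F (D t l) x)) (at x)" by auto
    have "g = F t" using LIMSEQ_unique[OF g(1) Fl[OF tT]] by auto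
    then show ?thesis using g(2) by simp
  qed
  have "Ck_on k UNIV (F t)" if "t \<in> T" for k t
    using that
  proof (induction k arbitrary: t)
    case 0
    then show ?case using has_derivative_continuous[OF der[OF 0]] by (simp add: continuous_at_imp_continuous_on)
  next
    case (Suc k)
    have "Ck_on k UNIV (\<lambda>x. \<Sum>l\<in>I. v $ l * F (D t l) x)" if "finite I" for v :: "real^'m" and I
      using that
    proof (induction I rule: finite_induct)
      case (insert l I)
      have "Ck_on k UNIV (\<lambda>x. v $ l * F (D t l) x)"
        by (intro Ck_on_mult Ck_on_const Suc.IH D(2) Suc.prems)
      then show ?case using insert by (simp add: Ck_on_add)
    qed (simp add: Ck_on_const)
    then show ?case unfolding Ck_on.simps
      by (intro exI[of _ "\<lambda>x v. \<Sum>l\<in>UNIV. v $ l * F (D t l) x"]) (use der[OF Suc.prems] in auto)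
  qed
  then have sm: "smooth (F t)" using t by (simp add: smooth_on_def)
  obtain s where s: "strict_mono s" "AE x in lborel. (\<lambda>n. ?c (s n) t x) \<longlonglongrightarrow> t x"
    using L2_AE_subseq[OF test_fun_L2[OF test[OF t]] W0_L2(1)[OF D(1)[OF t]] moll_L2[OF int[OF t] W0_L2(1)[OF D(1)[OF t]]]] by blast
  have "AE x in lborel. t x = F t x"
    using s(2)
  proof eventually_elim
    case (elim x)
    have "(\<lambda>n. ?c (s n) t x) \<longlonglongrightarrow> F t x" using LIMSEQ_subseq_LIMSEQ[OF Fl[OF t] s(1)] by (simp add: comp_def)
    then show ?case using LIMSEQ_unique elim by blast
  qed
  then show ?thesis using sm by blast
qed

text \<open>By Leibniz' rule the derivative of a cut-off function is a sum of two cut-off functions;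
  closing under sums makes the family stable under differentiation.\<close>

inductive_set cutoffs :: "real \<Rightarrow> (real^'m::finite \<Rightarrow> real) set \<Rightarrow> (real^'m \<Rightarrow> real) set"
  for r S where
  base: "test_fun (ball 0 r) \<eta> \<Longrightarrow> u \<in> S \<Longrightarrow> (\<lambda>x. \<eta> x * u x) \<in> cutoffs r S"
| add: "s \<in> cutoffs r S \<Longrightarrow> t \<in> cutoffs r S \<Longrightarrow> (\<lambda>x. s x + t x) \<in> cutoffs r S"

lemma smooth_representative:
  fixes S :: "(real^'m::finite \<Rightarrow> real) set"
  assumes S: "\<And>u l. u \<in> S \<Longrightarrow> \<exists>v\<in>S. wd \<rho> l u v" and u: "u \<in> S" and r: "0 < r" "r < \<rho>"
  shows "\<exists>w. smooth w \<and> (AE x in lborel. x \<in> ball 0 r \<longrightarrow> u x = w x)"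
proof -
  have "\<exists>e. W0 \<rho> t e \<and> (\<forall>l. e l \<in> cutoffs \<rho> S)" if "t \<in> cutoffs \<rho> S" for t
    using that
  proof induction
    case (base \<eta> u)
    have "\<forall>l. \<exists>v. v \<in> S \<and> wd \<rho> l u v" using S base(2) by blast
    from choice[OF this] obtain d where d: "\<And>l. d l \<in> S" "\<And>l. wd \<rho> l u (d l)" by blast
    have "W0 \<rho> (\<lambda>x. \<eta> x * u x) (\<lambda>l x. pderiv l \<eta> x * u x + \<eta> x * d l x)"
      by (rule W0_cutoff[OF d(2) base(1) order_refl])
    moreover have "(\<lambda>x. pderiv l \<eta> x * u x + \<eta> x * d l x) \<in> cutoffs \<rho> S" for l
      by (intro cutoffs.add cutoffs.base test_fun_pderiv base d(1))
    ultimately show ?case by blast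
  next
    case (add s t)
    then obtain e1 e2 where "W0 \<rho> s e1" "\<And>l. e1 l \<in> cutoffs \<rho> S" "W0 \<rho> t e2" "\<And>l. e2 l \<in> cutoffs \<rho> S" by blast
    then show ?case by (intro exI[of _ "\<lambda>l x. e1 l x + e2 l x"] conjI allI W0_add cutoffs.add)
  qed
  then have "\<forall>t\<in>cutoffs \<rho> S. \<exists>e. W0 \<rho> t e \<and> (\<forall>l. e l \<in> cutoffs \<rho> S)" by blast
  from bchoice[OF this] obtain D where D: "\<And>t. t \<in> cutoffs \<rho> S \<Longrightarrow> W0 \<rho> t (D t)" "\<And>t l. t \<in> cutoffs \<rho> S \<Longrightarrow> D t l \<in> cutoffs \<rho> S"
    by blast
  obtain \<eta> :: "real^'m \<Rightarrow> real" where \<eta>: "test_fun (ball 0 \<rho>) \<eta>" "\<And>x. x \<in> ball 0 r \<Longrightarrow> \<eta> x = 1"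
    using cutoff_exists[OF r] by metis
  from smooth_of_closed_family[OF D cutoffs.base[OF \<eta>(1) u]]
  obtain w where w: "smooth w" "AE x in lborel. \<eta> x * u x = w x" by blast
  have "AE x in lborel. x \<in> ball 0 r \<longrightarrow> u x = w x"
    using w(2) by eventually_elim (use \<eta>(2) in force)
  then show ?thesis using w(1) by blast
qed

theorem system_regularity:
  fixes U :: "(real^'m::finite \<Rightarrow> real) set"
  assumes dim: "CARD('m) \<le> 4" and sys: "esys R U d" and r: "0 < r" "r < R" "R \<le> 1" and u: "u \<in> U"
  shows "\<exists>w. smooth w \<and> (AE x in lborel. x \<in> ball 0 r \<longrightarrow> u x = w x)"
proof -
  obtain \<rho> where \<rho>: "r < \<rho>" "\<rho> < R" using dense r by blast
  then have "0 < \<rho>" using r by simp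
  obtain S where S: "U \<subseteq> S" "\<And>u l. u \<in> S \<Longrightarrow> \<exists>v\<in>S. wd \<rho> l u v"
    using bootstrap[OF dim sys \<open>0 < \<rho>\<close> \<rho>(2) r(3)] by blast
  show ?thesis by (rule smooth_representative[OF S(2) _ r(1) \<rho>(1)]) (use u S(1) in auto)
qed

section \<open>Gauge transformations of weak Yang--Mills connections\<close>

lemma mm_diff_right: "(A::real^'n^'n) ** (B - C) = A ** B - A ** C"
  by (simp add: vec_eq_iff matrix_matrix_mult_def sum_subtractf algebra_simps)
lemma mm_diff_left: "((A::real^'n^'n) - B) ** C = A ** C - B ** C"
  by (simp add: vec_eq_iff matrix_matrix_mult_def sum_subtractf algebra_simps)
lemma mm_add_left: "((A::real^'n^'n) + B) ** C = A ** C + B ** C"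
  by (simp add: vec_eq_iff matrix_matrix_mult_def sum.distrib algebra_simps)
lemma mm_minus_left: "(- (A::real^'n^'n)) ** C = - (A ** C)"
  by (simp add: vec_eq_iff matrix_matrix_mult_def sum_negf)
lemma mm_minus_right: "(C::real^'n^'n) ** (- A) = - (C ** A)"
  by (simp add: vec_eq_iff matrix_matrix_mult_def sum_negf)
lemma mm_sum_right: "(C::real^'n^'n) ** (\<Sum>j\<in>I. (A j::real^'n^'n)) = (\<Sum>j\<in>I. C ** A j)"
  by (induction I rule: infinite_finite_induct) (auto simp: matrix_add_ldistrib)
lemma mm_sum_left: "(\<Sum>j\<in>I. (A j::real^'n^'n)) ** (C::real^'n^'n) = (\<Sum>j\<in>I. A j ** C)"
  by (induction I rule: infinite_finite_induct) (auto simp: mm_add_left)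
lemmas mm_simps = mm_diff_right mm_diff_left mm_add_left matrix_add_ldistrib mm_minus_left mm_minus_right

lemma mm_entry: "((A::real^'n^'n) ** B) $ a $ b = (\<Sum>c\<in>UNIV. A $ a $ c * B $ c $ b)"
  by (simp add: matrix_matrix_mult_def)

definition mwd :: "real \<Rightarrow> 'm::finite \<Rightarrow> (real^'m \<Rightarrow> real^'n^'n) \<Rightarrow> (real^'m \<Rightarrow> real^'n^'n) \<Rightarrow> bool" where
  "mwd R l M N \<longleftrightarrow> (\<forall>a b. wd R l (\<lambda>x. M x $ a $ b) (\<lambda>x. N x $ a $ b))"

definition mL2 :: "(real^'m \<Rightarrow> real^'n^'n) \<Rightarrow> bool" where
  "mL2 M \<longleftrightarrow> (\<forall>a b. L2 (\<lambda>x. M x $ a $ b))"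

definition mmeas :: "(real^'m \<Rightarrow> real^'n^'n) \<Rightarrow> bool" where
  "mmeas M \<longleftrightarrow> (\<forall>a b. (\<lambda>x. M x $ a $ b) \<in> borel_measurable borel)"

definition madm :: "real \<Rightarrow> (real^'m::finite \<Rightarrow> real^'n^'n) \<Rightarrow> bool" where
  "madm R M \<longleftrightarrow> (\<forall>a b. adm R (\<lambda>x. M x $ a $ b))"

lemma mwdD: "mwd R l M N \<Longrightarrow> wd R l (\<lambda>x. M x $ a $ b) (\<lambda>x. N x $ a $ b)" by (simp add: mwd_def)
lemma mwd_mono: "mwd R l M N \<Longrightarrow> r \<le> R \<Longrightarrow> mwd r l M N" by (auto simp: mwd_def intro: wd_mono)
lemma mwd_mL2: "mwd R l M N \<Longrightarrow> mL2 M" "mwd R l M N \<Longrightarrow> mL2 N" by (auto simp: mwd_def mL2_def wd_def)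
lemma mL2_mmeas: "mL2 M \<Longrightarrow> mmeas M" by (auto simp: mL2_def mmeas_def L2_def)
lemma madm_mmeas: "madm R M \<Longrightarrow> mmeas M" by (auto simp: madm_def mmeas_def adm_def)
lemma mwd_mmeas: "mwd R l M N \<Longrightarrow> mmeas M" "mwd R l M N \<Longrightarrow> mmeas N" by (auto intro: mL2_mmeas mwd_mL2)

lemma mmeas_add: "mmeas M \<Longrightarrow> mmeas N \<Longrightarrow> mmeas (\<lambda>x. M x + N x)" by (auto simp: mmeas_def intro: borel_measurable_add)
lemma mmeas_diff: "mmeas M \<Longrightarrow> mmeas N \<Longrightarrow> mmeas (\<lambda>x. M x - N x)" by (auto simp: mmeas_def intro: borel_measurable_diff)
lemma mmeas_minus: "mmeas M \<Longrightarrow> mmeas (\<lambda>x. - M x)" by (simp add: mmeas_def)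
lemma mmeas_mult: "mmeas M \<Longrightarrow> mmeas N \<Longrightarrow> mmeas (\<lambda>x. M x ** N x)" by (auto simp: mmeas_def mm_entry intro!: borel_measurable_sum borel_measurable_times)
lemma mmeas_sum: "(\<And>i. i \<in> I \<Longrightarrow> mmeas (M i)) \<Longrightarrow> mmeas (\<lambda>x. \<Sum>i\<in>I. M i x)" by (auto simp: mmeas_def sum_component intro!: borel_measurable_sum)
lemma mmeas_bracket: "mmeas M \<Longrightarrow> mmeas N \<Longrightarrow> mmeas (\<lambda>x. lie_bracket (M x) (N x))"
  unfolding lie_bracket_def by (intro mmeas_diff mmeas_mult)

lemma test_integral_cong_AE:
  fixes f g :: "real^'m \<Rightarrow> real"
  assumes t: "test_fun (ball 0 r) \<phi>" and f: "f \<in> borel_measurable borel" "g \<in> borel_measurable borel"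
    and ae: "AE x in lborel. x \<in> ball 0 r \<longrightarrow> f x = g x"
  shows "(\<integral>x. \<phi> x * f x \<partial>lborel) = (\<integral>x. \<phi> x * g x \<partial>lborel)"
proof (rule integral_cong_AE)
  note [measurable] = f smooth_measurable[OF test_fun_smooth[OF t]]
  show "(\<lambda>x. \<phi> x * f x) \<in> borel_measurable lborel" "(\<lambda>x. \<phi> x * g x) \<in> borel_measurable lborel" by measurable
  show "AE x in lborel. \<phi> x * f x = \<phi> x * g x"
    using ae by eventually_elim (use test_fun_outside(1)[OF t] in force)
qed

lemma mat_test_integral_cong_AE:
  fixes M N :: "real^'m \<Rightarrow> real^'n^'n"
  assumes t: "test_fun (ball 0 r) \<phi>" and f: "mmeas M" "mmeas N"
    and ae: "AE x in lborel. x \<in> ball 0 r \<longrightarrow> M x = N x"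
  shows "(\<integral>x. \<phi> x * M x $ a $ b \<partial>lborel) = (\<integral>x. \<phi> x * N x $ a $ b \<partial>lborel)"
  by (rule test_integral_cong_AE[OF t]) (use f ae in \<open>auto simp: mmeas_def\<close>)

section \<open>Multiplying weak equations by Sobolev factors\<close>

lemma mat_product_rule:
  fixes M N :: "real^'m::finite \<Rightarrow> real^'n^'n"
  assumes M: "\<And>l. mwd R l M (M' l)" and N: "mwd R l N N'" and t: "test_fun (ball 0 R) \<phi>"
  shows "(\<integral>x. pderiv l \<phi> x * (M x ** N x) $ a $ b \<partial>lborel) = - (\<integral>x. \<phi> x * (M' l x ** N x + M x ** N' x) $ a $ b \<partial>lborel)"
    and "integrable lborel (\<lambda>x. pderiv l \<phi> x * (M x ** N x) $ a $ b)"
    and "integrable lborel (\<lambda>x. \<phi> x * (M' l x ** N x + M x ** N' x) $ a $ b)"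
proof -
  note P = product_rule[OF mwdD[OF M] mwdD[OF N] t]
  have e1: "pderiv l \<phi> x * (M x ** N x) $ a $ b = (\<Sum>c\<in>UNIV. pderiv l \<phi> x * (M x $ a $ c * N x $ c $ b))" for x
    by (simp add: mm_entry sum_distrib_left)
  have e2: "\<phi> x * (M' l x ** N x + M x ** N' x) $ a $ b = (\<Sum>c\<in>UNIV. \<phi> x * (M' l x $ a $ c * N x $ c $ b + M x $ a $ c * N' x $ c $ b))" for x
    by (simp add: mm_entry sum_distrib_left sum.distrib[symmetric])
  show "integrable lborel (\<lambda>x. pderiv l \<phi> x * (M x ** N x) $ a $ b)" unfolding e1 by (intro Bochner_Integration.integrable_sum P(2))
  show "integrable lborel (\<lambda>x. \<phi> x * (M' l x ** N x + M x ** N' x) $ a $ b)" unfolding e2 by (intro Bochner_Integration.integrable_sum P(3))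
  show "(\<integral>x. pderiv l \<phi> x * (M x ** N x) $ a $ b \<partial>lborel) = - (\<integral>x. \<phi> x * (M' l x ** N x + M x ** N' x) $ a $ b \<partial>lborel)"
    unfolding e1 e2 by (subst (1 2) Bochner_Integration.integral_sum) (auto intro: P(2) P(3) simp: P(1) sum_negf)
qed

text \<open>A weak divergence equation may be multiplied by a Sobolev function \<open>u\<close>
  since \<open>\<phi> * u\<close> is a \<open>W0\<close> function and thus allowed for
  testing.\<close>

lemma equation_mult:
  fixes F :: "'m::finite \<Rightarrow> real^'m \<Rightarrow> real"
  assumes F: "\<And>j. L2 (F j)" and f: "adm R f"
    and eq: "\<And>\<phi>. test_fun (ball 0 R) \<phi> \<Longrightarrow> (\<Sum>j\<in>UNIV. \<integral>x. pderiv j \<phi> x * F j x \<partial>lborel) = - (\<integral>x. \<phi> x * f x \<partial>lborel)"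
    and u: "\<And>j. wd R j u (du j)" and t: "test_fun (ball 0 R) \<phi>" and R: "R > 0"
  shows "(\<Sum>j\<in>UNIV. \<integral>x. pderiv j \<phi> x * (u x * F j x) \<partial>lborel) = - (\<integral>x. \<phi> x * (u x * f x + (\<Sum>j\<in>UNIV. du j x * F j x)) \<partial>lborel)"
    and "integrable lborel (\<lambda>x. \<phi> x * (u x * f x + (\<Sum>j\<in>UNIV. du j x * F j x)))"
    and "integrable lborel (\<lambda>x. pderiv j \<phi> x * (u x * F j x))"
proof -
  obtain r where r: "r < R" "test_fun (ball 0 r) \<phi>" using test_fun_ball_shrink[OF t R] by metis
  have W: "W0 r (\<lambda>x. \<phi> x * u x) (\<lambda>l x. pderiv l \<phi> x * u x + \<phi> x * du l x)"
    by (rule W0_cutoff[OF u r(2)]) (use r in simp)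
  have i1: "integrable lborel (\<lambda>x. pderiv j \<phi> x * u x * F j x)" for j
    by (rule L2_mult_integrable[OF L2_smooth_test[OF wd_L2(1)[OF u] test_fun_pderiv[OF t]] F])
  have i2: "integrable lborel (\<lambda>x. \<phi> x * du j x * F j x)" for j
    by (rule L2_mult_integrable[OF L2_smooth_test[OF wd_L2(2)[OF u] t] F])
  have i3: "integrable lborel (\<lambda>x. \<phi> x * u x * f x)" by (rule adm_integrable[OF f r(1) W])
  have e: "\<phi> x * (u x * f x + (\<Sum>j\<in>UNIV. du j x * F j x)) = \<phi> x * u x * f x + (\<Sum>j\<in>UNIV. \<phi> x * du j x * F j x)" for x
    by (simp add: distrib_left sum_distrib_left mult.assoc)
  show "integrable lborel (\<lambda>x. \<phi> x * (u x * f x + (\<Sum>j\<in>UNIV. du j x * F j x)))"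
    unfolding e using i2 i3 by simp
  show "integrable lborel (\<lambda>x. pderiv j \<phi> x * (u x * F j x))" using i1[of j] by (simp add: mult.assoc)
  have "(\<Sum>j\<in>UNIV. \<integral>x. (pderiv j \<phi> x * u x + \<phi> x * du j x) * F j x \<partial>lborel) = - (\<integral>x. \<phi> x * u x * f x \<partial>lborel)"
    by (rule extended_testing[OF F f eq W r(1)])
  moreover have "(\<integral>x. (pderiv j \<phi> x * u x + \<phi> x * du j x) * F j x \<partial>lborel)
     = (\<integral>x. pderiv j \<phi> x * (u x * F j x) \<partial>lborel) + (\<integral>x. \<phi> x * du j x * F j x \<partial>lborel)" for j
    using i1[of j] i2[of j] by (simp add: distrib_right mult.assoc)
  moreover have "(\<integral>x. \<phi> x * (u x * f x + (\<Sum>j\<in>UNIV. du j x * F j x)) \<partial>lborel)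
     = (\<integral>x. \<phi> x * u x * f x \<partial>lborel) + (\<Sum>j\<in>UNIV. \<integral>x. \<phi> x * du j x * F j x \<partial>lborel)"
    unfolding e using i2 i3 by simp
  ultimately show "(\<Sum>j\<in>UNIV. \<integral>x. pderiv j \<phi> x * (u x * F j x) \<partial>lborel) = - (\<integral>x. \<phi> x * (u x * f x + (\<Sum>j\<in>UNIV. du j x * F j x)) \<partial>lborel)"
    by (simp add: sum.distrib)
qed

lemma equation_mult_left:
  fixes F :: "'m::finite \<Rightarrow> real^'m \<Rightarrow> real^'n^'n"
  assumes F: "\<And>j. mL2 (F j)" and f: "madm R f"
    and eq: "\<And>\<phi> a b. test_fun (ball 0 R) \<phi> \<Longrightarrow> (\<Sum>j\<in>UNIV. \<integral>x. pderiv j \<phi> x * F j x $ a $ b \<partial>lborel) = - (\<integral>x. \<phi> x * f x $ a $ b \<partial>lborel)"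
    and h: "\<And>j. mwd R j h (dh j)" and t: "test_fun (ball 0 R) \<phi>" and R: "R > 0"
  shows "(\<Sum>j\<in>UNIV. \<integral>x. pderiv j \<phi> x * (h x ** F j x) $ a $ b \<partial>lborel)
     = - (\<integral>x. \<phi> x * (h x ** f x + (\<Sum>j\<in>UNIV. dh j x ** F j x)) $ a $ b \<partial>lborel)"
proof -
  have F': "L2 (\<lambda>x. F j x $ a $ b)" for j a b using F by (simp add: mL2_def)
  have f': "adm R (\<lambda>x. f x $ a $ b)" for a b using f by (simp add: madm_def)
  note P = equation_mult[OF F' f' eq mwdD[OF h] t R]
  have e1: "pderiv j \<phi> x * (h x ** F j x) $ a $ b = (\<Sum>c\<in>UNIV. pderiv j \<phi> x * (h x $ a $ c * F j x $ c $ b))" for x j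
    by (simp add: mm_entry sum_distrib_left)
  have e2: "\<phi> x * (h x ** f x + (\<Sum>j\<in>UNIV. dh j x ** F j x)) $ a $ b
     = (\<Sum>c\<in>UNIV. \<phi> x * (h x $ a $ c * f x $ c $ b + (\<Sum>j\<in>UNIV. dh j x $ a $ c * F j x $ c $ b)))" for x
  proof -
    have "(\<Sum>j\<in>UNIV. dh j x ** F j x) $ a $ b = (\<Sum>c\<in>UNIV. \<Sum>j\<in>UNIV. dh j x $ a $ c * F j x $ c $ b)"
      unfolding sum_component mm_entry by (rule sum.swap)
    then show ?thesis by (simp add: mm_entry sum_distrib_left[symmetric] sum.distrib)
  qed
  have "(\<Sum>j\<in>UNIV. \<integral>x. pderiv j \<phi> x * (h x ** F j x) $ a $ b \<partial>lborel)
     = (\<Sum>j\<in>UNIV. \<Sum>c\<in>UNIV. \<integral>x. pderiv j \<phi> x * (h x $ a $ c * F j x $ c $ b) \<partial>lborel)"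
    unfolding e1 by (intro sum.cong refl Bochner_Integration.integral_sum P(3))
  also have "\<dots> = (\<Sum>c\<in>UNIV. \<Sum>j\<in>UNIV. \<integral>x. pderiv j \<phi> x * (h x $ a $ c * F j x $ c $ b) \<partial>lborel)"
    by (rule sum.swap)
  also have "\<dots> = (\<Sum>c\<in>UNIV. - (\<integral>x. \<phi> x * (h x $ a $ c * f x $ c $ b + (\<Sum>j\<in>UNIV. dh j x $ a $ c * F j x $ c $ b)) \<partial>lborel))"
    by (intro sum.cong refl P(1))
  also have "\<dots> = - (\<integral>x. \<phi> x * (h x ** f x + (\<Sum>j\<in>UNIV. dh j x ** F j x)) $ a $ b \<partial>lborel)"
    unfolding e2 by (subst Bochner_Integration.integral_sum) (auto intro: P(2) simp: sum_negf)
  finally show ?thesis .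
qed

lemma equation_mult_right:
  fixes F :: "'m::finite \<Rightarrow> real^'m \<Rightarrow> real^'n^'n"
  assumes F: "\<And>j. mL2 (F j)" and f: "madm R f"
    and eq: "\<And>\<phi> a b. test_fun (ball 0 R) \<phi> \<Longrightarrow> (\<Sum>j\<in>UNIV. \<integral>x. pderiv j \<phi> x * F j x $ a $ b \<partial>lborel) = - (\<integral>x. \<phi> x * f x $ a $ b \<partial>lborel)"
    and h: "\<And>j. mwd R j h (dh j)" and t: "test_fun (ball 0 R) \<phi>" and R: "R > 0"
  shows "(\<Sum>j\<in>UNIV. \<integral>x. pderiv j \<phi> x * (F j x ** h x) $ a $ b \<partial>lborel)
     = - (\<integral>x. \<phi> x * (f x ** h x + (\<Sum>j\<in>UNIV. F j x ** dh j x)) $ a $ b \<partial>lborel)"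
proof -
  have F': "L2 (\<lambda>x. F j x $ a $ b)" for j a b using F by (simp add: mL2_def)
  have f': "adm R (\<lambda>x. f x $ a $ b)" for a b using f by (simp add: madm_def)
  note P = equation_mult[OF F' f' eq mwdD[OF h] t R]
  have e1: "pderiv j \<phi> x * (F j x ** h x) $ a $ b = (\<Sum>c\<in>UNIV. pderiv j \<phi> x * (h x $ c $ b * F j x $ a $ c))" for x j
    by (simp add: mm_entry sum_distrib_left mult_ac)
  have e2: "\<phi> x * (f x ** h x + (\<Sum>j\<in>UNIV. F j x ** dh j x)) $ a $ b
     = (\<Sum>c\<in>UNIV. \<phi> x * (h x $ c $ b * f x $ a $ c + (\<Sum>j\<in>UNIV. dh j x $ c $ b * F j x $ a $ c)))" for x
  proof -
    have "(\<Sum>j\<in>UNIV. F j x ** dh j x) $ a $ b = (\<Sum>c\<in>UNIV. \<Sum>j\<in>UNIV. F j x $ a $ c * dh j x $ c $ b)"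
      unfolding sum_component mm_entry by (rule sum.swap)
    then show ?thesis by (simp add: mm_entry sum_distrib_left[symmetric] sum.distrib mult.commute)
  qed
  have "(\<Sum>j\<in>UNIV. \<integral>x. pderiv j \<phi> x * (F j x ** h x) $ a $ b \<partial>lborel)
     = (\<Sum>j\<in>UNIV. \<Sum>c\<in>UNIV. \<integral>x. pderiv j \<phi> x * (h x $ c $ b * F j x $ a $ c) \<partial>lborel)"
    unfolding e1 by (intro sum.cong refl Bochner_Integration.integral_sum P(3))
  also have "\<dots> = (\<Sum>c\<in>UNIV. \<Sum>j\<in>UNIV. \<integral>x. pderiv j \<phi> x * (h x $ c $ b * F j x $ a $ c) \<partial>lborel)"
    by (rule sum.swap)
  also have "\<dots> = (\<Sum>c\<in>UNIV. - (\<integral>x. \<phi> x * (h x $ c $ b * f x $ a $ c + (\<Sum>j\<in>UNIV. dh j x $ c $ b * F j x $ a $ c)) \<partial>lborel))"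
    by (intro sum.cong refl P(1))
  also have "\<dots> = - (\<integral>x. \<phi> x * (f x ** h x + (\<Sum>j\<in>UNIV. F j x ** dh j x)) $ a $ b \<partial>lborel)"
    unfolding e2 by (subst Bochner_Integration.integral_sum) (auto intro: P(2) simp: sum_negf)
  finally show ?thesis .
qed

section \<open>The inverse of the gauge and its weak derivative\<close>

lemma n2_sum: "(\<And>i. i \<in> I \<Longrightarrow> L2 (f i)) \<Longrightarrow> n2 (\<lambda>x. \<Sum>i\<in>I. f i x) \<le> (\<Sum>i\<in>I. n2 (f i))"
proof (induction I rule: infinite_finite_induct)
  case (insert i I)
  have "n2 (\<lambda>x. f i x + (\<Sum>i\<in>I. f i x)) \<le> n2 (f i) + n2 (\<lambda>x. \<Sum>i\<in>I. f i x)"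
    by (rule n2_add) (use insert in \<open>auto intro: L2_sum\<close>)
  then show ?case using insert by force
qed (simp_all add: n2_def)

text \<open>Since \<open>h(y) - h(x) = - h(y) (g(y) - g(x)) h(x)\<close>, the difference quotients of the inverse are
  dominated by those of the gauge.\<close>
lemma inverse_weakly_differentiable:
  fixes g h :: "real^'m::finite \<Rightarrow> real^'n^'n"
  assumes g: "\<And>l. mwd 1 l g (dg l)" and h: "mL2 h" "\<And>x a b. \<bar>h x $ a $ b\<bar> \<le> M"
    and hg: "\<And>x. x \<in> ball 0 1 \<Longrightarrow> h x ** g x = mat 1" "\<And>x. x \<in> ball 0 1 \<Longrightarrow> g x ** h x = mat 1"
    and r: "0 < r" "r < 1"
  shows "\<exists>v. wd r k (\<lambda>x. h x $ a $ b) v"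
proof -
  define \<delta> where "\<delta> = (1 - r) / 3"
  define r1 where "r1 = r + \<delta>"
  have \<delta>: "\<delta> > 0" "r < r1" "r1 + \<delta> < 1" "0 < r1" using r by (auto simp: \<delta>_def r1_def field_simps)
  have M0: "M \<ge> 0" using h(2)[of undefined undefined undefined] by linarith
  obtain \<eta> :: "real^'m \<Rightarrow> real" where \<eta>: "test_fun (ball 0 r1) \<eta>" "\<And>x. x \<in> ball 0 r \<Longrightarrow> \<eta> x = 1"
    using cutoff_exists[OF r(1) \<delta>(2)] by metis
  have "\<forall>p. \<exists>C\<ge>0. \<forall>t. t \<noteq> 0 \<longrightarrow> \<bar>t\<bar> < \<delta> \<longrightarrow> n2 (\<lambda>x. \<eta> x * Dq t k (\<lambda>x. g x $ fst p $ snd p) x) \<le> C"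
    using dq_local_bound[OF mwdD[OF g] \<delta>(4,3,1) \<eta>(1)] by blast
  from choice[OF this] obtain C where C: "\<And>p t. t \<noteq> 0 \<Longrightarrow> \<bar>t\<bar> < \<delta> \<Longrightarrow> n2 (\<lambda>x. \<eta> x * Dq t k (\<lambda>x. g x $ fst p $ snd p) x) \<le> C p" by blast
  have hL: "L2 (\<lambda>x. h x $ a $ b)" for a b using h(1) by (simp add: mL2_def)
  have gL: "L2 (\<lambda>x. g x $ a $ b)" for a b using mwd_mL2(1)[OF g] by (simp add: mL2_def)
  have pL: "L2 (\<lambda>x. \<bar>\<eta> x * Dq t k (\<lambda>x. g x $ fst p $ snd p) x\<bar>)" for t and p :: "'n \<times> 'n"
    by (rule L2_abs[OF L2_smooth_test[OF L2_Dq[OF gL] \<eta>(1)]])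
  let ?P = "UNIV :: ('n \<times> 'n) set"
  show ?thesis
  proof (rule wd_from_dq_bound[OF hL \<delta>(1) \<eta>(2)])
    show "L2 (\<lambda>x. \<eta> x * Dq t k (\<lambda>x. h x $ a $ b) x)" for t by (rule L2_smooth_test[OF L2_Dq[OF hL] \<eta>(1)])
    fix t :: real assume t: "t \<noteq> 0" "\<bar>t\<bar> < \<delta>"
    have "\<bar>\<eta> x * Dq t k (\<lambda>x. h x $ a $ b) x\<bar> \<le> \<bar>M * M * (\<Sum>p\<in>?P. \<bar>\<eta> x * Dq t k (\<lambda>x. g x $ fst p $ snd p) x\<bar>)\<bar>" for x
    proof (cases "x \<in> ball 0 r1")
      case False
      then show ?thesis by (simp add: test_fun_outside(1)[OF \<eta>(1)])
    next
      case True
      let ?y = "x + t *\<^sub>R axis k 1"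
      have "norm ?y \<le> norm x + \<bar>t\<bar>" using norm_triangle_ineq[of x "t *\<^sub>R axis k 1"] by (simp add: norm_axis_1)
      then have xy: "x \<in> ball 0 1" "?y \<in> ball 0 1" using True t \<delta> by auto
      have "h ?y ** (g ?y - g x) ** h x = h x - h ?y"
        using hg(1)[OF xy(2)] hg(2)[OF xy(1)] by (simp add: mm_simps matrix_mul_assoc[symmetric])
      then have "\<bar>h ?y $ a $ b - h x $ a $ b\<bar> = \<bar>(h ?y ** (g ?y - g x) ** h x) $ a $ b\<bar>" by (simp add: abs_minus_commute)
      also have "\<dots> = \<bar>\<Sum>c\<in>UNIV. (\<Sum>e\<in>UNIV. h ?y $ a $ e * (g ?y - g x) $ e $ c) * h x $ c $ b\<bar>"
        by (simp only: mm_entry)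
      also have "\<dots> \<le> (\<Sum>c\<in>UNIV. \<Sum>e\<in>UNIV. M * M * \<bar>(g ?y - g x) $ e $ c\<bar>)"
      proof (rule order_trans[OF sum_abs], rule sum_mono)
        fix c
        have "\<bar>(\<Sum>e\<in>UNIV. h ?y $ a $ e * (g ?y - g x) $ e $ c) * h x $ c $ b\<bar>
           \<le> (\<Sum>e\<in>UNIV. M * \<bar>(g ?y - g x) $ e $ c\<bar>) * M"
          unfolding abs_mult
          by (intro mult_mono order_trans[OF sum_abs] sum_mono h(2) sum_nonneg) (auto simp: abs_mult M0 h(2) intro: mult_right_mono)
        then show "\<bar>(\<Sum>e\<in>UNIV. h ?y $ a $ e * (g ?y - g x) $ e $ c) * h x $ c $ b\<bar> \<le> (\<Sum>e\<in>UNIV. M * M * \<bar>(g ?y - g x) $ e $ c\<bar>)"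
          by (simp add: sum_distrib_left sum_distrib_right mult_ac)
      qed
      also have "\<dots> = M * M * (\<Sum>p\<in>?P. \<bar>(g ?y - g x) $ fst p $ snd p\<bar>)"
      proof -
        have "(\<Sum>c\<in>UNIV. \<Sum>e\<in>UNIV. M * M * \<bar>(g ?y - g x) $ e $ c\<bar>) = (\<Sum>e\<in>UNIV. \<Sum>c\<in>UNIV. M * M * \<bar>(g ?y - g x) $ e $ c\<bar>)"
          by (rule sum.swap)
        also have "\<dots> = (\<Sum>p\<in>?P. M * M * \<bar>(g ?y - g x) $ fst p $ snd p\<bar>)"
          unfolding UNIV_Times_UNIV[symmetric] by (subst sum.cartesian_product) (simp add: case_prod_unfold)
        finally show ?thesis by (simp only: sum_distrib_left)
      qed
      finally have "\<bar>\<eta> x / t\<bar> * \<bar>h ?y $ a $ b - h x $ a $ b\<bar> \<le> \<bar>\<eta> x / t\<bar> * (M * M * (\<Sum>p\<in>?P. \<bar>(g ?y - g x) $ fst p $ snd p\<bar>))"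
        by (rule mult_left_mono) simp
      also have "\<dots> = M * M * (\<Sum>p\<in>?P. \<bar>\<eta> x * Dq t k (\<lambda>x. g x $ fst p $ snd p) x\<bar>)"
        by (simp add: sum_distrib_left Dq_def abs_mult abs_divide mult_ac)
      also have "\<dots> \<le> \<bar>\<dots>\<bar>" by simp
      finally show ?thesis by (simp add: Dq_def abs_mult abs_divide)
    qed
    then have "n2 (\<lambda>x. \<eta> x * Dq t k (\<lambda>x. h x $ a $ b) x) \<le> n2 (\<lambda>x. M * M * (\<Sum>p\<in>?P. \<bar>\<eta> x * Dq t k (\<lambda>x. g x $ fst p $ snd p) x\<bar>))"
      by (intro n2_mono L2_cmult L2_sum pL L2_measurable[OF L2_smooth_test[OF L2_Dq[OF hL] \<eta>(1)]])
    also have "\<dots> \<le> \<bar>M * M\<bar> * (\<Sum>p\<in>?P. C p)"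
    proof -
      have "n2 (\<lambda>x. \<Sum>p\<in>?P. \<bar>\<eta> x * Dq t k (\<lambda>x. g x $ fst p $ snd p) x\<bar>) \<le> (\<Sum>p\<in>?P. n2 (\<lambda>x. \<bar>\<eta> x * Dq t k (\<lambda>x. g x $ fst p $ snd p) x\<bar>))"
        by (rule n2_sum[OF pL])
      also have "\<dots> \<le> (\<Sum>p\<in>?P. C p)"
      proof (rule sum_mono)
        fix p :: "'n \<times> 'n"
        have "n2 (\<lambda>x. \<bar>\<eta> x * Dq t k (\<lambda>x. g x $ fst p $ snd p) x\<bar>) = n2 (\<lambda>x. \<eta> x * Dq t k (\<lambda>x. g x $ fst p $ snd p) x)"
          by (rule n2_cong) simp
        then show "n2 (\<lambda>x. \<bar>\<eta> x * Dq t k (\<lambda>x. g x $ fst p $ snd p) x\<bar>) \<le> C p" using C[OF t] by simp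
      qed
      finally show ?thesis unfolding n2_cmult by (rule mult_left_mono) simp
    qed
    finally show "n2 (\<lambda>x. \<eta> x * Dq t k (\<lambda>x. h x $ a $ b) x) \<le> \<bar>M * M\<bar> * (\<Sum>p\<in>?P. C p)" .
  qed
qed

lemma mat_fundamental_lemma:
  fixes X :: "real^'m::finite \<Rightarrow> real^'n^'n"
  assumes int: "\<And>a b. integrable lborel (\<lambda>x. X x $ a $ b)"
    and zero: "\<And>\<phi> a b. test_fun (ball 0 R) \<phi> \<Longrightarrow> (\<integral>x. \<phi> x * X x $ a $ b \<partial>lborel) = 0"
  shows "AE x in lborel. x \<in> ball 0 R \<longrightarrow> X x = 0"
proof -
  have "AE x in lborel. x \<in> ball 0 R \<longrightarrow> X x $ a $ b = 0" for a b
    by (rule fundamental_lemma[OF _ zero])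
       (rule bounded_mult_integrable[OF int, of _ 1]; auto simp: indicator_def)
  then have "AE x in lborel. \<forall>a\<in>UNIV. \<forall>b\<in>UNIV. x \<in> ball 0 R \<longrightarrow> X x $ a $ b = 0"
    by (intro AE_finite_allI) auto
  then show ?thesis by eventually_elim (simp add: vec_eq_iff)
qed

lemma mm_integrable: "mL2 M \<Longrightarrow> mL2 N \<Longrightarrow> integrable lborel (\<lambda>x. (M x ** N x) $ a $ b)"
  unfolding mm_entry mL2_def by (intro Bochner_Integration.integrable_sum L2_mult_integrable) auto

text \<open>The weak form of differentiating \<open>h ** g = mat 1\<close>: the constant side
  contributes nothing by \<open>integral_pderiv_zero\<close>.\<close>

lemma inverse_derivative:
  fixes g h :: "real^'m::finite \<Rightarrow> real^'n^'n"
  assumes g: "\<And>l. mwd r l g (dg l)" and h: "\<And>l. mwd r l h (dh l)"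
    and hg: "\<And>x. x \<in> ball 0 r \<Longrightarrow> h x ** g x = mat 1"
  shows "AE x in lborel. x \<in> ball 0 r \<longrightarrow> dh l x ** g x + h x ** dg l x = 0"
proof (rule mat_fundamental_lemma)
  fix a b :: 'n
  show "integrable lborel (\<lambda>x. (dh l x ** g x + h x ** dg l x) $ a $ b)"
    using mm_integrable[OF mwd_mL2(2)[OF h] mwd_mL2(1)[OF g]] mm_integrable[OF mwd_mL2(1)[OF h] mwd_mL2(2)[OF g]] by simp
  fix \<phi> :: "real^'m \<Rightarrow> real" assume t: "test_fun (ball 0 r) \<phi>"
  have "pderiv l \<phi> x * (h x ** g x) $ a $ b = pderiv l \<phi> x * (mat 1 :: real^'n^'n) $ a $ b" for x
    using hg[of x] test_fun_outside(2)[OF t, of x] by (cases "x \<in> ball 0 r") auto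
  then have "(\<integral>x. pderiv l \<phi> x * (h x ** g x) $ a $ b \<partial>lborel) = (\<integral>x. pderiv l \<phi> x * (mat 1 :: real^'n^'n) $ a $ b \<partial>lborel)"
    by (simp only:)
  also have "\<dots> = 0" using integral_pderiv_zero[OF t, of l] by simp
  finally show "(\<integral>x. \<phi> x * (dh l x ** g x + h x ** dg l x) $ a $ b \<partial>lborel) = 0"
    using mat_product_rule(1)[OF h g t, of l a b] by simp
qed

section \<open>Curvature and the Yang--Mills equation under a change of gauge\<close>

lemma curvature_algebra:
  fixes g Bi Bj Ai Aj DBij DBji DAij DAji :: "real^'n^'n"
  assumes "((g ** Bi - Ai ** g) ** Bj + g ** DBij - (DAij ** g + Aj ** (g ** Bi - Ai ** g)))
     - ((g ** Bj - Aj ** g) ** Bi + g ** DBji - (DAji ** g + Ai ** (g ** Bj - Aj ** g))) = 0"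
  shows "g ** (DBij - DBji + lie_bracket Bi Bj) = (DAij - DAji + lie_bracket Ai Aj) ** g"
  using assms unfolding lie_bracket_def by (simp add: mm_simps matrix_mul_assoc algebra_simps)

text \<open>By the gauge relation, \<open>dg j\<close> is a difference of products of Sobolev
  functions and has the integrable weak derivatives \<open>?X i j\<close>. Symmetry of the second
  distributional derivatives of g gives \<open>?X i j = ?X j i\<close>, and
  \<open>curvature_algebra\<close> reads this as \<open>g F_B = F_A g\<close>.\<close>

lemma curvature_identity:
  fixes g :: "real^'m::finite \<Rightarrow> real^'n^'n"
  assumes g: "\<And>l. mwd r l g (dg l)" and A: "\<And>l j. mwd r l (A j) (DA l j)" and B: "\<And>l j. mwd r l (B j) (DB l j)"
    and gB: "\<And>j. AE x in lborel. x \<in> ball 0 r \<longrightarrow> dg j x = g x ** B j x - A j x ** g x"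
  shows "AE x in lborel. x \<in> ball 0 r \<longrightarrow> g x ** curvature B DB i j x = curvature A DA i j x ** g x"
proof -
  let ?X = "\<lambda>i j x. dg i x ** B j x + g x ** DB i j x - (DA i j x ** g x + A j x ** dg i x)"
  note L = mwd_mL2[OF g] mwd_mL2[OF A] mwd_mL2[OF B]
  note I = mm_integrable[OF L(2) L(5)] mm_integrable[OF L(1) L(6)] mm_integrable[OF L(4) L(1)] mm_integrable[OF L(3) L(2)]
  have Xi: "integrable lborel (\<lambda>x. ?X i j x $ a $ b)" for i j a b using I by simp
  have Xphi: "(\<integral>x. \<phi> x * ?X i j x $ a $ b \<partial>lborel) = - (\<integral>x. pderiv i \<phi> x * dg j x $ a $ b \<partial>lborel)"
    if t: "test_fun (ball 0 r) \<phi>" for \<phi> i j a b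
  proof -
    note P = mat_product_rule[OF g B t, of i j a b] and Q = mat_product_rule[OF A g t, of i j a b]
    have "(\<integral>x. pderiv i \<phi> x * dg j x $ a $ b \<partial>lborel) = (\<integral>x. pderiv i \<phi> x * (g x ** B j x - A j x ** g x) $ a $ b \<partial>lborel)"
      by (rule mat_test_integral_cong_AE[OF test_fun_pderiv[OF t]])
         (use gB in \<open>auto intro!: mmeas_diff mmeas_mult mwd_mmeas[OF g] mwd_mmeas[OF A] mwd_mmeas[OF B]\<close>)
    also have "\<dots> = (\<integral>x. pderiv i \<phi> x * (g x ** B j x) $ a $ b \<partial>lborel) - (\<integral>x. pderiv i \<phi> x * (A j x ** g x) $ a $ b \<partial>lborel)"
      using P(2) Q(2) by (simp add: right_diff_distrib)
    also have "\<dots> = - (\<integral>x. \<phi> x * (dg i x ** B j x + g x ** DB i j x) $ a $ b - \<phi> x * (DA i j x ** g x + A j x ** dg i x) $ a $ b \<partial>lborel)"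
      unfolding P(1) Q(1) using P(3) Q(3) by (subst Bochner_Integration.integral_diff) auto
    also have "\<dots> = - (\<integral>x. \<phi> x * ?X i j x $ a $ b \<partial>lborel)" by (simp add: right_diff_distrib)
    finally show ?thesis by simp
  qed
  have "AE x in lborel. x \<in> ball 0 r \<longrightarrow> ?X i j x - ?X j i x = 0"
  proof (rule mat_fundamental_lemma)
    fix a b :: 'n
    show "integrable lborel (\<lambda>x. (?X i j x - ?X j i x) $ a $ b)"
      using Bochner_Integration.integrable_diff[OF Xi[of i j a b] Xi[of j i a b]] by simp
    fix \<phi> :: "real^'m \<Rightarrow> real" assume t: "test_fun (ball 0 r) \<phi>"
    have ip: "integrable lborel (\<lambda>x. \<phi> x * ?X i j x $ a $ b)" for i j
    proof -
      obtain K where K: "\<And>x. \<bar>\<phi> x\<bar> \<le> K" using test_fun_bounded[OF t] by blast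
      show ?thesis by (rule bounded_mult_integrable[OF Xi smooth_measurable[OF test_fun_smooth[OF t]] K])
    qed
    have s: "(\<integral>x. pderiv i \<phi> x * dg j x $ a $ b \<partial>lborel) = - (\<integral>x. pderiv j (pderiv i \<phi>) x * g x $ a $ b \<partial>lborel)" for i j
      using wdD[OF mwdD[OF g[of j], of a b] test_fun_pderiv[OF t, of i]] by simp
    have "(\<integral>x. \<phi> x * (?X i j x - ?X j i x) $ a $ b \<partial>lborel) = (\<integral>x. \<phi> x * ?X i j x $ a $ b \<partial>lborel) - (\<integral>x. \<phi> x * ?X j i x $ a $ b \<partial>lborel)"
      using Bochner_Integration.integral_diff[OF ip[of i j] ip[of j i]] by (simp add: right_diff_distrib)
    also have "\<dots> = 0" unfolding Xphi[OF t] s using pderiv_commute_fun[OF test_fun_smooth[OF t], of i j] by simp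
    finally show "(\<integral>x. \<phi> x * (?X i j x - ?X j i x) $ a $ b \<partial>lborel) = 0" .
  qed
  with gB[of i] gB[of j] show ?thesis
  proof eventually_elim
    case (elim x)
    show ?case
    proof
      assume x: "x \<in> ball 0 r"
      show "g x ** curvature B DB i j x = curvature A DA i j x ** g x"
        unfolding curvature_def by (rule curvature_algebra) (use elim x in simp)
    qed
  qed
qed

lemma madm_mult_left:
  fixes A X :: "real^'m::finite \<Rightarrow> real^'n^'n"
  assumes dim: "CARD('m) \<le> 4" and A: "\<And>l. mwd r l A (DA l)" and r: "r \<le> 1" and X: "mL2 X"
  shows "madm r (\<lambda>x. A x ** X x)" "madm r (\<lambda>x. X x ** A x)"
proof -
  have X': "L2 (\<lambda>x. X x $ a $ b)" for a b using X by (simp add: mL2_def)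
  have l: "L2 (\<lambda>x. indicat_real (ball 0 s) x * X x $ a $ b)" for s a b
    by (rule L2_bounded_mult[OF X', of _ 1]) (auto simp: indicator_def)
  note m = adm_mult[OF dim mwdD[OF A] r L2_measurable[OF X'] l]
  show "madm r (\<lambda>x. A x ** X x)" unfolding madm_def mm_entry by (intro allI adm_sum m)
  show "madm r (\<lambda>x. X x ** A x)" unfolding madm_def mm_entry
    using m by (intro allI adm_sum) (simp add: mult.commute)
qed

lemma madm_diff: "madm R M \<Longrightarrow> madm R N \<Longrightarrow> madm R (\<lambda>x. M x - N x)" by (simp add: madm_def adm_diff)
lemma madm_sum: "(\<And>i. i \<in> I \<Longrightarrow> madm R (M i)) \<Longrightarrow> madm R (\<lambda>x. \<Sum>i\<in>I. M i x)" by (simp add: madm_def sum_component adm_sum)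
lemma madm_minus: "madm R M \<Longrightarrow> madm R (\<lambda>x. - M x)" using madm_diff[of R "\<lambda>x. 0" M] by (simp add: madm_def adm_zero)

text \<open>In dimension four a Sobolev factor alone would leave the product only in L^{4/3}. The
  bound on \<open>h\<close> keeps \<open>h F\<close> in L2, so that the divergence equation can be
  multiplied a second time.\<close>

lemma mL2_bounded_mult:
  assumes h: "mmeas h" "\<And>x a b. \<bar>h x $ a $ b\<bar> \<le> M" and X: "mL2 X"
  shows "mL2 (\<lambda>x. h x ** X x)"
  unfolding mL2_def mm_entry
  by (intro allI L2_sum L2_bounded_mult[where M = M]) (use h X in \<open>auto simp: mL2_def mmeas_def\<close>)

text \<open>Since \<open>F_B = h F g\<close>, the equation is multiplied by \<open>h\<close> on the
  left and by \<open>g\<close> on the right. Substituting \<open>dh = h A - B h\<close> and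
  \<open>dg = g B - A g\<close> cancels every explicit term with A.\<close>

lemma gauge_equation:
  fixes g h :: "real^'m::finite \<Rightarrow> real^'n^'n"
  assumes dim: "CARD('m) \<le> 4" and r: "0 < r" "r \<le> 1"
    and g: "\<And>l. mwd r l g (dg l)" and h: "\<And>l. mwd r l h (dh l)" "\<And>x a b. \<bar>h x $ a $ b\<bar> \<le> M"
    and A: "\<And>l j. mwd r l (A j) (DA l j)" and B: "\<And>l j. mwd r l (B j) (DB l j)"
    and hg: "\<And>x. x \<in> ball 0 r \<Longrightarrow> h x ** g x = mat 1" "\<And>x. x \<in> ball 0 r \<Longrightarrow> g x ** h x = mat 1"
    and gB: "\<And>j. AE x in lborel. x \<in> ball 0 r \<longrightarrow> dg j x = g x ** B j x - A j x ** g x"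
    and F: "\<And>j. mL2 (F j)" "\<And>j x. x \<in> ball 0 r \<Longrightarrow> F j x = curvature A DA i j x"
    and YM: "\<And>\<phi> a b. test_fun (ball 0 r) \<phi> \<Longrightarrow> (\<Sum>j\<in>UNIV. \<integral>x. pderiv j \<phi> x * F j x $ a $ b \<partial>lborel)
        = - (\<integral>x. \<phi> x * (- (\<Sum>j\<in>UNIV. lie_bracket (A j x) (F j x))) $ a $ b \<partial>lborel)"
    and t: "test_fun (ball 0 r) \<phi>"
  shows "(\<Sum>j\<in>UNIV. \<integral>x. pderiv j \<phi> x * curvature B DB i j x $ a $ b \<partial>lborel)
        = (\<integral>x. \<phi> x * (\<Sum>j\<in>UNIV. lie_bracket (B j x) (curvature B DB i j x)) $ a $ b \<partial>lborel)"
proof -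
  note mA = mwd_mmeas[OF A] and mB = mwd_mmeas[OF B] and mg = mwd_mmeas[OF g] and mh = mwd_mmeas[OF h(1)]
  have mF: "mmeas (F j)" for j by (rule mL2_mmeas[OF F(1)])
  have mC: "mmeas (curvature B DB i j)" for j
    unfolding curvature_def[abs_def] by (intro mmeas_add mmeas_diff mmeas_bracket mB)
  \<comment> \<open>The right-hand side of the divergence equation for \<open>h F\<close>: the terms
    \<open>h A F\<close> coming from \<open>dh\<close> and from the bracket cancel.\<close>
  define f1 where "f1 x = (\<Sum>j\<in>UNIV. (h x ** F j x) ** A j x - B j x ** (h x ** F j x))" for x
  have hF: "mL2 (\<lambda>x. h x ** F j x)" for j by (rule mL2_bounded_mult[OF mh(1) h(2) F(1)])
  have f0: "madm r (\<lambda>x. - (\<Sum>j\<in>UNIV. lie_bracket (A j x) (F j x)))"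
    unfolding lie_bracket_def by (intro madm_minus madm_sum madm_diff madm_mult_left[OF dim A r(2) F(1)])
  have f1a: "madm r f1" unfolding f1_def[abs_def]
    by (intro madm_sum madm_diff madm_mult_left(2)[OF dim A r(2) hF] madm_mult_left(1)[OF dim B r(2) hF])
  have dh: "AE x in lborel. x \<in> ball 0 r \<longrightarrow> dh j x = h x ** A j x - B j x ** h x" for j
  proof -
    have "AE x in lborel. x \<in> ball 0 r \<longrightarrow> dh j x ** g x + h x ** dg j x = 0"
      by (rule inverse_derivative[OF g h(1) hg(1)])
    with gB[of j] show ?thesis
  proof eventually_elim
    case (elim x)
    show ?case
    proof
      assume x: "x \<in> ball 0 r"
      have "dh j x ** g x + h x ** (g x ** B j x - A j x ** g x) = 0" using elim x by simp
      \<comment> \<open>Multiplying by \<open>h\<close> on the right isolates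
        \<open>dh\<close>.\<close>
      then have "(dh j x ** g x + h x ** (g x ** B j x - A j x ** g x)) ** h x = 0 ** h x" by simp
      then have "dh j x ** (g x ** h x) + (h x ** g x) ** B j x ** h x - h x ** A j x ** (g x ** h x) = 0"
        by (simp add: mm_simps matrix_mul_assoc add_diff_eq)
      then show "dh j x = h x ** A j x - B j x ** h x" using hg(1)[OF x] hg(2)[OF x] by (simp add: algebra_simps)
    qed
  qed
  qed
  have dh': "AE x in lborel. \<forall>j\<in>UNIV. x \<in> ball 0 r \<longrightarrow> dh j x = h x ** A j x - B j x ** h x"
    using dh by (intro AE_finite_allI) auto
  have dg': "AE x in lborel. \<forall>j\<in>UNIV. x \<in> ball 0 r \<longrightarrow> dg j x = g x ** B j x - A j x ** g x"
    using gB by (intro AE_finite_allI) auto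
  have cur: "AE x in lborel. \<forall>j\<in>UNIV. x \<in> ball 0 r \<longrightarrow> g x ** curvature B DB i j x = curvature A DA i j x ** g x"
    using curvature_identity[OF g A B gB] by (intro AE_finite_allI) auto
  have FB: "AE x in lborel. \<forall>j\<in>UNIV. x \<in> ball 0 r \<longrightarrow> h x ** F j x ** g x = curvature B DB i j x"
    using cur
  proof eventually_elim
    case (elim x)
    show ?case
    proof (intro ballI impI)
      fix j assume x: "x \<in> ball 0 r"
      have "h x ** F j x ** g x = h x ** (g x ** curvature B DB i j x)" using elim x F(2)[OF x] by (simp add: matrix_mul_assoc)
      then show "h x ** F j x ** g x = curvature B DB i j x" using hg(1)[OF x] by (simp add: matrix_mul_assoc)
    qed
  qed
  have eq1: "(\<Sum>j\<in>UNIV. \<integral>x. pderiv j \<phi> x * (h x ** F j x) $ a $ b \<partial>lborel) = - (\<integral>x. \<phi> x * f1 x $ a $ b \<partial>lborel)"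
    if t: "test_fun (ball 0 r) \<phi>" for \<phi> a b
  proof -
    have "(\<integral>x. \<phi> x * (h x ** (- (\<Sum>j\<in>UNIV. lie_bracket (A j x) (F j x))) + (\<Sum>j\<in>UNIV. dh j x ** F j x)) $ a $ b \<partial>lborel)
       = (\<integral>x. \<phi> x * f1 x $ a $ b \<partial>lborel)"
    proof (rule mat_test_integral_cong_AE[OF t])
      show "mmeas (\<lambda>x. h x ** (- (\<Sum>j\<in>UNIV. lie_bracket (A j x) (F j x))) + (\<Sum>j\<in>UNIV. dh j x ** F j x))"
        by (intro mmeas_add mmeas_mult mmeas_minus mmeas_sum mmeas_bracket mh mA mF)
      show "mmeas f1" by (rule madm_mmeas[OF f1a])
      show "AE x in lborel. x \<in> ball 0 r \<longrightarrow> h x ** (- (\<Sum>j\<in>UNIV. lie_bracket (A j x) (F j x))) + (\<Sum>j\<in>UNIV. dh j x ** F j x) = f1 x"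
        using dh'
      proof eventually_elim
        case (elim x)
        show ?case
        proof
          assume x: "x \<in> ball 0 r"
          have "h x ** (- (\<Sum>j\<in>UNIV. lie_bracket (A j x) (F j x))) + (\<Sum>j\<in>UNIV. dh j x ** F j x)
             = (\<Sum>j\<in>UNIV. (h x ** A j x - B j x ** h x) ** F j x - h x ** lie_bracket (A j x) (F j x))"
            using elim x by (simp add: mm_minus_right mm_sum_right sum_subtractf)
          also have "\<dots> = f1 x" unfolding f1_def lie_bracket_def
            by (rule sum.cong) (auto simp: mm_simps matrix_mul_assoc)
          finally show "h x ** (- (\<Sum>j\<in>UNIV. lie_bracket (A j x) (F j x))) + (\<Sum>j\<in>UNIV. dh j x ** F j x) = f1 x" .
        qed
      qed
    qed
    then show ?thesis using equation_mult_left[OF F(1) f0 YM h(1) t r(1), of a b] by simp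
  qed
  have "(\<Sum>j\<in>UNIV. \<integral>x. pderiv j \<phi> x * (h x ** F j x ** g x) $ a $ b \<partial>lborel)
     = - (\<integral>x. \<phi> x * (f1 x ** g x + (\<Sum>j\<in>UNIV. h x ** F j x ** dg j x)) $ a $ b \<partial>lborel)"
    by (rule equation_mult_right[OF hF f1a eq1 g t r(1)])
  also have "(\<integral>x. \<phi> x * (f1 x ** g x + (\<Sum>j\<in>UNIV. h x ** F j x ** dg j x)) $ a $ b \<partial>lborel)
     = (\<integral>x. \<phi> x * (- (\<Sum>j\<in>UNIV. lie_bracket (B j x) (curvature B DB i j x))) $ a $ b \<partial>lborel)"
  proof (rule mat_test_integral_cong_AE[OF t])
    show "mmeas (\<lambda>x. f1 x ** g x + (\<Sum>j\<in>UNIV. h x ** F j x ** dg j x))"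
      by (intro mmeas_add mmeas_mult mmeas_sum mh mg mF madm_mmeas[OF f1a])
    show "mmeas (\<lambda>x. - (\<Sum>j\<in>UNIV. lie_bracket (B j x) (curvature B DB i j x)))"
      by (intro mmeas_minus mmeas_sum mmeas_bracket mB mC)
    show "AE x in lborel. x \<in> ball 0 r \<longrightarrow> f1 x ** g x + (\<Sum>j\<in>UNIV. h x ** F j x ** dg j x)
        = - (\<Sum>j\<in>UNIV. lie_bracket (B j x) (curvature B DB i j x))"
      using dg' FB
    proof eventually_elim
      case (elim x)
      show ?case
      proof
        assume x: "x \<in> ball 0 r"
        have "f1 x ** g x + (\<Sum>j\<in>UNIV. h x ** F j x ** dg j x)
          = (\<Sum>j\<in>UNIV. ((h x ** F j x) ** A j x - B j x ** (h x ** F j x)) ** g x + h x ** F j x ** (g x ** B j x - A j x ** g x))"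
          using elim(1) x by (simp add: f1_def mm_sum_left sum.distrib)
        also have "\<dots> = (\<Sum>j\<in>UNIV. - lie_bracket (B j x) (h x ** F j x ** g x))"
          unfolding lie_bracket_def by (rule sum.cong) (auto simp: mm_simps matrix_mul_assoc)
        also have "\<dots> = - (\<Sum>j\<in>UNIV. lie_bracket (B j x) (curvature B DB i j x))"
          using elim(2) x by (simp add: sum_negf)
        finally show "f1 x ** g x + (\<Sum>j\<in>UNIV. h x ** F j x ** dg j x)
          = - (\<Sum>j\<in>UNIV. lie_bracket (B j x) (curvature B DB i j x))" .
      qed
    qed
  qed
  also have "(\<Sum>j\<in>UNIV. \<integral>x. pderiv j \<phi> x * (h x ** F j x ** g x) $ a $ b \<partial>lborel)
     = (\<Sum>j\<in>UNIV. \<integral>x. pderiv j \<phi> x * curvature B DB i j x $ a $ b \<partial>lborel)"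
  proof (rule sum.cong[OF refl])
    fix j
    show "(\<integral>x. pderiv j \<phi> x * (h x ** F j x ** g x) $ a $ b \<partial>lborel) = (\<integral>x. pderiv j \<phi> x * curvature B DB i j x $ a $ b \<partial>lborel)"
      by (rule mat_test_integral_cong_AE[OF test_fun_pderiv[OF t]])
         (use FB in \<open>auto intro!: mmeas_mult mh mg mF mC\<close>)
  qed
  finally show ?thesis by simp
qed

text \<open>The resulting system has the form \<open>\<Delta> B = B \<partial>B + B B B\<close>.\<close>
lemma coulomb_system:
  fixes B :: "'m::finite \<Rightarrow> real^'m \<Rightarrow> real^'n^'n"
  assumes r: "r \<le> 1" and B: "\<And>l j. \<exists>v. mwd r l (B j) v"
    and YM: "\<And>DB i \<phi> a b. (\<And>l j. mwd r l (B j) (DB l j)) \<Longrightarrow> test_fun (ball 0 r) \<phi> \<Longrightarrow>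
        (\<Sum>j\<in>UNIV. \<integral>x. pderiv j \<phi> x * curvature B DB i j x $ a $ b \<partial>lborel)
        = (\<integral>x. \<phi> x * (\<Sum>j\<in>UNIV. lie_bracket (B j x) (curvature B DB i j x)) $ a $ b \<partial>lborel)"
    and int: "\<And>DB i \<phi> a b. (\<And>l j. mwd r l (B j) (DB l j)) \<Longrightarrow> test_fun (ball 0 r) \<phi> \<Longrightarrow>
        integrable lborel (\<lambda>x. \<phi> x * (\<Sum>j\<in>UNIV. lie_bracket (B j x) (curvature B DB i j x)) $ a $ b)"
    and C: "\<And>\<phi> a b. test_fun (ball 0 r) \<phi> \<Longrightarrow> (\<Sum>j\<in>UNIV. \<integral>x. pderiv j \<phi> x * B j x $ a $ b \<partial>lborel) = 0"
  shows "\<exists>d. esys r (range (\<lambda>(j, a, b). \<lambda>x. B j x $ a $ b)) d"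
proof -
  define U where "U = range (\<lambda>(j, a, b). \<lambda>x. B j x $ a $ b)"
  have inU: "(\<lambda>x. B j x $ a $ b) \<in> U" for j a b unfolding U_def by (rule range_eqI[of _ _ "(j, a, b)"]) simp
  have ex: "\<exists>v. wd r l u v" if u: "u \<in> U" for u l
  proof -
    obtain j a b where u: "u = (\<lambda>x. B j x $ a $ b)" using u unfolding U_def by auto
    obtain v where "mwd r l (B j) v" using B by blast
    then show ?thesis unfolding u by (blast intro: mwdD)
  qed
  \<comment> \<open>The gradient must be a function of the entry itself, so entries that coincide
    share their derivatives. These are chosen only here, after which the Yang--Mills hypothesis,
    stated for every \<open>DB\<close>, is applied to the choice.\<close>
  define d where "d u l = (SOME v. wd r l u v)" for u :: "real^'m \<Rightarrow> real" and l
  have d: "wd r l u (d u l)" if "u \<in> U" for u l unfolding d_def by (rule someI_ex[OF ex[OF that]])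
  define DB :: "'m \<Rightarrow> 'm \<Rightarrow> real^'m \<Rightarrow> real^'n^'n" where "DB l j x = (\<chi> a b. d (\<lambda>x. B j x $ a $ b) l x)" for l j x
  have DBe: "DB l j x $ a $ b = d (\<lambda>x. B j x $ a $ b) l x" for l j x a b by (simp add: DB_def)
  have DB: "mwd r l (B j) (DB l j)" for l j unfolding mwd_def DBe using d[OF inU] by blast
  define f where "f i x = (\<Sum>j\<in>UNIV. (DB j i x ** B j x + B i x ** DB j j x - (DB j j x ** B i x + B j x ** DB j i x))
      + lie_bracket (B j x) (curvature B DB i j x))" for i x
  have eq: "(\<Sum>j\<in>UNIV. \<integral>x. pderiv j \<phi> x * DB j i x $ a $ b \<partial>lborel) = - (\<integral>x. \<phi> x * f i x $ a $ b \<partial>lborel)"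
    if t: "test_fun (ball 0 r) \<phi>" for \<phi> i a b
  proof -
    have L: "L2 (\<lambda>x. DB l j x $ a $ b)" for l j using mwd_mL2(2)[OF DB] by (simp add: mL2_def)
    have iD: "integrable lborel (\<lambda>x. pderiv k \<phi> x * DB l j x $ a $ b)" for k l j
      by (rule L2_mult_integrable[OF test_fun_L2[OF test_fun_pderiv[OF t]] L])
    note P = mat_product_rule[OF DB[of _ i] DB t, of _ _ a b] and Q = mat_product_rule[OF DB DB[of _ i] t, of _ _ a b]
    have split: "(\<integral>x. pderiv j \<phi> x * curvature B DB i j x $ a $ b \<partial>lborel)
      = (\<integral>x. pderiv j \<phi> x * DB i j x $ a $ b \<partial>lborel) - (\<integral>x. pderiv j \<phi> x * DB j i x $ a $ b \<partial>lborel)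
        - (\<integral>x. \<phi> x * (DB j i x ** B j x + B i x ** DB j j x - (DB j j x ** B i x + B j x ** DB j i x)) $ a $ b \<partial>lborel)" for j
    proof -
      have "(\<integral>x. pderiv j \<phi> x * curvature B DB i j x $ a $ b \<partial>lborel) =
        (\<integral>x. (pderiv j \<phi> x * DB i j x $ a $ b - pderiv j \<phi> x * DB j i x $ a $ b)
          + (pderiv j \<phi> x * (B i x ** B j x) $ a $ b - pderiv j \<phi> x * (B j x ** B i x) $ a $ b) \<partial>lborel)"
        by (simp add: curvature_def lie_bracket_def algebra_simps)
      also have "\<dots> = ((\<integral>x. pderiv j \<phi> x * DB i j x $ a $ b \<partial>lborel) - (\<integral>x. pderiv j \<phi> x * DB j i x $ a $ b \<partial>lborel))
         + ((\<integral>x. pderiv j \<phi> x * (B i x ** B j x) $ a $ b \<partial>lborel) - (\<integral>x. pderiv j \<phi> x * (B j x ** B i x) $ a $ b \<partial>lborel))"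
        using iD P(2)[of j j] Q(2)[of j j] by simp
      also have "(\<integral>x. pderiv j \<phi> x * (B i x ** B j x) $ a $ b \<partial>lborel) - (\<integral>x. pderiv j \<phi> x * (B j x ** B i x) $ a $ b \<partial>lborel)
        = - (\<integral>x. \<phi> x * (DB j i x ** B j x + B i x ** DB j j x) $ a $ b - \<phi> x * (DB j j x ** B i x + B j x ** DB j i x) $ a $ b \<partial>lborel)"
        unfolding P(1) Q(1) using P(3)[of j j] Q(3)[of j j] by (subst Bochner_Integration.integral_diff) auto
      also have "\<dots> = - (\<integral>x. \<phi> x * (DB j i x ** B j x + B i x ** DB j j x - (DB j j x ** B i x + B j x ** DB j i x)) $ a $ b \<partial>lborel)"
        by (simp add: right_diff_distrib)
      finally show ?thesis by simp
    qed
    have iX: "integrable lborel (\<lambda>x. \<phi> x * (DB j i x ** B j x + B i x ** DB j j x - (DB j j x ** B i x + B j x ** DB j i x)) $ a $ b)" for j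
      using Bochner_Integration.integrable_diff[OF P(3)[of j j] Q(3)[of j j]] by (simp add: right_diff_distrib)
    \<comment> \<open>The Coulomb condition tested with \<open>pderiv i \<phi>\<close>: it removes
      the mixed second derivatives and leaves the Laplacian.\<close>
    have zero: "(\<Sum>j\<in>UNIV. \<integral>x. pderiv j \<phi> x * DB i j x $ a $ b \<partial>lborel) = 0"
    proof -
      have "(\<integral>x. pderiv j \<phi> x * DB i j x $ a $ b \<partial>lborel) = - (\<integral>x. pderiv j (pderiv i \<phi>) x * B j x $ a $ b \<partial>lborel)" for j
        using wdD[OF mwdD[OF DB[of i j], of a b] test_fun_pderiv[OF t, of j]] pderiv_commute_fun[OF test_fun_smooth[OF t], of i j] by simp
      then show ?thesis using C[OF test_fun_pderiv[OF t], of i a b] by (simp add: sum_negf)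
    qed
    have "(\<integral>x. \<phi> x * f i x $ a $ b \<partial>lborel) = (\<integral>x. (\<Sum>j\<in>UNIV. \<phi> x * (DB j i x ** B j x + B i x ** DB j j x - (DB j j x ** B i x + B j x ** DB j i x)) $ a $ b)
        + \<phi> x * (\<Sum>j\<in>UNIV. lie_bracket (B j x) (curvature B DB i j x)) $ a $ b \<partial>lborel)"
      unfolding f_def by (simp add: sum.distrib sum_component distrib_left sum_distrib_left)
    also have "\<dots> = (\<Sum>j\<in>UNIV. \<integral>x. \<phi> x * (DB j i x ** B j x + B i x ** DB j j x - (DB j j x ** B i x + B j x ** DB j i x)) $ a $ b \<partial>lborel)
        + (\<integral>x. \<phi> x * (\<Sum>j\<in>UNIV. lie_bracket (B j x) (curvature B DB i j x)) $ a $ b \<partial>lborel)"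
      using iX int[OF DB t, of i a b] by (subst Bochner_Integration.integral_add) (auto intro!: Bochner_Integration.integrable_sum)
    also have "\<dots> = - (\<Sum>j\<in>UNIV. \<integral>x. pderiv j \<phi> x * DB j i x $ a $ b \<partial>lborel)"
      using YM[OF DB t, of i a b] zero unfolding split by (simp add: sum_subtractf)
    finally show ?thesis by simp
  qed
  have NLB: "NL U d (\<lambda>x. (\<Sum>c\<in>UNIV. F c x))" if "\<And>c. NL U d (F c)" for F :: "'i::finite \<Rightarrow> real^'m \<Rightarrow> real"
  proof -
    have "NL U d (\<lambda>x. (\<Sum>c\<in>I. F c x))" if "finite I" for I
      using that by (induction I rule: finite_induct) (auto intro: NL.zero NL.add \<open>\<And>c. NL U d (F c)\<close>)
    then show ?thesis by simp
  qed
  have NLdiff: "NL U d (\<lambda>x. F x - G x)" if "NL U d F" "NL U d G" for F G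
    using NL.add[OF that(1) NL.cmult[OF that(2), of "-1"]] by simp
  have n1: "NL U d (\<lambda>x. (B i x ** DB l j x) $ a $ b)" for i j l a b
    unfolding mm_entry DBe by (intro NLB NL.quad inU)
  have n2: "NL U d (\<lambda>x. (DB l j x ** B i x) $ a $ b)" for i j l a b
    unfolding mm_entry DBe by (intro NLB, subst mult.commute, intro NL.quad inU)
  have n3: "NL U d (\<lambda>x. (B i x ** (B j x ** B k x)) $ a $ b)" for i j k a b
    unfolding mm_entry sum_distrib_left mult.assoc[symmetric] by (intro NLB NL.cub inU)
  have n4: "NL U d (\<lambda>x. ((B i x ** B j x) ** B k x) $ a $ b)" for i j k a b
    using n3[of i j k a b] by (simp add: matrix_mul_assoc)
  have NLf: "NL U d (\<lambda>x. f i x $ a $ b)" for i a b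
    unfolding f_def curvature_def lie_bracket_def sum_component mm_simps vector_add_component vector_minus_component
    by (intro NLB NL.add NLdiff n1 n2 n3 n4)
  have "esys r U d" unfolding esys_def
  proof (intro conjI ballI allI)
    show "finite U" by (simp add: U_def)
    show "wd r l u (d u l)" if "u \<in> U" for u l by (rule d[OF that])
    fix u assume "u \<in> U"
    then obtain i a b where u: "u = (\<lambda>x. B i x $ a $ b)" unfolding U_def by auto
    show "\<exists>f. NL U d f \<and> (\<forall>\<phi>. test_fun (ball 0 r) \<phi> \<longrightarrow> (\<Sum>l\<in>UNIV. \<integral>x. pderiv l \<phi> x * d u l x \<partial>lborel) = - (\<integral>x. \<phi> x * f x \<partial>lborel))"
      using NLf[of i a b] eq[of _ i a b] unfolding u DBe by blast
  qed
  then show ?thesis unfolding U_def by blast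
qed

section \<open>From matrix-valued functions on the ball to their entries\<close>

lemma Ck_on_linear:
  "bounded_linear L \<Longrightarrow> Ck_on k S f \<Longrightarrow> Ck_on k S (\<lambda>x. L (f x))"
proof (induction k arbitrary: f)
  case 0
  then show ?case by (simp add: bounded_linear.continuous_on)
next
  case (Suc k)
  obtain f' where f': "\<forall>x\<in>S. (f has_derivative f' x) (at x)" "\<And>v. Ck_on k S (\<lambda>x. f' x v)"
    using Suc.prems by auto
  show ?case unfolding Ck_on.simps
    by (rule exI[of _ "\<lambda>x v. L (f' x v)"])
       (use f' Suc in \<open>auto intro: bounded_linear.has_derivative\<close>)
qed

lemma Ck_on_sum: "(\<And>i. i \<in> I \<Longrightarrow> Ck_on k S (f i)) \<Longrightarrow> Ck_on k S (\<lambda>x. \<Sum>i\<in>I. f i x)"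
  by (induction I rule: infinite_finite_induct) (auto intro: Ck_on_add Ck_on_const)

lemma mat_expand: "(X::real^'n^'k) = (\<Sum>a\<in>UNIV. \<Sum>b\<in>UNIV. X $ a $ b *\<^sub>R axis a (axis b 1))"
proof -
  have "(\<Sum>b\<in>(UNIV::'n set). if P then f b else 0) = (if P then sum f UNIV else 0)" for P and f :: "'n \<Rightarrow> real"
    by simp
  then show ?thesis
    by (simp add: vec_eq_iff sum_component axis_def if_distrib[of "\<lambda>v. v $ _"] if_distrib[of "\<lambda>v. _ * v"] sum.delta cong: if_cong)
qed

lemma Ck_on_mat:
  fixes X :: "'a::euclidean_space \<Rightarrow> real^'n^'k"
  assumes "\<And>a b. Ck_on k S (\<lambda>x. X x $ a $ b)"
  shows "Ck_on k S X"
proof -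
  have "Ck_on k S (\<lambda>x. \<Sum>a\<in>UNIV. \<Sum>b\<in>UNIV. X x $ a $ b *\<^sub>R (axis a (axis b 1) :: real^'n^'k))"
    by (intro Ck_on_sum Ck_on_linear[OF bounded_linear_scaleR_left] assms)
  then show ?thesis unfolding mat_expand[symmetric] .
qed

text \<open>\<open>Ck_on\<close> asks for one derivative on all of S; the Frechet derivative is the
  canonical choice and agrees near each point with that of the local model.\<close>

lemma Ck_on_local:
  assumes "open S" "\<And>x. x \<in> S \<Longrightarrow> \<exists>T W. open T \<and> x \<in> T \<and> Ck_on k UNIV W \<and> (\<forall>y\<in>T. f y = W y)"
  shows "Ck_on k S f"
  using assms(2)
proof (induction k arbitrary: f)
  case 0
  have "isCont f x" if x: "x \<in> S" for x
  proof -
    obtain T W where T: "open T" "x \<in> T" "Ck_on 0 UNIV W" "\<forall>y\<in>T. f y = W y" using 0 x by blast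
    have "eventually (\<lambda>y. f y = W y) (nhds x)" using T eventually_nhds by blast
    then have "isCont f x = isCont W x" by (rule isCont_cong)
    then show ?thesis using T(3) by (simp add: continuous_on_eq_continuous_at)
  qed
  then show ?case by (simp add: continuous_at_imp_continuous_on)
next
  case (Suc k)
  have loc: "\<exists>T W'. open T \<and> x \<in> T \<and> (\<forall>v. Ck_on k UNIV (\<lambda>y. W' y v)) \<and> (\<forall>y\<in>T. (f has_derivative W' y) (at y))"
    if x: "x \<in> S" for x
  proof -
    obtain T W where T: "open T" "x \<in> T" "Ck_on (Suc k) UNIV W" "\<forall>y\<in>T. f y = W y" using Suc.prems x by blast
    obtain W' where W': "\<forall>y. (W has_derivative W' y) (at y)" "\<And>v. Ck_on k UNIV (\<lambda>y. W' y v)" using T(3) by auto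
    have "(f has_derivative W' y) (at y)" if y: "y \<in> T" for y
      by (rule has_derivative_transform_within_open[OF _ T(1) y]) (use W' T in auto)
    then show ?thesis using T W' by blast
  qed
  have fd: "(f has_derivative frechet_derivative f (at x)) (at x)" if "x \<in> S" for x
    using loc[OF that] frechet_derivative_works differentiable_def by blast
  have "Ck_on k S (\<lambda>x. frechet_derivative f (at x) v)" for v
  proof (rule Suc.IH)
    fix x assume x: "x \<in> S"
    obtain T W' where T: "open T" "x \<in> T" "\<forall>v. Ck_on k UNIV (\<lambda>y. W' y v)" "\<forall>y\<in>T. (f has_derivative W' y) (at y)"
      using loc[OF x] by blast
    have "\<forall>y\<in>T. frechet_derivative f (at y) v = W' y v"
    proof
      fix y assume "y \<in> T"
      then have "W' y = frechet_derivative f (at y)" using T(4) by (intro frechet_derivative_at) blast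
      then show "frechet_derivative f (at y) v = W' y v" by simp
    qed
    then show "\<exists>T W. open T \<and> x \<in> T \<and> Ck_on k UNIV W \<and> (\<forall>y\<in>T. frechet_derivative f (at y) v = W y)"
      using T by blast
  qed
  then show ?case unfolding Ck_on.simps using fd by (intro exI[of _ "\<lambda>x. frechet_derivative f (at x)"]) blast
qed

lemma continuous_AE_eq:
  fixes f g :: "'a::euclidean_space \<Rightarrow> real"
  assumes "continuous_on UNIV f" "continuous_on UNIV g" "open S"
    "AE x in lborel. x \<in> S \<longrightarrow> f x = g x" "x \<in> S"
  shows "f x = g x"
proof -
  have "x \<in> {x. f x = g x}"
  proof (rule mem_closed_if_AE_lebesgue_open[OF assms(3) _ _ assms(5)])
    show "closed {x. f x = g x}" by (rule closed_Collect_eq[OF assms(1,2)])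
    show "AE x in lebesgue. x \<in> S \<longrightarrow> x \<in> {x. f x = g x}" using AE_completion[OF assms(4)] by simp
  qed
  then show ?thesis by simp
qed

lemma patch_smooth:
  fixes u :: "real^'m \<Rightarrow> real"
  assumes u: "\<And>r. 0 < r \<Longrightarrow> r < 1 \<Longrightarrow> \<exists>w. smooth w \<and> (AE x in lborel. x \<in> ball 0 r \<longrightarrow> u x = w x)"
  shows "\<exists>v. (\<forall>r. 0 < r \<longrightarrow> r < 1 \<longrightarrow> (\<exists>w. smooth w \<and> (\<forall>x\<in>ball 0 r. v x = w x))) \<and>
    (AE x in lborel. x \<in> ball 0 1 \<longrightarrow> v x = u x)"
proof -
  define w where "w r = (SOME w. smooth w \<and> (AE x in lborel. x \<in> ball 0 r \<longrightarrow> u x = w x))" for r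
  have w: "smooth (w r)" "AE x in lborel. x \<in> ball 0 r \<longrightarrow> u x = w r x" if "0 < r" "r < 1" for r
    using someI_ex[OF u[OF that]] unfolding w_def by blast+
  \<comment> \<open>The radius lies midway between \<open>norm x\<close> and 1, so it varies with
    the point. Continuous representatives that agree almost everywhere agree on overlaps, hence the
    choice of radius does not matter.\<close>
  define v where "v x = w ((1 + norm x) / 2) x" for x
  have vw: "v x = w r x" if r: "0 < r" "r < 1" and x: "x \<in> ball 0 r" for r x
  proof -
    let ?s = "(1 + norm x) / 2"
    have s: "0 < ?s" "?s < 1" "x \<in> ball 0 ?s" using x r by (auto simp: add_pos_nonneg)
    have "w ?s x = w r x"
    proof (rule continuous_AE_eq[of "w ?s" "w r" "ball 0 ?s \<inter> ball 0 r"])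
      show "continuous_on UNIV (w ?s)" "continuous_on UNIV (w r)" using w(1) s r smooth_continuous by blast+
      show "AE y in lborel. y \<in> ball 0 ?s \<inter> ball 0 r \<longrightarrow> w ?s y = w r y"
        using w(2)[OF s(1,2)] w(2)[OF r] by eventually_elim auto
    qed (use s x in auto)
    then show ?thesis by (simp add: v_def)
  qed
  have "AE x in lborel. \<forall>n. x \<in> ball 0 (1 - 1 / (real n + 2)) \<longrightarrow> u x = w (1 - 1 / (real n + 2)) x"
    unfolding AE_all_countable by (intro allI w(2)) (auto simp: field_simps)
  then have "AE x in lborel. x \<in> ball 0 1 \<longrightarrow> v x = u x"
  proof eventually_elim
    case (elim x)
    show ?case
    proof
      assume "x \<in> ball 0 1"
      then have "0 < 1 - norm x" by simp
      then obtain n where n: "inverse (real (Suc n)) < 1 - norm x" using reals_Archimedean by blast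
      have "1 / (real n + 2) \<le> inverse (real (Suc n))" by (simp add: field_simps)
      then have x: "x \<in> ball 0 (1 - 1 / (real n + 2))" using n by simp
      show "v x = u x" using elim x vw[OF _ _ x] by (simp add: field_simps)
    qed
  qed
  then show ?thesis using vw w(1) by blast
qed

section \<open>Reading the distributional hypotheses entrywise\<close>

abbreviation cut :: "(real^'m \<Rightarrow> real^'n^'n) \<Rightarrow> real^'m \<Rightarrow> real^'n^'n" where
  "cut M x \<equiv> indicat_real (ball 0 1) x *\<^sub>R M x"

lemma bounded_linear_entry: "bounded_linear (\<lambda>X::real^'n^'k. X $ a $ b)"
  by (intro bounded_linear_compose[OF bounded_linear_vec_nth] bounded_linear_vec_nth)

lemma mat_integral:
  fixes X :: "'a \<Rightarrow> real^'n^'k"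
  assumes "\<And>a b. integrable M (\<lambda>x. X x $ a $ b)"
  shows "integrable M X" "integral\<^sup>L M X $ a $ b = (\<integral>x. X x $ a $ b \<partial>M)"
proof -
  have "integrable M (\<lambda>x. \<Sum>a\<in>UNIV. \<Sum>b\<in>UNIV. X x $ a $ b *\<^sub>R (axis a (axis b 1) :: real^'n^'k))"
    by (intro Bochner_Integration.integrable_sum integrable_scaleR_left assms)
  then show X: "integrable M X" unfolding mat_expand[symmetric] .
  show "integral\<^sup>L M X $ a $ b = (\<integral>x. X x $ a $ b \<partial>M)"
    using integral_bounded_linear[OF bounded_linear_entry X] by simp
qed

lemma loc_integrable_entry:
  fixes M :: "real^'m::finite \<Rightarrow> real^'n^'n"
  assumes "loc_integrable (ball 0 1) M" "r < 1"
  shows "integrable lborel (\<lambda>x. indicat_real (ball 0 r) x * M x $ a $ b)"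
proof -
  have "compact (cball (0::real^'m) r)" "cball (0::real^'m) r \<subseteq> ball 0 1" using assms(2) by auto
  then have "set_integrable lborel (cball 0 r) M" using assms(1) unfolding loc_integrable_def by blast
  then have "set_integrable lborel (ball 0 r) M" by (rule set_integrable_subset) auto
  then show ?thesis unfolding set_integrable_def using integrable_bounded_linear[OF bounded_linear_entry, of lborel _ a b] by fastforce
qed

text \<open>Local integrability gives measurability on strictly smaller balls; the unit ball is
  their increasing union, and limits preserve measurability.\<close>

lemma loc_integrable_measurable:
  fixes M :: "real^'m::finite \<Rightarrow> real^'n^'n"
  assumes "loc_integrable (ball 0 1) M"
  shows "mmeas (cut M)"
  unfolding mmeas_def
proof (intro allI)
  fix a b
  let ?f = "\<lambda>n x. indicat_real (ball 0 (1 - inverse (real (Suc n)))) x * M x $ a $ b"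
  show "(\<lambda>x. cut M x $ a $ b) \<in> borel_measurable borel"
  proof (rule borel_measurable_LIMSEQ_real)
    show "?f n \<in> borel_measurable borel" for n
      using borel_measurable_integrable[OF loc_integrable_entry[OF assms, of "1 - inverse (real (Suc n))" a b]] by simp
    fix x :: "real^'m"
    show "(\<lambda>n. ?f n x) \<longlonglongrightarrow> cut M x $ a $ b"
    proof (cases "x \<in> ball 0 1")
      case True
      then have "0 < 1 - norm x" by simp
      then have "eventually (\<lambda>n. inverse (real (Suc n)) < 1 - norm x) sequentially"
        using LIMSEQ_inverse_real_of_nat order_tendstoD(2) by blast
      then have "eventually (\<lambda>n. ?f n x = cut M x $ a $ b) sequentially"
        by eventually_elim (use True in simp)
      then show ?thesis by (rule tendsto_eventually)
    next
      case False
      then have "x \<notin> ball 0 (1 - inverse (real (Suc n)))" for n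
      proof -
        have "0 \<le> inverse (real (Suc n))" by simp
        then have "ball (0::real^'m) (1 - inverse (real (Suc n))) \<subseteq> ball 0 1" by (intro subset_ball) linarith
        then show ?thesis using False by blast
      qed
      then show ?thesis using False by (simp add: indicator_def)
    qed
  qed
qed

lemma loc_integrable_test:
  fixes M :: "real^'m::finite \<Rightarrow> real^'n^'n"
  assumes M: "loc_integrable (ball 0 1) M" and t: "test_fun (ball 0 1) \<phi>"
  shows "integrable lborel (\<lambda>x. \<phi> x * cut M x $ a $ b)"
    and "(LINT x:ball 0 1|lborel. \<phi> x *\<^sub>R M x) $ a $ b = (\<integral>x. \<phi> x * cut M x $ a $ b \<partial>lborel)"
proof -
  show i: "integrable lborel (\<lambda>x. \<phi> x * cut M x $ a $ b)" for a b
  proof -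
    obtain r where r: "r < 1" "test_fun (ball 0 r) \<phi>" using test_fun_ball_shrink[OF t] by auto
    obtain K where K: "\<And>x. \<bar>\<phi> x\<bar> \<le> K" using test_fun_bounded[OF t] by blast
    have "\<phi> x * cut M x $ a $ b = \<phi> x * (indicat_real (ball 0 r) x * M x $ a $ b)" for x
      using test_fun_outside(1)[OF r(2), of x] r(1) by (cases "x \<in> ball 0 r") auto
    then have "(\<lambda>x. \<phi> x * cut M x $ a $ b) = (\<lambda>x. \<phi> x * (indicat_real (ball 0 r) x * M x $ a $ b))" by (rule ext)
    then show ?thesis
      using bounded_mult_integrable[OF loc_integrable_entry[OF M r(1)] smooth_measurable[OF test_fun_smooth[OF t]] K] by (simp only:)
  qed
  have e: "(indicat_real (ball 0 1) x *\<^sub>R \<phi> x *\<^sub>R M x) $ a $ b = \<phi> x * cut M x $ a $ b" for x a b by simp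
  show "(LINT x:ball 0 1|lborel. \<phi> x *\<^sub>R M x) $ a $ b = (\<integral>x. \<phi> x * cut M x $ a $ b \<partial>lborel)"
    unfolding set_lebesgue_integral_def using i by (subst mat_integral(2)) (simp_all only: e)
qed

lemma weak_pderiv_entry:
  fixes M :: "real^'m::finite \<Rightarrow> real^'n^'n"
  assumes w: "weak_pderiv (ball 0 1) i M V" and t: "test_fun (ball 0 1) \<phi>"
  shows "(\<integral>x. pderiv i \<phi> x * cut M x $ a $ b \<partial>lborel) = - (\<integral>x. \<phi> x * cut V x $ a $ b \<partial>lborel)"
proof -
  have l: "loc_integrable (ball 0 1) M" "loc_integrable (ball 0 1) V" using w by (auto simp: weak_pderiv_def)
  have "(LINT x:ball 0 1|lborel. pderiv i \<phi> x *\<^sub>R M x) $ a $ b = - ((LINT x:ball 0 1|lborel. \<phi> x *\<^sub>R V x) $ a $ b)"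
    using w t unfolding weak_pderiv_def by simp
  then show ?thesis unfolding loc_integrable_test(2)[OF l(1) test_fun_pderiv[OF t]] loc_integrable_test(2)[OF l(2) t] .
qed

lemma L2_on_entries:
  fixes M :: "real^'m::finite \<Rightarrow> real^'n^'n"
  assumes "L2_on (ball 0 1) M"
  shows "mL2 (cut M)" "cut M \<in> borel_measurable borel"
proof -
  show m: "cut M \<in> borel_measurable borel" using assms unfolding L2_on_def set_borel_measurable_def by simp
  have i: "integrable lborel (\<lambda>x. indicat_real (ball 0 1) x *\<^sub>R norm (M x) ^ 2)" using assms unfolding L2_on_def set_integrable_def by simp
  show "mL2 (cut M)" unfolding mL2_def L2_def
  proof (intro allI conjI)
    fix a b
    have "(\<lambda>X::real^'n^'n. X $ a $ b) \<in> borel_measurable borel"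
      by (intro borel_measurable_continuous_onI linear_continuous_on bounded_linear_entry)
    then show e: "(\<lambda>x. cut M x $ a $ b) \<in> borel_measurable borel"
      using measurable_compose[OF m] by blast
    show "integrable lborel (\<lambda>x. (cut M x $ a $ b)\<^sup>2)"
    proof (rule Bochner_Integration.integrable_bound[OF i])
      show "(\<lambda>x. (cut M x $ a $ b)\<^sup>2) \<in> borel_measurable lborel" using e by simp
      have "\<bar>M x $ a $ b\<bar> \<le> norm (M x)" for x
        using component_le_norm_cart[of "M x $ a" b] Finite_Cartesian_Product.norm_nth_le[of "M x" a] by linarith
      then have "(M x $ a $ b)\<^sup>2 \<le> norm (M x) ^ 2" for x by (metis abs_ge_zero power2_abs power_mono)
      then show "AE x in lborel. norm ((cut M x $ a $ b)\<^sup>2) \<le> norm (indicat_real (ball 0 1) x *\<^sub>R norm (M x) ^ 2)"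
        by (auto simp: indicator_def)
    qed
  qed
qed

lemma L2_cong_AE:
  assumes "L2 f" "g \<in> borel_measurable borel" "AE x in lborel. f x = g x" shows "L2 g"
proof -
  have "integrable lborel (\<lambda>x. (g x)\<^sup>2) = integrable lborel (\<lambda>x. (f x)\<^sup>2)"
    by (rule integrable_cong_AE) (use assms L2_measurable[OF assms(1)] in \<open>auto elim: eventually_mono\<close>)
  then show ?thesis using assms L2_sq by (auto simp: L2_def)
qed

text \<open>\<open>W12\<close> provides some square-integrable derivative, while the given one is
  only known to be locally integrable; the fundamental lemma identifies the two almost
  everywhere.\<close>

lemma W12_mwd:
  fixes M :: "real^'m::finite \<Rightarrow> real^'n^'n"
  assumes M: "W12 (ball 0 1) M" and V: "weak_pderiv (ball 0 1) i M V"
  shows "mwd 1 i (cut M) (cut V)"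
  unfolding mwd_def
proof (intro allI)
  fix a b
  obtain V' where V': "weak_pderiv (ball 0 1) i M V'" "L2_on (ball 0 1) V'" using M by (auto simp: W12_def)
  have l: "loc_integrable (ball 0 1) V" "loc_integrable (ball 0 1) V'" using V V' by (auto simp: weak_pderiv_def)
  have mV: "(\<lambda>x. cut V x $ a $ b) \<in> borel_measurable borel" using loc_integrable_measurable[OF l(1)] unfolding mmeas_def by blast
  have LM: "L2 (\<lambda>x. cut M x $ a $ b)" using L2_on_entries(1) M by (auto simp: W12_def mL2_def)
  have LV': "L2 (\<lambda>x. cut V' x $ a $ b)" using L2_on_entries(1) V' by (auto simp: mL2_def)
  have "AE x in lborel. x \<in> ball 0 1 \<longrightarrow> cut V' x $ a $ b - cut V x $ a $ b = 0"
  proof (rule fundamental_lemma)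
    fix r :: real assume r: "r < 1"
    have "indicat_real (ball 0 r) x * (cut V' x $ a $ b - cut V x $ a $ b) =
      indicat_real (ball 0 r) x * V' x $ a $ b - indicat_real (ball 0 r) x * V x $ a $ b" for x
      using r by (auto simp: indicator_def)
    then show "integrable lborel (\<lambda>x. indicat_real (ball 0 r) x * (cut V' x $ a $ b - cut V x $ a $ b))"
      using loc_integrable_entry[OF l(1) r] loc_integrable_entry[OF l(2) r] by simp
  next
    fix \<phi> :: "real^'m \<Rightarrow> real" assume t: "test_fun (ball 0 1) \<phi>"
    have "(\<integral>x. \<phi> x * (cut V' x $ a $ b - cut V x $ a $ b) \<partial>lborel) = (\<integral>x. \<phi> x * cut V' x $ a $ b - \<phi> x * cut V x $ a $ b \<partial>lborel)"
      by (simp only: right_diff_distrib)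
    also have "\<dots> = (\<integral>x. \<phi> x * cut V' x $ a $ b \<partial>lborel) - (\<integral>x. \<phi> x * cut V x $ a $ b \<partial>lborel)"
      by (rule Bochner_Integration.integral_diff[OF loc_integrable_test(1)[OF l(2) t] loc_integrable_test(1)[OF l(1) t]])
    also have "\<dots> = 0" using weak_pderiv_entry[OF V t, of a b] weak_pderiv_entry[OF V'(1) t, of a b] by linarith
    finally show "(\<integral>x. \<phi> x * (cut V' x $ a $ b - cut V x $ a $ b) \<partial>lborel) = 0" .
  qed
  then have "AE x in lborel. cut V' x $ a $ b = cut V x $ a $ b" by eventually_elim (auto simp: indicator_def)
  then have "L2 (\<lambda>x. cut V x $ a $ b)" by (rule L2_cong_AE[OF LV' mV])
  then show "wd 1 i (\<lambda>x. cut M x $ a $ b) (\<lambda>x. cut V x $ a $ b)"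
    unfolding wd_def using LM weak_pderiv_entry[OF V] by blast
qed

lemma wd_cong_AE:
  fixes u :: "real^'m::finite \<Rightarrow> real"
  assumes w: "wd R i u v" and u': "u' \<in> borel_measurable borel" "AE x in lborel. u x = u' x"
  shows "wd R i u' v"
  unfolding wd_def
proof (intro conjI allI impI)
  show "L2 u'" by (rule L2_cong_AE[OF wd_L2(1)[OF w] u'])
  show "L2 v" by (rule wd_L2(2)[OF w])
  fix \<phi> :: "real^'m \<Rightarrow> real" assume t: "test_fun (ball 0 R) \<phi>"
  have "(\<integral>x. pderiv i \<phi> x * u' x \<partial>lborel) = (\<integral>x. pderiv i \<phi> x * u x \<partial>lborel)"
  proof (rule test_integral_cong_AE[OF test_fun_pderiv[OF t] u'(1) L2_measurable[OF wd_L2(1)[OF w]]])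
    show "AE x in lborel. x \<in> ball 0 R \<longrightarrow> u' x = u x" using u'(2) by eventually_elim simp
  qed
  then show "(\<integral>x. pderiv i \<phi> x * u' x \<partial>lborel) = - (\<integral>x. \<phi> x * v x \<partial>lborel)" using wdD[OF w t] by simp
qed

section \<open>Inversion on a compact matrix group\<close>

lemma matrix_inv_mult:
  fixes X :: "real^'n^'n" assumes "invertible X"
  shows "X ** matrix_inv X = mat 1" "matrix_inv X ** X = mat 1"
  using someI_ex[of "\<lambda>Y. X ** Y = mat 1 \<and> Y ** X = mat 1"] assms
  unfolding matrix_inv_def invertible_def by blast+

lemma matrix_inv_unique_right:
  fixes X Y :: "real^'n^'n" assumes "X ** Y = mat 1" shows "matrix_inv X = Y"
proof -
  have "invertible X" using assms matrix_left_right_inverse unfolding invertible_def by blast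
  then have "matrix_inv X ** (X ** Y) = Y" by (simp add: matrix_mul_assoc matrix_inv_mult)
  then show ?thesis using assms by simp
qed

text \<open>The graph of inversion over a compact group is compact, so inversion is continuous.\<close>
lemma continuous_on_matrix_inv:
  fixes G :: "(real^'n^'n) set"
  assumes G: "compact_matrix_group G"
  shows "continuous_on G matrix_inv"
proof -
  define S where "S = (G \<times> G) \<inter> {p. fst p ** snd p = mat 1}"
  have c: "continuous_on UNIV (\<lambda>p::(real^'n^'n) \<times> (real^'n^'n). fst p ** snd p)"
    unfolding matrix_matrix_mult_def by (intro continuous_intros continuous_on_vec_lambda)
  have "closed {p::(real^'n^'n) \<times> (real^'n^'n). fst p ** snd p = mat 1}"
    by (intro closed_Collect_eq c continuous_on_const)
  then have S: "compact S" unfolding S_def using G unfolding compact_matrix_group_def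
    by (intro compact_Int_closed compact_Times) auto
  have "continuous_on (fst ` S) (\<lambda>X. (X, matrix_inv X))"
    by (rule continuous_on_inv[OF continuous_on_fst[OF continuous_on_id] S])
       (auto simp: S_def intro: matrix_inv_unique_right)
  moreover have "fst ` S = G"
  proof
    show "G \<subseteq> fst ` S"
    proof
      fix X assume "X \<in> G"
      then have "(X, matrix_inv X) \<in> S" using G unfolding S_def compact_matrix_group_def by (auto simp: matrix_inv_mult)
      then show "X \<in> fst ` S" by force
    qed
  qed (auto simp: S_def)
  ultimately show ?thesis using continuous_on_snd by fastforce
qed

text \<open>The commutator part is in L2 through the Sobolev inequality, which applies only after a
  cutoff; hence the smaller ball.\<close>

lemma curvature_local:
  fixes B :: "'m::finite \<Rightarrow> real^'m \<Rightarrow> real^'n^'n"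
  assumes dim: "CARD('m) \<le> 4" and B: "\<And>l j. mwd R l (B j) (DB l j)" and R: "R \<le> 1" "0 < s" "s < R"
  shows "mL2 (\<lambda>x. indicat_real (ball 0 s) x *\<^sub>R curvature B DB i j x)"
  unfolding mL2_def
proof (intro allI)
  fix a b
  have D: "L2 (\<lambda>x. indicat_real (ball 0 s) x * DB l k x $ a $ b)" for l k
    using mwd_mL2(2)[OF B, of l k] by (intro L2_bounded_mult[where M = 1]) (auto simp: mL2_def indicator_def)
  have P: "L2 (\<lambda>x. indicat_real (ball 0 s) x * (B l x ** B k x) $ a $ b)" for l k
    unfolding mm_entry sum_distrib_left by (intro L2_sum L2_local_mult[OF dim mwdD[OF B] mwdD[OF B] R])
  have "(indicat_real (ball 0 s) x *\<^sub>R curvature B DB i j x) $ a $ b =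
     (indicat_real (ball 0 s) x * DB i j x $ a $ b - indicat_real (ball 0 s) x * DB j i x $ a $ b)
     + (indicat_real (ball 0 s) x * (B i x ** B j x) $ a $ b - indicat_real (ball 0 s) x * (B j x ** B i x) $ a $ b)" for x
    by (simp add: curvature_def lie_bracket_def algebra_simps)
  then show "L2 (\<lambda>x. (indicat_real (ball 0 s) x *\<^sub>R curvature B DB i j x) $ a $ b)"
    using L2_add[OF L2_diff[OF D[of i j] D[of j i]] L2_diff[OF P[of i j] P[of j i]]] by simp
qed

lemma bracket_integrable:
  fixes B F :: "real^'m::finite \<Rightarrow> real^'n^'n"
  assumes dim: "CARD('m) \<le> 4" and B: "\<And>l. mwd R l B (DB l)" and R: "R \<le> 1" "0 < R"
    and F: "mL2 F" and t: "test_fun (ball 0 R) \<phi>"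
  shows "integrable lborel (\<lambda>x. \<phi> x * lie_bracket (B x) (F x) $ a $ b)"
proof -
  obtain r where r: "r < R" "test_fun (ball 0 r) \<phi>" using test_fun_ball_shrink[OF t R(2)] by metis
  have "madm R (\<lambda>x. lie_bracket (B x) (F x))"
    unfolding lie_bracket_def by (intro madm_diff madm_mult_left[OF dim B R(1) F])
  then have "adm R (\<lambda>x. lie_bracket (B x) (F x) $ a $ b)" by (simp add: madm_def)
  then show ?thesis by (rule adm_integrable[OF _ r(1) test_fun_W0[OF r(2)]])
qed

lemma curvature_bracket_integrable:
  fixes B :: "'m::finite \<Rightarrow> real^'m \<Rightarrow> real^'n^'n"
  assumes dim: "CARD('m) \<le> 4" and B: "\<And>l j. mwd R l (B j) (DB l j)" and R: "R \<le> 1" "0 < R"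
    and t: "test_fun (ball 0 R) \<phi>"
  shows "integrable lborel (\<lambda>x. \<phi> x * (\<Sum>j\<in>UNIV. lie_bracket (B j x) (curvature B DB i j x)) $ a $ b)"
proof -
  obtain s where s: "0 < s" "s < R" "test_fun (ball 0 s) \<phi>" using test_fun_ball_shrink[OF t R(2)] by metis
  \<comment> \<open>On the support of the test function the curvature may be truncated, which places
    it in L2.\<close>
  have e: "\<phi> x * (\<Sum>j\<in>UNIV. lie_bracket (B j x) (curvature B DB i j x)) $ a $ b
     = (\<Sum>j\<in>UNIV. \<phi> x * lie_bracket (B j x) (indicat_real (ball 0 s) x *\<^sub>R curvature B DB i j x) $ a $ b)" for x
    using test_fun_outside(1)[OF s(3), of x] by (cases "x \<in> ball 0 s") (auto simp: sum_component sum_distrib_left)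
  show ?thesis unfolding e
    by (intro Bochner_Integration.integrable_sum bracket_integrable[OF dim B R _ t] curvature_local[OF dim B R(1) s(1,2)])
qed

lemma cut_curvature: "curvature (\<lambda>j. cut (A j)) (\<lambda>i j. cut (DA i j)) i j x = indicat_real (ball 0 1) x *\<^sub>R curvature A DA i j x"
  by (simp add: curvature_def lie_bracket_def indicator_def)

text \<open>Test functions of the smaller ball see only the truncated curvature \<open>F\<close>,
  which is in L2 and so fits \<open>gauge_equation\<close>.\<close>

lemma yang_mills_entries:
  fixes A :: "'m::finite \<Rightarrow> real^'m \<Rightarrow> real^'n^'n"
  assumes dim: "CARD('m) \<le> 4" and A: "\<And>l j. mwd 1 l (cut (A j)) (cut (DA l j))" and r: "0 < r" "r < 1"
    and t: "test_fun (ball 0 r) \<phi>"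
    and YM: "(\<Sum>j\<in>UNIV. - (LINT x:ball 0 1|lborel. pderiv j \<phi> x *\<^sub>R curvature A DA i j x)
                   + (LINT x:ball 0 1|lborel. \<phi> x *\<^sub>R lie_bracket (A j x) (curvature A DA i j x))) = 0"
  defines "F \<equiv> \<lambda>j x. indicat_real (ball 0 r) x *\<^sub>R curvature (\<lambda>j. cut (A j)) (\<lambda>i j. cut (DA i j)) i j x"
  shows "(\<Sum>j\<in>UNIV. \<integral>x. pderiv j \<phi> x * F j x $ a $ b \<partial>lborel)
        = - (\<integral>x. \<phi> x * (- (\<Sum>j\<in>UNIV. lie_bracket (cut (A j) x) (F j x))) $ a $ b \<partial>lborel)"
proof -
  have F: "mL2 (F j)" for j unfolding F_def by (rule curvature_local[OF dim A order_refl r])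
  have i1: "integrable lborel (\<lambda>x. (pderiv j \<phi> x *\<^sub>R F j x) $ a $ b)" for j a b
  proof -
    have "L2 (\<lambda>x. F j x $ a $ b)" using F by (simp add: mL2_def)
    then show ?thesis using L2_mult_integrable[OF test_fun_L2[OF test_fun_pderiv[OF t]]] by simp
  qed
  have i2': "integrable lborel (\<lambda>x. \<phi> x * lie_bracket (cut (A j) x) (F j x) $ a $ b)" for j a b
    by (rule bracket_integrable[OF dim A _ _ F]) (use t r in \<open>auto intro: test_fun_ball_mono\<close>)
  then have i2: "integrable lborel (\<lambda>x. (\<phi> x *\<^sub>R lie_bracket (cut (A j) x) (F j x)) $ a $ b)" for j a b by simp
  have "indicat_real (ball 0 1) x *\<^sub>R pderiv j \<phi> x *\<^sub>R curvature A DA i j x = pderiv j \<phi> x *\<^sub>R F j x" for x j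
    using test_fun_outside(2)[OF t, of x j] r by (cases "x \<in> ball 0 r") (auto simp: F_def cut_curvature)
  then have e1: "(LINT x:ball 0 1|lborel. pderiv j \<phi> x *\<^sub>R curvature A DA i j x) = (\<integral>x. pderiv j \<phi> x *\<^sub>R F j x \<partial>lborel)" for j
    unfolding set_lebesgue_integral_def by simp
  have "indicat_real (ball 0 1) x *\<^sub>R \<phi> x *\<^sub>R lie_bracket (A j x) (curvature A DA i j x) = \<phi> x *\<^sub>R lie_bracket (cut (A j) x) (F j x)" for x j
    using test_fun_outside(1)[OF t, of x] r by (cases "x \<in> ball 0 r") (auto simp: F_def cut_curvature)
  then have e2: "(LINT x:ball 0 1|lborel. \<phi> x *\<^sub>R lie_bracket (A j x) (curvature A DA i j x)) = (\<integral>x. \<phi> x *\<^sub>R lie_bracket (cut (A j) x) (F j x) \<partial>lborel)" for j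
    unfolding set_lebesgue_integral_def by simp
  have "(\<Sum>j\<in>UNIV. - (\<integral>x. pderiv j \<phi> x *\<^sub>R F j x \<partial>lborel) + (\<integral>x. \<phi> x *\<^sub>R lie_bracket (cut (A j) x) (F j x) \<partial>lborel)) $ a $ b = 0"
    using YM unfolding e1 e2 by simp
  then have "(\<Sum>j\<in>UNIV. - (\<integral>x. pderiv j \<phi> x * F j x $ a $ b \<partial>lborel) + (\<integral>x. \<phi> x * lie_bracket (cut (A j) x) (F j x) $ a $ b \<partial>lborel)) = 0"
    by (simp add: sum_component mat_integral(2)[OF i1] mat_integral(2)[OF i2])
  moreover have "(\<integral>x. \<phi> x * (- (\<Sum>j\<in>UNIV. lie_bracket (cut (A j) x) (F j x))) $ a $ b \<partial>lborel)
    = - (\<Sum>j\<in>UNIV. \<integral>x. \<phi> x * lie_bracket (cut (A j) x) (F j x) $ a $ b \<partial>lborel)"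
    by (simp add: sum_component sum_distrib_left Bochner_Integration.integral_sum i2')
  ultimately show ?thesis by (simp only: sum.distrib sum_negf)
qed

text \<open>Changing \<open>g\<close> on a null set puts its values in G everywhere in the ball, so
  the inverse identities hold pointwise. Continuity of inversion on G makes \<open>h\<close> Borel,
  and compactness of G makes it bounded.\<close>

lemma gauge_with_inverse:
  fixes g :: "real^'m::finite \<Rightarrow> real^'n^'n"
  assumes G: "compact_matrix_group G" and gG: "AE x in lborel. x \<in> ball 0 1 \<longrightarrow> g x \<in> G" and g: "W12 (ball 0 1) g"
  shows "\<exists>g' h M. (AE x in lborel. cut g x = g' x) \<and> mmeas g' \<and> mL2 h \<and> (\<forall>x a b. \<bar>h x $ a $ b\<bar> \<le> M) \<and>
    (\<forall>x\<in>ball 0 1. h x ** g' x = mat 1 \<and> g' x ** h x = mat 1)"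
proof -
  have G': "compact G" "mat 1 \<in> G" "\<And>X. X \<in> G \<Longrightarrow> invertible X" "\<And>X. X \<in> G \<Longrightarrow> matrix_inv X \<in> G"
    using G unfolding compact_matrix_group_def by auto
  have Gb: "G \<in> sets borel" using G'(1) by (simp add: borel_closed compact_imp_closed)
  have cm: "cut g \<in> borel_measurable borel" using L2_on_entries(2) g by (auto simp: W12_def)
  \<comment> \<open>The identity matrix fills the exceptional null set; the value 0 outside the ball
    matches \<open>cut\<close>.\<close>
  define g' where "g' x = (if x \<in> ball 0 1 then if cut g x \<in> G then cut g x else mat 1 else 0)" for x
  have g'm: "g' \<in> borel_measurable borel"
  proof -
    have "cut g -` G \<in> sets borel" using measurable_sets[OF cm Gb] by simp
    then have "{x. cut g x \<in> G} \<in> sets borel" by (simp add: vimage_def)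
    then show ?thesis unfolding g'_def[abs_def]
      by (intro measurable_If cm borel_measurable_const) (auto simp: Collect_mem_eq)
  qed
  define \<psi> where "\<psi> X = indicat_real G X *\<^sub>R matrix_inv X" for X :: "real^'n^'n"
  have \<psi>m: "\<psi> \<in> borel_measurable borel" unfolding \<psi>_def[abs_def]
    by (rule borel_measurable_continuous_on_indicator[OF Gb continuous_on_matrix_inv[OF G]])
  have em: "(\<lambda>X::real^'n^'n. X $ a $ b) \<in> borel_measurable borel" for a b
    by (intro borel_measurable_continuous_onI linear_continuous_on bounded_linear_entry)
  obtain M where M: "\<And>X. X \<in> G \<Longrightarrow> norm X \<le> M" using compact_imp_bounded[OF G'(1)] unfolding bounded_iff by blast
  have M0: "M \<ge> 0" using M[OF G'(2)] norm_ge_zero order_trans by blast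
  have eb: "\<bar>X $ a $ b\<bar> \<le> norm X" for X :: "real^'n^'n" and a b
    using component_le_norm_cart[of "X $ a" b] Finite_Cartesian_Product.norm_nth_le[of X a] by linarith
  have \<psi>b: "\<bar>\<psi> X $ a $ b\<bar> \<le> M" for X a b
    using M0 order_trans[OF eb M[OF G'(4)]] by (auto simp: \<psi>_def indicator_def)
  have "\<not> invertible (0::real^'n^'n)"
  proof
    assume "invertible (0::real^'n^'n)"
    then have "(0::real^'n^'n) ** matrix_inv 0 = mat 1" by (rule matrix_inv_mult(1))
    then have "(mat 1 :: real^'n^'n) $ a $ a = 0" for a by (simp add: vec_eq_iff matrix_matrix_mult_def)
    then show False by (simp add: mat_def)
  qed
  \<comment> \<open>As 0 is not in G, \<open>\<psi>\<close> sends it to 0, so \<open>h\<close>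
    vanishes outside the ball; being bounded with bounded support, it is in L2.\<close>
  then have G0: "0 \<notin> G" using G'(3) by blast
  have g'G: "g' x \<in> G" if "x \<in> ball 0 1" for x using that G'(2) by (auto simp: g'_def)
  have h0: "\<psi> (g' x) = 0" if "x \<notin> ball 0 1" for x using that G0 by (simp add: g'_def \<psi>_def)
  show ?thesis
  proof (intro exI conjI)
    show "AE x in lborel. cut g x = g' x" using gG by eventually_elim (auto simp: g'_def)
    show "mmeas g'" unfolding mmeas_def using measurable_compose[OF g'm em] by blast
    show "mL2 (\<lambda>x. \<psi> (g' x))" unfolding mL2_def
    proof (intro allI)
      fix a b
      have m: "(\<lambda>x. \<psi> (g' x) $ a $ b) \<in> borel_measurable borel"
        by (rule measurable_compose[OF measurable_compose[OF g'm \<psi>m] em])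
      have "(\<lambda>x. \<psi> (g' x) $ a $ b * indicat_real (ball 0 1) x) = (\<lambda>x. \<psi> (g' x) $ a $ b)"
        by (rule ext) (auto simp: indicator_def h0)
      then show "L2 (\<lambda>x. \<psi> (g' x) $ a $ b)" using L2_bounded_mult[OF L2_indicator_ball m \<psi>b, of 1] by (simp only:)
    qed
    show "\<forall>x a b. \<bar>\<psi> (g' x) $ a $ b\<bar> \<le> M" using \<psi>b by blast
    show "\<forall>x\<in>ball 0 1. \<psi> (g' x) ** g' x = mat 1 \<and> g' x ** \<psi> (g' x) = mat 1"
      using g'G G'(3) by (auto simp: \<psi>_def matrix_inv_mult)
  qed
qed

text \<open>A Sobolev function is determined up to null sets, so smoothness of the transformed
  connection means the existence of a smooth representative. \<open>DA\<close> and \<open>dg\<close>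
  are arbitrary weak derivatives, which are likewise determined up to null sets.\<close>

theorem mainTheorem8:
  fixes G :: "(real^'n^'n) set"
    and A :: "'m::finite \<Rightarrow> real^'m \<Rightarrow> real^'n^'n"
    and DA :: "'m \<Rightarrow> 'm \<Rightarrow> real^'m \<Rightarrow> real^'n^'n"
    and g :: "real^'m \<Rightarrow> real^'n^'n"
    and dg :: "'m \<Rightarrow> real^'m \<Rightarrow> real^'n^'n"
  assumes G: "compact_matrix_group G"
    and dim: "CARD('m) \<le> 4"
    and A_lie: "\<And>i. AE x in lborel. x \<in> ball 0 1 \<longrightarrow> A i x \<in> lie_algebra G"
    and A_W12: "\<And>i. W12 (ball 0 1) (A i)"
    and DA: "\<And>i j. weak_pderiv (ball 0 1) i (A j) (DA i j)"
    and YM: "\<And>i \<phi>. test_fun (ball 0 1) \<phi> \<Longrightarrow>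
               (\<Sum>j\<in>UNIV. - (LINT x:ball 0 1|lborel. pderiv j \<phi> x *\<^sub>R curvature A DA i j x)
                   + (LINT x:ball 0 1|lborel. \<phi> x *\<^sub>R lie_bracket (A j x) (curvature A DA i j x))) = 0"
    and g_G: "AE x in lborel. x \<in> ball 0 1 \<longrightarrow> g x \<in> G"
    and g_W12: "W12 (ball 0 1) g"
    and dg: "\<And>i. weak_pderiv (ball 0 1) i g (dg i)"
    and Ag_W12: "\<And>i. W12 (ball 0 1) (gauge_transform g dg A i)"
    and coulomb: "\<And>\<phi>. test_fun (ball 0 1) \<phi> \<Longrightarrow>
               (\<Sum>i\<in>UNIV. LINT x:ball 0 1|lborel. pderiv i \<phi> x *\<^sub>R gauge_transform g dg A i x) = 0"
  shows "\<exists>B :: 'm \<Rightarrow> real^'m \<Rightarrow> real^'n^'n.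
           (\<forall>i. smooth_on (ball 0 1) (B i)) \<and>
           (\<forall>i. AE x in lborel. x \<in> ball 0 1 \<longrightarrow> B i x = gauge_transform g dg A i x)"
proof -
  obtain g' h M where g': "AE x in lborel. cut g x = g' x" "mmeas g'" and h: "mL2 h" "\<And>x a b. \<bar>h x $ a $ b\<bar> \<le> M"
    and hg: "\<And>x. x \<in> ball 0 1 \<Longrightarrow> h x ** g' x = mat 1" "\<And>x. x \<in> ball 0 1 \<Longrightarrow> g' x ** h x = mat 1"
    using gauge_with_inverse[OF G g_G g_W12] by blast
  define A' where "A' j = cut (A j)" for j
  define DA' where "DA' l j = cut (DA l j)" for l j
  define B where "B j = cut (gauge_transform g dg A j)" for j
  have wA: "mwd 1 l (cut (A j)) (cut (DA l j))" for l j by (rule W12_mwd[OF A_W12 DA])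
  have wg: "mwd 1 l g' (cut (dg l))" for l unfolding mwd_def
  proof (intro allI)
    fix a b
    show "wd 1 l (\<lambda>x. g' x $ a $ b) (\<lambda>x. cut (dg l) x $ a $ b)"
    proof (rule wd_cong_AE[OF mwdD[OF W12_mwd[OF g_W12 dg]]])
      show "(\<lambda>x. g' x $ a $ b) \<in> borel_measurable borel" using g'(2) by (simp add: mmeas_def)
      show "AE x in lborel. cut g x $ a $ b = g' x $ a $ b" using g'(1) by eventually_elim simp
    qed
  qed
  have wB: "\<exists>v. mwd 1 l (B j) v" for l j
  proof -
    obtain v where "weak_pderiv (ball 0 1) l (gauge_transform g dg A j) v" using Ag_W12[of j] by (auto simp: W12_def)
    then show ?thesis unfolding B_def using W12_mwd[OF Ag_W12] by blast
  qed
  \<comment> \<open>The definition of the gauge transform solved for \<open>dg\<close>. The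
    right-hand side consists of products of Sobolev functions, so this relation gives
    \<open>dg\<close> a further weak derivative.\<close>
  have gB: "AE x in lborel. x \<in> ball 0 1 \<longrightarrow> cut (dg j) x = g' x ** B j x - A' j x ** g' x" for j
    using g'(1) g_G
  proof eventually_elim
    case (elim x)
    show ?case
    proof
      assume x: "x \<in> ball 0 1"
      then have gx: "g' x = g x" "g x \<in> G" using elim by auto
      then have "invertible (g x)" using G by (auto simp: compact_matrix_group_def)
      note i = matrix_inv_mult(1)[OF this]
      show "cut (dg j) x = g' x ** B j x - A' j x ** g' x"
        using x gx by (simp add: B_def A'_def gauge_transform_def matrix_add_ldistrib matrix_mul_assoc i)
    qed
  qed
  \<comment> \<open>Weak derivatives of the inverse gauge and square integrability of the curvature
    are obtained on strictly smaller balls only.\<close>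
  have main: "\<exists>d. esys r (range (\<lambda>(j, a, b). \<lambda>x. B j x $ a $ b)) d" if r: "0 < r" "r < 1" for r
  proof -
    have sub: "x \<in> ball 0 1" if "x \<in> ball 0 r" for x :: "real^'m" using that r by auto
    \<comment> \<open>The direction of differentiation and the two matrix indices are packed into
      one index for a single choice.\<close>
    have "\<forall>q. \<exists>v. wd r (fst q) (\<lambda>x. h x $ fst (snd q) $ snd (snd q)) v"
      using inverse_weakly_differentiable[OF wg h hg r] by blast
    from choice[OF this] obtain dh0 where dh0: "\<And>q. wd r (fst q) (\<lambda>x. h x $ fst (snd q) $ snd (snd q)) (dh0 q)" by blast
    define dh where "dh l x = (\<chi> a b. dh0 (l, a, b) x)" for l x
    have dhe: "dh l x $ a $ b = dh0 (l, a, b) x" for l x a b by (simp add: dh_def)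
    have wh: "mwd r l h (dh l)" for l unfolding mwd_def dhe using dh0[of "(l, _, _)"] by simp
    have wA': "mwd r l (A' j) (DA' l j)" for l j unfolding A'_def DA'_def by (rule mwd_mono[OF wA less_imp_le[OF r(2)]])
    have wg': "mwd r l g' (cut (dg l))" for l by (rule mwd_mono[OF wg less_imp_le[OF r(2)]])
    have gB': "AE x in lborel. x \<in> ball 0 r \<longrightarrow> cut (dg j) x = g' x ** B j x - A' j x ** g' x" for j
      using gB[of j] by eventually_elim (use sub in blast)
    define F where "F i j x = indicat_real (ball 0 r) x *\<^sub>R curvature A' DA' i j x" for i j x
    have F: "mL2 (F i j)" for i j unfolding F_def A'_def DA'_def by (rule curvature_local[OF dim wA order_refl r])
    have Fc: "F i j x = curvature A' DA' i j x" if "x \<in> ball 0 r" for i j x using that by (simp add: F_def)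
    show ?thesis
    proof (rule coulomb_system)
      show "r \<le> 1" using r by simp
      show "\<exists>v. mwd r l (B j) v" for l j using wB[of l j] mwd_mono[OF _ less_imp_le[OF r(2)]] by blast
    next
      fix DB i and \<phi> :: "real^'m \<Rightarrow> real" and a b
      assume DB: "\<And>l j. mwd r l (B j) (DB l j)" and t: "test_fun (ball 0 r) \<phi>"
      show "integrable lborel (\<lambda>x. \<phi> x * (\<Sum>j\<in>UNIV. lie_bracket (B j x) (curvature B DB i j x)) $ a $ b)"
        by (rule curvature_bracket_integrable[OF dim DB _ r(1) t]) (use r in simp)
      have ym: "(\<Sum>j\<in>UNIV. \<integral>x. pderiv j \<phi> x * F i j x $ a $ b \<partial>lborel)
        = - (\<integral>x. \<phi> x * (- (\<Sum>j\<in>UNIV. lie_bracket (A' j x) (F i j x))) $ a $ b \<partial>lborel)"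
        if t: "test_fun (ball 0 r) \<phi>" for \<phi> a b
        unfolding F_def A'_def DA'_def
        by (rule yang_mills_entries[OF dim wA r t YM]) (rule test_fun_ball_mono[OF t], use r in simp)
      show "(\<Sum>j\<in>UNIV. \<integral>x. pderiv j \<phi> x * curvature B DB i j x $ a $ b \<partial>lborel)
        = (\<integral>x. \<phi> x * (\<Sum>j\<in>UNIV. lie_bracket (B j x) (curvature B DB i j x)) $ a $ b \<partial>lborel)"
        by (rule gauge_equation[OF dim r(1) less_imp_le[OF r(2)] wg' wh h(2) wA' DB hg(1)[OF sub] hg(2)[OF sub] gB' F Fc ym t])
    next
      fix \<phi> :: "real^'m \<Rightarrow> real" and a b assume t: "test_fun (ball 0 r) \<phi>"
      then have t: "test_fun (ball 0 1) \<phi>" by (rule test_fun_ball_mono) (use r in simp)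
      have l: "loc_integrable (ball 0 1) (gauge_transform g dg A j)" for j
        using Ag_W12[of j] by (auto simp: W12_def weak_pderiv_def)
      have "(\<Sum>j\<in>UNIV. LINT x:ball 0 1|lborel. pderiv j \<phi> x *\<^sub>R gauge_transform g dg A j x) $ a $ b = 0"
        using coulomb[OF t] by simp
      then show "(\<Sum>j\<in>UNIV. \<integral>x. pderiv j \<phi> x * B j x $ a $ b \<partial>lborel) = 0"
        unfolding B_def sum_component loc_integrable_test(2)[OF l test_fun_pderiv[OF t]] .
    qed
  qed
  have reg: "\<exists>w. smooth w \<and> (AE x in lborel. x \<in> ball 0 r \<longrightarrow> B j x $ a $ b = w x)" if r: "0 < r" "r < 1" for r j a b
  proof -
    \<comment> \<open>The regularity theorem loses radius, so the system is set up on an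
      intermediate ball.\<close>
    obtain R where R: "r < R" "R < 1" using dense[OF r(2)] by blast
    have "0 < R" using r R by linarith
    from main[OF this R(2)] obtain d where d: "esys R (range (\<lambda>(j, a, b). \<lambda>x. B j x $ a $ b)) d" by blast
    show ?thesis
      by (rule system_regularity[OF dim d r(1) R(1) less_imp_le[OF R(2)]]) (rule range_eqI[of _ _ "(j, a, b)"], simp)
  qed
  have "\<forall>q. \<exists>v. (\<forall>r. 0 < r \<longrightarrow> r < 1 \<longrightarrow> (\<exists>w. smooth w \<and> (\<forall>x\<in>ball 0 r. v x = w x))) \<and>
    (AE x in lborel. x \<in> ball 0 1 \<longrightarrow> v x = B (fst q) x $ fst (snd q) $ snd (snd q))"
    using patch_smooth[OF reg] by blast
  from choice[OF this] obtain v where v: "\<And>q r. 0 < r \<Longrightarrow> r < 1 \<Longrightarrow> \<exists>w. smooth w \<and> (\<forall>x\<in>ball 0 r. v q x = w x)"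
    "\<And>q. AE x in lborel. x \<in> ball 0 1 \<longrightarrow> v q x = B (fst q) x $ fst (snd q) $ snd (snd q)" by blast
  define C where "C j x = (\<chi> a b. v (j, a, b) x)" for j x
  have "smooth_on (ball 0 1) (C j)" for j
    unfolding smooth_on_def
  proof (intro allI Ck_on_mat Ck_on_local open_ball)
    fix k a b and x :: "real^'m" assume "x \<in> ball 0 1"
    then have r: "0 < (1 + norm x) / 2" "(1 + norm x) / 2 < 1" "x \<in> ball 0 ((1 + norm x) / 2)" by (auto simp: add_pos_nonneg)
    obtain w where w: "smooth w" "\<forall>y\<in>ball 0 ((1 + norm x) / 2). v (j, a, b) y = w y" using v(1)[OF r(1,2)] by blast
    show "\<exists>T W. open T \<and> x \<in> T \<and> Ck_on k UNIV W \<and> (\<forall>y\<in>T. C j y $ a $ b = W y)"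
      by (intro exI[of _ "ball 0 ((1 + norm x) / 2)"] exI[of _ w]) (use r w in \<open>auto simp: C_def smooth_on_def\<close>)
  qed
  moreover have "AE x in lborel. x \<in> ball 0 1 \<longrightarrow> C j x = gauge_transform g dg A j x" for j
  proof -
    have "AE x in lborel. \<forall>a\<in>UNIV. \<forall>b\<in>UNIV. x \<in> ball 0 1 \<longrightarrow> v (j, a, b) x = B j x $ a $ b"
      using v(2)[of "(j, _, _)"] by (intro AE_finite_allI) auto
    then show ?thesis by eventually_elim (auto simp: C_def B_def vec_eq_iff)
  qed
  ultimately show ?thesis by blast
qed

end
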